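(* The free energy $f$ is strictly convex and $\mathcal C^\infty$ on $(h_c,+\infty)$, and the following property holds for $\mathbb P$-a.e. $\omega$: for every compact set $H\subset(h_c,+\infty)$ and every $r\in\mathbb N_0$ $$\lim_{n\uparrow\infty}\sup_{h\in H}\Big|\frac1n\partial_h^r\log Z_{n,h}(\omega)-\partial_h^rf(h)\Big|=\lim_{n\uparrow\infty}\sup_{h\in H}\Big|\mathbb E\Big[\frac1n\partial_h^r\log Z_{n,h}\Big]-\partial_h^rf(h)\Big|=0.$$ Moreover, $f$ is of class Gevrey-$3$ on $(h_c,+\infty)$: for every closed set $H\subset\mathbb R$ with $H\subset(h_c,+\infty)$ there exists $c>0$ such that for all $r\in\mathbb N$ $$\sup_{h\in H}\big|\partial_h^rf(h)\big|\le c^r(r!)^3.$$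
   Context: Notation: $\mathbb N=\{1,2,\ldots\}$, $\mathbb N_0=\{0\}\cup\mathbb N$. Renewal process: under a law $\mathsf P$ (expectation $\mathsf E$), $T_1,T_2,\ldots$ are i.i.d. $\mathbb N$-valued random variables with $p(t):=\mathsf P[T_1=t]=\ell(t)/t^{\alpha+1}>0$ for all $t\in\mathbb N$, where $\alpha\ge0$ and $\ell:[1,+\infty)\to[0,+\infty)$ is slowly varying at infinity. Set $S_0=0$, $S_i=T_1+\cdots+T_i$, $S=(S_i)_{i\in\mathbb N_0}$, and $X_a=\mathbf 1_{\{a\in S\}}$ for $a\in\mathbb N_0$. Disorder: $\Omega=\mathbb R^{\mathbb N_0}$ with its Borel $\sigma$-field carries a probability measure $\mathbb P$ (expectation $\mathbb E$) under which the coordinates of $\omega=(\omega_a)_{a\in\mathbb N_0}$ form a centered stationary Gaussian sequence with covariance function $\gamma(a)=\int_\Omega\omega_0\omega_a\,\mathbb P[d\omega]$, $a\in\mathbb N_0$, satisfying $\bar\gamma:=\sum_{a\in\mathbb N_0}|\gamma(a)|<+\infty$. Partition function: for $n\in\mathbb N$, $h\in\mathbb R$, $\omega\in\Omega$, $Z_{n,h}(\omega)=\mathsf E\big[e^{\sum_{a=1}^n(h+\omega_a)X_a}X_n\big]$. Free energy and critical point: $f(h)=\lim_{n\uparrow\infty}\mathbb E[\frac1n\log Z_{n,h}]$, which exists, is finite for all $h\in\mathbb R$, and equals $\lim_n\frac1n\log Z_{n,h}(\omega)$ for $\mathbb P$-a.e. $\omega$; $f$ is convex, non-negative and non-decreasing.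 $h_c=\inf\{h\in\mathbb R:f(h)>0\}$, and $-\infty<h_c\le0$. *)

theory Defs
  imports "HOL-Probability.Probability"
begin

(* The last clause forces l to be nonzero near infinity, because x / 0 = 0. *)
definition slowly_varying :: "(real \<Rightarrow> real) \<Rightarrow> bool" where
  "slowly_varying l \<longleftrightarrow>
     set_borel_measurable borel {1..} l \<and> (\<forall>x\<ge>1. 0 \<le> l x) \<and>
     (\<forall>c>0. ((\<lambda>x. l (c * x) / l x) \<longlongrightarrow> 1) at_top)"

text \<open>The inter-arrival times are \<open>T 1, T 2, \<dots>\<close>; the value \<open>T 0\<close> is never used.\<close>

definition iid_interarrival_times :: "'a measure \<Rightarrow> (nat \<Rightarrow> 'a \<Rightarrow> nat) \<Rightarrow> bool" where
  "iid_interarrival_times P T \<longleftrightarrow>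
     (\<forall>i\<ge>1. \<forall>x\<in>space P. 1 \<le> T i x) \<and>
     prob_space.indep_vars P (\<lambda>_. count_space UNIV) T {1..} \<and>
     (\<forall>i\<ge>1. distr P (count_space UNIV) (T i) = distr P (count_space UNIV) (T 1))"

definition renewal_epoch :: "(nat \<Rightarrow> 'a \<Rightarrow> nat) \<Rightarrow> nat \<Rightarrow> 'a \<Rightarrow> nat" where
  "renewal_epoch T i x = (\<Sum>j=1..i. T j x)"

definition contact :: "(nat \<Rightarrow> 'a \<Rightarrow> nat) \<Rightarrow> nat \<Rightarrow> 'a \<Rightarrow> real" where
  "contact T a x = indicator (range (\<lambda>i. renewal_epoch T i x)) a"

text \<open>Degenerate (point mass) laws count as Gaussian.\<close>

definition gaussian_rv :: "'a measure \<Rightarrow> ('a \<Rightarrow> real) \<Rightarrow> bool" where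
  "gaussian_rv M Y \<longleftrightarrow> Y \<in> borel_measurable M \<and>
     (\<exists>\<mu> \<sigma>. 0 \<le> \<sigma> \<and>
        distr M borel Y =
          (if \<sigma> = 0 then return borel \<mu> else density lborel (\<lambda>x. ennreal (normal_density \<mu> \<sigma> x))))"

definition gaussian_sequence :: "(nat \<Rightarrow> real) measure \<Rightarrow> bool" where
  "gaussian_sequence D \<longleftrightarrow>
     (\<forall>I c. finite I \<longrightarrow> gaussian_rv D (\<lambda>\<omega>. \<Sum>a\<in>I. c a * \<omega> a))"

definition centered_sequence :: "(nat \<Rightarrow> real) measure \<Rightarrow> bool" where
  "centered_sequence D \<longleftrightarrow> (\<forall>a. integral\<^sup>L D (\<lambda>\<omega>. \<omega> a) = 0)"

definition stationary_sequence :: "(nat \<Rightarrow> real) measure \<Rightarrow> bool" where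
  "stationary_sequence D \<longleftrightarrow> (\<forall>k. distr D D (\<lambda>\<omega> a. \<omega> (a + k)) = D)"

definition covariance_fun :: "(nat \<Rightarrow> real) measure \<Rightarrow> nat \<Rightarrow> real" where
  "covariance_fun D a = integral\<^sup>L D (\<lambda>\<omega>. \<omega> 0 * \<omega> a)"

definition partition_fun ::
  "'a measure \<Rightarrow> (nat \<Rightarrow> 'a \<Rightarrow> nat) \<Rightarrow> nat \<Rightarrow> real \<Rightarrow> (nat \<Rightarrow> real) \<Rightarrow> real" where
  "partition_fun P T n h \<omega> =
     integral\<^sup>L P (\<lambda>x. exp (\<Sum>a=1..n. (h + \<omega> a) * contact T a x) * contact T n x)"

definition free_energy ::
  "'a measure \<Rightarrow> (nat \<Rightarrow> 'a \<Rightarrow> nat) \<Rightarrow> (nat \<Rightarrow> real) measure \<Rightarrow> real \<Rightarrow> real" where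
  "free_energy P T D h =
     lim (\<lambda>n. integral\<^sup>L D (\<lambda>\<omega>. 1 / real n * ln (partition_fun P T n h \<omega>)))"

definition critical_point ::
  "'a measure \<Rightarrow> (nat \<Rightarrow> 'a \<Rightarrow> nat) \<Rightarrow> (nat \<Rightarrow> real) measure \<Rightarrow> real" where
  "critical_point P T D = Inf {h. 0 < free_energy P T D h}"

definition strictly_convex_on :: "real set \<Rightarrow> (real \<Rightarrow> real) \<Rightarrow> bool" where
  "strictly_convex_on S f \<longleftrightarrow> convex S \<and>
     (\<forall>x\<in>S. \<forall>y\<in>S. \<forall>u>0. \<forall>v>0. x \<noteq> y \<longrightarrow> u + v = 1 \<longrightarrow>
        f (u * x + v * y) < u * f x + v * f y)"

text \<open>For open \<open>S\<close> only: there the iterated \<^const>\<open>deriv\<close> depends only on \<open>f\<close> near the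
  point. Continuity of every derivative is implied by its differentiability.\<close>

definition smooth_on_open :: "real set \<Rightarrow> (real \<Rightarrow> real) \<Rightarrow> bool" where
  "smooth_on_open S f \<longleftrightarrow> (\<forall>r. (deriv ^^ r) f differentiable_on S)"

end

theory Submission
  imports Defs "HOL-Complex_Analysis.Complex_Analysis" "HOL-Real_Asymp.Real_Asymp"
begin

text \<open>Write \<open>L i j\<close> for the logarithm of the partition function of a polymer on \<open>{i..j}\<close> pinned at both
  ends. The logarithm of \<open>Z\<^sub>n\<close> is the sum over \<open>i < j\<close> of the second differences
  \<open>L i j - L (i+1) j - L i (j-1) + L (i+1) (j-1)\<close>. Exchanging the tails of two independent polymers after
  their first common contact shows that such a difference is controlled by the probability that the
  two polymers never meet, and Cauchy's estimate on a disc of radius of order \<open>1 / (j - i)\<close> extends this to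
  its derivatives in \<open>h\<close>.

  Where the free energy is positive, this probability has an expectation that decays exponentially
  in \<open>j - i\<close>: by Gaussian concentration it is unlikely that long gaps cover a fixed fraction of
  \<open>{i..j}\<close>, and two polymers with many points in short gaps meet with overwhelming probability, since
  a common contact can be inserted at each such point at bounded cost. Hence the \<open>r\<close>-th derivative of
  the mean of \<open>L 0 n / n\<close> is at most \<open>\<Sum>\<^sub>k r! (C k)^r exp (- c k)\<close>, of order \<open>C^r (r!)\<^sup>2\<close>, uniformly in \<open>n\<close>, which yields
  smoothness, convergence of all derivatives and the Gevrey bound. For almost every disorder the
  same estimates hold up to subpolynomial factors, and interpolation against the polynomially small
  deviation of \<open>L 0 n / n\<close> from its mean removes them. Strict convexity follows from a lower bound
  on the variance of the number of contacts: given that both its neighbours are contacts, a site is a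
  contact independently of the rest of the polymer.\<close>

section \<open>Paths and their weights\<close>

text \<open>The disorder is correlated, so different gaps of a polymer are not independent. The
  product of the inverse partition functions of several gaps is therefore regarded as the
  exponential of a single function of the disorder, to which concentration is applied once; the
  resulting bound depends only on the total length of the gaps. A small power of these products is
  used, because the drift is linear in the exponent and the fluctuations are quadratic. This does no
  harm when probabilities are estimated, since they are at most 1. All bounds must hold for every
  \<open>h\<close> above a level \<open>h0\<close> simultaneously, although the Gaussian estimates
  concern one \<open>h\<close> at a time. They are made at \<open>h0\<close> and carried upwards by
  monotonicity: the reward at the right end of a gap is common to the gap and to all its fillings,
  and cancels from their ratio. The discs shrink with the length because a path may have as many
  contacts as sites, and a shift of \<open>h\<close> multiplies its weight by an exponential of that
  number. The means converge at no known rate, so for almost every disorder only the difference from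
  the mean is interpolated.\<close>

text \<open>A polymer is encoded by the set of its contacts; its weight is a product over inter-arrivals.\<close>

definition gaps :: "nat set \<Rightarrow> (nat \<times> nat) set" where
  "gaps S = {(a, b). a \<in> S \<and> b \<in> S \<and> a < b \<and> S \<inter> {a<..<b} = {}}"

definition paths :: "nat \<Rightarrow> nat \<Rightarrow> nat set set" where
  "paths i j = {S. S \<subseteq> {i..j} \<and> i \<in> S \<and> j \<in> S}"

text \<open>Weights take values in a commutative ring because they are used both over the reals,
  where they are positive, and over the complex numbers, for complex \<open>h\<close>.\<close>

definition wt :: "(nat \<Rightarrow> nat \<Rightarrow> 'c::comm_ring_1) \<Rightarrow> nat set \<Rightarrow> 'c" where
  "wt g S = (\<Prod>(a, b)\<in>gaps S. g a b)"

definition path_sum :: "(nat \<Rightarrow> nat \<Rightarrow> 'c::comm_ring_1) \<Rightarrow> nat \<Rightarrow> nat \<Rightarrow> 'c" where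
  "path_sum g i j = (\<Sum>S\<in>paths i j. wt g S)"

lemma finite_paths [simp, intro]: "finite (paths i j)"
  unfolding paths_def by (rule finite_subset[of _ "Pow {i..j}"]) auto

lemma finite_path: "S \<in> paths i j \<Longrightarrow> finite S"
  unfolding paths_def using finite_subset by blast

lemma path_le: "S \<in> paths i j \<Longrightarrow> i \<le> j"
  unfolding paths_def by auto

lemma pathsD: "S \<in> paths i j \<Longrightarrow> S \<subseteq> {i..j}" "S \<in> paths i j \<Longrightarrow> i \<in> S" "S \<in> paths i j \<Longrightarrow> j \<in> S"
  unfolding paths_def by auto

lemma finite_gaps [simp, intro]: "finite S \<Longrightarrow> finite (gaps S)"
  unfolding gaps_def by (rule finite_subset[of _ "S \<times> S"]) auto

lemma gapsD: "(a, b) \<in> gaps S \<Longrightarrow> a \<in> S \<and> b \<in> S \<and> a < b"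
  unfolding gaps_def by auto

lemma gaps_no_between: "(a, b) \<in> gaps S \<Longrightarrow> x \<in> S \<Longrightarrow> x \<le> a \<or> b \<le> x"
  unfolding gaps_def by force

lemma gapsI: "a \<in> S \<Longrightarrow> b \<in> S \<Longrightarrow> a < b \<Longrightarrow> (\<And>x. x \<in> S \<Longrightarrow> x \<le> a \<or> b \<le> x) \<Longrightarrow> (a, b) \<in> gaps S"
  unfolding gaps_def by force

lemma paths_refl: "paths i i = {{i}}"
  unfolding paths_def by auto

lemma gaps_singleton [simp]: "gaps {i} = {}"
  unfolding gaps_def by auto

lemma path_sum_refl [simp]: "path_sum g i i = 1"
  by (simp add: path_sum_def paths_refl wt_def)

lemma concat_path: "S \<in> paths i x \<Longrightarrow> R \<in> paths x j \<Longrightarrow> S \<union> R \<in> paths i j"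
  unfolding paths_def by force

lemma gaps_concat:
  assumes "S \<in> paths i x" "R \<in> paths x j"
  shows "gaps (S \<union> R) = gaps S \<union> gaps R" "gaps S \<inter> gaps R = {}"
proof -
  note p = pathsD[OF assms(1)] pathsD[OF assms(2)]
  have S: "s \<le> x" if "s \<in> S" for s using p that by auto
  have R: "x \<le> s" if "s \<in> R" for s using p that by auto
  show "gaps (S \<union> R) = gaps S \<union> gaps R"
  proof (intro equalityI subsetI)
    fix y assume "y \<in> gaps (S \<union> R)"
    then obtain a b where y: "y = (a,b)" and ab: "(a,b) \<in> gaps (S \<union> R)" by (cases y) auto
    have h: "a \<in> S \<union> R" "b \<in> S \<union> R" "a < b" using gapsD[OF ab] by auto
    have n: "x \<le> a \<or> b \<le> x" using gaps_no_between[OF ab] p by blast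
    show "y \<in> gaps S \<union> gaps R"
    proof (cases "b \<le> x")
      case True
      hence "a \<in> S" "b \<in> S" using h R p by (metis Un_iff le_antisym le_less_trans not_le, metis Un_iff True h(2) R p(3) le_antisym)
      thus ?thesis using ab h y unfolding gaps_def by auto
    next
      case False
      hence "x \<le> a" using n by auto
      hence "a \<in> R" "b \<in> R" using h S p False by (metis Un_iff le_antisym, metis Un_iff False h(2) S)
      thus ?thesis using ab h y unfolding gaps_def by auto
    qed
  next
    fix y assume "y \<in> gaps S \<union> gaps R"
    then obtain a b where y: "y = (a,b)" and "(a,b) \<in> gaps S \<or> (a,b) \<in> gaps R" by (cases y) auto
    thus "y \<in> gaps (S \<union> R)"
      unfolding y by (elim disjE) (intro gapsI; metis Un_iff gapsD gaps_no_between R S order_trans)+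
  qed
  show "gaps S \<inter> gaps R = {}"
  proof -
    have "False" if "(a,b) \<in> gaps S" "(a,b) \<in> gaps R" for a b
    proof -
      have "b \<le> x" using gapsD[OF that(1)] S by blast
      moreover have "x \<le> a" using gapsD[OF that(2)] R by blast
      ultimately show False using gapsD[OF that(1)] by linarith
    qed
    thus ?thesis by force
  qed
qed

lemma wt_concat:
  assumes "S \<in> paths i x" "R \<in> paths x j"
  shows "wt g (S \<union> R) = wt g S * wt g R"
  unfolding wt_def gaps_concat(1)[OF assms]
  by (rule prod.union_disjoint) (use assms finite_path gaps_concat[OF assms] in auto)

lemma split_path:
  assumes "S \<in> paths i j" "x \<in> S"
  shows "S \<inter> {..x} \<in> paths i x" "S \<inter> {x..} \<in> paths x j" "S \<inter> {..x} \<union> S \<inter> {x..} = S"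
  using assms unfolding paths_def by force+

lemma wt_split:
  assumes "S \<in> paths i j" "x \<in> S"
  shows "wt g S = wt g (S \<inter> {..x}) * wt g (S \<inter> {x..})"
  using wt_concat[OF split_path(1,2)[OF assms], of g] split_path(3)[OF assms] by simp

lemma fill_path:
  assumes "S \<in> paths i j" "(a, b) \<in> gaps S" "R \<in> paths a b"
  shows "S \<union> R \<in> paths i j"
  using assms gapsD[OF assms(2)] unfolding paths_def by force

lemma gaps_fill:
  assumes "(a, b) \<in> gaps S" "R \<in> paths a b"
  shows "gaps (S \<union> R) = (gaps S - {(a, b)}) \<union> gaps R" "(gaps S - {(a, b)}) \<inter> gaps R = {}"
proof -
  note p = pathsD[OF assms(2)]
  note d = gapsD[OF assms(1)]
  have R: "a \<le> s \<and> s \<le> b" if "s \<in> R" for s using p that by auto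
  have S: "s \<le> a \<or> b \<le> s" if "s \<in> S" for s using gaps_no_between[OF assms(1) that] .
  have SR: "s = a \<or> s = b" if "s \<in> S" "s \<in> R" for s using R S that by force
  show "gaps (S \<union> R) = (gaps S - {(a, b)}) \<union> gaps R"
  proof (intro equalityI subsetI)
    fix y assume "y \<in> gaps (S \<union> R)"
    then obtain u v where y: "y = (u,v)" and uv: "(u,v) \<in> gaps (S \<union> R)" by (cases y) auto
    have h: "u \<in> S \<union> R" "v \<in> S \<union> R" "u < v" using gapsD[OF uv] by auto
    have na: "a \<le> u \<or> v \<le> a" and nb: "b \<le> u \<or> v \<le> b"
      using gaps_no_between[OF uv] p by blast+
    show "y \<in> (gaps S - {(a, b)}) \<union> gaps R"
    proof (cases "a \<le> u \<and> v \<le> b")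
      case True
      have "u \<in> R" using h True S p d by (metis Un_iff le_antisym not_le order_trans less_le_trans)
      moreover have "v \<in> R" using h True S p d by (metis Un_iff le_antisym not_le order_trans le_less_trans)
      ultimately show ?thesis using uv h y unfolding gaps_def by auto
    next
      case False
      hence c: "v \<le> a \<or> b \<le> u" using na nb by auto
      have "u \<in> S" using c h R d by (metis Un_iff le_antisym not_le order_trans less_le_trans less_imp_le)
      moreover have "v \<in> S" using c h R d by (metis Un_iff le_antisym not_le order_trans le_less_trans)
      ultimately show ?thesis using uv h y c d unfolding gaps_def by auto
    qed
  next
    fix y assume "y \<in> (gaps S - {(a, b)}) \<union> gaps R"
    then obtain u v where y: "y = (u,v)" and c: "(u,v) \<in> gaps S \<and> (u,v) \<noteq> (a,b) \<or> (u,v) \<in> gaps R" by (cases y) auto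
    show "y \<in> gaps (S \<union> R)"
      using c unfolding y
    proof (elim disjE conjE)
      assume u: "(u,v) \<in> gaps S" and ne: "(u,v) \<noteq> (a,b)"
      have du: "u \<in> S" "v \<in> S" "u < v" using gapsD[OF u] by auto
      have "v \<le> a \<or> b \<le> u"
      proof (rule ccontr)
        assume "\<not> ?thesis"
        hence n: "a < v" "u < b" by auto
        hence "b \<le> v" "u \<le> a" using S du by force+
        moreover have "a \<le> u \<or> v \<le> a" "b \<le> u \<or> v \<le> b" using gaps_no_between[OF u] d by auto
        ultimately show False using n ne by auto
      qed
      thus "(u, v) \<in> gaps (S \<union> R)" using du R gaps_no_between[OF u] by (intro gapsI) (auto, (meson le_trans)+)
    next
      assume u: "(u,v) \<in> gaps R"
      have du: "u \<in> R" "v \<in> R" "u < v" using gapsD[OF u] by auto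
      show "(u, v) \<in> gaps (S \<union> R)" using du R S gaps_no_between[OF u] by (intro gapsI) (auto, (meson le_trans)+)
    qed
  qed
  have False if "(u,v) \<in> gaps S" "(u,v) \<noteq> (a,b)" "(u,v) \<in> gaps R" for u v
    using gapsD[OF that(1)] gapsD[OF that(3)] SR d that(2)
    by (metis R le_antisym not_le)
  thus "(gaps S - {(a, b)}) \<inter> gaps R = {}" by force
qed

text \<open>Stated without division, so that it makes sense in every commutative ring. Over the
  reals it says that refining one gap by \<open>R\<close> multiplies the weight by
  \<open>wt g R / g a b\<close>.\<close>

lemma wt_fill:
  assumes "finite S" "(a, b) \<in> gaps S" "R \<in> paths a b"
  shows "g a b * wt g (S \<union> R) = wt g S * wt g R"
proof -
  have "wt g (S \<union> R) = (\<Prod>(a, b)\<in>gaps S - {(a,b)}. g a b) * wt g R"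
    unfolding wt_def gaps_fill(1)[OF assms(2,3)]
    by (rule prod.union_disjoint) (use assms finite_path gaps_fill[OF assms(2,3)] in auto)
  moreover have "wt g S = g a b * (\<Prod>(a, b)\<in>gaps S - {(a,b)}. g a b)"
    unfolding wt_def by (subst prod.remove[of _ "(a,b)"]) (use assms in auto)
  ultimately show ?thesis by simp
qed

lemma gap_exists:
  assumes "finite S" "i \<in> S" "j \<in> S" "i < x" "x < j" "x \<notin> S"
  obtains a b where "(a, b) \<in> gaps S" "a < x" "x < b"
proof -
  define a where "a = Max (S \<inter> {..<x})"
  define b where "b = Min (S \<inter> {x<..})"
  have A: "finite (S \<inter> {..<x})" "S \<inter> {..<x} \<noteq> {}" and B: "finite (S \<inter> {x<..})" "S \<inter> {x<..} \<noteq> {}"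
    using assms by auto
  have a: "a \<in> S \<inter> {..<x}" unfolding a_def using A by (rule Max_in)
  have b: "b \<in> S \<inter> {x<..}" unfolding b_def using B by (rule Min_in)
  have "(a, b) \<in> gaps S"
  proof (rule gapsI)
    fix y assume y: "y \<in> S"
    show "y \<le> a \<or> b \<le> y"
    proof (cases "y < x")
      case True thus ?thesis unfolding a_def using A y by (intro disjI1 Max_ge) auto
    next
      case False
      hence "x < y" using assms y by (metis linorder_neqE_nat)
      thus ?thesis unfolding b_def using B y by (intro disjI2 Min_le) auto
    qed
  qed (use a b in auto)
  thus ?thesis using that a b by auto
qed

text \<open>Every contact except the first is the right end of exactly one gap. A reward attached to
  right ends of gaps is thus a reward attached to contacts.\<close>

lemma snd_gaps_bij:
  assumes "S \<in> paths i j"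
  shows "bij_betw snd (gaps S) (S - {i})"
  unfolding bij_betw_def
proof
  show "inj_on snd (gaps S)"
  proof (rule inj_onI, clarsimp)
    fix a b a' assume h: "(a, b) \<in> gaps S" "(a', b) \<in> gaps S"
    show "a = a'" using gaps_no_between[OF h(1)] gaps_no_between[OF h(2)] gapsD[OF h(1)] gapsD[OF h(2)]
      by (metis le_antisym not_le)
  qed
  show "snd ` gaps S = S - {i}"
  proof (intro equalityI subsetI)
    fix y assume "y \<in> snd ` gaps S"
    then obtain a where "(a,y) \<in> gaps S" by force
    thus "y \<in> S - {i}" using gapsD[of a y S] pathsD[OF assms] by force
  next
    fix y assume y: "y \<in> S - {i}"
    define a where "a = Max (S \<inter> {..<y})"
    have A: "finite (S \<inter> {..<y})" "S \<inter> {..<y} \<noteq> {}"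
      using finite_path[OF assms] y pathsD[OF assms] by (auto simp: disjoint_iff intro!: exI[of _ i])
    have a: "a \<in> S \<inter> {..<y}" unfolding a_def using A by (rule Max_in)
    have "(a, y) \<in> gaps S"
    proof (rule gapsI)
      fix x assume x: "x \<in> S"
      show "x \<le> a \<or> y \<le> x"
      proof (cases "x < y")
        case True thus ?thesis unfolding a_def using A x by (intro disjI1 Max_ge) auto
      qed auto
    qed (use a y in auto)
    thus "y \<in> snd ` gaps S" by force
  qed
qed

lemma wt_mult_end:
  assumes "S \<in> paths i j"
  shows "wt (\<lambda>a b. q a b * r b) S = wt q S * (\<Prod>x\<in>S - {i}. r x)"
proof -
  have "(\<Prod>x\<in>S - {i}. r x) = (\<Prod>y\<in>gaps S. r (snd y))"
    using prod.reindex_bij_betw[OF snd_gaps_bij[OF assms], of r] by simp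
  thus ?thesis unfolding wt_def by (simp add: prod.distrib case_prod_unfold)
qed

lemma card_gaps_le:
  assumes "S \<in> paths i j"
  shows "card (gaps S) \<le> j - i"
proof -
  have "card (gaps S) = card (S - {i})" using snd_gaps_bij[OF assms] by (rule bij_betw_same_card)
  also have "\<dots> \<le> card {i<..j}" using pathsD[OF assms] by (intro card_mono) force+
  finally show ?thesis by simp
qed

section \<open>Exchange of tails between two paths\<close>

definition disj_pairs :: "nat \<Rightarrow> nat \<Rightarrow> nat \<Rightarrow> nat \<Rightarrow> (nat set \<times> nat set) set" where
  "disj_pairs i j i' j' = {(S, S') \<in> paths i j \<times> paths i' j'. S \<inter> S' = {}}"

definition disj_sum :: "(nat \<Rightarrow> nat \<Rightarrow> 'c::comm_ring_1) \<Rightarrow> nat \<Rightarrow> nat \<Rightarrow> nat \<Rightarrow> nat \<Rightarrow> 'c" where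
  "disj_sum g i j i' j' = (\<Sum>(S, S')\<in>disj_pairs i j i' j'. wt g S * wt g S')"

lemma finite_disj_pairs [simp, intro]: "finite (disj_pairs i j i' j')"
  unfolding disj_pairs_def by (rule finite_subset[of _ "paths i j \<times> paths i' j'"]) auto

text \<open>Two paths that meet may exchange their tails after the first meeting point.\<close>

lemma meeting_sum_swap:
  fixes g :: "nat \<Rightarrow> nat \<Rightarrow> 'c::comm_ring_1"
  shows "path_sum g i j * path_sum g i' j' - disj_sum g i j i' j'
       = path_sum g i j' * path_sum g i' j - disj_sum g i j' i' j"
proof -
  define M where "M j j' = {(S, S') \<in> paths i j \<times> paths i' j'. S \<inter> S' \<noteq> {}}" for j j'
  have fM: "finite (M j j')" for j j'
    unfolding M_def by (rule finite_subset[of _ "paths i j \<times> paths i' j'"]) auto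
  have split: "path_sum g i j * path_sum g i' j' - disj_sum g i j i' j' = (\<Sum>(S, S')\<in>M j j'. wt g S * wt g S')" for j j'
  proof -
    have "path_sum g i j * path_sum g i' j' = (\<Sum>(S, S')\<in>paths i j \<times> paths i' j'. wt g S * wt g S')"
      unfolding path_sum_def by (simp add: sum_product sum.cartesian_product)
    also have "paths i j \<times> paths i' j' = disj_pairs i j i' j' \<union> M j j'"
      unfolding disj_pairs_def M_def by auto
    also have "(\<Sum>(S, S')\<in>disj_pairs i j i' j' \<union> M j j'. wt g S * wt g S')
      = disj_sum g i j i' j' + (\<Sum>(S, S')\<in>M j j'. wt g S * wt g S')"
      unfolding disj_sum_def
      by (rule sum.union_disjoint[OF finite_disj_pairs fM]) (auto simp: disj_pairs_def M_def)
    finally show ?thesis by simp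
  qed
  define sw where "sw = (\<lambda>(S, S'). let x = Min (S \<inter> S') in
     (S \<inter> {..x} \<union> S' \<inter> {x..}, S' \<inter> {..x} \<union> S \<inter> {x..}) :: nat set \<times> nat set)"
  have key: "sw (S, S') \<in> M j' j \<and> sw (sw (S, S')) = (S, S') \<and>
        wt g (fst (sw (S,S'))) * wt g (snd (sw (S,S'))) = wt g S * wt g S'"
    if SS: "(S, S') \<in> M j j'" for S S' j j'
  proof -
    have S: "S \<in> paths i j" and S': "S' \<in> paths i' j'" and ne: "S \<inter> S' \<noteq> {}" using SS by (auto simp: M_def)
    define x where "x = Min (S \<inter> S')"
    have fin: "finite (S \<inter> S')" using finite_path[OF S] by auto
    have x: "x \<in> S \<inter> S'" unfolding x_def using fin ne by (rule Min_in)
    define U where "U = S \<inter> {..x} \<union> S' \<inter> {x..}"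
    define U' where "U' = S' \<inter> {..x} \<union> S \<inter> {x..}"
    have sw: "sw (S, S') = (U, U')" by (simp add: sw_def U_def U'_def x_def Let_def)
    have xS: "x \<in> S" "x \<in> S'" using x by auto
    \<comment> \<open>The exchange leaves the intersection of the two paths unchanged, hence also
      their first meeting point; this makes \<open>sw\<close> an involution.\<close>
    have UU: "U \<inter> U' = S \<inter> S'" using xS unfolding U_def U'_def by auto
    have U: "U \<in> paths i j'" unfolding U_def by (rule concat_path[OF split_path(1)[OF S] split_path(2)[OF S']]) (use x in auto)
    have U': "U' \<in> paths i' j" unfolding U'_def by (rule concat_path[OF split_path(1)[OF S'] split_path(2)[OF S]]) (use x in auto)
    have "sw (U, U') = (S, S')"
    proof -
      have "sw (U, U') = (U \<inter> {..x} \<union> U' \<inter> {x..}, U' \<inter> {..x} \<union> U \<inter> {x..})"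
        by (simp add: sw_def UU x_def Let_def)
      moreover have "U \<inter> {..x} = S \<inter> {..x}" "U' \<inter> {x..} = S \<inter> {x..}"
        "U' \<inter> {..x} = S' \<inter> {..x}" "U \<inter> {x..} = S' \<inter> {x..}"
        using xS unfolding U_def U'_def by (auto dest: le_antisym)
      moreover have "S \<inter> {..x} \<union> S \<inter> {x..} = S" "S' \<inter> {..x} \<union> S' \<inter> {x..} = S'" by auto
      ultimately show ?thesis by simp
    qed
    moreover have "wt g U * wt g U' = wt g S * wt g S'"
    proof -
      have "wt g U = wt g (S \<inter> {..x}) * wt g (S' \<inter> {x..})"
        unfolding U_def by (rule wt_concat[OF split_path(1)[OF S] split_path(2)[OF S']]) (use x in auto)
      moreover have "wt g U' = wt g (S' \<inter> {..x}) * wt g (S \<inter> {x..})"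
        unfolding U'_def by (rule wt_concat[OF split_path(1)[OF S'] split_path(2)[OF S]]) (use x in auto)
      ultimately show ?thesis using wt_split[OF S xS(1), of g] wt_split[OF S' xS(2), of g] by (simp add: mult_ac)
    qed
    moreover have "(U, U') \<in> M j' j" using U U' UU ne by (auto simp: M_def)
    ultimately show ?thesis by (simp add: sw)
  qed
  have "(\<Sum>y\<in>M j j'. wt g (fst y) * wt g (snd y)) = (\<Sum>y\<in>M j' j. wt g (fst y) * wt g (snd y))"
    by (rule sum.reindex_bij_witness[of _ sw sw]) (use key in \<open>auto\<close>)
  thus ?thesis using split[of j j'] split[of j' j] by (simp add: case_prod_unfold)
qed

section \<open>Positive weights and insertion of points\<close>

definition pos_wt :: "(nat \<Rightarrow> nat \<Rightarrow> real) \<Rightarrow> bool" where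
  "pos_wt g \<longleftrightarrow> (\<forall>a b. a < b \<longrightarrow> 0 < g a b)"

lemma pos_wtD: "pos_wt g \<Longrightarrow> a < b \<Longrightarrow> 0 < g a b"
  by (simp add: pos_wt_def)

lemma wt_pos:
  fixes g :: "nat \<Rightarrow> nat \<Rightarrow> real"
  assumes "pos_wt g"
  shows "0 < wt g S"
  unfolding wt_def by (rule prod_pos) (use assms gapsD in \<open>force simp: pos_wt_def\<close>)

lemma wt_nonneg:
  fixes g :: "nat \<Rightarrow> nat \<Rightarrow> real"
  assumes "pos_wt g"
  shows "0 \<le> wt g S"
  using wt_pos[of g S] assms by (simp add: less_imp_le)

lemma path_sum_pos:
  fixes g :: "nat \<Rightarrow> nat \<Rightarrow> real"
  assumes "pos_wt g" "i \<le> j"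
  shows "0 < path_sum g i j"
  unfolding path_sum_def
proof (rule sum_pos)
  show "paths i j \<noteq> {}" using assms(2) by (auto simp: paths_def intro!: exI[of _ "{i..j}"])
qed (use wt_pos[OF assms(1)] in auto)

lemma path_sum_nonneg:
  fixes g :: "nat \<Rightarrow> nat \<Rightarrow> real"
  assumes "pos_wt g"
  shows "0 \<le> path_sum g i j"
  unfolding path_sum_def by (intro sum_nonneg less_imp_le wt_pos assms)

text \<open>Filling a prescribed gap \<open>(a, b)\<close> with an arbitrary path from
  \<open>a\<close> to \<open>b\<close> is injective, because the filling can be read off inside
  \<open>{a..b}\<close>. Each gap of \<open>J\<close> therefore reduces the total weight by the
  factor \<open>g a b / path_sum g a b\<close>.\<close>

lemma sum_fill_gaps_le:
  fixes g :: "nat \<Rightarrow> nat \<Rightarrow> real"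
  assumes g: "pos_wt g" and J: "finite J" "\<And>a b. (a, b) \<in> J \<Longrightarrow> a < b"
  shows "(\<Sum>S | S \<in> paths i j \<and> J \<subseteq> gaps S. wt g S) * (\<Prod>(a, b)\<in>J. path_sum g a b / g a b)
    \<le> path_sum g i j"
  using J
proof (induction J rule: finite_induct)
  case empty
  then show ?case by (simp add: path_sum_def)
next
  case (insert I J)
  obtain a b where I: "I = (a, b)" by (cases I)
  have ab: "a < b" using insert.prems[of a b] I by simp
  let ?A = "{S. S \<in> paths i j \<and> insert I J \<subseteq> gaps S}"
  let ?B = "{S. S \<in> paths i j \<and> J \<subseteq> gaps S}"
  have fA: "finite ?A" and fB: "finite ?B" by auto
  have inj: "inj_on (\<lambda>(S, R). S \<union> R) (?A \<times> paths a b)"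
  proof (rule inj_onI, clarify)
    fix S R S' R'
    assume h: "S \<in> paths i j" "insert I J \<subseteq> gaps S" "R \<in> paths a b"
      "S' \<in> paths i j" "insert I J \<subseteq> gaps S'" "R' \<in> paths a b" "S \<union> R = S' \<union> R'"
    have *: "S = (S \<union> R) - {a<..<b} \<and> R = (S \<union> R) \<inter> {a..b}"
      if "(a,b) \<in> gaps S" "R \<in> paths a b" for S R
      using that unfolding gaps_def paths_def by (auto simp: le_less)
    show "S = S' \<and> R = R'" using *[of S R] *[of S' R'] h I by auto
  qed
  have "(\<Sum>S\<in>?A. wt g S) * (path_sum g a b / g a b) = (\<Sum>(S, R)\<in>?A \<times> paths a b. wt g S * wt g R / g a b)"
    unfolding path_sum_def
    by (simp add: sum_product sum.cartesian_product sum_divide_distrib)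
  also have "\<dots> = (\<Sum>(S, R)\<in>?A \<times> paths a b. wt g (S \<union> R))"
  proof (rule sum.cong[OF refl], clarify)
    fix S R assume h: "S \<in> paths i j" "insert I J \<subseteq> gaps S" "R \<in> paths a b"
    have "g a b * wt g (S \<union> R) = wt g S * wt g R"
      by (rule wt_fill) (use h I finite_path in auto)
    thus "wt g S * wt g R / g a b = wt g (S \<union> R)" using pos_wtD[OF g ab] by (simp add: field_simps)
  qed
  also have "\<dots> = (\<Sum>U\<in>(\<lambda>(S, R). S \<union> R) ` (?A \<times> paths a b). wt g U)"
    by (subst sum.reindex[OF inj]) (simp add: case_prod_unfold)
  also have "\<dots> \<le> (\<Sum>U\<in>?B. wt g U)"
  proof (rule sum_mono2[OF fB])
    show "(\<lambda>(S, R). S \<union> R) ` (?A \<times> paths a b) \<subseteq> ?B"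
    proof clarify
      fix S R assume h: "S \<in> paths i j" "insert I J \<subseteq> gaps S" "R \<in> paths a b"
      have g1: "(a,b) \<in> gaps S" using h I by auto
      show "S \<union> R \<in> paths i j \<and> J \<subseteq> gaps (S \<union> R)"
        using fill_path[OF h(1) g1 h(3)] gaps_fill(1)[OF g1 h(3)] h(2) insert.hyps I by auto
    qed
  qed (use wt_nonneg[OF g] in auto)
  finally have 1: "(\<Sum>S\<in>?A. wt g S) * (path_sum g a b / g a b) \<le> (\<Sum>U\<in>?B. wt g U)" .
  have pos: "0 \<le> (\<Prod>(a, b)\<in>J. path_sum g a b / g a b)"
    using insert.prems pos_wtD[OF g] path_sum_nonneg[OF g]
    by (intro prod_nonneg) (auto intro!: divide_nonneg_nonneg less_imp_le[OF pos_wtD[OF g]])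
  have "(\<Sum>S\<in>?A. wt g S) * (\<Prod>(a, b)\<in>insert I J. path_sum g a b / g a b)
     = (\<Sum>S\<in>?A. wt g S) * (path_sum g a b / g a b) * (\<Prod>(a, b)\<in>J. path_sum g a b / g a b)"
    using insert.hyps I by simp
  also have "\<dots> \<le> (\<Sum>U\<in>?B. wt g U) * (\<Prod>(a, b)\<in>J. path_sum g a b / g a b)"
    by (rule mult_right_mono[OF 1 pos])
  also have "\<dots> \<le> path_sum g i j" using insert.IH insert.prems by auto
  finally show ?case .
qed

text \<open>The fraction \<open>1/8\<close> leaves enough short gaps for both of two polymers on \<open>{i..j}\<close>.\<close>

definition big_gaps :: "nat \<Rightarrow> nat set \<Rightarrow> (nat \<times> nat) set" where
  "big_gaps m S = {(a, b) \<in> gaps S. m \<le> b - a}"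

definition total_length :: "(nat \<times> nat) set \<Rightarrow> nat" where
  "total_length J = (\<Sum>(a, b)\<in>J. b - a)"

text \<open>Only the long gaps of a path are remembered, so that the union bound runs over few sets
  instead of all paths. The witness \<open>S\<close> keeps the gaps of \<open>J\<close> inside
  \<open>{i..j}\<close> and makes their interiors disjoint.\<close>

definition gap_families :: "nat \<Rightarrow> nat \<Rightarrow> nat \<Rightarrow> (nat \<times> nat) set set" where
  "gap_families m i j = {J. (\<exists>S\<subseteq>{i..j}. J \<subseteq> big_gaps m S) \<and> j - i \<le> 8 * total_length J}"

lemma gap_families_subset:
  "J \<in> gap_families m i j \<Longrightarrow> J \<subseteq> {(a, b). i \<le> a \<and> a < b \<and> b \<le> j \<and> m \<le> b - a}"
  unfolding gap_families_def big_gaps_def gaps_def by auto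

lemma finite_gap_families [simp, intro]: "finite (gap_families m i j)"
proof (rule finite_subset)
  show "gap_families m i j \<subseteq> Pow ({i..j} \<times> {i..j})" using gap_families_subset by fastforce
qed auto

lemma gap_familyD:
  assumes "J \<in> gap_families m i j"
  shows "finite J" "\<And>a b. (a, b) \<in> J \<Longrightarrow> a < b \<and> m \<le> b - a"
proof -
  have "J \<subseteq> {i..j} \<times> {i..j}" using gap_families_subset[OF assms] by auto
  thus "finite J" by (rule finite_subset) auto
qed (use gap_families_subset[OF assms] in auto)

lemma sum_UN_le:
  fixes f :: "'b \<Rightarrow> real"
  assumes "finite I" "\<And>i. i \<in> I \<Longrightarrow> finite (A i)" "\<And>x. 0 \<le> f x"
  shows "sum f (\<Union>i\<in>I. A i) \<le> (\<Sum>i\<in>I. sum f (A i))"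
  using assms(1,2)
proof (induction I rule: finite_induct)
  case (insert x F)
  have "sum f (\<Union>i\<in>insert x F. A i) + sum f (A x \<inter> (\<Union>i\<in>F. A i)) = sum f (A x) + sum f (\<Union>i\<in>F. A i)"
    using insert by (simp add: sum.union_inter)
  moreover have "0 \<le> sum f (A x \<inter> (\<Union>i\<in>F. A i))" by (intro sum_nonneg assms(3))
  ultimately show ?case using insert by simp
qed simp

text \<open>The families belong to the larger interval \<open>{i..j}\<close>, so that one bound
  serves all four intervals that occur in a second difference.\<close>

lemma sum_many_big_gaps_le:
  fixes g :: "nat \<Rightarrow> nat \<Rightarrow> real"
  assumes g: "pos_wt g" and ij: "i \<le> i'" "j' \<le> j"
  shows "(\<Sum>S | S \<in> paths i' j' \<and> j - i \<le> 8 * total_length (big_gaps m S). wt g S)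
     \<le> path_sum g i' j' * (\<Sum>J\<in>gap_families m i j. \<Prod>(a, b)\<in>J. g a b / path_sum g a b)"
proof -
  let ?F = "gap_families m i j"
  have fin: "finite (\<Union>J\<in>?F. {S. S \<in> paths i' j' \<and> J \<subseteq> gaps S})" by auto
  have "(\<Sum>S | S \<in> paths i' j' \<and> j - i \<le> 8 * total_length (big_gaps m S). wt g S)
     \<le> (\<Sum>S\<in>(\<Union>J\<in>?F. {S. S \<in> paths i' j' \<and> J \<subseteq> gaps S}). wt g S)"
  proof (rule sum_mono2[OF fin], clarify)
    fix S assume S: "S \<in> paths i' j'" "j - i \<le> 8 * total_length (big_gaps m S)"
    have "S \<subseteq> {i..j}" using pathsD(1)[OF S(1)] ij by auto
    hence "big_gaps m S \<in> ?F" using S unfolding gap_families_def by auto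
    moreover have "big_gaps m S \<subseteq> gaps S" unfolding big_gaps_def by auto
    ultimately show "S \<in> (\<Union>J\<in>?F. {S. S \<in> paths i' j' \<and> J \<subseteq> gaps S})" using S by blast
  qed (use wt_nonneg[OF g] in auto)
  also have "\<dots> \<le> (\<Sum>J\<in>?F. \<Sum>S | S \<in> paths i' j' \<and> J \<subseteq> gaps S. wt g S)"
    by (rule sum_UN_le) (use wt_nonneg[OF g] in auto)
  also have "\<dots> \<le> (\<Sum>J\<in>?F. path_sum g i' j' * (\<Prod>(a, b)\<in>J. g a b / path_sum g a b))"
  proof (rule sum_mono)
    fix J assume J: "J \<in> ?F"
    have le: "(\<Sum>S | S \<in> paths i' j' \<and> J \<subseteq> gaps S. wt g S) * (\<Prod>(a, b)\<in>J. path_sum g a b / g a b)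
       \<le> path_sum g i' j'"
      by (rule sum_fill_gaps_le[OF g]) (use gap_familyD[OF J] in auto)
    have pos: "0 < (\<Prod>(a, b)\<in>J. path_sum g a b / g a b)"
      by (rule prod_pos) (use gap_familyD[OF J] in \<open>auto intro!: divide_pos_pos path_sum_pos[OF g] pos_wtD[OF g] less_imp_le\<close>)
    have "(\<Prod>(a, b)\<in>J. g a b / path_sum g a b) = inverse (\<Prod>(a, b)\<in>J. path_sum g a b / g a b)"
      by (simp add: prod_inversef[symmetric] case_prod_unfold comp_def)
    thus "(\<Sum>S | S \<in> paths i' j' \<and> J \<subseteq> gaps S. wt g S) \<le> path_sum g i' j' * (\<Prod>(a, b)\<in>J. g a b / path_sum g a b)"
      using pos_le_divide_eq[OF pos] le by (simp add: divide_inverse)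
  qed
  finally show ?thesis by (simp add: sum_distrib_left)
qed

text \<open>At such a point a contact is present or can be inserted at bounded cost: the new gaps
  are shorter than \<open>m\<close>, so only finitely many values of the inter-arrival law are
  involved.\<close>

definition good :: "nat \<Rightarrow> nat set \<Rightarrow> nat \<Rightarrow> bool" where
  "good m S x \<longleftrightarrow> x \<in> S \<or> (\<exists>a b. (a, b) \<in> gaps S \<and> a < x \<and> x < b \<and> b - a < m)"

text \<open>A point that is not good lies strictly inside a long gap.\<close>

lemma card_not_good_le:
  assumes "S \<in> paths i j"
  shows "card {x \<in> {i..j}. \<not> good m S x} \<le> total_length (big_gaps m S)"
proof -
  have fin: "finite (big_gaps m S)"
    by (rule finite_subset[of _ "gaps S"]) (use finite_path[OF assms] in \<open>auto simp: big_gaps_def\<close>)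
  have "{x \<in> {i..j}. \<not> good m S x} \<subseteq> (\<Union>(a, b)\<in>big_gaps m S. {a<..<b})"
  proof
    fix x assume x: "x \<in> {x \<in> {i..j}. \<not> good m S x}"
    hence nS: "x \<notin> S" "i \<le> x" "x \<le> j" by (auto simp: good_def)
    have "i < x" "x < j" using nS pathsD[OF assms] by (auto simp: le_less)
    then obtain a b where ab: "(a, b) \<in> gaps S" "a < x" "x < b"
      using gap_exists[OF finite_path[OF assms] pathsD(2,3)[OF assms] _ _ nS(1)] by blast
    have "m \<le> b - a" using x ab unfolding good_def by (metis (no_types, lifting) mem_Collect_eq not_less)
    thus "x \<in> (\<Union>(a, b)\<in>big_gaps m S. {a<..<b})" using ab unfolding big_gaps_def by force
  qed
  hence "card {x \<in> {i..j}. \<not> good m S x} \<le> card (\<Union>(a, b)\<in>big_gaps m S. {a<..<b})"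
    by (rule card_mono[rotated]) (use fin in auto)
  also have "\<dots> \<le> (\<Sum>y\<in>big_gaps m S. card (case y of (a, b) \<Rightarrow> {a<..<b}))" using fin by (rule card_UN_le)
  also have "\<dots> \<le> total_length (big_gaps m S)" unfolding total_length_def by (rule sum_mono) auto
  finally show ?thesis .
qed

text \<open>The points are inserted one at a time. An insertion splits a short gap into two shorter
  ones, so the remaining points stay good; the last claim is carried along because the induction
  needs it.\<close>

lemma add_good_points:
  fixes g :: "nat \<Rightarrow> nat \<Rightarrow> real"
  assumes g: "pos_wt g"
    and \<epsilon>: "0 < \<epsilon>" "\<epsilon> \<le> 1" "\<forall>a x b. a < x \<and> x < b \<and> b - a < m \<and> x \<in> X \<longrightarrow> \<epsilon> * g a b \<le> g a x * g x b"
    and S: "S \<in> paths i j" and A: "finite A" "A \<subseteq> X" "\<forall>x\<in>A. good m S x"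
  shows "S \<union> A \<in> paths i j \<and> \<epsilon> ^ card A * wt g S \<le> wt g (S \<union> A) \<and> (\<forall>y. good m S y \<longrightarrow> good m (S \<union> A) y)"
  using A
proof (induction A rule: finite_induct)
  case empty
  then show ?case using S by simp
next
  case (insert x A)
  define U where "U = S \<union> A"
  have IH: "U \<in> paths i j" "\<epsilon> ^ card A * wt g S \<le> wt g U" "\<And>y. good m S y \<Longrightarrow> good m U y"
    using insert.IH insert.prems unfolding U_def by auto
  have gx: "good m U x" using insert.prems IH by auto
  have e: "\<epsilon> ^ card (insert x A) * wt g S \<le> \<epsilon> * wt g U"
    using IH(2) insert.hyps \<epsilon>(1) by (simp add: mult.assoc)
  have Ui: "S \<union> insert x A = insert x U" unfolding U_def by auto
  show ?case
  proof (cases "x \<in> U")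
    case True
    hence [simp]: "insert x U = U" by auto
    have "\<epsilon> * wt g U \<le> 1 * wt g U" by (rule mult_right_mono) (use \<epsilon> wt_nonneg[OF g] in auto)
    thus ?thesis unfolding Ui using IH e by auto
  next
    case False
    then obtain a b where ab: "(a, b) \<in> gaps U" "a < x" "x < b" "b - a < m" using gx unfolding good_def by auto
    define R where "R = {a, x, b}"
    have R: "R \<in> paths a b" unfolding R_def paths_def using ab by auto
    have UR: "insert x U = U \<union> R" unfolding R_def using gapsD[OF ab(1)] by auto
    have gR: "gaps R = {(a,x),(x,b)}" unfolding R_def gaps_def using ab by auto
    have wR: "wt g R = g a x * g x b" unfolding wt_def gR using ab by simp
    have w: "g a b * wt g (U \<union> R) = wt g U * (g a x * g x b)"
      using wt_fill[OF finite_path[OF IH(1)] ab(1) R, of g] wR by simp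
    have gab: "0 < g a b" using pos_wtD[OF g] ab by auto
    have "g a b * (\<epsilon> * wt g U) \<le> g a b * wt g (U \<union> R)"
    proof -
      have "wt g U * (\<epsilon> * g a b) \<le> wt g U * (g a x * g x b)"
        by (rule mult_left_mono) (use \<epsilon>(3) ab insert.prems wt_nonneg[OF g] in auto)
      thus ?thesis using w by (simp add: mult_ac)
    qed
    hence "\<epsilon> * wt g U \<le> wt g (U \<union> R)" using gab by simp
    moreover have "good m (U \<union> R) y" if y: "good m U y" for y
    proof -
      have gg: "gaps (U \<union> R) = gaps U - {(a, b)} \<union> {(a,x),(x,b)}" using gaps_fill(1)[OF ab(1) R] gR by simp
      consider "y \<in> U" | c d where "(c,d) \<in> gaps U" "c < y" "y < d" "d - c < m" using y unfolding good_def by auto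
      thus ?thesis
      proof cases
        case 2
        show ?thesis
        proof (cases "(c,d) = (a,b)")
          case True
          hence "y = x \<or> (a < y \<and> y < x) \<or> (x < y \<and> y < b)" using 2 by auto
          moreover have "x - a < m" "b - x < m" using ab by auto
          moreover have "(a, x) \<in> gaps (U \<union> R)" "(x, b) \<in> gaps (U \<union> R)" "x \<in> U \<union> R"
            unfolding gg by (auto simp: R_def)
          ultimately show ?thesis unfolding good_def by blast
        next
          case False
          thus ?thesis using 2 unfolding good_def gg by blast
        qed
      qed (auto simp: good_def)
    qed
    ultimately show ?thesis unfolding Ui UR using e IH fill_path[OF IH(1) ab(1) R] by auto
  qed
qed

lemma sum_power_card_Pow:
  fixes t :: real
  assumes "finite B"
  shows "(\<Sum>A\<in>Pow B. t ^ card A) = (1 + t) ^ card B"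
  using prod_add[OF assms, of "\<lambda>_. t" "\<lambda>_. 1"] by (simp add: add.commute)

text \<open>Points added to both paths become their meeting points, hence the added set can be read off
  the modified pair; only the choice which of the two paths already contained the point is lost.\<close>

lemma disjoint_pairs_good_le:
  fixes g :: "nat \<Rightarrow> nat \<Rightarrow> real"
  assumes g: "pos_wt g"
    and \<epsilon>: "0 < \<epsilon>" "\<epsilon> \<le> 1" "\<forall>a x b. a < x \<and> x < b \<and> b - a < m \<and> x \<in> X \<longrightarrow> \<epsilon> * g a b \<le> g a x * g x b"
    and X: "finite X"
  shows "(\<Sum>(S, S') | (S, S') \<in> disj_pairs i j i' j' \<and> G \<le> card {x \<in> X. good m S x \<and> good m S' x}. wt g S * wt g S')
     * (1 + \<epsilon>\<^sup>2 / 4) ^ G \<le> path_sum g i j * path_sum g i' j'"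
proof -
  define P where "P = {(S, S'). (S, S') \<in> disj_pairs i j i' j' \<and> G \<le> card {x \<in> X. good m S x \<and> good m S' x}}"
  define Q where "Q S S' = {x \<in> X. good m S x \<and> good m S' x}" for S S'
  define C where "C = (SIGMA (U, U') : paths i j \<times> paths i' j'. Pow (U \<inter> U') \<times> Pow (U \<inter> U'))"
  define T where "T = (SIGMA (S, S') : P. Pow (Q S S'))"
  have fP: "finite P" unfolding P_def by (rule finite_subset[of _ "disj_pairs i j i' j'"]) auto
  have fQ: "finite (Q S S')" for S S' unfolding Q_def using X by auto
  have fin_int: "finite (U \<inter> U')" if "U \<in> paths i j" for U U' using finite_path[OF that] by auto
  have fC: "finite C" unfolding C_def
    using fin_int by (intro finite_SigmaI) (auto simp: case_prod_unfold simp del: Pow_Int_eq)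
  \<comment> \<open>A common point costs a factor \<open>\<epsilon>\<close> in each of the two
    paths. The factor 1/4 pays for the pair of subsets recorded by \<open>\<phi>\<close>, which has
    \<open>4 ^ card A\<close> possible values once the intersection \<open>A\<close> is
    known.\<close>
  define t where "t = \<epsilon>\<^sup>2 / 4"
  define \<phi> where "\<phi> = (\<lambda>((S, S'), A). ((S \<union> A, S' \<union> A), (A \<inter> S, A \<inter> S')) :: (nat set \<times> nat set) \<times> (nat set \<times> nat set))"
  have T: "S \<in> paths i j" "S' \<in> paths i' j'" "S \<inter> S' = {}" "A \<subseteq> X" "finite A"
     "\<forall>x\<in>A. good m S x" "\<forall>x\<in>A. good m S' x"
    if "((S, S'), A) \<in> T" for S S' A
    using that X by (auto simp: T_def P_def Q_def disj_pairs_def dest: finite_subset)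
  have addS: "S \<union> A \<in> paths i j" "\<epsilon> ^ card A * wt g S \<le> wt g (S \<union> A)"
     "S' \<union> A \<in> paths i' j'" "\<epsilon> ^ card A * wt g S' \<le> wt g (S' \<union> A)"
    if t: "((S, S'), A) \<in> T" for S S' A
    using add_good_points[OF g \<epsilon> T(1)[OF t] T(5)[OF t] T(4)[OF t] T(6)[OF t]]
       add_good_points[OF g \<epsilon> T(2)[OF t] T(5)[OF t] T(4)[OF t] T(7)[OF t]] by auto
  have inter: "(S \<union> A) \<inter> (S' \<union> A) = A" if "((S, S'), A) \<in> T" for S S' A
    using T(3)[OF that] by auto
  have inj: "inj_on \<phi> T"
  proof (rule inj_onI)
    fix y z assume y: "y \<in> T" and z: "z \<in> T" and e: "\<phi> y = \<phi> z"
    obtain S S' A where yy: "y = ((S, S'), A)" by (metis prod.exhaust)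
    obtain V V' B where zz: "z = ((V, V'), B)" by (metis prod.exhaust)
    have "S \<union> A = V \<union> B" "S' \<union> A = V' \<union> B" "A \<inter> S = B \<inter> V" "A \<inter> S' = B \<inter> V'"
      using e unfolding yy zz \<phi>_def by auto
    moreover have "A = B" using inter[of S S' A] inter[of V V' B] y z calculation unfolding yy zz by simp
    ultimately show "y = z" unfolding yy zz by auto
  qed
  have "(\<Sum>(S, S')\<in>P. wt g S * wt g S') * (1 + t) ^ G
      \<le> (\<Sum>(S, S')\<in>P. wt g S * wt g S' * (1 + t) ^ card (Q S S'))"
    unfolding sum_distrib_right
  proof (rule sum_mono, clarify)
    fix S S' assume "(S, S') \<in> P"
    hence "G \<le> card (Q S S')" unfolding P_def Q_def by auto
    thus "wt g S * wt g S' * (1 + t) ^ G \<le> wt g S * wt g S' * (1 + t) ^ card (Q S S')"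
      by (intro mult_left_mono power_increasing mult_nonneg_nonneg less_imp_le[OF wt_pos[OF g]]) (auto simp: t_def)
  qed
  \<comment> \<open>By the binomial theorem the power of \<open>1 + t\<close> is a sum over the sets
    \<open>A\<close> of common good points to be inserted.\<close>
  also have "\<dots> = (\<Sum>(S, S')\<in>P. \<Sum>A\<in>Pow (Q S S'). wt g S * wt g S' * t ^ card A)"
    by (simp add: sum_distrib_left[symmetric] sum_power_card_Pow[OF fQ])
  also have "\<dots> = (\<Sum>((S, S'), A)\<in>T. wt g S * wt g S' * t ^ card A)"
    unfolding T_def by (subst sum.Sigma[symmetric]) (use fP fQ in \<open>auto simp: case_prod_unfold\<close>)
  also have "\<dots> \<le> (\<Sum>y\<in>T. case \<phi> y of ((U, U'), B) \<Rightarrow> wt g U * wt g U' * (1/4) ^ card (U \<inter> U'))"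
  proof (rule sum_mono, clarify)
    fix S S' A assume t: "((S, S'), A) \<in> T"
    have "(\<epsilon> ^ card A * wt g S) * (\<epsilon> ^ card A * wt g S') \<le> wt g (S \<union> A) * wt g (S' \<union> A)"
      by (rule mult_mono) (use addS[OF t] \<epsilon> wt_pos[OF g] in \<open>auto intro!: mult_nonneg_nonneg less_imp_le\<close>)
    hence "(\<epsilon> ^ card A * wt g S) * (\<epsilon> ^ card A * wt g S') * (1/4) ^ card A \<le> wt g (S \<union> A) * wt g (S' \<union> A) * (1/4) ^ card A"
      by (intro mult_right_mono) auto
    moreover have "t ^ card A = \<epsilon> ^ card A * \<epsilon> ^ card A * (1/4) ^ card A"
      unfolding t_def by (simp add: power_divide power2_eq_square power_mult_distrib)
    ultimately show "wt g S * wt g S' * t ^ card A \<le> (case \<phi> ((S, S'), A) of ((U, U'), B) \<Rightarrow> wt g U * wt g U' * (1/4) ^ card (U \<inter> U'))"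
      unfolding \<phi>_def using inter[OF t] by (simp add: mult_ac)
  qed
  also have "\<dots> = (\<Sum>z\<in>\<phi> ` T. case z of ((U, U'), B) \<Rightarrow> wt g U * wt g U' * (1/4) ^ card (U \<inter> U'))"
    by (subst sum.reindex[OF inj]) simp
  also have "\<dots> \<le> (\<Sum>z\<in>C. case z of ((U, U'), B) \<Rightarrow> wt g U * wt g U' * (1/4) ^ card (U \<inter> U'))"
  proof (rule sum_mono2[OF fC])
    show "\<phi> ` T \<subseteq> C"
    proof (rule image_subsetI)
      fix y assume y: "y \<in> T"
      obtain S S' A where yy: "y = ((S, S'), A)" by (metis prod.exhaust)
      show "\<phi> y \<in> C" using addS[OF y[unfolded yy]] unfolding yy \<phi>_def C_def by auto
    qed
  qed (use wt_nonneg[OF g] in \<open>auto intro!: mult_nonneg_nonneg\<close>)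
  also have "\<dots> = (\<Sum>(U, U')\<in>paths i j \<times> paths i' j'. \<Sum>B\<in>Pow (U \<inter> U') \<times> Pow (U \<inter> U'). wt g U * wt g U' * (1/4) ^ card (U \<inter> U'))"
    unfolding C_def by (subst sum.Sigma[symmetric]) (use fin_int in \<open>auto simp: case_prod_unfold simp del: Pow_Int_eq\<close>)
  also have "\<dots> = (\<Sum>(U, U')\<in>paths i j \<times> paths i' j'. wt g U * wt g U')"
  proof (rule sum.cong[OF refl], clarify)
    fix U U' assume U: "U \<in> paths i j"
    have "real (card (Pow (U \<inter> U') \<times> Pow (U \<inter> U'))) = 4 ^ card (U \<inter> U')"
      using fin_int[OF U] by (simp add: card_cartesian_product card_Pow power_mult_distrib[symmetric] del: Pow_Int_eq)
    thus "(\<Sum>B\<in>Pow (U \<inter> U') \<times> Pow (U \<inter> U'). wt g U * wt g U' * (1/4) ^ card (U \<inter> U')) = wt g U * wt g U'"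
      by (simp add: power_one_over)
  qed
  also have "\<dots> = path_sum g i j * path_sum g i' j'"
    unfolding path_sum_def by (simp add: sum_product sum.cartesian_product)
  finally show ?thesis unfolding P_def t_def by simp
qed

section \<open>Cumulants of the number of contacts\<close>

lemma norm_exp_minus_one_le:
  fixes u :: complex
  assumes "norm u \<le> 1/2"
  shows "norm (exp u - 1) \<le> 2 * norm u"
proof -
  have "norm (exp u - exp 0) \<le> 2 * norm (u - 0)"
  proof (rule field_differentiable_bound[of "cball 0 (1/2)" exp exp])
    fix z :: complex assume z: "z \<in> cball 0 (1/2)"
    show "(exp has_field_derivative exp z) (at z within cball 0 (1 / 2))"
      by (rule DERIV_subset[OF DERIV_exp]) simp
    have "norm (exp z) \<le> 1 + 2 * norm z" by (rule exp_bound_lemma) (use z in auto)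
    thus "norm (exp z) \<le> 2" using z by auto
  qed (use assms in auto)
  thus ?thesis by simp
qed

text \<open>Since the weights are nonnegative, a bound on the relative error of the terms is one on
  the relative error of their sum.\<close>

lemma exp_sum_near:
  fixes w :: "'s \<Rightarrow> real" and v :: "'s \<Rightarrow> complex"
  assumes "\<And>s. s \<in> A \<Longrightarrow> 0 \<le> w s" "\<And>s. s \<in> A \<Longrightarrow> norm (v s) \<le> t" "t \<le> 1/2"
  shows "norm ((\<Sum>s\<in>A. of_real (w s) * exp (v s)) - of_real (\<Sum>s\<in>A. w s)) \<le> 2 * t * (\<Sum>s\<in>A. w s)"
proof -
  have "(\<Sum>s\<in>A. of_real (w s) * exp (v s)) - of_real (\<Sum>s\<in>A. w s) = (\<Sum>s\<in>A. of_real (w s) * (exp (v s) - 1))"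
    by (simp add: sum_subtractf algebra_simps)
  also have "norm \<dots> \<le> (\<Sum>s\<in>A. w s * (2 * t))"
  proof (rule sum_norm_le)
    fix s assume s: "s \<in> A"
    have "norm (exp (v s) - 1) \<le> 2 * norm (v s)"
      by (rule norm_exp_minus_one_le) (use assms s in force)
    also have "\<dots> \<le> 2 * t" using assms s by auto
    finally show "norm (of_real (w s) * (exp (v s) - 1)) \<le> w s * (2 * t)"
      using assms(1)[OF s] by (simp add: norm_mult mult_left_mono)
  qed
  finally show ?thesis by (simp add: sum_distrib_left sum_distrib_right mult_ac)
qed

text \<open>Identifies iterated real derivatives with those of a holomorphic extension, so that
  Cauchy's estimate applies to them.\<close>

lemma higher_deriv_Re:
  fixes F :: "real \<Rightarrow> real" and \<Phi> :: "complex \<Rightarrow> complex"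
  assumes hol: "\<Phi> holomorphic_on ball (of_real h) \<rho>"
    and eq: "\<And>x. \<bar>x - h\<bar> < \<rho> \<Longrightarrow> F x = Re (\<Phi> (of_real x))"
    and x: "\<bar>x - h\<bar> < \<rho>"
  shows "(deriv ^^ r) F x = Re ((deriv ^^ r) \<Phi> (of_real x))"
    and "((deriv ^^ r) F has_real_derivative (deriv ^^ Suc r) F x) (at x)"
proof -
  have D: "((\<lambda>x. Re ((deriv ^^ r) \<Phi> (of_real x))) has_real_derivative Re ((deriv ^^ Suc r) \<Phi> (of_real x))) (at x)"
    if "\<bar>x - h\<bar> < \<rho>" for x r
  proof -
    have b: "(of_real x :: complex) \<in> ball (of_real h) \<rho>"
      using that by (simp add: dist_norm norm_minus_commute flip: of_real_diff)
    have "((deriv ^^ r) \<Phi> has_field_derivative (deriv ^^ Suc r) \<Phi> (of_real x)) (at (of_real x))"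
      by (rule has_field_derivative_higher_deriv[OF hol open_ball b])
    hence "(((deriv ^^ r) \<Phi> \<circ> of_real) has_vector_derivative (1 * (deriv ^^ Suc r) \<Phi> (of_real x))) (at x)"
      by (intro field_vector_diff_chain_at) (auto intro!: derivative_eq_intros simp: has_vector_derivative_def scaleR_conv_of_real)
    hence "((\<lambda>x. Re (((deriv ^^ r) \<Phi> \<circ> of_real) x)) has_vector_derivative Re (1 * (deriv ^^ Suc r) \<Phi> (of_real x))) (at x)"
      by (rule bounded_linear.has_vector_derivative[OF bounded_linear_Re])
    thus ?thesis by (simp add: has_real_derivative_iff_has_vector_derivative comp_def)
  qed
  have op: "open {x. \<bar>x - h\<bar> < \<rho>}" by (intro open_Collect_less continuous_intros)
  have E: "(deriv ^^ r) F x = Re ((deriv ^^ r) \<Phi> (of_real x))" if "\<bar>x - h\<bar> < \<rho>" for x r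
    using that
  proof (induction r arbitrary: x)
    case 0 thus ?case using eq by simp
  next
    case (Suc r)
    have "((deriv ^^ r) F has_real_derivative Re ((deriv ^^ Suc r) \<Phi> (of_real x))) (at x)"
      by (rule has_field_derivative_transform_within_open[OF D[OF Suc.prems] op])
        (use Suc in auto)
    thus ?case by (simp add: DERIV_imp_deriv)
  qed
  show "(deriv ^^ r) F x = Re ((deriv ^^ r) \<Phi> (of_real x))" by (rule E[OF x])
  show "((deriv ^^ r) F has_real_derivative (deriv ^^ Suc r) F x) (at x)"
    unfolding E[OF x, of "Suc r"]
    by (rule has_field_derivative_transform_within_open[OF D[OF x] op]) (use E x in auto)
qed

text \<open>The reward of a contact is attached to the gap that ends there. The left end of a path
  then carries none, and the junction of two concatenated paths is counted once.\<close>

definition bw :: "(nat \<Rightarrow> real) \<Rightarrow> (nat \<Rightarrow> real) \<Rightarrow> 'c::{real_normed_field,banach} \<Rightarrow> nat \<Rightarrow> nat \<Rightarrow> 'c" where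
  "bw p \<omega> z a b = of_real (p (b - a)) * exp (z + of_real (\<omega> b))"

definition ZZ :: "(nat \<Rightarrow> real) \<Rightarrow> (nat \<Rightarrow> real) \<Rightarrow> nat \<Rightarrow> nat \<Rightarrow> real \<Rightarrow> real" where
  "ZZ p \<omega> i j h = path_sum (bw p \<omega> h) i j"

text \<open>The logarithm of the partition function (\<open>r = 0\<close>) and the cumulants of the number of contacts.\<close>

definition KK :: "(nat \<Rightarrow> real) \<Rightarrow> nat \<Rightarrow> (nat \<Rightarrow> real) \<Rightarrow> nat \<Rightarrow> nat \<Rightarrow> real \<Rightarrow> real" where
  "KK p r \<omega> i j = (deriv ^^ r) (\<lambda>h. ln (ZZ p \<omega> i j h))"

lemma wt_bw_shift:
  "wt (bw p \<omega> (of_real h + u :: complex)) S = of_real (wt (bw p \<omega> h) S) * exp (of_nat (card (gaps S)) * u)"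
proof (cases "finite (gaps S)")
  case True
  have "exp (of_nat (card (gaps S)) * u) = (\<Prod>y\<in>gaps S. exp u)" by (simp add: exp_of_nat_mult)
  thus ?thesis unfolding wt_def bw_def of_real_prod
    by (simp add: prod.distrib case_prod_unfold exp_add of_real_exp mult_ac)
next
  case False thus ?thesis by (simp add: wt_def)
qed

lemma pos_wt_bw: "\<forall>t\<ge>1. 0 < p t \<Longrightarrow> pos_wt (bw p \<omega> h)"
  unfolding pos_wt_def bw_def by auto

section \<open>Complex rewards and Cauchy's estimate\<close>

context
  fixes p :: "nat \<Rightarrow> real"
  assumes p_pos: "\<forall>t\<ge>1. 0 < p t"
begin

lemma ZZ_pos: "i \<le> j \<Longrightarrow> 0 < ZZ p \<omega> i j h"
  unfolding ZZ_def by (rule path_sum_pos[OF pos_wt_bw[OF p_pos]])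

text \<open>A path has at most \<open>k\<close> gaps, so within distance \<open>1 / (8 * k)\<close>
  of \<open>h\<close> the exponent of each weight moves by at most 1/8. This fixes the radius of all
  discs below, and it keeps the complex sum away from 0.\<close>

lemma path_sum_bw_complex_near:
  fixes u :: complex
  assumes "real k * norm u \<le> 1/8" "j - i \<le> k"
  shows "norm (path_sum (bw p \<omega> (of_real h + u)) i j - of_real (ZZ p \<omega> i j h)) \<le> 1/4 * ZZ p \<omega> i j h"
proof -
  have "norm ((\<Sum>S\<in>paths i j. of_real (wt (bw p \<omega> h) S) * exp (of_nat (card (gaps S)) * u))
      - of_real (\<Sum>S\<in>paths i j. wt (bw p \<omega> h) S)) \<le> 2 * (1/8) * (\<Sum>S\<in>paths i j. wt (bw p \<omega> h) S)"
  proof (rule exp_sum_near)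
    fix S assume "S \<in> paths i j"
    hence "card (gaps S) \<le> k" using card_gaps_le[of S i j] assms by simp
    hence "real (card (gaps S)) * norm u \<le> real k * norm u" by (intro mult_right_mono) auto
    thus "norm (of_nat (card (gaps S)) * u) \<le> 1/8" using assms by (simp add: norm_mult)
  qed (use wt_nonneg[OF pos_wt_bw[OF p_pos]] in auto)
  thus ?thesis unfolding path_sum_def ZZ_def wt_bw_shift by simp
qed

lemma disj_sum_bw_complex_le:
  fixes u :: complex
  assumes "real k * norm u \<le> 1/8" "j - i \<le> k" "j' - i' \<le> k"
  shows "norm (disj_sum (bw p \<omega> (of_real h + u)) i j i' j') \<le> 2 * disj_sum (bw p \<omega> h) i j i' j'"
proof -
  have "norm (disj_sum (bw p \<omega> (of_real h + u)) i j i' j')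
     \<le> (\<Sum>y\<in>disj_pairs i j i' j'. wt (bw p \<omega> h) (fst y) * wt (bw p \<omega> h) (snd y) * 2)"
    unfolding disj_sum_def
  proof (rule sum_norm_le, clarsimp)
    fix S S' assume "(S, S') \<in> disj_pairs i j i' j'"
    hence "card (gaps S) \<le> k" "card (gaps S') \<le> k"
      using card_gaps_le[of S i j] card_gaps_le[of S' i' j'] assms by (auto simp: disj_pairs_def)
    hence "real (card (gaps S) + card (gaps S')) * norm u \<le> real (2 * k) * norm u" by (intro mult_right_mono) auto
    hence n: "norm (of_nat (card (gaps S) + card (gaps S')) * u) \<le> 1/4" using assms(1) by (simp only: norm_mult norm_of_nat)
    have "norm (exp (of_nat (card (gaps S) + card (gaps S')) * u)) \<le> 1 + 2 * norm (of_nat (card (gaps S) + card (gaps S')) * u)"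
      by (rule exp_bound_lemma) (use n in linarith)
    hence e: "norm (exp (of_nat (card (gaps S) + card (gaps S')) * u)) \<le> 2" using n by linarith
    have "wt (bw p \<omega> (of_real h + u)) S * wt (bw p \<omega> (of_real h + u)) S'
      = of_real (wt (bw p \<omega> h) S * wt (bw p \<omega> h) S') * exp (of_nat (card (gaps S) + card (gaps S')) * u)"
    proof -
      have "exp (of_nat (card (gaps S) + card (gaps S')) * u) = exp (of_nat (card (gaps S)) * u) * exp (of_nat (card (gaps S')) * u)"
        by (simp add: distrib_right exp_add)
      thus ?thesis unfolding wt_bw_shift by (simp add: mult_ac)
    qed
    hence "norm (wt (bw p \<omega> (of_real h + u)) S * wt (bw p \<omega> (of_real h + u)) S')
      = wt (bw p \<omega> h) S * wt (bw p \<omega> h) S' * norm (exp (of_nat (card (gaps S) + card (gaps S')) * u))"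
      using wt_nonneg[OF pos_wt_bw[OF p_pos]] by (simp add: norm_mult)
    also have "\<dots> \<le> wt (bw p \<omega> h) S * wt (bw p \<omega> h) S' * 2"
      by (rule mult_left_mono[OF e]) (use wt_nonneg[OF pos_wt_bw[OF p_pos]] in auto)
    finally show "norm (wt (bw p \<omega> (of_real h + u)) S * wt (bw p \<omega> (of_real h + u)) S') \<le> wt (bw p \<omega> h) S * wt (bw p \<omega> h) S' * 2" .
  qed
  also have "\<dots> = 2 * disj_sum (bw p \<omega> h) i j i' j'"
    unfolding disj_sum_def by (simp add: sum_distrib_left case_prod_unfold mult_ac)
  finally show ?thesis .
qed

definition cratio :: "(nat \<Rightarrow> real) \<Rightarrow> nat \<Rightarrow> nat \<Rightarrow> real \<Rightarrow> complex \<Rightarrow> complex" where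
  "cratio \<omega> i j h z = path_sum (bw p \<omega> z) i j / of_real (ZZ p \<omega> i j h)"

text \<open>A branch of the logarithm of the complex partition function near \<open>h\<close>.
  Division by the real value at \<open>h\<close> brings the argument of \<open>Ln\<close> within 1/4
  of 1, hence off the branch cut.\<close>

definition clog :: "(nat \<Rightarrow> real) \<Rightarrow> nat \<Rightarrow> nat \<Rightarrow> real \<Rightarrow> complex \<Rightarrow> complex" where
  "clog \<omega> i j h z = of_real (ln (ZZ p \<omega> i j h)) + Ln (cratio \<omega> i j h z)"

lemma cratio_near:
  assumes "real k * norm (z - of_real h) \<le> 1/8" "j - i \<le> k" "i \<le> j"
  shows "norm (cratio \<omega> i j h z - 1) \<le> 1/4"
proof -
  have "cratio \<omega> i j h z - 1 = (path_sum (bw p \<omega> (of_real h + (z - of_real h))) i j - of_real (ZZ p \<omega> i j h)) / of_real (ZZ p \<omega> i j h)"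
    using ZZ_pos[OF assms(3), of \<omega> h] by (simp add: cratio_def field_simps)
  also have "norm \<dots> \<le> 1/4"
    using path_sum_bw_complex_near[OF assms(1,2), of \<omega> h] ZZ_pos[OF assms(3), of \<omega> h]
    by (simp add: norm_divide divide_le_eq)
  finally show ?thesis .
qed

lemma norm_le_1_4_imp:
  fixes w :: complex
  assumes "norm (w - 1) \<le> 1/4"
  shows "0 < Re w" "norm (Ln w) \<le> 1/2"
proof -
  have "\<bar>Re w - 1\<bar> \<le> 1/4" using abs_Re_le_cmod[of "w - 1"] assms by simp
  thus "0 < Re w" by linarith
  have "norm (Ln (1 + (w - 1))) \<le> 2 * norm (w - 1)" by (rule norm_Ln_le) (use assms in auto)
  thus "norm (Ln w) \<le> 1/2" using assms by simp
qed

lemma clog_props: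
  assumes k: "j - i \<le> k" "i \<le> j" "0 < k"
  shows "clog \<omega> i j h holomorphic_on ball (of_real h) (1 / (8 * real k))"
    and "continuous_on (cball (of_real h) (1 / (8 * real k))) (clog \<omega> i j h)"
    and "\<And>z. z \<in> cball (of_real h) (1 / (8 * real k)) \<Longrightarrow> norm (clog \<omega> i j h z - of_real (ln (ZZ p \<omega> i j h))) \<le> 1/2"
    and "\<And>z. z \<in> cball (of_real h) (1 / (8 * real k)) \<Longrightarrow> exp (clog \<omega> i j h z) = path_sum (bw p \<omega> z) i j"
    and "\<And>x. \<bar>x - h\<bar> < 1 / (8 * real k) \<Longrightarrow> ln (ZZ p \<omega> i j x) = Re (clog \<omega> i j h (of_real x))"
proof -
  let ?B = "cball (of_real h :: complex) (1 / (8 * real k))"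
  have near: "norm (cratio \<omega> i j h z - 1) \<le> 1/4" if "z \<in> ?B" for z
    by (rule cratio_near[OF _ k(1,2)])
       (use that k(3) in \<open>auto simp: dist_norm norm_minus_commute field_simps\<close>)
  have Re: "0 < Re (cratio \<omega> i j h z)" if "z \<in> ?B" for z
    using norm_le_1_4_imp(1)[OF near[OF that]] .
  have np: "cratio \<omega> i j h z \<notin> \<real>\<^sub>\<le>\<^sub>0" if "z \<in> ?B" for z
    using Re[OF that] by (auto simp: complex_nonpos_Reals_iff)
  have hol: "cratio \<omega> i j h holomorphic_on UNIV"
    using ZZ_pos[OF k(2), of \<omega> h]
    unfolding cratio_def path_sum_def wt_def bw_def case_prod_unfold by (intro holomorphic_intros) auto
  have hc: "cratio \<omega> i j h holomorphic_on S" for S using hol by (rule holomorphic_on_subset) auto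
  show "clog \<omega> i j h holomorphic_on ball (of_real h) (1 / (8 * real k))"
    unfolding clog_def by (intro holomorphic_intros hc) (use np in auto)
  show "continuous_on ?B (clog \<omega> i j h)"
    unfolding clog_def by (intro continuous_intros holomorphic_on_imp_continuous_on[OF hc]) (use np in auto)
  show "norm (clog \<omega> i j h z - of_real (ln (ZZ p \<omega> i j h))) \<le> 1/2" if "z \<in> ?B" for z
    unfolding clog_def using norm_le_1_4_imp(2)[OF near[OF that]] by simp
  show "exp (clog \<omega> i j h z) = path_sum (bw p \<omega> z) i j" if "z \<in> ?B" for z
  proof -
    have "cratio \<omega> i j h z \<noteq> 0" using Re[OF that] by auto
    hence "exp (clog \<omega> i j h z) = of_real (ZZ p \<omega> i j h) * cratio \<omega> i j h z"
      unfolding clog_def using ZZ_pos[OF k(2), of \<omega> h] by (simp add: exp_add exp_of_real)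
    thus ?thesis using ZZ_pos[OF k(2), of \<omega> h] by (simp add: cratio_def)
  qed
  show "ln (ZZ p \<omega> i j x) = Re (clog \<omega> i j h (of_real x))" for x
  proof -
    have "path_sum (bw p \<omega> (of_real x :: complex)) i j = of_real (ZZ p \<omega> i j x)"
      unfolding ZZ_def path_sum_def using wt_bw_shift[of p \<omega> x 0] by simp
    hence "cratio \<omega> i j h (of_real x) = of_real (ZZ p \<omega> i j x / ZZ p \<omega> i j h)" by (simp add: cratio_def)
    moreover have "0 < ZZ p \<omega> i j x / ZZ p \<omega> i j h" using ZZ_pos[OF k(2)] by (intro divide_pos_pos)
    ultimately have "Ln (cratio \<omega> i j h (of_real x)) = of_real (ln (ZZ p \<omega> i j x / ZZ p \<omega> i j h))"
      by (simp add: Ln_of_real del: of_real_divide)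
    also have "ln (ZZ p \<omega> i j x / ZZ p \<omega> i j h) = ln (ZZ p \<omega> i j x) - ln (ZZ p \<omega> i j h)"
      using ZZ_pos[OF k(2)] by (intro ln_divide_pos) auto
    finally show ?thesis by (simp add: clog_def)
  qed
qed

lemma KK_eq_Re:
  assumes "j - i \<le> k" "i \<le> j" "0 < k"
  shows "KK p r \<omega> i j h = Re ((deriv ^^ r) (clog \<omega> i j h) (of_real h))"
  unfolding KK_def
  by (rule higher_deriv_Re(1)[OF clog_props(1)[OF assms] clog_props(5)[OF assms]]) (use assms in auto)

lemma KK_DERIV:
  assumes "i \<le> j"
  shows "(KK p r \<omega> i j has_real_derivative KK p (Suc r) \<omega> i j h) (at h)"
  unfolding KK_def
  by (rule higher_deriv_Re(2)[OF clog_props(1)[of j i "Suc (j - i)"] clog_props(5)[of j i "Suc (j - i)"], where x = h and h = h]) (use assms in auto)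

text \<open>Subtracting a constant does not change derivatives of positive order, so the size of
  \<open>f\<close> may be measured from any convenient value \<open>c\<close>.\<close>

lemma Cauchy_inequality':
  assumes holf: "f holomorphic_on ball \<xi> \<rho>" and contf: "continuous_on (cball \<xi> \<rho>) f" and "0 < \<rho>"
    and "\<And>x. x \<in> cball \<xi> \<rho> \<Longrightarrow> norm (f x - c) \<le> B" and r: "1 \<le> r"
  shows "norm ((deriv ^^ r) f \<xi>) \<le> fact r * B / \<rho> ^ r"
proof -
  have "norm ((deriv ^^ r) (\<lambda>w. f w - c) \<xi>) \<le> fact r * B / \<rho> ^ r"
    by (rule Cauchy_inequality) (use assms in \<open>auto intro!: holomorphic_intros continuous_intros simp: dist_norm\<close>)
  moreover have "(deriv ^^ r) (\<lambda>w. f w - c) \<xi> = (deriv ^^ r) f \<xi>"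
    by (subst higher_deriv_diff[OF holf holomorphic_on_const open_ball]) (use assms in auto)
  ultimately show ?thesis by simp
qed

text \<open>Holds for every disorder and every \<open>h\<close>, localized or not. It makes the
  cumulants integrable and is used where the meeting probability gives no information.\<close>

lemma KK_crude_bound:
  assumes "j - i \<le> k" "i \<le> j" "0 < k" "1 \<le> r"
  shows "\<bar>KK p r \<omega> i j h\<bar> \<le> fact r * (8 * real k) ^ r"
proof -
  have "norm ((deriv ^^ r) (clog \<omega> i j h) (of_real h)) \<le> fact r * (1/2) / (1 / (8 * real k)) ^ r"
    by (rule Cauchy_inequality'[OF clog_props(1,2)[OF assms(1-3)] _ clog_props(3)[OF assms(1-3)]]) (use assms in auto)
  also have "\<dots> = 1/2 * (fact r * (8 * real k) ^ r)" by (simp add: power_one_over field_simps)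
  also have "\<dots> \<le> 1 * (fact r * (8 * real k) ^ r)" by (rule mult_right_mono) auto
  finally show ?thesis using abs_Re_le_cmod KK_eq_Re[OF assms(1-3)] by (metis mult_1 order_trans)
qed

text \<open>The probability that two independent polymers do not meet.\<close>

definition meet_defect :: "(nat \<Rightarrow> real) \<Rightarrow> nat \<Rightarrow> nat \<Rightarrow> nat \<Rightarrow> nat \<Rightarrow> real \<Rightarrow> real" where
  "meet_defect \<omega> i j i' j' h = disj_sum (bw p \<omega> h) i j i' j' / (ZZ p \<omega> i j h * ZZ p \<omega> i' j' h)"

lemma disj_sum_nonneg: "0 \<le> disj_sum (bw p \<omega> (h :: real)) i j i' j'"
  unfolding disj_sum_def by (rule sum_nonneg) (use wt_nonneg[OF pos_wt_bw[OF p_pos]] in auto)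

lemma meet_defect_nonneg: "0 \<le> meet_defect \<omega> i j i' j' h"
  unfolding meet_defect_def ZZ_def
  by (intro divide_nonneg_nonneg mult_nonneg_nonneg disj_sum_nonneg path_sum_nonneg[OF pos_wt_bw[OF p_pos]])

text \<open>The exponential of the second difference \<open>W\<close> is a ratio of two products of
  partition functions. By the exchange of tails these products differ only in the pairs of paths
  that do not meet, so \<open>exp W\<close> is close to 1, and \<open>W\<close> close to 0, on the
  whole disc when such pairs carry little weight. Cauchy's estimate then passes to the
  derivatives.\<close>

lemma KK_second_difference_bound:
  assumes "i + 2 \<le> j" "1 \<le> r"
  shows "\<bar>KK p r \<omega> i j h - KK p r \<omega> (i+1) j h - KK p r \<omega> i (j-1) h + KK p r \<omega> (i+1) (j-1) h\<bar>
    \<le> 64 * fact r * (8 * real (j - i)) ^ r * (meet_defect \<omega> i j (i+1) (j-1) h + meet_defect \<omega> i (j-1) (i+1) j h)"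
proof -
  define k where "k = j - i"
  define \<rho> where "\<rho> = 1 / (8 * real k)"
  have k0: "0 < k" unfolding k_def using assms by auto
  have \<rho>0: "0 < \<rho>" unfolding \<rho>_def using k0 by auto
  let ?c = "\<lambda>i j. clog \<omega> i j h" and ?h = "complex_of_real h"
  have ks: "j - i \<le> k" "j - (i+1) \<le> k" "j - 1 - i \<le> k" "j - 1 - (i+1) \<le> k"
     "i \<le> j" "i + 1 \<le> j" "i \<le> j - 1" "i + 1 \<le> j - 1" using assms by (auto simp: k_def)
  note c1 = clog_props[OF ks(1,5) k0, where \<omega> = \<omega> and h = h, folded \<rho>_def]
  note c2 = clog_props[OF ks(2,6) k0, where \<omega> = \<omega> and h = h, folded \<rho>_def]
  note c3 = clog_props[OF ks(3,7) k0, where \<omega> = \<omega> and h = h, folded \<rho>_def]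
  note c4 = clog_props[OF ks(4,8) k0, where \<omega> = \<omega> and h = h, folded \<rho>_def]
  define W where "W z = ?c i j z - ?c (i+1) j z - ?c i (j-1) z + ?c (i+1) (j-1) z" for z
  have holW: "W holomorphic_on ball ?h \<rho>" unfolding W_def
    by (intro holomorphic_on_add holomorphic_on_diff c1(1) c2(1) c3(1) c4(1))
  have conW: "continuous_on (cball ?h \<rho>) W" unfolding W_def
    by (intro continuous_on_add continuous_on_diff c1(2) c2(2) c3(2) c4(2))
  have derW: "(deriv ^^ r) W ?h = (deriv ^^ r) (?c i j) ?h - (deriv ^^ r) (?c (i+1) j) ?h - (deriv ^^ r) (?c i (j-1)) ?h + (deriv ^^ r) (?c (i+1) (j-1)) ?h"
  proof -
    have b: "?h \<in> ball ?h \<rho>" using \<rho>0 by simp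
    note H = c1(1) c2(1) c3(1) c4(1)
    have "(deriv ^^ r) W ?h = (deriv ^^ r) (\<lambda>z. ?c i j z - ?c (i+1) j z - ?c i (j-1) z) ?h + (deriv ^^ r) (?c (i+1) (j-1)) ?h"
      unfolding W_def by (rule higher_deriv_add[OF _ H(4) open_ball b]) (intro holomorphic_on_diff H)
    also have "(deriv ^^ r) (\<lambda>z. ?c i j z - ?c (i+1) j z - ?c i (j-1) z) ?h
      = (deriv ^^ r) (\<lambda>z. ?c i j z - ?c (i+1) j z) ?h - (deriv ^^ r) (?c i (j-1)) ?h"
      by (rule higher_deriv_diff[OF _ H(3) open_ball b]) (intro holomorphic_on_diff H)
    also have "(deriv ^^ r) (\<lambda>z. ?c i j z - ?c (i+1) j z) ?h = (deriv ^^ r) (?c i j) ?h - (deriv ^^ r) (?c (i+1) j) ?h"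
      by (rule higher_deriv_diff[OF H(1,2) open_ball b])
    finally show ?thesis .
  qed
  define \<Delta> where "\<Delta> = ln (ZZ p \<omega> i j h) - ln (ZZ p \<omega> (i+1) j h) - ln (ZZ p \<omega> i (j-1) h) + ln (ZZ p \<omega> (i+1) (j-1) h)"
  \<comment> \<open>Each of the four logarithms moves by at most 1/2 on the disc. This keeps the
    imaginary part of \<open>W\<close> below \<open>pi\<close>, so that \<open>Ln\<close> inverts
    \<open>exp\<close> there, and it settles the case in which the defects are not small.\<close>
  have W\<Delta>: "norm (W z - of_real \<Delta>) \<le> 2" if z: "z \<in> cball ?h \<rho>" for z
  proof -
    have n4: "norm (x - y - v + w) \<le> 2"
      if "norm x \<le> 1/2" "norm y \<le> 1/2" "norm v \<le> 1/2" "norm w \<le> 1/2" for x y v w :: complex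
      using that norm_triangle_ineq[of "x - y - v" w] norm_triangle_ineq4[of "x - y" v] norm_triangle_ineq4[of x y]
      by linarith
    have tri: "norm ((a - b - c + d) - of_real (a' - b' - c' + d')) \<le> 2"
      if "norm (a - of_real a') \<le> 1/2" "norm (b - of_real b') \<le> 1/2" "norm (c - of_real c') \<le> 1/2"
        "norm (d - of_real d') \<le> 1/2" for a b c d :: complex and a' b' c' d'
    proof -
      have "(a - b - c + d) - of_real (a' - b' - c' + d')
          = ((a - of_real a') - (b - of_real b') - (c - of_real c')) + (d - of_real d')" by simp
      thus ?thesis using n4[OF that] by (simp only:)
    qed
    show ?thesis unfolding W_def \<Delta>_def by (rule tri[OF c1(3)[OF z] c2(3)[OF z] c3(3)[OF z] c4(3)[OF z]])
  qed
  let ?N1 = "\<lambda>z. disj_sum (bw p \<omega> z) i j (i+1) (j-1)" and ?N2 = "\<lambda>z. disj_sum (bw p \<omega> z) i (j-1) (i+1) j"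
  let ?Z = "\<lambda>i j. ZZ p \<omega> i j h"
  define q1 where "q1 = meet_defect \<omega> i j (i+1) (j-1) h"
  define q2 where "q2 = meet_defect \<omega> i (j-1) (i+1) j h"
  have q0: "0 \<le> q1" "0 \<le> q2" unfolding q1_def q2_def by (rule meet_defect_nonneg)+
  have Zp: "0 < ?Z i j" "0 < ?Z (i+1) j" "0 < ?Z i (j-1)" "0 < ?Z (i+1) (j-1)" by (intro ZZ_pos ks)+
  have expW: "norm (exp (W z) - 1) \<le> 8 * (q1 + q2)" if z: "z \<in> cball ?h \<rho>" and q: "q1 \<le> 1/2" for z
  proof -
    define u where "u = z - ?h"
    have zu: "z = ?h + u" by (simp add: u_def)
    have ku: "real k * norm u \<le> 1/8" using z k0 unfolding \<rho>_def u_def by (simp add: dist_norm norm_minus_commute field_simps)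
    let ?C = "\<lambda>i j. path_sum (bw p \<omega> z) i j"
    have low: "norm (?C i' j') \<ge> 3/4 * ?Z i' j'" if "j' - i' \<le> k" "i' \<le> j'" for i' j'
    proof -
      have "norm (of_real (?Z i' j') - ?C i' j') \<le> 1/4 * ?Z i' j'"
        using path_sum_bw_complex_near[OF ku that(1), of \<omega> h] by (simp add: zu norm_minus_commute)
      hence "norm (complex_of_real (?Z i' j')) - norm (?C i' j') \<le> 1/4 * ?Z i' j'"
        using norm_triangle_ineq2 order_trans by blast
      thus ?thesis using ZZ_pos[OF that(2), of \<omega> h] by simp
    qed
    have l2: "norm (?C (i+1) j) \<ge> 3/4 * ?Z (i+1) j" and l3: "norm (?C i (j-1)) \<ge> 3/4 * ?Z i (j-1)"
      using low ks by blast+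
    have cn: "?C (i+1) j \<noteq> 0" "?C i (j-1) \<noteq> 0" using l2 l3 Zp by force+
    have "exp (W z) = ?C i j * ?C (i+1) (j-1) / (?C i (j-1) * ?C (i+1) j)"
      unfolding W_def using c1(4)[OF z] c2(4)[OF z] c3(4)[OF z] c4(4)[OF z]
      by (simp add: exp_add exp_diff)
    hence "exp (W z) - 1 = (?C i j * ?C (i+1) (j-1) - ?C i (j-1) * ?C (i+1) j) / (?C i (j-1) * ?C (i+1) j)"
      using cn by (simp add: field_simps)
    also have "?C i j * ?C (i+1) (j-1) - ?C i (j-1) * ?C (i+1) j = ?N1 z - ?N2 z"
      using meeting_sum_swap[of "bw p \<omega> z" i j "i+1" "j-1"] by (simp add: algebra_simps)
    finally have e: "norm (exp (W z) - 1) = norm (?N1 z - ?N2 z) / (norm (?C i (j-1)) * norm (?C (i+1) j))"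
      by (simp add: norm_divide norm_mult)
    have "norm (?N1 z - ?N2 z) \<le> 2 * ?N1 h + 2 * ?N2 h"
      using disj_sum_bw_complex_le[OF ku ks(1) ks(4), of \<omega> h] disj_sum_bw_complex_le[OF ku ks(3) ks(2), of \<omega> h]
        norm_triangle_ineq4[of "?N1 z" "?N2 z"] by (simp add: zu)
    moreover have "norm (?C i (j-1)) * norm (?C (i+1) j) \<ge> (3/4 * ?Z i (j-1)) * (3/4 * ?Z (i+1) j)"
      by (rule mult_mono) (use l2 l3 Zp in auto)
    ultimately have "norm (exp (W z) - 1) \<le> (2 * ?N1 h + 2 * ?N2 h) / ((3/4 * ?Z i (j-1)) * (3/4 * ?Z (i+1) j))"
      unfolding e by (intro frac_le) (use Zp disj_sum_nonneg in auto)
    also have "\<dots> \<le> 4 * ((?N1 h + ?N2 h) / (?Z i (j-1) * ?Z (i+1) j))"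
      using Zp disj_sum_nonneg[of \<omega> h i j "i+1" "j-1"] disj_sum_nonneg[of \<omega> h i "j-1" "i+1" j] by (simp add: field_simps)
    \<comment> \<open>\<open>q1\<close> is normalized by \<open>A\<close>, whereas the denominator
      is \<open>B\<close>. The parts of both sums that come from meeting pairs agree, so
      \<open>q1 \<le> 1/2\<close> gives \<open>A \<le> 2 * B\<close>.\<close>
    also have "(?N1 h + ?N2 h) / (?Z i (j-1) * ?Z (i+1) j) \<le> 2 * q1 + q2"
    proof -
      define A where "A = ?Z i j * ?Z (i+1) (j-1)"
      define B where "B = ?Z i (j-1) * ?Z (i+1) j"
      have AB: "A - ?N1 h = B - ?N2 h" unfolding A_def B_def ZZ_def by (rule meeting_sum_swap)
      have A0: "0 < A" "0 < B" using Zp by (auto simp: A_def B_def)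
      have n1: "?N1 h = q1 * A" using Zp unfolding q1_def meet_defect_def A_def by (simp add: field_simps)
      have n2: "?N2 h = q2 * B" using Zp unfolding q2_def meet_defect_def B_def by (simp add: field_simps)
      have "A * (1/2) \<le> A * (1 - q1)" using q A0 by (intro mult_left_mono) auto
      also have "\<dots> = B * (1 - q2)" using AB n1 n2 by (simp add: algebra_simps)
      also have "\<dots> \<le> B" using A0 q0 by (simp add: algebra_simps)
      finally have "A \<le> 2 * B" by simp
      hence "q1 * A \<le> q1 * (2 * B)" using q0 by (intro mult_left_mono)
      hence "?N1 h + ?N2 h \<le> (2 * q1 + q2) * B" using n1 n2 by (simp add: algebra_simps)
      thus ?thesis unfolding B_def[symmetric] using A0 by (simp add: divide_le_eq)
    qed
    finally show ?thesis using q0 by simp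
  qed
  have "\<exists>c. \<forall>z\<in>cball ?h \<rho>. norm (W z - c) \<le> 64 * (q1 + q2)"
  \<comment> \<open>At the threshold 1/32 the trivial bound 2 equals \<open>64 * (q1 + q2)\<close>;
    below it \<open>8 * (q1 + q2)\<close> is at most 1/4, in the range where \<open>Ln\<close> near
    1 is linearly bounded.\<close>
  proof (cases "q1 + q2 \<le> 1/32")
    case True
    show ?thesis
    proof (rule exI[of _ 0], rule ballI)
      fix z assume z: "z \<in> cball ?h \<rho>"
      have q1': "q1 \<le> 1/2" using True q0 by linarith
      have e: "norm (exp (W z) - 1) \<le> 8 * (q1 + q2)" by (rule expW[OF z q1'])
      have "8 * (q1 + q2) < 1/2" using True by simp
      hence "norm (Ln (1 + (exp (W z) - 1))) \<le> 2 * norm (exp (W z) - 1)"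
        by (intro norm_Ln_le le_less_trans[OF e])
      hence "norm (Ln (exp (W z))) \<le> 2 * (8 * (q1 + q2))" using e by simp
      moreover have "Ln (exp (W z)) = W z"
      proof -
        have "\<bar>Im (W z - of_real \<Delta>)\<bar> \<le> 2" using abs_Im_le_cmod W\<Delta>[OF z] order_trans by blast
        thus ?thesis using pi_gt3 by (intro Ln_exp) auto
      qed
      ultimately show "norm (W z - 0) \<le> 64 * (q1 + q2)" using q0 by simp
    qed
  next
    case False
    hence "2 \<le> 64 * (q1 + q2)" by simp
    thus ?thesis using W\<Delta> by (intro exI[of _ "of_real \<Delta>"]) (meson order_trans)
  qed
  then obtain c where c: "\<And>z. z \<in> cball ?h \<rho> \<Longrightarrow> norm (W z - c) \<le> 64 * (q1 + q2)" by blast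
  have "norm ((deriv ^^ r) W ?h) \<le> fact r * (64 * (q1 + q2)) / \<rho> ^ r"
    by (rule Cauchy_inequality'[OF holW conW \<rho>0 c assms(2)])
  also have "\<dots> = 64 * fact r * (8 * real k) ^ r * (q1 + q2)" unfolding \<rho>_def by (simp add: power_one_over field_simps)
  finally have "\<bar>Re ((deriv ^^ r) W ?h)\<bar> \<le> 64 * fact r * (8 * real k) ^ r * (q1 + q2)"
    using abs_Re_le_cmod order_trans by blast
  thus ?thesis unfolding derW q1_def q2_def k_def
    using KK_eq_Re[OF ks(1,5) k0, of r \<omega> h] KK_eq_Re[OF ks(2,6) k0, of r \<omega> h] KK_eq_Re[OF ks(3,7) k0, of r \<omega> h] KK_eq_Re[OF ks(4,8) k0, of r \<omega> h]
    by simp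
qed

end

section \<open>Gaussian disorder\<close>

text \<open>The total masses agree by the case \<open>t = 0\<close>. If they vanish there is nothing
  left to prove; otherwise normalization reduces to Levy's uniqueness theorem for probability
  measures.\<close>

lemma finite_measure_char_unique:
  fixes M N :: "real measure"
  assumes M: "finite_measure M" "sets M = sets borel" and N: "finite_measure N" "sets N = sets borel"
    and eq: "\<And>t. (\<integral>x. iexp (t * x) \<partial>M) = (\<integral>x. iexp (t * x) \<partial>N)"
  shows "M = N"
proof -
  interpret M: finite_measure M by fact
  interpret N: finite_measure N by fact
  have spM: "space M = UNIV" "space N = UNIV" 
    using sets_eq_imp_space_eq[OF M(2)] sets_eq_imp_space_eq[OF N(2)] by simp_all
  define c where "c = measure M UNIV"
  have "complex_of_real (measure M UNIV) = complex_of_real (measure N UNIV)"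
    using eq[of 0] spM by (simp add: scaleR_conv_of_real)
  hence cN: "c = measure N UNIV" unfolding c_def by simp
  show ?thesis
  proof (cases "c = 0")
    case True
    have "emeasure M A = emeasure N A" if "A \<in> sets M" for A
    proof -
      have "measure M A \<le> measure M UNIV" by (rule M.finite_measure_mono) (use M(2) in simp_all)
      hence "measure M A = 0" using measure_nonneg[of M A] True c_def by linarith
      moreover have "measure N A \<le> measure N UNIV" by (rule N.finite_measure_mono) (use N(2) in simp_all)
      hence "measure N A = 0" using measure_nonneg[of N A] True cN by linarith
      ultimately show ?thesis by (simp add: M.emeasure_eq_measure N.emeasure_eq_measure)
    qed
    thus ?thesis using M(2) N(2) by (intro measure_eqI) auto
  next
    case False
    hence c0: "0 < c" unfolding c_def using measure_nonneg[of M UNIV] by linarith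
    define M' where "M' = density M (\<lambda>_. ennreal (1 / c))"
    define N' where "N' = density N (\<lambda>_. ennreal (1 / c))"
    have rd: "real_distribution M'" "real_distribution N'"
    proof -
      have "emeasure M' (space M') = 1" unfolding M'_def
        using c0 spM M(2) by (simp add: emeasure_density_const M.emeasure_eq_measure c_def[symmetric] ennreal_mult[symmetric])
      hence "prob_space M'" by (rule prob_spaceI)
      moreover have "emeasure N' (space N') = 1" unfolding N'_def
        using c0 spM N(2) by (simp add: emeasure_density_const N.emeasure_eq_measure cN[symmetric] ennreal_mult[symmetric])
      hence "prob_space N'" by (rule prob_spaceI)
      ultimately show "real_distribution M'" "real_distribution N'"
        unfolding real_distribution_def real_distribution_axioms_def by (auto simp: M'_def N'_def M N)
    qed
    have "char M' = char N'"
    proof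
      fix t
      have "char M' t = (\<integral>x. (1/c) *\<^sub>R iexp (t * x) \<partial>M)" "char N' t = (\<integral>x. (1/c) *\<^sub>R iexp (t * x) \<partial>N)"
        unfolding char_def M'_def N'_def
        by (subst integral_density; use c0 M(2) N(2) in simp)+
      thus "char M' t = char N' t" using eq[of t] by simp
    qed
    hence e: "M' = N'" using Levy_uniqueness rd by blast
    have "emeasure M A = emeasure N A" if A: "A \<in> sets M" for A
    proof -
      have "ennreal (1/c) * emeasure M A = emeasure M' A" "ennreal (1/c) * emeasure N A = emeasure N' A"
        unfolding M'_def N'_def using A M(2) N(2) by (auto simp: emeasure_density_const)
      hence *: "ennreal (1/c) * emeasure M A = ennreal (1/c) * emeasure N A" using e by simp
      have "ennreal c * (ennreal (1/c) * x) = x" for x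
        using c0 by (simp add: mult.assoc[symmetric] ennreal_mult[symmetric])
      thus ?thesis using arg_cong[OF *, of "\<lambda>x. ennreal c * x"] by simp
    qed
    thus ?thesis using M(2) N(2) by (intro measure_eqI) auto
  qed
qed

text \<open>The Cramer--Wold device for arbitrarily many coordinates: one coordinate at a time, the
  indicator of a Borel set is produced from the characters by one-dimensional uniqueness, applied
  to the finite measures with densities \<open>1\<close>, \<open>1 + cos\<close> and \<open>1 + sin\<close>.\<close>

lemma PiM_char_unique:
  fixes M N :: "('i \<Rightarrow> real) measure"
  assumes M: "prob_space M" "sets M = sets (PiM UNIV (\<lambda>_. borel))"
    and N: "prob_space N" "sets N = sets (PiM UNIV (\<lambda>_. borel))"
    and eq: "\<And>J c. finite J \<Longrightarrow> (\<integral>x. iexp (\<Sum>a\<in>J. c a * x a) \<partial>M) = (\<integral>x. iexp (\<Sum>a\<in>J. c a * x a) \<partial>N)"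
  shows "M = N"
proof -
  define lin where "lin J c = (\<lambda>x :: 'i \<Rightarrow> real. \<Sum>a\<in>J. c a * x a)" for J c
  define L where "L = {lin J c | J c. finite J}"
  have "lin {} c = (\<lambda>x. 0)" for c by (simp add: lin_def)
  hence L0: "(\<lambda>x. 0) \<in> L" unfolding L_def by (metis (mono_tags, lifting) finite.emptyI mem_Collect_eq)
  have Ladd: "(\<lambda>x. l x + t * x b) \<in> L" if l: "l \<in> L" for l t b
  proof -
    obtain J c where J: "finite J" "l = lin J c" using l unfolding L_def by blast
    have "(\<Sum>a\<in>J. c a * x a) = (\<Sum>a\<in>insert b J. (if a \<in> J then c a else 0) * x a)" for x :: "'i \<Rightarrow> real"
      by (rule sum.mono_neutral_cong_left) (use J in auto)
    moreover have "t * x b = (\<Sum>a\<in>insert b J. (if a = b then t else 0) * x a)" for x :: "'i \<Rightarrow> real"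
    proof -
      have "(\<Sum>a\<in>insert b J. (if a = b then t else 0) * x a) = (\<Sum>a\<in>{b}. t * x a)"
        by (rule sum.mono_neutral_cong_right) (use J in auto)
      thus ?thesis by simp
    qed
    ultimately have "(\<lambda>x. l x + t * x b) = lin (insert b J) (\<lambda>a. (if a \<in> J then c a else 0) + (if a = b then t else 0))"
      unfolding J(2) lin_def by (simp add: distrib_right sum.distrib)
    thus ?thesis unfolding L_def using J(1) by blast
  qed
  have Lneg: "(\<lambda>x. - l x) \<in> L" if l: "l \<in> L" for l
  proof -
    obtain J c where J: "finite J" "l = lin J c" using l unfolding L_def by blast
    have "(\<lambda>x. - l x) = lin J (\<lambda>a. - c a)" unfolding J(2) lin_def by (simp add: sum_negf)
    thus ?thesis unfolding L_def using J(1) by blast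
  qed
  have Lm: "l \<in> borel_measurable Q" if "l \<in> L" "sets Q = sets (PiM UNIV (\<lambda>_. borel :: real measure))" for l Q
  proof -
    have "l \<in> borel_measurable (PiM UNIV (\<lambda>_. borel :: real measure))"
      using that(1) unfolding L_def lin_def by auto
    thus ?thesis using measurable_cong_sets[OF that(2) refl] by blast
  qed
  define B where "B K A x = (\<Prod>a\<in>K. indicator (A a) (x a) :: real)" for K A and x :: "'i \<Rightarrow> real"
  have Bm: "B K A \<in> borel_measurable Q"
    if "\<And>a. A a \<in> sets borel" "sets Q = sets (PiM UNIV (\<lambda>_. borel :: real measure))" for K A Q
  proof -
    have "B K A \<in> borel_measurable (PiM UNIV (\<lambda>_. borel :: real measure))"
      unfolding B_def using that(1) by measurable
    thus ?thesis using measurable_cong_sets[OF that(2) refl] by blast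
  qed
  have B01: "0 \<le> B K A x" "B K A x \<le> 1" for K A x
    unfolding B_def by (auto intro!: prod_nonneg prod_le_1 simp: indicator_def)
  \<comment> \<open>The coordinates in \<open>K\<close> are already tested by Borel sets, the others
    still by characters. At the end \<open>l = 0\<close> leaves the finite-dimensional rectangles,
    which determine the measure.\<close>
  have main: "(\<integral>x. B K A x *\<^sub>R iexp (l x) \<partial>M) = (\<integral>x. B K A x *\<^sub>R iexp (l x) \<partial>N)"
    if "finite K" "\<And>a. A a \<in> sets borel" "l \<in> L" for K A l
    using that(1,3)
  proof (induction K arbitrary: l rule: finite_induct)
    case empty
    then obtain J c where J: "finite J" "l = lin J c" unfolding L_def by blast
    show ?case using eq[OF J(1), of c] unfolding J(2) lin_def by (simp add: B_def)
  next
    case (insert b K)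
    have intb: "integrable Q (\<lambda>x. (B K A x * g x) *\<^sub>R iexp (l' x))" "integrable Q (\<lambda>x. B K A x * g x)"
      if Q: "prob_space Q" "sets Q = sets (PiM UNIV (\<lambda>_. borel :: real measure))"
        and g: "g \<in> borel_measurable Q" "\<And>x. \<bar>g x\<bar> \<le> 2" and l': "l' \<in> L" for Q g l'
    proof -
      interpret prob_space Q by fact
      note [measurable] = g(1) Lm[OF l' Q(2)]
      have bm [measurable]: "B K A \<in> borel_measurable Q" using Bm[of A Q K] Q(2) \<open>\<And>a. A a \<in> sets borel\<close> by auto
      have le: "\<bar>B K A x * g x\<bar> \<le> 2" for x
        using mult_mono[of "\<bar>B K A x\<bar>" 1 "\<bar>g x\<bar>" 2] B01[of K A x] g(2)[of x] by (simp add: abs_mult)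
      show "integrable Q (\<lambda>x. (B K A x * g x) *\<^sub>R iexp (l' x))"
        by (rule integrable_const_bound[where B = 2]) (use le in auto)
      show "integrable Q (\<lambda>x. B K A x * g x)"
        by (rule integrable_const_bound[where B = 2]) (use le in auto)
    qed
    have key: "(\<integral>x. (B K A x * g x) * indicator (A b) (x b) \<partial>M) = (\<integral>x. (B K A x * g x) * indicator (A b) (x b) \<partial>N)"
      if gm: "\<And>Q. sets Q = sets (PiM UNIV (\<lambda>_. borel :: real measure)) \<Longrightarrow> g \<in> borel_measurable Q"
        and g2: "\<And>x. 0 \<le> g x" "\<And>x. g x \<le> 2"
        and ge: "\<And>t. (\<integral>x. (B K A x * g x) *\<^sub>R iexp (t * x b) \<partial>M) = (\<integral>x. (B K A x * g x) *\<^sub>R iexp (t * x b) \<partial>N)" for g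
    proof -
      define \<mu> where "\<mu> Q = distr (density Q (\<lambda>x. ennreal (B K A x * g x))) borel (\<lambda>x. x b)" for Q
      have Q: "finite_measure (\<mu> Q)" "sets (\<mu> Q) = sets borel"
        "\<And>t. (\<integral>y. iexp (t * y) \<partial>\<mu> Q) = (\<integral>x. (B K A x * g x) *\<^sub>R iexp (t * x b) \<partial>Q)"
        "measure (\<mu> Q) (A b) = (\<integral>x. (B K A x * g x) * indicator (A b) (x b) \<partial>Q)"
        if Q: "prob_space Q" "sets Q = sets (PiM UNIV (\<lambda>_. borel :: real measure))" for Q
      proof -
        interpret prob_space Q by fact
        have [measurable]: "B K A \<in> borel_measurable Q" "g \<in> borel_measurable Q" using Bm[of A Q K] Q(2) gm \<open>\<And>a. A a \<in> sets borel\<close> by auto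
        have [measurable]: "(\<lambda>x. x b) \<in> borel_measurable Q"
          using measurable_cong_sets[OF Q(2) refl] measurable_component_singleton[of b UNIV "\<lambda>_. borel :: real measure"] by blast
        have [measurable]: "A b \<in> sets borel" using \<open>\<And>a. A a \<in> sets borel\<close> .
        have i: "integrable Q (\<lambda>x. B K A x * g x)" by (rule intb(2)[OF Q _ _ L0]) (use g2 in auto)
        have nn: "0 \<le> B K A x * g x" for x using B01 g2 by auto
        have "emeasure (\<mu> Q) (space (\<mu> Q)) = (\<integral>\<^sup>+x. ennreal (B K A x * g x) \<partial>Q)"
          unfolding \<mu>_def by (simp add: emeasure_distr emeasure_density)
        also have "\<dots> = ennreal (\<integral>x. B K A x * g x \<partial>Q)" by (rule nn_integral_eq_integral[OF i]) (use nn in auto)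
        finally show "finite_measure (\<mu> Q)" by (intro finite_measureI) auto
        show "sets (\<mu> Q) = sets borel" by (simp add: \<mu>_def)
        show "(\<integral>y. iexp (t * y) \<partial>\<mu> Q) = (\<integral>x. (B K A x * g x) *\<^sub>R iexp (t * x b) \<partial>Q)" for t
          unfolding \<mu>_def by (subst integral_distr) (auto intro!: integral_density simp: nn)
        have "measure (\<mu> Q) (A b) = (\<integral>y. indicator (A b) y \<partial>\<mu> Q)" by (simp add: \<mu>_def)
        also have "\<dots> = (\<integral>x. indicator (A b) (x b) \<partial>density Q (\<lambda>x. ennreal (B K A x * g x)))"
          unfolding \<mu>_def by (rule integral_distr) measurable
        also have "\<dots> = (\<integral>x. (B K A x * g x) *\<^sub>R indicator (A b) (x b) \<partial>Q)"
          by (rule integral_density) (auto simp: nn)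
        finally show "measure (\<mu> Q) (A b) = (\<integral>x. (B K A x * g x) * indicator (A b) (x b) \<partial>Q)" by simp
      qed
      have "\<mu> M = \<mu> N" by (rule finite_measure_char_unique) (use Q[OF M] Q[OF N] ge in auto)
      thus ?thesis using Q(4)[OF M] Q(4)[OF N] by simp
    qed
    define k0 where "k0 Q = (\<integral>x. B K A x * indicator (A b) (x b) \<partial>Q)" for Q :: "('i \<Rightarrow> real) measure"
    have g0: "k0 M = k0 N"
      unfolding k0_def using key[of "\<lambda>_. 1"] insert.IH[OF Ladd[OF L0]] by simp
    have part: "(\<integral>x. (B K A x * u (l x)) * indicator (A b) (x b) \<partial>M) = (\<integral>x. (B K A x * u (l x)) * indicator (A b) (x b) \<partial>N)"
      if u: "u = cos \<or> u = sin" for u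
    proof -
      have um: "(\<lambda>x. u (l x)) \<in> borel_measurable Q" if "sets Q = sets (PiM UNIV (\<lambda>_. borel :: real measure))" for Q
        using u Lm[OF insert.prems that] by auto
      have u1: "\<bar>u y\<bar> \<le> 1" for y using u by auto
      have u1': "-1 \<le> u y" "u y \<le> 1" for y using u1[of y] by auto
      obtain al be :: complex where uc: "\<And>y. of_real (u y) = al * iexp y + be * iexp (- y)"
      proof (cases "u = cos")
        case True
        have "complex_of_real (cos y) = (1/2) * iexp y + (1/2) * iexp (- y)" for y
          by (simp add: complex_eq_iff exp_eq_polar cis.ctr Re_exp Im_exp)
        thus ?thesis using that True by blast
      next
        case False
        hence us: "u = sin" using u by auto
        have "complex_of_real (sin y) = (-\<i>/2) * iexp y + (\<i>/2) * iexp (- y)" for y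
          by (simp add: complex_eq_iff Re_exp Im_exp)
        thus ?thesis using that us by blast
      qed
      have ch: "(\<integral>x. (B K A x * (1 + u (l x))) *\<^sub>R iexp (t * x b) \<partial>Q)
         = (\<integral>x. B K A x *\<^sub>R iexp (0 + t * x b) \<partial>Q) + al * (\<integral>x. B K A x *\<^sub>R iexp (l x + t * x b) \<partial>Q)
           + be * (\<integral>x. B K A x *\<^sub>R iexp (- l x + t * x b) \<partial>Q)"
        if Q: "prob_space Q" "sets Q = sets (PiM UNIV (\<lambda>_. borel :: real measure))" for Q t
      proof -
        have ii: "integrable Q (\<lambda>x. B K A x *\<^sub>R iexp (l' x))" if "l' \<in> L" for l'
          using intb(1)[OF Q, of "\<lambda>_. 1" l'] that by simp
        have "(B K A x * (1 + u (l x))) *\<^sub>R iexp (t * x b) = B K A x *\<^sub>R iexp (0 + t * x b)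
           + al * (B K A x *\<^sub>R iexp (l x + t * x b)) + be * (B K A x *\<^sub>R iexp (- l x + t * x b))" for x
        proof -
          have "iexp (l x + t * x b) = iexp (l x) * iexp (t * x b)" "iexp (- l x + t * x b) = iexp (- l x) * iexp (t * x b)"
            by (simp_all add: exp_add[symmetric] algebra_simps)
          thus ?thesis using uc[of "l x"] by (simp add: scaleR_conv_of_real algebra_simps)
        qed
        moreover have "(\<integral>x. f1 x + al * f2 x + be * f3 x \<partial>Q) = (\<integral>x. f1 x \<partial>Q) + al * (\<integral>x. f2 x \<partial>Q) + be * (\<integral>x. f3 x \<partial>Q)"
          if "integrable Q f1" "integrable Q f2" "integrable Q f3" for f1 f2 f3 :: "_ \<Rightarrow> complex"
          using that by simp
        ultimately show ?thesis
          using ii[OF Ladd[OF L0, of t b]] ii[OF Ladd[OF insert.prems, of t b]] ii[OF Ladd[OF Lneg[OF insert.prems], of t b]]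
          by presburger
      qed
      have eqp: "(\<integral>x. (B K A x * (1 + u (l x))) * indicator (A b) (x b) \<partial>M) = (\<integral>x. (B K A x * (1 + u (l x))) * indicator (A b) (x b) \<partial>N)"
      proof (rule key)
        show "(\<integral>x. (B K A x * (1 + u (l x))) *\<^sub>R iexp (t * x b) \<partial>M) = (\<integral>x. (B K A x * (1 + u (l x))) *\<^sub>R iexp (t * x b) \<partial>N)" for t
          unfolding ch[OF M] ch[OF N]
          using insert.IH[OF Ladd[OF L0, of t b]] insert.IH[OF Ladd[OF insert.prems, of t b]] insert.IH[OF Ladd[OF Lneg[OF insert.prems], of t b]]
          by simp
        show "0 \<le> 1 + u (l x)" "1 + u (l x) \<le> 2" for x using u1'[of "l x"] by auto
        show "(\<lambda>x. 1 + u (l x)) \<in> borel_measurable Q" if "sets Q = sets (PiM UNIV (\<lambda>_. borel :: real measure))" for Q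
          using um[OF that] by simp
      qed
      have sp: "(\<integral>x. (B K A x * (1 + u (l x))) * indicator (A b) (x b) \<partial>Q)
         = k0 Q + (\<integral>x. (B K A x * u (l x)) * indicator (A b) (x b) \<partial>Q)"
        if Q: "prob_space Q" "sets Q = sets (PiM UNIV (\<lambda>_. borel :: real measure))" for Q
      proof -
        interpret prob_space Q by fact
        have [measurable]: "B K A \<in> borel_measurable Q" "(\<lambda>x. u (l x)) \<in> borel_measurable Q" using Bm[of A Q K] Q(2) um \<open>\<And>a. A a \<in> sets borel\<close> by auto
        have [measurable]: "(\<lambda>x. x b) \<in> borel_measurable Q"
          using measurable_cong_sets[OF Q(2) refl] measurable_component_singleton[of b UNIV "\<lambda>_. borel :: real measure"] by blast
        have [measurable]: "A b \<in> sets borel" using \<open>\<And>a. A a \<in> sets borel\<close> .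
        have "integrable Q (\<lambda>x. B K A x * indicator (A b) (x b))"
          by (rule integrable_const_bound[where B = 1]) (use B01 in \<open>auto simp: indicator_def\<close>)
        moreover have "integrable Q (\<lambda>x. (B K A x * u (l x)) * indicator (A b) (x b))"
          by (rule integrable_const_bound[where B = 1])
             (use B01 u1 in \<open>auto simp: indicator_def abs_mult intro!: mult_le_one\<close>)
        ultimately show ?thesis unfolding k0_def by (simp add: algebra_simps)
      qed
      show ?thesis using eqp sp[OF M] sp[OF N] g0 by simp
    qed
    have fin: "(\<integral>x. B (insert b K) A x *\<^sub>R iexp (l x) \<partial>Q)
      = of_real (\<integral>x. (B K A x * cos (l x)) * indicator (A b) (x b) \<partial>Q) + \<i> * of_real (\<integral>x. (B K A x * sin (l x)) * indicator (A b) (x b) \<partial>Q)"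
      if Q: "prob_space Q" "sets Q = sets (PiM UNIV (\<lambda>_. borel :: real measure))" for Q
    proof -
      interpret prob_space Q by fact
      have [measurable]: "B K A \<in> borel_measurable Q" "l \<in> borel_measurable Q" using Bm[of A Q K] Q(2) Lm[OF insert.prems] \<open>\<And>a. A a \<in> sets borel\<close> by auto
      have [measurable]: "(\<lambda>x. x b) \<in> borel_measurable Q"
        using measurable_cong_sets[OF Q(2) refl] measurable_component_singleton[of b UNIV "\<lambda>_. borel :: real measure"] by blast
      have [measurable]: "A b \<in> sets borel" using \<open>\<And>a. A a \<in> sets borel\<close> .
      have i: "integrable Q (\<lambda>x. (B K A x * cos (l x)) * indicator (A b) (x b))" "integrable Q (\<lambda>x. (B K A x * sin (l x)) * indicator (A b) (x b))"
        by (rule integrable_const_bound[where B = 1];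
             use B01 in \<open>auto simp: indicator_def abs_mult intro!: mult_le_one\<close>)+
      have "B (insert b K) A x *\<^sub>R iexp (l x) = of_real ((B K A x * cos (l x)) * indicator (A b) (x b)) + \<i> * of_real ((B K A x * sin (l x)) * indicator (A b) (x b))" for x
      proof -
        have "B (insert b K) A x = indicator (A b) (x b) * B K A x" using insert.hyps by (simp add: B_def)
        thus ?thesis by (simp add: complex_eq_iff Re_exp Im_exp)
      qed
      moreover have "(\<integral>x. of_real (f x) + \<i> * of_real (g x) \<partial>Q) = of_real (\<integral>x. f x \<partial>Q) + \<i> * of_real (\<integral>x. g x \<partial>Q)"
        if "integrable Q f" "integrable Q g" for f g :: "_ \<Rightarrow> real"
        using that by simp
      ultimately show ?thesis using i by presburger
    qed
    show ?case unfolding fin[OF M] fin[OF N] using part[of cos] part[of sin] by simp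
  qed
  show ?thesis
  proof (rule measure_eqI_PiM_infinite[OF M(2) N(2)])
    fix A :: "'i \<Rightarrow> real set" and J :: "'i set"
    assume J: "finite J" "\<And>i. i \<in> J \<Longrightarrow> A i \<in> sets borel"
    define A' where "A' i = (if i \<in> J then A i else {})" for i
    have A': "\<And>i. A' i \<in> sets borel" using J by (auto simp: A'_def)
    have E: "Q (prod_emb UNIV (\<lambda>_. borel) J (Pi\<^sub>E J A)) = ennreal (Re (\<integral>x. B J A' x *\<^sub>R iexp 0 \<partial>Q))"
      if Q: "prob_space Q" "sets Q = sets (PiM UNIV (\<lambda>_. borel :: real measure))" for Q
    proof -
      interpret prob_space Q by fact
      let ?X = "prod_emb UNIV (\<lambda>_. borel :: real measure) J (Pi\<^sub>E J A)"
      have X: "?X \<in> sets Q" unfolding Q(2) using J by (intro sets_PiM_I) auto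
      have sp: "space Q = UNIV" using sets_eq_imp_space_eq[OF Q(2)] by (simp add: space_PiM)
      have "B J A' x = indicator ?X x" for x
      proof (cases "\<forall>i\<in>J. x i \<in> A i")
        case True
        hence "B J A' x = 1" unfolding B_def by (intro prod.neutral) (auto simp: A'_def)
        moreover have "x \<in> ?X" using True by (auto simp: prod_emb_def PiE_def extensional_def)
        ultimately show ?thesis by simp
      next
        case False
        then obtain i where "i \<in> J" "x i \<notin> A i" by auto
        hence "B J A' x = 0" unfolding B_def using J(1) by (intro prod_zero bexI[of _ i]) (auto simp: A'_def)
        moreover have "x \<notin> ?X" using False by (auto simp: prod_emb_def PiE_def Pi_def)
        ultimately show ?thesis by simp
      qed
      hence "(\<integral>x. B J A' x *\<^sub>R iexp 0 \<partial>Q) = of_real (\<integral>x. indicator ?X x \<partial>Q)"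
        by (simp add: scaleR_conv_of_real)
      also have "(\<integral>x. indicator ?X x \<partial>Q) = measure Q ?X" using X by simp
      finally show ?thesis by (simp add: emeasure_eq_measure)
    qed
    show "M (prod_emb UNIV (\<lambda>_. borel) J (Pi\<^sub>E J A)) = N (prod_emb UNIV (\<lambda>_. borel) J (Pi\<^sub>E J A))"
      unfolding E[OF M] E[OF N] using main[OF J(1) A' L0] by simp
  qed (use M in \<open>auto simp: prob_space_def\<close>)
qed

text \<open>An affine image of the standard normal law covers point masses and nondegenerate laws
  together, so moments need to be computed only once.\<close>

lemma gaussian_rv_std:
  assumes "gaussian_rv M Y"
  obtains \<mu> \<sigma> where "distr M borel Y = distr std_normal_distribution borel (\<lambda>x. \<mu> + \<sigma> * x)"
proof -
  interpret S: prob_space std_normal_distribution using prob_space_normal_density[of 1 0] by simp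
  obtain \<mu> \<sigma> where \<sigma>: "0 \<le> \<sigma>" and d: "distr M borel Y =
      (if \<sigma> = 0 then return borel \<mu> else density lborel (\<lambda>x. ennreal (normal_density \<mu> \<sigma> x)))"
    using assms unfolding gaussian_rv_def by blast
  show ?thesis
  proof (cases "\<sigma> = 0")
    case True
    have "distr std_normal_distribution borel (\<lambda>x. \<mu> + \<sigma> * x) = return borel \<mu>"
      using True S.prob_space_axioms by (simp add: S.distr_const)
    thus ?thesis using that[of \<mu> \<sigma>] d True by simp
  next
    case False
    have "distributed std_normal_distribution lborel (\<lambda>x. x) (normal_density 0 1)"
      unfolding distributed_def by (auto simp: distr_id2)
    hence "distributed std_normal_distribution lborel (\<lambda>x. \<mu> + \<sigma> * x) (normal_density (\<mu> + \<sigma> * 0) (\<bar>\<sigma>\<bar> * 1))"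
      by (rule S.normal_density_affine) (use False in auto)
    hence "distr std_normal_distribution lborel (\<lambda>x. \<mu> + \<sigma> * x) = density lborel (\<lambda>x. ennreal (normal_density \<mu> \<sigma> x))"
      using \<sigma> unfolding distributed_def by simp
    moreover have "distr std_normal_distribution lborel (\<lambda>x. \<mu> + \<sigma> * x) = distr std_normal_distribution borel (\<lambda>x. \<mu> + \<sigma> * x)"
      by (rule distr_cong) auto
    ultimately show ?thesis using that[of \<mu> \<sigma>] d False by simp
  qed
qed

lemma std_normal_mgf:
  "integrable std_normal_distribution (\<lambda>x. exp (s * x))"
  "(\<integral>x. exp (s * x) \<partial>std_normal_distribution) = exp (s\<^sup>2 / 2)"
proof -
  \<comment> \<open>Completing the square: the exponential tilt shifts the mean to
    \<open>s\<close>.\<close>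
  have e: "std_normal_density x * exp (s * x) = exp (s\<^sup>2 / 2) * normal_density s 1 x" for x
    unfolding normal_density_def
    by (simp add: exp_add[symmetric] power2_eq_square field_simps)
  have i: "integrable lborel (\<lambda>x. std_normal_density x * exp (s * x))" unfolding e by simp
  show "integrable std_normal_distribution (\<lambda>x. exp (s * x))"
    by (subst integrable_density) (use i in auto)
  have "(\<integral>x. exp (s * x) \<partial>std_normal_distribution) = (\<integral>x. std_normal_density x * exp (s * x) \<partial>lborel)"
    by (subst integral_density) auto
  also have "\<dots> = exp (s\<^sup>2 / 2)" unfolding e by simp
  finally show "(\<integral>x. exp (s * x) \<partial>std_normal_distribution) = exp (s\<^sup>2 / 2)" .
qed

lemma std_normal_moments:
  "integrable std_normal_distribution (\<lambda>x. x)" "(\<integral>x. x \<partial>std_normal_distribution) = 0"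
  "integrable std_normal_distribution (\<lambda>x. x\<^sup>2)" "(\<integral>x. x\<^sup>2 \<partial>std_normal_distribution) = 1"
proof -
  show "integrable std_normal_distribution (\<lambda>x. x)" "integrable std_normal_distribution (\<lambda>x. x\<^sup>2)"
    using integrable_std_normal_distribution_moment[of 1] integrable_std_normal_distribution_moment[of 2] by simp_all
  show "(\<integral>x. x \<partial>std_normal_distribution) = 0"
    using integral_std_normal_distribution_moment_odd[of 1] by simp
  show "(\<integral>x. x\<^sup>2 \<partial>std_normal_distribution) = 1"
    using std_normal_distribution_even_moments(1)[of 1] by simp
qed

lemma gaussian_rv_facts:
  assumes "prob_space M" "gaussian_rv M Y"
  shows "integrable M Y" "integrable M (\<lambda>x. (Y x)\<^sup>2)" "integrable M (\<lambda>x. exp (Y x))"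
    and "(\<integral>x. Y x \<partial>M) = 0 \<Longrightarrow> (\<integral>x. exp (Y x) \<partial>M) = exp ((\<integral>x. (Y x)\<^sup>2 \<partial>M) / 2)"
    and "(\<integral>x. Y x \<partial>M) = 0 \<Longrightarrow> (\<integral>x. iexp (Y x) \<partial>M) = of_real (exp (- (\<integral>x. (Y x)\<^sup>2 \<partial>M) / 2))"
proof -
  interpret prob_space M by fact
  interpret S: prob_space std_normal_distribution using prob_space_normal_density[of 1 0] by simp
  have Y [measurable]: "Y \<in> borel_measurable M" using assms(2) by (simp add: gaussian_rv_def)
  obtain \<mu> \<sigma> where d: "distr M borel Y = distr std_normal_distribution borel (\<lambda>x. \<mu> + \<sigma> * x)"
    using gaussian_rv_std[OF assms(2)] .
  have int: "integrable M (\<lambda>x. g (Y x)) \<longleftrightarrow> integrable std_normal_distribution (\<lambda>x. g (\<mu> + \<sigma> * x))"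
    and val: "(\<integral>x. g (Y x) \<partial>M) = (\<integral>x. g (\<mu> + \<sigma> * x) \<partial>std_normal_distribution)"
    if [measurable]: "g \<in> borel_measurable borel" for g :: "real \<Rightarrow> 'b::{banach,second_countable_topology}"
  proof -
    have "integrable M (\<lambda>x. g (Y x)) \<longleftrightarrow> integrable (distr M borel Y) g" by (subst integrable_distr_eq) auto
    also have "\<dots> \<longleftrightarrow> integrable std_normal_distribution (\<lambda>x. g (\<mu> + \<sigma> * x))" unfolding d by (subst integrable_distr_eq) auto
    finally show "integrable M (\<lambda>x. g (Y x)) \<longleftrightarrow> integrable std_normal_distribution (\<lambda>x. g (\<mu> + \<sigma> * x))" .
    have "(\<integral>x. g (Y x) \<partial>M) = (\<integral>x. g x \<partial>distr M borel Y)" by (subst integral_distr) auto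
    also have "\<dots> = (\<integral>x. g (\<mu> + \<sigma> * x) \<partial>std_normal_distribution)" unfolding d by (subst integral_distr) auto
    finally show "(\<integral>x. g (Y x) \<partial>M) = (\<integral>x. g (\<mu> + \<sigma> * x) \<partial>std_normal_distribution)" .
  qed
  note sm = std_normal_moments std_normal_mgf
  have b: "(\<lambda>x :: real. x) \<in> borel_measurable borel" "(\<lambda>x :: real. x\<^sup>2) \<in> borel_measurable borel"
    "(exp :: real \<Rightarrow> real) \<in> borel_measurable borel" "iexp \<in> borel_measurable borel" by measurable
  show "integrable M Y" using int[OF b(1)] sm(1) by simp
  have "(\<mu> + \<sigma> * x)\<^sup>2 = \<mu>\<^sup>2 + \<sigma>\<^sup>2 * x\<^sup>2 + 2 * \<mu> * \<sigma> * x" for x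
    by (simp add: power2_eq_square algebra_simps)
  thus "integrable M (\<lambda>x. (Y x)\<^sup>2)" unfolding int[OF b(2)] using sm(1,3) by simp
  show "integrable M (\<lambda>x. exp (Y x))" unfolding int[OF b(3)] exp_add using sm(5)[of \<sigma>] by simp
  have mean: "(\<integral>x. Y x \<partial>M) = \<mu>" using val[OF b(1)] sm(1,2) S.prob_space by simp
  assume "(\<integral>x. Y x \<partial>M) = 0"
  hence \<mu>0: "\<mu> = 0" using mean by simp
  have var: "(\<integral>x. (Y x)\<^sup>2 \<partial>M) = \<sigma>\<^sup>2" using val[OF b(2)] sm(3,4) by (simp add: \<mu>0 power_mult_distrib)
  show "(\<integral>x. exp (Y x) \<partial>M) = exp ((\<integral>x. (Y x)\<^sup>2 \<partial>M) / 2)"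
    unfolding var using val[OF b(3)] sm(6)[of \<sigma>] by (simp add: \<mu>0)
  have "(\<integral>x. iexp (Y x) \<partial>M) = char std_normal_distribution \<sigma>"
    using val[OF b(4)] by (simp add: \<mu>0 char_def)
  thus "(\<integral>x. iexp (Y x) \<partial>M) = of_real (exp (- (\<integral>x. (Y x)\<^sup>2 \<partial>M) / 2))"
    unfolding var by (simp add: char_std_normal_distribution)
qed

section \<open>Linear forms in the disorder and their exponential moments\<close>

locale disorder = prob_space D for D :: "(nat \<Rightarrow> real) measure" +
  assumes sets_D: "sets D = sets (borel :: (nat \<Rightarrow> real) measure)"
    and gauss: "gaussian_sequence D"
    and centered: "centered_sequence D"
    and stationary: "stationary_sequence D"
    and summable_cov: "summable (\<lambda>a. \<bar>covariance_fun D a\<bar>)"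
begin

definition gbar :: real where "gbar = (\<Sum>a. \<bar>covariance_fun D a\<bar>)"

lemma gbar_nonneg: "0 \<le> gbar" unfolding gbar_def by (rule suminf_nonneg[OF summable_cov]) auto

lemma sets_D_PiM: "sets D = sets (PiM UNIV (\<lambda>_. borel :: real measure))"
  using sets_D sets_PiM_equal_borel by metis

lemma space_D [simp]: "space D = UNIV" using sets_eq_imp_space_eq[OF sets_D] by simp

lemma coord_measurable [measurable]: "(\<lambda>\<omega>. \<omega> a) \<in> borel_measurable D"
  using measurable_cong_sets[OF sets_D_PiM refl] measurable_component_singleton[of a UNIV "\<lambda>_. borel :: real measure"] by blast

lemma measurable_into_D:
  assumes "\<And>a. (\<lambda>x. f x a) \<in> borel_measurable N"
  shows "f \<in> measurable N D"
proof -
  have "f \<in> measurable N (PiM UNIV (\<lambda>_. borel :: real measure))"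
    by (rule measurable_PiM_single') (use assms in auto)
  thus ?thesis using measurable_cong_sets[OF refl sets_D_PiM] by blast
qed

definition lf :: "nat set \<Rightarrow> (nat \<Rightarrow> real) \<Rightarrow> (nat \<Rightarrow> real) \<Rightarrow> real" where
  "lf J c \<omega> = (\<Sum>a\<in>J. c a * \<omega> a)"

lemma lf_measurable [measurable]: "lf J c \<in> borel_measurable D"
  unfolding lf_def by measurable

lemma gaussian_lf: "finite J \<Longrightarrow> gaussian_rv D (lf J c)"
  using gauss unfolding gaussian_sequence_def lf_def by blast

lemma gaussian_coord: "gaussian_rv D (\<lambda>\<omega>. \<omega> a)"
  using gaussian_lf[of "{a}" "\<lambda>_. 1"] by (simp add: lf_def[abs_def])

lemma integrable_coord [simp, intro]: "integrable D (\<lambda>\<omega>. \<omega> a)" "integrable D (\<lambda>\<omega>. (\<omega> a)\<^sup>2)"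
  using gaussian_rv_facts(1,2)[OF prob_space_axioms gaussian_coord] by auto

lemma expectation_coord [simp]: "expectation (\<lambda>\<omega>. \<omega> a) = 0"
  using centered by (simp add: centered_sequence_def)

lemma expectation_lf: "expectation (lf J c) = 0"
  unfolding lf_def by (subst Bochner_Integration.integral_sum) auto

lemma integrable_coord_mult [simp, intro]: "integrable D (\<lambda>\<omega>. \<omega> a * \<omega> b)"
proof (rule Bochner_Integration.integrable_bound)
  show "integrable D (\<lambda>\<omega>. (\<omega> a)\<^sup>2 + (\<omega> b)\<^sup>2)" by simp
  show "AE \<omega> in D. norm (\<omega> a * \<omega> b) \<le> norm ((\<omega> a)\<^sup>2 + (\<omega> b)\<^sup>2)"
  proof (rule AE_I2)
    fix \<omega> :: "nat \<Rightarrow> real"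
    have "2 * (\<bar>\<omega> a\<bar> * \<bar>\<omega> b\<bar>) \<le> (\<omega> a)\<^sup>2 + (\<omega> b)\<^sup>2" using sum_squares_bound[of "\<bar>\<omega> a\<bar>" "\<bar>\<omega> b\<bar>"] by simp
    moreover have "0 \<le> \<bar>\<omega> a\<bar> * \<bar>\<omega> b\<bar>" by simp
    ultimately have "\<bar>\<omega> a\<bar> * \<bar>\<omega> b\<bar> \<le> (\<omega> a)\<^sup>2 + (\<omega> b)\<^sup>2" by linarith
    thus "norm (\<omega> a * \<omega> b) \<le> norm ((\<omega> a)\<^sup>2 + (\<omega> b)\<^sup>2)" by (simp add: abs_mult)
  qed
qed measurable

lemma shift_measurable: "(\<lambda>\<omega> a. \<omega> (a + k)) \<in> measurable D D"
  by (rule measurable_into_D) simp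

lemma expectation_shift:
  fixes f :: "(nat \<Rightarrow> real) \<Rightarrow> real"
  assumes [measurable]: "f \<in> borel_measurable D"
  shows "expectation (\<lambda>\<omega>. f (\<lambda>a. \<omega> (a + k))) = expectation f"
    and "integrable D (\<lambda>\<omega>. f (\<lambda>a. \<omega> (a + k))) \<longleftrightarrow> integrable D f"
proof -
  have d: "distr D D (\<lambda>\<omega> a. \<omega> (a + k)) = D" using stationary by (simp add: stationary_sequence_def)
  show "expectation (\<lambda>\<omega>. f (\<lambda>a. \<omega> (a + k))) = expectation f"
    using integral_distr[OF shift_measurable assms, of k] d by simp
  show "integrable D (\<lambda>\<omega>. f (\<lambda>a. \<omega> (a + k))) \<longleftrightarrow> integrable D f"
    using integrable_distr_eq[OF shift_measurable assms, of k] d by simp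
qed

lemma covariance: "expectation (\<lambda>\<omega>. \<omega> a * \<omega> b) = covariance_fun D (if a \<le> b then b - a else a - b)"
proof -
  have "expectation (\<lambda>\<omega>. \<omega> a * \<omega> (a + d)) = covariance_fun D d" for a d
    using expectation_shift(1)[of "\<lambda>\<omega>. \<omega> 0 * \<omega> d" a] by (simp add: covariance_fun_def add.commute)
  from this[of a "b - a"] this[of b "a - b"] show ?thesis by (auto simp: mult.commute)
qed

text \<open>Each lag occurs at most once on either side of \<open>a\<close>, hence the factor
  2.\<close>

lemma sum_cov_le: assumes "finite A"
  shows "(\<Sum>b\<in>A. \<bar>expectation (\<lambda>\<omega>. \<omega> a * \<omega> b)\<bar>) \<le> 2 * gbar"
proof -
  let ?g = "\<lambda>d. \<bar>covariance_fun D d\<bar>"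
  have le: "(\<Sum>d\<in>B. ?g d) \<le> gbar" if "finite B" for B
    unfolding gbar_def by (rule sum_le_suminf[OF summable_cov that]) auto
  have "(\<Sum>b\<in>A. \<bar>expectation (\<lambda>\<omega>. \<omega> a * \<omega> b)\<bar>)
     = (\<Sum>b\<in>A. if a \<le> b then ?g (b - a) else ?g (a - b))"
    unfolding covariance by (intro sum.cong) auto
  also have "\<dots> = (\<Sum>b\<in>A \<inter> {b. a \<le> b}. ?g (b - a)) + (\<Sum>b\<in>A \<inter> - {b. a \<le> b}. ?g (a - b))"
    by (rule sum.If_cases[OF assms])
  also have "(\<Sum>b\<in>A \<inter> {b. a \<le> b}. ?g (b - a)) = (\<Sum>d\<in>(\<lambda>b. b - a) ` (A \<inter> {b. a \<le> b}). ?g d)"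
    by (subst sum.reindex) (auto simp: inj_on_def)
  also have "\<dots> \<le> gbar" by (rule le) (use assms in auto)
  also have "(\<Sum>b\<in>A \<inter> - {b. a \<le> b}. ?g (a - b)) = (\<Sum>d\<in>(\<lambda>b. a - b) ` (A \<inter> - {b. a \<le> b}). ?g d)"
    by (subst sum.reindex) (auto simp: inj_on_def)
  also have "\<dots> \<le> gbar" by (rule le) (use assms in auto)
  finally show ?thesis by simp
qed

text \<open>Schur's test: the absolute row sums of the covariance matrix are at most
  \<open>2 * gbar\<close>, which therefore bounds its quadratic form.\<close>

lemma lf_square_le:
  assumes "finite A"
  shows "expectation (\<lambda>\<omega>. (lf A v \<omega>)\<^sup>2) \<le> 2 * gbar * (\<Sum>a\<in>A. (v a)\<^sup>2)"
proof -
  let ?c = "\<lambda>a b. \<bar>expectation (\<lambda>\<omega>. \<omega> a * \<omega> b)\<bar>"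
  have sym: "?c a b = ?c b a" for a b by (simp add: mult.commute)
  have "(lf A v \<omega>)\<^sup>2 = (\<Sum>a\<in>A. \<Sum>b\<in>A. v a * v b * (\<omega> a * \<omega> b))" for \<omega>
    unfolding lf_def power2_eq_square sum_product by (intro sum.cong) auto
  hence "expectation (\<lambda>\<omega>. (lf A v \<omega>)\<^sup>2) = (\<Sum>a\<in>A. \<Sum>b\<in>A. v a * v b * expectation (\<lambda>\<omega>. \<omega> a * \<omega> b))"
    by simp
  also have "\<dots> \<le> (\<Sum>a\<in>A. \<Sum>b\<in>A. (v a)\<^sup>2 / 2 * ?c a b + (v b)\<^sup>2 / 2 * ?c a b)"
  proof (intro sum_mono)
    fix a b
    have "v a * v b * expectation (\<lambda>\<omega>. \<omega> a * \<omega> b) \<le> \<bar>v a * v b\<bar> * ?c a b"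
      using abs_ge_self[of "v a * v b * expectation (\<lambda>\<omega>. \<omega> a * \<omega> b)"] by (simp only: abs_mult)
    also have "\<bar>v a * v b\<bar> \<le> (v a)\<^sup>2 / 2 + (v b)\<^sup>2 / 2"
      using sum_squares_bound[of "\<bar>v a\<bar>" "\<bar>v b\<bar>"] by (simp add: abs_mult)
    finally show "v a * v b * expectation (\<lambda>\<omega>. \<omega> a * \<omega> b) \<le> (v a)\<^sup>2 / 2 * ?c a b + (v b)\<^sup>2 / 2 * ?c a b"
      by (simp add: mult_right_mono distrib_right)
  qed
  also have "\<dots> = (\<Sum>a\<in>A. (v a)\<^sup>2 / 2 * (\<Sum>b\<in>A. ?c a b)) + (\<Sum>b\<in>A. (v b)\<^sup>2 / 2 * (\<Sum>a\<in>A. ?c b a))"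
  proof -
    have "(\<Sum>a\<in>A. \<Sum>b\<in>A. (v b)\<^sup>2 / 2 * ?c a b) = (\<Sum>b\<in>A. \<Sum>a\<in>A. (v b)\<^sup>2 / 2 * ?c b a)"
      
      by (subst sum.swap) (intro sum.cong refl, simp add: mult.commute)
    thus ?thesis by (simp only: sum.distrib sum_distrib_left)
  qed
  also have "\<dots> \<le> (\<Sum>a\<in>A. (v a)\<^sup>2 / 2 * (2 * gbar)) + (\<Sum>b\<in>A. (v b)\<^sup>2 / 2 * (2 * gbar))"
    by (intro add_mono sum_mono mult_left_mono sum_cov_le assms) auto
  also have "\<dots> = 2 * gbar * (\<Sum>a\<in>A. (v a)\<^sup>2)" by (simp add: sum_distrib_left mult_ac sum.distrib[symmetric])
  finally show ?thesis .
qed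

lemma exp_lf:
  assumes "finite J"
  shows "integrable D (\<lambda>\<omega>. exp (lf J c \<omega>))"
    and "expectation (\<lambda>\<omega>. exp (lf J c \<omega>)) = exp (expectation (\<lambda>\<omega>. (lf J c \<omega>)\<^sup>2) / 2)"
    and "(\<integral>\<omega>. iexp (lf J c \<omega>) \<partial>D) = of_real (exp (- expectation (\<lambda>\<omega>. (lf J c \<omega>)\<^sup>2) / 2))"
    and "integrable D (\<lambda>\<omega>. (lf J c \<omega>)\<^sup>2)" "integrable D (lf J c)"
  using gaussian_rv_facts[OF prob_space_axioms gaussian_lf[OF assms, of c]] expectation_lf by auto

text \<open>The exponential of an absolute value is at most the sum of the exponentials of both
  signs. The product of these sums expands over all sign patterns into exponentials of linear forms,
  whose expectations are explicit.\<close>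

lemma exp_abs_sum_eq:
  assumes "finite A"
  shows "(\<Prod>a\<in>A. exp (t * \<omega> a) + exp (- t * \<omega> a)) = (\<Sum>B\<in>Pow A. exp (lf A (\<lambda>a. if a \<in> B then t else - t) \<omega>))"
proof -
  have "(\<Prod>a\<in>A. exp (t * \<omega> a) + exp (- t * \<omega> a)) = (\<Sum>B\<in>Pow A. (\<Prod>a\<in>B. exp (t * \<omega> a)) * (\<Prod>a\<in>A - B. exp (- t * \<omega> a)))"
    by (rule prod_add[OF assms])
  also have "\<dots> = (\<Sum>B\<in>Pow A. exp (lf A (\<lambda>a. if a \<in> B then t else - t) \<omega>))"
  proof (rule sum.cong[OF refl])
    fix B assume B: "B \<in> Pow A"
    hence fB: "finite B" using assms finite_subset by auto
    have "lf A (\<lambda>a. if a \<in> B then t else - t) \<omega> = (\<Sum>a\<in>B. t * \<omega> a) + (\<Sum>a\<in>A - B. - t * \<omega> a)"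
      unfolding lf_def by (subst sum.subset_diff[of B A]) (use B assms in \<open>auto intro!: arg_cong2[where f = "(+)"] sum.cong\<close>)
    thus "(\<Prod>a\<in>B. exp (t * \<omega> a)) * (\<Prod>a\<in>A - B. exp (- t * \<omega> a)) = exp (lf A (\<lambda>a. if a \<in> B then t else - t) \<omega>)"
      using fB assms by (simp add: exp_add exp_sum)
  qed
  finally show ?thesis .
qed

lemma exp_abs_sum_le:
  fixes t :: real
  assumes that: "finite A"
  shows "exp (t * (\<Sum>a\<in>A. \<bar>\<omega> a\<bar>)) \<le> (\<Prod>a\<in>A. exp (t * \<omega> a) + exp (- t * \<omega> (a::nat)))"
proof -
  have "exp (t * (\<Sum>a\<in>A. \<bar>\<omega> a\<bar>)) = (\<Prod>a\<in>A. exp (t * \<bar>\<omega> a\<bar>))" using that by (simp add: exp_sum sum_distrib_left)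
  also have "\<dots> \<le> (\<Prod>a\<in>A. exp (t * \<omega> a) + exp (- t * \<omega> a))"
    by (rule prod_mono) (auto simp: abs_if)
  finally show ?thesis .
qed

lemma exp_abs_sum:
  assumes "finite A"
  shows "integrable D (\<lambda>\<omega>. exp (t * (\<Sum>a\<in>A. \<bar>\<omega> a\<bar>)))"
    and "expectation (\<lambda>\<omega>. exp (t * (\<Sum>a\<in>A. \<bar>\<omega> a\<bar>))) \<le> (2 * exp (gbar * t\<^sup>2)) ^ card A"
proof -
  let ?G = "\<lambda>\<omega>. \<Sum>B\<in>Pow A. exp (lf A (\<lambda>a. if a \<in> B then t else - t) \<omega>)"
  have le: "exp (t * (\<Sum>a\<in>A. \<bar>\<omega> a\<bar>)) \<le> ?G \<omega>" for \<omega>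
    using exp_abs_sum_le[OF assms, of t \<omega>] unfolding exp_abs_sum_eq[OF assms] .
  have iG: "integrable D ?G" using exp_lf(1)[OF assms] by simp
  show i: "integrable D (\<lambda>\<omega>. exp (t * (\<Sum>a\<in>A. \<bar>\<omega> a\<bar>)))"
    by (rule Bochner_Integration.integrable_bound[OF iG]) (use le in \<open>auto intro!: AE_I2 order_trans[OF le]\<close>)
  have "expectation (\<lambda>\<omega>. exp (t * (\<Sum>a\<in>A. \<bar>\<omega> a\<bar>))) \<le> expectation ?G"
    by (rule integral_mono[OF i iG]) (rule le)
  also have "\<dots> = (\<Sum>B\<in>Pow A. exp (expectation (\<lambda>\<omega>. (lf A (\<lambda>a. if a \<in> B then t else - t) \<omega>)\<^sup>2) / 2))"
    using exp_lf(1,2)[OF assms] by simp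
  also have "\<dots> \<le> (\<Sum>B\<in>Pow A. exp (gbar * t\<^sup>2) ^ card A)"
  proof (rule sum_mono)
    fix B
    have "expectation (\<lambda>\<omega>. (lf A (\<lambda>a. if a \<in> B then t else - t) \<omega>)\<^sup>2) \<le> 2 * gbar * (\<Sum>a\<in>A. (if a \<in> B then t else - t)\<^sup>2)"
      by (rule lf_square_le[OF assms])
    also have "(\<Sum>a\<in>A. (if a \<in> B then t else - t)\<^sup>2) = card A * t\<^sup>2"
    proof -
      have "(if a \<in> B then t else - t)\<^sup>2 = t\<^sup>2" for a by simp
      thus ?thesis by (simp only: sum_constant)
    qed
    finally have "expectation (\<lambda>\<omega>. (lf A (\<lambda>a. if a \<in> B then t else - t) \<omega>)\<^sup>2) / 2 \<le> card A * (gbar * t\<^sup>2)" by (simp add: mult_ac)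
    thus "exp (expectation (\<lambda>\<omega>. (lf A (\<lambda>a. if a \<in> B then t else - t) \<omega>)\<^sup>2) / 2) \<le> exp (gbar * t\<^sup>2) ^ card A"
      by (simp add: exp_of_nat_mult[symmetric])
  qed
  also have "\<dots> = (2 * exp (gbar * t\<^sup>2)) ^ card A" using assms by (simp add: card_Pow power_mult_distrib)
  finally show "expectation (\<lambda>\<omega>. exp (t * (\<Sum>a\<in>A. \<bar>\<omega> a\<bar>))) \<le> (2 * exp (gbar * t\<^sup>2)) ^ card A" .
qed

end

section \<open>Rotation invariance and Gaussian concentration\<close>

context disorder
begin

sublocale DD: pair_prob_space D D ..

text \<open>When \<open>\<alpha>\<close> and \<open>\<beta>\<close> are the cosine and sine of an
  angle, this is the plane rotation by that angle, applied to every coordinate of a pair of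
  disorders.\<close>

definition rot :: "real \<Rightarrow> real \<Rightarrow> (nat \<Rightarrow> real) \<times> (nat \<Rightarrow> real) \<Rightarrow> (nat \<Rightarrow> real) \<times> (nat \<Rightarrow> real)" where
  "rot \<alpha> \<beta> z = (\<lambda>a. \<alpha> * fst z a + \<beta> * snd z a, \<lambda>a. - \<beta> * fst z a + \<alpha> * snd z a)"

lemma rot_measurable [measurable]: "rot \<alpha> \<beta> \<in> measurable (D \<Otimes>\<^sub>M D) (D \<Otimes>\<^sub>M D)"
  unfolding rot_def by (intro measurable_Pair measurable_into_D) measurable

lemma lf_add: "lf A (\<lambda>a. u a + v a) x = lf A u x + lf A v x"
  and lf_cmult: "lf A (\<lambda>a. c * u a) x = c * lf A u x"
  unfolding lf_def by (simp add: sum.distrib distrib_right, simp add: sum_distrib_left mult_ac)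

text \<open>The variance of a linear form is quadratic, so the cross terms that the rotation creates
  in the two copies cancel.\<close>

lemma DD_iexp_rot:
  assumes A: "finite A" and ab: "\<alpha>\<^sup>2 + \<beta>\<^sup>2 = 1"
  shows "(\<integral>z. iexp (lf A u (fst (rot \<alpha> \<beta> z)) + lf A v (snd (rot \<alpha> \<beta> z))) \<partial>(D \<Otimes>\<^sub>M D))
     = of_real (exp (- (expectation (\<lambda>\<omega>. (lf A u \<omega>)\<^sup>2) + expectation (\<lambda>\<omega>. (lf A v \<omega>)\<^sup>2)) / 2))"
proof -
  define u' where "u' a = \<alpha> * u a + (- \<beta>) * v a" for a
  define v' where "v' a = \<beta> * u a + \<alpha> * v a" for a
  have u': "lf A u' x = \<alpha> * lf A u x + (- \<beta>) * lf A v x" and v': "lf A v' x = \<beta> * lf A u x + \<alpha> * lf A v x" for x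
    unfolding u'_def v'_def lf_add lf_cmult by simp_all
  have split: "lf A u (fst (rot \<alpha> \<beta> z)) + lf A v (snd (rot \<alpha> \<beta> z)) = lf A u' (fst z) + lf A v' (snd z)" for z
    unfolding lf_def rot_def u'_def v'_def by (simp add: sum.distrib[symmetric] algebra_simps)
  have "(\<integral>z. iexp (lf A u (fst (rot \<alpha> \<beta> z)) + lf A v (snd (rot \<alpha> \<beta> z))) \<partial>(D \<Otimes>\<^sub>M D))
    = (\<integral>z. iexp (lf A u' (fst z)) * iexp (lf A v' (snd z)) \<partial>(D \<Otimes>\<^sub>M D))"
    unfolding split by (simp add: exp_add[symmetric] distrib_left)
  also have "\<dots> = (\<integral>x. (\<integral>y. iexp (lf A u' x) * iexp (lf A v' y) \<partial>D) \<partial>D)"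
  proof (subst DD.integral_fst'[symmetric])
    have [measurable]: "(\<lambda>z. lf A c (fst z)) \<in> borel_measurable (D \<Otimes>\<^sub>M D)" "(\<lambda>z. lf A c (snd z)) \<in> borel_measurable (D \<Otimes>\<^sub>M D)" for c
      unfolding lf_def by measurable
    show "integrable (D \<Otimes>\<^sub>M D) (\<lambda>z. iexp (lf A u' (fst z)) * iexp (lf A v' (snd z)))"
      by (rule DD.integrable_const_bound[where B = 1]) (auto simp: norm_mult)
  qed simp
  also have "\<dots> = (\<integral>x. iexp (lf A u' x) \<partial>D) * (\<integral>y. iexp (lf A v' y) \<partial>D)" by simp
  also have "\<dots> = of_real (exp (- (expectation (\<lambda>\<omega>. (lf A u' \<omega>)\<^sup>2) + expectation (\<lambda>\<omega>. (lf A v' \<omega>)\<^sup>2)) / 2))"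
    unfolding exp_lf(3)[OF A] of_real_mult[symmetric] exp_add[symmetric] by (simp add: field_simps)
  also have "expectation (\<lambda>\<omega>. (lf A u' \<omega>)\<^sup>2) + expectation (\<lambda>\<omega>. (lf A v' \<omega>)\<^sup>2)
     = expectation (\<lambda>\<omega>. (lf A u' \<omega>)\<^sup>2 + (lf A v' \<omega>)\<^sup>2)"
    using exp_lf(4)[OF A] by simp
  also have "\<dots> = expectation (\<lambda>\<omega>. (lf A u \<omega>)\<^sup>2 + (lf A v \<omega>)\<^sup>2)"
  proof (rule Bochner_Integration.integral_cong[OF refl])
    fix \<omega>
    have "(lf A u' \<omega>)\<^sup>2 + (lf A v' \<omega>)\<^sup>2 = (\<alpha>\<^sup>2 + \<beta>\<^sup>2) * ((lf A u \<omega>)\<^sup>2 + (lf A v \<omega>)\<^sup>2)"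
      unfolding u' v' by (simp add: power2_eq_square algebra_simps)
    thus "(lf A u' \<omega>)\<^sup>2 + (lf A v' \<omega>)\<^sup>2 = (lf A u \<omega>)\<^sup>2 + (lf A v \<omega>)\<^sup>2" using ab by simp
  qed
  also have "\<dots> = expectation (\<lambda>\<omega>. (lf A u \<omega>)\<^sup>2) + expectation (\<lambda>\<omega>. (lf A v \<omega>)\<^sup>2)"
    using exp_lf(4)[OF A] by simp
  finally show ?thesis .
qed

lemma distr_rot:
  assumes ab: "\<alpha>\<^sup>2 + \<beta>\<^sup>2 = 1"
  shows "distr (D \<Otimes>\<^sub>M D) (D \<Otimes>\<^sub>M D) (rot \<alpha> \<beta>) = D \<Otimes>\<^sub>M D"
proof -
  let ?B = "PiM UNIV (\<lambda>_. borel) :: (bool \<times> nat \<Rightarrow> real) measure"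
  \<comment> \<open>The uniqueness statement concerns one family of real coordinates, so the pair of
    sequences is merged into a family indexed by \<open>bool \<times> nat\<close>.\<close>
  define mg where "mg z = (\<lambda>(b, a). if b then fst z a else snd z a)" for z :: "(nat \<Rightarrow> real) \<times> (nat \<Rightarrow> real)"
  define bk where "bk m = (\<lambda>a. m (True, a), \<lambda>a. m (False, a))" for m :: "bool \<times> nat \<Rightarrow> real"
  have mg [measurable]: "mg \<in> measurable (D \<Otimes>\<^sub>M D) ?B"
  proof (rule measurable_PiM_single')
    show "(\<lambda>z. mg z i) \<in> borel_measurable (D \<Otimes>\<^sub>M D)" for i
      unfolding mg_def by (cases i; cases "fst i") auto
  qed auto
  have bk [measurable]: "bk \<in> measurable ?B (D \<Otimes>\<^sub>M D)"
    unfolding bk_def by (intro measurable_Pair measurable_into_D) measurable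
  have bm: "bk (mg z) = z" for z unfolding bk_def mg_def by simp
  have char: "(\<integral>m. iexp (\<Sum>i\<in>J. c i * m i) \<partial>distr (D \<Otimes>\<^sub>M D) ?B (\<lambda>z. mg (rot \<alpha> \<beta> z)))
     = of_real (exp (- (expectation (\<lambda>\<omega>. (lf (snd ` J) (\<lambda>a. if (True, a) \<in> J then c (True, a) else 0) \<omega>)\<^sup>2)
         + expectation (\<lambda>\<omega>. (lf (snd ` J) (\<lambda>a. if (False, a) \<in> J then c (False, a) else 0) \<omega>)\<^sup>2)) / 2))"
    if J: "finite J" and ab: "\<alpha>\<^sup>2 + \<beta>\<^sup>2 = 1" for J c \<alpha> \<beta>
  proof -
    let ?A = "snd ` J"
    let ?d = "\<lambda>i. if i \<in> J then c i else 0"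
    have e: "(\<Sum>i\<in>J. c i * m i) = lf ?A (\<lambda>a. ?d (True, a)) (fst (bk m)) + lf ?A (\<lambda>a. ?d (False, a)) (snd (bk m))" for m
    proof -
      have "(\<Sum>i\<in>J. c i * m i) = (\<Sum>i\<in>UNIV \<times> ?A. ?d i * m i)"
        by (rule sum.mono_neutral_cong_left) (use J in \<open>force+\<close>)
      also have "\<dots> = (\<Sum>b\<in>UNIV. \<Sum>a\<in>?A. ?d (b, a) * m (b, a))"
        by (simp add: sum.cartesian_product case_prod_unfold cong: if_cong)
      finally show ?thesis by (simp add: UNIV_bool lf_def bk_def add.commute cong: if_cong)
    qed
    have "(\<integral>m. iexp (\<Sum>i\<in>J. c i * m i) \<partial>distr (D \<Otimes>\<^sub>M D) ?B (\<lambda>z. mg (rot \<alpha> \<beta> z)))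
       = (\<integral>z. iexp (\<Sum>i\<in>J. c i * mg (rot \<alpha> \<beta> z) i) \<partial>(D \<Otimes>\<^sub>M D))"
      by (rule integral_distr) measurable
    also have "\<dots> = (\<integral>z. iexp (lf ?A (\<lambda>a. ?d (True, a)) (fst (rot \<alpha> \<beta> z)) + lf ?A (\<lambda>a. ?d (False, a)) (snd (rot \<alpha> \<beta> z))) \<partial>(D \<Otimes>\<^sub>M D))"
      unfolding e bm ..
    also have "\<dots> = of_real (exp (- (expectation (\<lambda>\<omega>. (lf ?A (\<lambda>a. ?d (True, a)) \<omega>)\<^sup>2) + expectation (\<lambda>\<omega>. (lf ?A (\<lambda>a. ?d (False, a)) \<omega>)\<^sup>2)) / 2))"
      by (rule DD_iexp_rot) (use J ab in auto)
    finally show ?thesis .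
  qed
  have r1: "rot 1 0 z = z" for z by (simp add: rot_def)
  have "distr (D \<Otimes>\<^sub>M D) ?B (\<lambda>z. mg (rot \<alpha> \<beta> z)) = distr (D \<Otimes>\<^sub>M D) ?B (\<lambda>z. mg (rot 1 0 z))"
  proof (rule PiM_char_unique)
    show "prob_space (distr (D \<Otimes>\<^sub>M D) ?B (\<lambda>z. mg (rot \<alpha> \<beta> z)))" "prob_space (distr (D \<Otimes>\<^sub>M D) ?B (\<lambda>z. mg (rot 1 0 z)))"
      by (intro DD.prob_space_distr; measurable)+
    fix J :: "(bool \<times> nat) set" and c assume "finite J"
    thus "(\<integral>m. iexp (\<Sum>i\<in>J. c i * m i) \<partial>distr (D \<Otimes>\<^sub>M D) ?B (\<lambda>z. mg (rot \<alpha> \<beta> z)))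
      = (\<integral>m. iexp (\<Sum>i\<in>J. c i * m i) \<partial>distr (D \<Otimes>\<^sub>M D) ?B (\<lambda>z. mg (rot 1 0 z)))"
      using char[of J \<alpha> \<beta> c] char[of J 1 0 c] ab by simp
  qed simp_all
  hence "distr (distr (D \<Otimes>\<^sub>M D) ?B (\<lambda>z. mg (rot \<alpha> \<beta> z))) (D \<Otimes>\<^sub>M D) bk = distr (distr (D \<Otimes>\<^sub>M D) ?B mg) (D \<Otimes>\<^sub>M D) bk"
    by (simp add: r1)
  moreover have "distr (distr (D \<Otimes>\<^sub>M D) ?B (\<lambda>z. mg (rot \<alpha> \<beta> z))) (D \<Otimes>\<^sub>M D) bk = distr (D \<Otimes>\<^sub>M D) (D \<Otimes>\<^sub>M D) (rot \<alpha> \<beta>)"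
    by (subst distr_distr) (auto simp: comp_def bm)
  moreover have "distr (distr (D \<Otimes>\<^sub>M D) ?B mg) (D \<Otimes>\<^sub>M D) bk = distr (D \<Otimes>\<^sub>M D) (D \<Otimes>\<^sub>M D) (\<lambda>z. z)"
    by (subst distr_distr) (auto simp: comp_def bm)
  ultimately show ?thesis by (simp add: distr_id2)
qed

lemma nn_integral_rot:
  assumes "\<alpha>\<^sup>2 + \<beta>\<^sup>2 = 1" "H \<in> borel_measurable (D \<Otimes>\<^sub>M D)"
  shows "(\<integral>\<^sup>+z. H (rot \<alpha> \<beta> z) \<partial>(D \<Otimes>\<^sub>M D)) = (\<integral>\<^sup>+z. H z \<partial>(D \<Otimes>\<^sub>M D))"
  using nn_integral_distr[OF rot_measurable, of H \<alpha> \<beta>] distr_rot[OF assms(1)] assms(2) by simp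

text \<open>Gaussian concentration for functions with bounded subgradients. The quarter turn from
  \<open>x\<close> to \<open>y\<close> is cut into \<open>N\<close> small rotations; each increment is bounded through the subgradient by
  a linear function of the rotated pair, which has the law of an independent pair.\<close>

definition has_subgradient :: "((nat \<Rightarrow> real) \<Rightarrow> real) \<Rightarrow> nat set \<Rightarrow> bool" where
  "has_subgradient F A \<longleftrightarrow> finite A \<and> F \<in> borel_measurable D \<and> (\<exists>v. (\<forall>a\<in>A. v a \<in> borel_measurable D \<and> (\<forall>x. 0 \<le> v a x \<and> v a x \<le> 1)) \<and>
     (\<forall>x y. F x - F y \<le> (\<Sum>a\<in>A. v a x * (x a - y a))))"

text \<open>The square of the length \<open>pi / 2\<close> of the quarter turn, times half of the
  bound \<open>2 * gbar\<close> on the covariance.\<close>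

definition cgauss :: real where "cgauss = pi\<^sup>2 * gbar / 4"

lemma cgauss_nonneg: "0 \<le> cgauss" unfolding cgauss_def using gbar_nonneg by simp

lemma has_subgradient_growth:
  assumes "has_subgradient F A"
  shows "\<bar>F x - F y\<bar> \<le> (\<Sum>a\<in>A. \<bar>x a\<bar>) + (\<Sum>a\<in>A. \<bar>y a\<bar>)"
proof -
  obtain v where v: "\<forall>a\<in>A. v a \<in> borel_measurable D \<and> (\<forall>x. 0 \<le> v a x \<and> v a x \<le> 1)"
     "\<forall>x y. F x - F y \<le> (\<Sum>a\<in>A. v a x * (x a - y a))" using assms unfolding has_subgradient_def by blast
  have "F x - F y \<le> (\<Sum>a\<in>A. \<bar>x a\<bar>) + (\<Sum>a\<in>A. \<bar>y a\<bar>)" for x y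
  proof -
    have "F x - F y \<le> (\<Sum>a\<in>A. v a x * (x a - y a))" using v by blast
    also have "\<dots> \<le> (\<Sum>a\<in>A. \<bar>x a\<bar> + \<bar>y a\<bar>)"
    proof (rule sum_mono)
      fix a assume "a \<in> A"
      hence "0 \<le> v a x" "v a x \<le> 1" using v(1) by auto
      have "v a x * (x a - y a) \<le> v a x * \<bar>x a - y a\<bar>" by (rule mult_left_mono) (use \<open>0 \<le> v a x\<close> in auto)
      also have "\<dots> \<le> 1 * \<bar>x a - y a\<bar>" by (rule mult_right_mono) (use \<open>v a x \<le> 1\<close> in auto)
      also have "\<dots> \<le> \<bar>x a\<bar> + \<bar>y a\<bar>" using abs_triangle_ineq4[of "x a" "y a"] by simp
      finally show "v a x * (x a - y a) \<le> \<bar>x a\<bar> + \<bar>y a\<bar>" .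
    qed
    finally show ?thesis by (simp add: sum.distrib)
  qed
  from this[of x y] this[of y x] show ?thesis by linarith
qed

lemma has_subgradient_integrable:
  assumes F: "has_subgradient F A"
  shows "integrable D F" "integrable D (\<lambda>x. exp (t * F x))"
proof -
  have A: "finite A" and [measurable]: "F \<in> borel_measurable D" using F unfolding has_subgradient_def by auto
  define S where "S x = (\<Sum>a\<in>A. \<bar>x a :: real\<bar>)" for x
  have le: "\<bar>F x\<bar> \<le> \<bar>F (\<lambda>_. 0)\<bar> + S x" for x
    using has_subgradient_growth[OF F, of x "\<lambda>_. 0"] unfolding S_def by simp
  have "integrable D S" unfolding S_def by simp
  show "integrable D F"
    by (rule Bochner_Integration.integrable_bound[of _ "\<lambda>x. \<bar>F (\<lambda>_. 0)\<bar> + S x"])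
       (use \<open>integrable D S\<close> le in \<open>auto intro!: AE_I2 order_trans[OF le] simp: S_def\<close>)
  have i: "integrable D (\<lambda>x. exp (\<bar>t\<bar> * \<bar>F (\<lambda>_. 0)\<bar>) * exp (\<bar>t\<bar> * S x))"
    unfolding S_def using exp_abs_sum(1)[OF A, of "\<bar>t\<bar>"] by simp
  show "integrable D (\<lambda>x. exp (t * F x))"
  proof (rule Bochner_Integration.integrable_bound[OF i])
    show "AE x in D. norm (exp (t * F x)) \<le> norm (exp (\<bar>t\<bar> * \<bar>F (\<lambda>_. 0)\<bar>) * exp (\<bar>t\<bar> * S x))"
    proof (rule AE_I2)
      fix x
      have "t * F x \<le> \<bar>t\<bar> * \<bar>F x\<bar>" by (metis abs_ge_self abs_mult)
      also have "\<dots> \<le> \<bar>t\<bar> * (\<bar>F (\<lambda>_. 0)\<bar> + S x)" by (rule mult_left_mono[OF le]) simp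
      finally show "norm (exp (t * F x)) \<le> norm (exp (\<bar>t\<bar> * \<bar>F (\<lambda>_. 0)\<bar>) * exp (\<bar>t\<bar> * S x))"
        by (simp add: exp_add[symmetric] distrib_left)
    qed
  qed measurable
qed

text \<open>Convexity of \<open>exp\<close> separates increments that are not independent. The price
  is a factor \<open>N\<close> in the exponent, which increments of order \<open>1 / N\<close> can
  afford.\<close>

lemma exp_telescope_le:
  fixes d :: "nat \<Rightarrow> real"
  assumes "0 < N"
  shows "exp (\<Sum>k<N. d k) \<le> (\<Sum>k<N. exp (real N * d k)) / real N"
proof -
  have "exp (\<Sum>k\<in>{..<N}. (1 / real N) *\<^sub>R (real N * d k)) \<le> (\<Sum>k\<in>{..<N}. (1 / real N) * exp (real N * d k))"
    by (rule convex_on_sum[of "{..<N}" UNIV exp "\<lambda>_. 1 / real N"]) (use assms exp_convex in auto)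
  thus ?thesis using assms by (simp add: sum_divide_distrib)
qed

lemma concentration_aux:
  assumes F: "has_subgradient F A" and t: "0 \<le> t" and N: "0 < N" "t * pi\<^sup>2 / (8 * real N) \<le> 1"
  shows "(\<integral>\<^sup>+z. ennreal (exp (t * (F (snd z) - F (fst z)))) \<partial>(D \<Otimes>\<^sub>M D))
    \<le> ennreal (exp (cgauss * t\<^sup>2 * card A) * (1 + t * pi\<^sup>2 / (8 * real N) * expectation (\<lambda>x. exp (\<Sum>a\<in>A. \<bar>x a\<bar>))))"
proof -
  have A: "finite A" and Fm [measurable]: "F \<in> borel_measurable D" using F unfolding has_subgradient_def by auto
  obtain v where v: "\<And>a. a \<in> A \<Longrightarrow> v a \<in> borel_measurable D" "\<And>a x. a \<in> A \<Longrightarrow> 0 \<le> v a x" "\<And>a x. a \<in> A \<Longrightarrow> v a x \<le> 1"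
     "\<And>x y. F x - F y \<le> (\<Sum>a\<in>A. v a x * (x a - y a))" using F unfolding has_subgradient_def by blast
  define \<delta> where "\<delta> = pi / (2 * real N)"
  have \<delta>0: "0 < \<delta>" unfolding \<delta>_def using N by simp
  define X where "X k z = rot (cos (real k * \<delta>)) (sin (real k * \<delta>)) z" for k :: nat and z
  define G where "G z = (\<Sum>a\<in>A. v a (fst z) * ((1 - cos \<delta>) * fst z a + sin \<delta> * snd z a))" for z
  have Gm [measurable]: "G \<in> borel_measurable (D \<Otimes>\<^sub>M D)"
    unfolding G_def
  proof (intro borel_measurable_sum)
    fix a assume "a \<in> A"
    hence [measurable]: "(\<lambda>z. v a (fst z)) \<in> borel_measurable (D \<Otimes>\<^sub>M D)"
      using measurable_comp[OF measurable_fst v(1)] by (simp add: comp_def)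
    show "(\<lambda>z. v a (fst z) * ((1 - cos \<delta>) * fst z a + sin \<delta> * snd z a)) \<in> borel_measurable (D \<Otimes>\<^sub>M D)"
      by measurable
  qed
  \<comment> \<open>The subgradient is taken at the end of the step, and the start of the step is
    obtained from that end by a rotation back through \<open>\<delta>\<close>. The increment is thus
    bounded by one fixed function \<open>G\<close> of the rotated pair, whose law does not depend on
    \<open>k\<close>.\<close>
  have step: "F (fst (X (Suc k) z)) - F (fst (X k z)) \<le> G (X (Suc k) z)" for k z
  proof -
    define th where "th = real (Suc k) * \<delta>"
    have thk: "real k * \<delta> = th - \<delta>" unfolding th_def by (simp add: algebra_simps)
    have "fst (X (Suc k) z) a - fst (X k z) a = (1 - cos \<delta>) * fst (X (Suc k) z) a + sin \<delta> * snd (X (Suc k) z) a" for a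
    proof -
      have s2: "(sin th)\<^sup>2 = 1 - (cos th)\<^sup>2" by (simp add: sin_squared_eq)
      show ?thesis
        unfolding X_def thk th_def[symmetric] rot_def cos_diff sin_diff by (simp add: algebra_simps)
    qed
    thus ?thesis using v(4)[of "fst (X (Suc k) z)" "fst (X k z)"] unfolding G_def by simp
  qed
  have X0: "fst (X 0 z) = fst z" for z by (simp add: X_def rot_def)
  have N\<delta>: "real N * \<delta> = pi / 2" unfolding \<delta>_def using N by simp
  have XN: "fst (X N z) = snd z" for z unfolding X_def rot_def N\<delta> by simp
  have rk: "(cos (real k * \<delta>))\<^sup>2 + (sin (real k * \<delta>))\<^sup>2 = 1" for k by simp
  have pt: "exp (t * (F (snd z) - F (fst z))) \<le> (\<Sum>k<N. exp (real N * t * G (X (Suc k) z))) / real N" for z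
  proof -
    have "F (snd z) - F (fst z) = (\<Sum>k<N. F (fst (X (Suc k) z)) - F (fst (X k z)))"
      using sum_lessThan_telescope[of "\<lambda>k. F (fst (X k z))" N] X0 XN by simp
    also have "\<dots> \<le> (\<Sum>k<N. G (X (Suc k) z))" by (intro sum_mono step)
    finally have "t * (F (snd z) - F (fst z)) \<le> (\<Sum>k<N. t * G (X (Suc k) z))"
      using t by (simp add: sum_distrib_left[symmetric] mult_left_mono)
    hence "exp (t * (F (snd z) - F (fst z))) \<le> exp (\<Sum>k<N. t * G (X (Suc k) z))" by simp
    also have "\<dots> \<le> (\<Sum>k<N. exp (real N * (t * G (X (Suc k) z)))) / real N" by (rule exp_telescope_le[OF N(1)])
    finally show ?thesis by (simp add: mult.assoc)
  qed
  have "(\<integral>\<^sup>+z. ennreal (exp (t * (F (snd z) - F (fst z)))) \<partial>(D \<Otimes>\<^sub>M D))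
    \<le> (\<integral>\<^sup>+z. (\<Sum>k<N. ennreal (exp (real N * t * G (X (Suc k) z)))) * ennreal (1 / real N) \<partial>(D \<Otimes>\<^sub>M D))"
  proof (rule nn_integral_mono)
    fix z
    have "ennreal (exp (t * (F (snd z) - F (fst z)))) \<le> ennreal ((\<Sum>k<N. exp (real N * t * G (X (Suc k) z))) * (1 / real N))"
      using pt[of z] by (intro ennreal_leI) simp
    thus "ennreal (exp (t * (F (snd z) - F (fst z)))) \<le> (\<Sum>k<N. ennreal (exp (real N * t * G (X (Suc k) z)))) * ennreal (1 / real N)"
      by (simp only: sum_ennreal ennreal_mult'' exp_ge_zero divide_nonneg_nonneg of_nat_0_le_iff zero_le_one)
  qed
  also have "\<dots> = (\<Sum>k<N. (\<integral>\<^sup>+z. ennreal (exp (real N * t * G (X (Suc k) z))) \<partial>(D \<Otimes>\<^sub>M D))) * ennreal (1 / real N)"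
    unfolding X_def by (subst nn_integral_multc, measurable, subst nn_integral_sum, measurable)
  also have "\<dots> = (\<Sum>k<N. (\<integral>\<^sup>+z. ennreal (exp (real N * t * G z)) \<partial>(D \<Otimes>\<^sub>M D))) * ennreal (1 / real N)"
    unfolding X_def by (subst nn_integral_rot[OF rk]) measurable
  also have "\<dots> = (\<integral>\<^sup>+z. ennreal (exp (real N * t * G z)) \<partial>(D \<Otimes>\<^sub>M D))"
  proof -
    have "of_nat N * x * ennreal (1 / real N) = x" for x :: ennreal
    proof -
      have "ennreal (real N) * ennreal (1 / real N) = 1" using N by (simp add: ennreal_mult[symmetric])
      thus ?thesis by (metis ennreal_of_nat_eq_real_of_nat mult.commute mult.left_commute mult.right_neutral)
    qed
    thus ?thesis by simp
  qed
  also have "\<dots> = (\<integral>\<^sup>+x. \<integral>\<^sup>+y. ennreal (exp (real N * t * G (x, y))) \<partial>D \<partial>D)"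
    by (rule nn_integral_fst[symmetric, where f = "\<lambda>z. ennreal (exp (real N * t * G z))"]) measurable
  also have "\<dots> \<le> (\<integral>\<^sup>+x. ennreal (exp (cgauss * t\<^sup>2 * card A) * (1 + t * pi\<^sup>2 / (8 * real N) * exp (\<Sum>a\<in>A. \<bar>x a\<bar>))) \<partial>D)"
  proof (rule nn_integral_mono)
    fix x :: "nat \<Rightarrow> real"
    \<comment> \<open>\<open>c1\<close> is the curvature part, of order \<open>1 / N\<close>. The
      tangential part \<open>c2\<close> is at most \<open>t * pi / 2\<close>, and it alone survives
      as \<open>N\<close> grows.\<close>
    define c1 where "c1 = real N * t * (1 - cos \<delta>)"
    define c2 where "c2 = real N * t * sin \<delta>"
    define s where "s = t * pi\<^sup>2 / (8 * real N)"
    define S where "S = (\<Sum>a\<in>A. \<bar>x a\<bar>)"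
    have s01: "0 \<le> s" "s \<le> 1" using t N unfolding s_def by auto
    have e: "exp (real N * t * G (x, y)) = exp (c1 * (\<Sum>a\<in>A. v a x * x a)) * exp (lf A (\<lambda>a. c2 * v a x) y)" for y
      unfolding G_def c1_def c2_def lf_def exp_add[symmetric]
      by (simp add: sum_distrib_left distrib_left sum.distrib mult_ac)
    have "(\<integral>\<^sup>+y. ennreal (exp (real N * t * G (x, y))) \<partial>D) = ennreal (exp (c1 * (\<Sum>a\<in>A. v a x * x a))) * (\<integral>\<^sup>+y. ennreal (exp (lf A (\<lambda>a. c2 * v a x) y)) \<partial>D)"
      unfolding e by (simp add: ennreal_mult nn_integral_cmult)
    also have "(\<integral>\<^sup>+y. ennreal (exp (lf A (\<lambda>a. c2 * v a x) y)) \<partial>D) = ennreal (exp (expectation (\<lambda>\<omega>. (lf A (\<lambda>a. c2 * v a x) \<omega>)\<^sup>2) / 2))"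
      using nn_integral_eq_integral[OF exp_lf(1)[OF A]] exp_lf(2)[OF A] by simp
    also have "ennreal (exp (c1 * (\<Sum>a\<in>A. v a x * x a))) * \<dots> = ennreal (exp (c1 * (\<Sum>a\<in>A. v a x * x a)) * exp (expectation (\<lambda>\<omega>. (lf A (\<lambda>a. c2 * v a x) \<omega>)\<^sup>2) / 2))"
      by (simp add: ennreal_mult)
    also have "\<dots> \<le> ennreal ((1 + s * exp S) * exp (cgauss * t\<^sup>2 * card A))"
    proof (intro ennreal_leI mult_mono)
      have c12: "1 - cos \<delta> \<le> \<delta>\<^sup>2 / 2"
      proof -
        have "1 - cos \<delta> = 2 * (sin (\<delta> / 2))\<^sup>2" using cos_double_sin[of "\<delta>/2"] by simp
        also have "\<dots> \<le> 2 * (\<delta> / 2)\<^sup>2"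
        proof -
          have "\<bar>sin (\<delta> / 2)\<bar> \<le> \<bar>\<delta> / 2\<bar>" by (rule abs_sin_x_le_abs_x)
          hence "(sin (\<delta> / 2))\<^sup>2 \<le> (\<delta> / 2)\<^sup>2" by (rule abs_le_square_iff[THEN iffD1])
          thus ?thesis by simp
        qed
        finally show ?thesis by (simp add: power2_eq_square)
      qed
      have "c1 \<le> real N * t * (\<delta>\<^sup>2 / 2)" unfolding c1_def by (rule mult_left_mono[OF c12]) (use t in auto)
      also have "\<dots> = s" unfolding s_def \<delta>_def using N by (simp add: field_simps power2_eq_square)
      finally have c1s: "c1 \<le> s" .
      have c10: "0 \<le> c1" unfolding c1_def using t by simp
      have "(\<Sum>a\<in>A. v a x * x a) \<le> S" unfolding S_def
      proof (rule sum_mono)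
        fix a assume a: "a \<in> A"
        have "v a x * x a \<le> v a x * \<bar>x a\<bar>" by (rule mult_left_mono) (use v(2)[OF a] in auto)
        also have "\<dots> \<le> 1 * \<bar>x a\<bar>" by (rule mult_right_mono) (use v(3)[OF a] in auto)
        finally show "v a x * x a \<le> \<bar>x a\<bar>" by simp
      qed
      hence "c1 * (\<Sum>a\<in>A. v a x * x a) \<le> c1 * S" using c10 by (rule mult_left_mono)
      also have "\<dots> \<le> s * S" by (rule mult_right_mono[OF c1s]) (simp add: S_def sum_nonneg)
      finally have "exp (c1 * (\<Sum>a\<in>A. v a x * x a)) \<le> exp (s * S)" by simp
      \<comment> \<open>Convexity takes the small number \<open>s\<close> out of the exponent, so
        that the error is \<open>s\<close> times a fixed exponential moment.\<close>
      also have "\<dots> \<le> (1 - s) * exp 0 + s * exp S"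
        using convex_onD[OF exp_convex, of s 0 S] s01 by simp
      also have "\<dots> \<le> 1 + s * exp S" using s01 by simp
      finally show "exp (c1 * (\<Sum>a\<in>A. v a x * x a)) \<le> 1 + s * exp S" .
      have "expectation (\<lambda>\<omega>. (lf A (\<lambda>a. c2 * v a x) \<omega>)\<^sup>2) \<le> 2 * gbar * (\<Sum>a\<in>A. (c2 * v a x)\<^sup>2)"
        by (rule lf_square_le[OF A])
      also have "\<dots> \<le> 2 * gbar * (\<Sum>a\<in>A. (t * (pi / 2))\<^sup>2)"
      proof (intro mult_left_mono sum_mono)
        fix a assume a: "a \<in> A"
        have "sin \<delta> \<le> \<delta>" using \<delta>0 by (simp add: sin_x_le_x)
        moreover have "0 \<le> sin \<delta>"
        proof (rule sin_ge_zero)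
          show "\<delta> \<le> pi" unfolding \<delta>_def using N by (simp add: field_simps)
        qed (use \<delta>0 in simp)
        ultimately have "0 \<le> c2" "c2 \<le> real N * t * \<delta>" unfolding c2_def using t by (auto intro!: mult_left_mono)
        moreover have "real N * t * \<delta> = t * (pi / 2)" unfolding \<delta>_def using N by simp
        ultimately have "0 \<le> c2" "c2 \<le> t * (pi / 2)" by auto
        hence "c2 * v a x \<le> t * (pi / 2) * 1" using v(2,3)[OF a] by (intro mult_mono) auto
        thus "(c2 * v a x)\<^sup>2 \<le> (t * (pi / 2))\<^sup>2" using \<open>0 \<le> c2\<close> v(2)[OF a] by (intro power_mono) auto
      qed (use gbar_nonneg in auto)
      also have "\<dots> = 2 * (cgauss * t\<^sup>2 * card A)" unfolding cgauss_def by (simp add: power2_eq_square)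
      finally show "exp (expectation (\<lambda>\<omega>. (lf A (\<lambda>a. c2 * v a x) \<omega>)\<^sup>2) / 2) \<le> exp (cgauss * t\<^sup>2 * card A)" by simp
    qed (use s01 in auto)
    finally show "(\<integral>\<^sup>+y. ennreal (exp (real N * t * G (x, y))) \<partial>D)
       \<le> ennreal (exp (cgauss * t\<^sup>2 * card A) * (1 + t * pi\<^sup>2 / (8 * real N) * exp (\<Sum>a\<in>A. \<bar>x a\<bar>)))"
      unfolding s_def S_def by (simp add: mult_ac)
  qed
  also have "\<dots> = ennreal (exp (cgauss * t\<^sup>2 * card A) * (1 + t * pi\<^sup>2 / (8 * real N) * expectation (\<lambda>x. exp (\<Sum>a\<in>A. \<bar>x a\<bar>))))"
  proof (subst nn_integral_eq_integral)
    have i: "integrable D (\<lambda>x. exp (\<Sum>a\<in>A. \<bar>x a\<bar>))" using exp_abs_sum(1)[OF A, of 1] by simp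
    show "integrable D (\<lambda>x. exp (cgauss * t\<^sup>2 * card A) * (1 + t * pi\<^sup>2 / (8 * real N) * exp (\<Sum>a\<in>A. \<bar>x a\<bar>)))"
      using i by simp
    show "AE x in D. 0 \<le> exp (cgauss * t\<^sup>2 * card A) * (1 + t * pi\<^sup>2 / (8 * real N) * exp (\<Sum>a\<in>A. \<bar>x a\<bar>))"
      using t by (auto intro!: AE_I2 add_nonneg_nonneg)
    show "ennreal (expectation (\<lambda>x. exp (cgauss * t\<^sup>2 * card A) * (1 + t * pi\<^sup>2 / (8 * real N) * exp (\<Sum>a\<in>A. \<bar>x a\<bar>))))
      = ennreal (exp (cgauss * t\<^sup>2 * card A) * (1 + t * pi\<^sup>2 / (8 * real N) * expectation (\<lambda>x. exp (\<Sum>a\<in>A. \<bar>x a\<bar>))))"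
      using i by (simp add: prob_space[unfolded space_D])
  qed
  finally show ?thesis .
qed

lemma exp_Jensen:
  fixes F :: "(nat \<Rightarrow> real) \<Rightarrow> real"
  assumes "integrable D F" "integrable D (\<lambda>x. exp (F x))"
  shows "exp (expectation F) \<le> expectation (\<lambda>x. exp (F x))"
  by (rule jensens_inequality[where I = UNIV and q = exp]) (use assms exp_convex in auto)

text \<open>Letting \<open>N\<close> tend to infinity bounds the exponential moment of the
  difference of \<open>F\<close> at two independent disorders, which factorizes. Jensen's inequality
  then replaces one of the two copies by its expectation.\<close>

theorem concentration:
  assumes F: "has_subgradient F A"
  shows "expectation (\<lambda>x. exp (t * (F x - expectation F))) \<le> exp (cgauss * t\<^sup>2 * card A)"
proof -
  have [measurable]: "F \<in> borel_measurable D" using F unfolding has_subgradient_def by auto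
  note i = has_subgradient_integrable[OF F]
  define I where "I l = expectation (\<lambda>x. exp (l * F x))" for l
  have I0: "0 \<le> I l" for l unfolding I_def by (rule Bochner_Integration.integral_nonneg) auto
  have prod: "(\<integral>\<^sup>+z. ennreal (exp (l * (F (snd z) - F (fst z)))) \<partial>(D \<Otimes>\<^sub>M D)) = ennreal (I l * I (- l))" for l
  proof -
    have "(\<integral>\<^sup>+z. ennreal (exp (l * (F (snd z) - F (fst z)))) \<partial>(D \<Otimes>\<^sub>M D))
      = (\<integral>\<^sup>+x. \<integral>\<^sup>+y. ennreal (exp (l * (F (snd (x, y)) - F (fst (x, y))))) \<partial>D \<partial>D)"
      by (rule nn_integral_fst[symmetric, where f = "\<lambda>z. ennreal (exp (l * (F (snd z) - F (fst z))))"]) measurable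
    also have "\<dots> = (\<integral>\<^sup>+x. ennreal (exp (- l * F x)) * (\<integral>\<^sup>+y. ennreal (exp (l * F y)) \<partial>D) \<partial>D)"
    proof (rule nn_integral_cong)
      fix x
      have "exp (l * (F (snd (x, y)) - F (fst (x, y)))) = exp (- l * F x) * exp (l * F y)" for y
        by (simp add: exp_add[symmetric] algebra_simps)
      thus "(\<integral>\<^sup>+y. ennreal (exp (l * (F (snd (x, y)) - F (fst (x, y))))) \<partial>D) = ennreal (exp (- l * F x)) * (\<integral>\<^sup>+y. ennreal (exp (l * F y)) \<partial>D)"
        by (simp add: ennreal_mult nn_integral_cmult)
    qed
    also have "\<dots> = (\<integral>\<^sup>+x. ennreal (exp (- l * F x)) \<partial>D) * (\<integral>\<^sup>+y. ennreal (exp (l * F y)) \<partial>D)"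
      by (rule nn_integral_multc) measurable
    also have "\<dots> = ennreal (I (- l)) * ennreal (I l)"
      unfolding I_def using nn_integral_eq_integral[OF i(2)[of l]] nn_integral_eq_integral[OF i(2)[of "- l"]] by simp
    finally show ?thesis using I0 by (simp add: ennreal_mult mult.commute)
  qed
  have pos: "I l * I (- l) \<le> exp (cgauss * l\<^sup>2 * card A)" if l: "0 \<le> l" for l
  proof -
    define M where "M = expectation (\<lambda>x. exp (\<Sum>a\<in>A. \<bar>x a\<bar>))"
    have M0: "0 \<le> M" unfolding M_def by (rule Bochner_Integration.integral_nonneg) auto
    have "eventually (\<lambda>N. I l * I (- l) \<le> exp (cgauss * l\<^sup>2 * card A) * (1 + l * pi\<^sup>2 / (8 * real N) * M)) sequentially"
    proof -
      have "(\<lambda>N. l * pi\<^sup>2 / (8 * real N)) \<longlonglongrightarrow> 0" by real_asymp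
      hence "eventually (\<lambda>N. l * pi\<^sup>2 / (8 * real N) < 1) sequentially" by (rule order_tendstoD) simp
      thus ?thesis using eventually_gt_at_top[of 0]
      proof eventually_elim
        case (elim N)
        have "ennreal (I l * I (- l)) \<le> ennreal (exp (cgauss * l\<^sup>2 * card A) * (1 + l * pi\<^sup>2 / (8 * real N) * M))"
          using concentration_aux[OF F l, of N] elim unfolding prod M_def by simp
        thus ?case by (subst (asm) ennreal_le_iff) (use l M0 in auto)
      qed
    qed
    moreover have "(\<lambda>N. exp (cgauss * l\<^sup>2 * card A) * (1 + l * pi\<^sup>2 / (8 * real N) * M)) \<longlonglongrightarrow> exp (cgauss * l\<^sup>2 * card A) * (1 + 0 * M)"
      by (intro tendsto_intros) real_asymp
    ultimately have "I l * I (- l) \<le> exp (cgauss * l\<^sup>2 * card A) * (1 + 0 * M)"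
      by (intro tendsto_lowerbound) auto
    thus ?thesis by simp
  qed
  have "I t * I (- t) \<le> exp (cgauss * t\<^sup>2 * card A)"
    using pos[of t] pos[of "- t"] by (cases "0 \<le> t") (auto simp: mult.commute)
  moreover have "exp (- t * expectation F) \<le> I (- t)"
    using exp_Jensen[of "\<lambda>x. - t * F x"] i(1) i(2)[of "- t"] unfolding I_def by simp
  ultimately have "I t * exp (- t * expectation F) \<le> exp (cgauss * t\<^sup>2 * card A)"
    using mult_left_mono[OF _ I0[of t], of "exp (- t * expectation F)" "I (- t)"] by linarith
  moreover have "expectation (\<lambda>x. exp (t * (F x - expectation F))) = I t * exp (- t * expectation F)"
  proof -
    have "exp (t * (F x - expectation F)) = exp (t * F x) * exp (- t * expectation F)" for x
      by (simp add: exp_add[symmetric] algebra_simps)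
    thus ?thesis unfolding I_def by simp
  qed
  ultimately show ?thesis by simp
qed

end

section \<open>The free energy\<close>

text \<open>Fekete's lemma. The second conclusion, that no term exceeds the limit, later bounds the
  free energy from below.\<close>

lemma superadditive_limit:
  fixes u :: "nat \<Rightarrow> real"
  assumes sup: "\<And>m n. u m + u n \<le> u (m + n)" and bd: "\<And>n. u n \<le> C * real n" and u0: "u 0 = 0"
  obtains L where "(\<lambda>n. u n / real n) \<longlonglongrightarrow> L" "\<And>n. 1 \<le> n \<Longrightarrow> u n / real n \<le> L"
proof -
  define L where "L = (SUP n\<in>{1..}. u n / real n)"
  have bdd: "bdd_above ((\<lambda>n. u n / real n) ` {1..})"
    using bd by (intro bdd_aboveI2[where M = C]) (auto simp: divide_le_eq)
  have le: "u n / real n \<le> L" if "1 \<le> n" for n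
    unfolding L_def by (rule cSUP_upper[OF _ bdd]) (use that in auto)
  have mult: "real q * u m \<le> u (q * m)" for q m
  proof (induction q)
    case 0
    show ?case by (simp add: u0)
  next
    case (Suc q)
    thus ?case using sup[of m "q * m"] by (simp add: algebra_simps)
  qed
  have "(\<lambda>n. u n / real n) \<longlonglongrightarrow> L"
  proof (rule LIMSEQ_I)
    fix e :: real assume e: "0 < e"
    have "L - e / 2 < L" using e by simp
    then obtain m where m: "1 \<le> m" "L - e / 2 < u m / real m"
      unfolding L_def using less_cSUP_iff[OF _ bdd] by (metis atLeast_iff empty_iff order_refl)
    define B where "B = (\<Sum>r<m. \<bar>u r\<bar>)"
    have B: "\<bar>u r\<bar> \<le> B" if "r < m" for r
      unfolding B_def by (rule member_le_sum) (use that in auto)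
    have "(\<lambda>n. (\<bar>u m\<bar> + B) / real n) \<longlonglongrightarrow> 0" by real_asymp
    hence "eventually (\<lambda>n. (\<bar>u m\<bar> + B) / real n < e / 2) sequentially"
      by (rule order_tendstoD) (use e in simp)
    then obtain N where N: "\<And>n. N \<le> n \<Longrightarrow> (\<bar>u m\<bar> + B) / real n < e / 2"
      unfolding eventually_sequentially by blast
    show "\<exists>N. \<forall>n\<ge>N. norm (u n / real n - L) < e"
    proof (intro exI allI impI)
      fix n assume n: "max N 1 \<le> n"
      define q where "q = n div m"
      define r where "r = n mod m"
      have r: "r < m" using m(1) by (simp add: r_def)
      have nqr: "n = q * m + r" by (simp add: q_def r_def)
      have "real q * u m - B \<le> u n"
        using sup[of "q * m" r, folded nqr] mult[of q m] B[OF r] by linarith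
      moreover have "real n * (u m / real m) - \<bar>u m\<bar> \<le> real q * u m"
      proof -
        have "real n * (u m / real m) = real q * u m + real r / real m * u m"
          using m(1) unfolding nqr by (simp add: field_simps)
        moreover have "real r / real m * u m \<le> 1 * \<bar>u m\<bar>"
        proof -
          have "real r / real m * u m \<le> real r / real m * \<bar>u m\<bar>" by (intro mult_left_mono) auto
          also have "\<dots> \<le> 1 * \<bar>u m\<bar>" using r by (intro mult_right_mono) auto
          finally show ?thesis .
        qed
        ultimately show ?thesis by linarith
      qed
      ultimately have "real n * (u m / real m) - (\<bar>u m\<bar> + B) \<le> u n" by linarith
      hence "(real n * (u m / real m) - (\<bar>u m\<bar> + B)) / real n \<le> u n / real n"
        by (rule divide_right_mono) simp
      moreover have "(real n * y - c) / real n = y - c / real n" for y c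
        using n by (simp add: diff_divide_distrib)
      ultimately have "u m / real m - (\<bar>u m\<bar> + B) / real n \<le> u n / real n" by (simp only:)
      hence "L - e < u n / real n" using m(2) N[of n] n by linarith
      thus "norm (u n / real n - L) < e" using le[of n] n e by (simp add: abs_if)
    qed
  qed
  thus ?thesis using le that by blast
qed

lemma paths_shift: "paths (i + k) (j + k) = (\<lambda>S. (\<lambda>x. x + k) ` S) ` paths i j"
proof (intro equalityI subsetI)
  fix S assume S: "S \<in> paths (i + k) (j + k)"
  have ge: "k \<le> x" if "x \<in> S" for x using pathsD(1)[OF S] that by auto
  have "(\<lambda>x. x + k) ` (\<lambda>x. x - k) ` S = S" using ge by (force simp: image_image)
  moreover have "(\<lambda>x. x - k) ` S \<in> paths i j"
    using pathsD[OF S] unfolding paths_def by (force simp: image_iff intro: bexI[of _ "i + k"] bexI[of _ "j + k"])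
  ultimately show "S \<in> (\<lambda>S. (\<lambda>x. x + k) ` S) ` paths i j" by blast
qed (auto simp: paths_def)

lemma gaps_shift: "gaps ((\<lambda>x. x + k) ` S) = (\<lambda>(a, b). (a + k, b + k)) ` gaps S"
proof -
  have "(\<lambda>x. x + k) ` S \<inter> {a + k<..<b + k} = (\<lambda>x. x + k) ` (S \<inter> {a<..<b})" for a b by auto
  thus ?thesis unfolding gaps_def by (auto simp: image_iff)
qed

lemma path_sum_shift: "path_sum g (i + k) (j + k) = path_sum (\<lambda>a b. g (a + k) (b + k)) i j"
proof -
  have "wt g ((\<lambda>x. x + k) ` S) = wt (\<lambda>a b. g (a + k) (b + k)) S" for S
    unfolding wt_def gaps_shift by (subst prod.reindex) (auto simp: inj_on_def case_prod_unfold)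
  thus ?thesis unfolding path_sum_def paths_shift
    by (subst sum.reindex) (auto simp: inj_on_def inj_image_eq_iff)
qed

lemma ZZ_shift: "ZZ p \<omega> (i + k) (j + k) h = ZZ p (\<lambda>a. \<omega> (a + k)) i j h"
  unfolding ZZ_def path_sum_shift bw_def by simp

definition pw :: "(nat \<Rightarrow> real) \<Rightarrow> nat set \<Rightarrow> real" where
  "pw p S = wt (\<lambda>a b. p (b - a)) S"

lemma wt_bw_real:
  assumes "S \<in> paths i j"
  shows "wt (bw p \<omega> h) S = pw p S * exp (\<Sum>x\<in>S - {i}. h + \<omega> x)"
proof -
  have "bw p \<omega> h = (\<lambda>a b. p (b - a) * exp (h + \<omega> b))" by (simp add: bw_def fun_eq_iff)
  moreover have "finite (S - {i})" using finite_path[OF assms] by simp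
  ultimately show ?thesis using wt_mult_end[OF assms, of "\<lambda>a b. p (b - a)" "\<lambda>b. exp (h + \<omega> b)"]
    by (simp add: pw_def exp_sum)
qed

text \<open>The renewal process enters through its inter-arrival law \<open>p\<close>. That the
  weights of the paths to \<open>n\<close> sum to at most 1 reflects that they are probabilities of
  disjoint events.\<close>

locale pinning = disorder +
  fixes p :: "nat \<Rightarrow> real"
  assumes p_pos: "\<forall>t\<ge>1. 0 < p t"
    and p_le_1: "\<And>t. p t \<le> 1"
    and sum_pw_le_1: "\<And>n. (\<Sum>S\<in>paths 0 n. pw p S) \<le> 1"
begin

abbreviation "Z i j h \<omega> \<equiv> ZZ p \<omega> i j h"

lemmas pos_bw = pos_wt_bw[OF p_pos]
lemmas Z_pos = ZZ_pos[OF p_pos]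

lemma pw_pos: "0 < pw p S"
  unfolding pw_def by (rule wt_pos) (use p_pos in \<open>auto simp: pos_wt_def\<close>)

lemma Z_eq: "Z i j h \<omega> = (\<Sum>S\<in>paths i j. pw p S * exp (\<Sum>x\<in>S - {i}. h + \<omega> x))"
  unfolding ZZ_def path_sum_def by (intro sum.cong refl wt_bw_real)

lemma Z_measurable [measurable]: "Z i j h \<in> borel_measurable D"
  unfolding Z_eq by measurable

text \<open>The subgradient \<open>v a\<close> is the Gibbs probability of a contact at
  \<open>a\<close>, which is why it lies between 0 and 1. The inequality is Jensen's for the Gibbs
  average \<open>m\<close> of the change of energy, obtained from
  \<open>1 + y \<le> exp y\<close>.\<close>

lemma log_sum_exp_subgradient:
  assumes C: "finite C" "C \<noteq> {}" and A: "finite A" and c: "\<And>S. S \<in> C \<Longrightarrow> 0 < c S"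
  shows "has_subgradient (\<lambda>\<omega>. ln (\<Sum>S\<in>C. c S * exp (\<Sum>x\<in>S \<inter> A. \<omega> x))) A"
proof -
  define e where "e S x = c S * exp (\<Sum>a\<in>S \<inter> A. x a)" for S and x :: "nat \<Rightarrow> real"
  define W where "W x = (\<Sum>S\<in>C. e S x)" for x
  define V where "V a x = (\<Sum>S\<in>{S\<in>C. a \<in> S}. e S x)" for a x
  define v where "v a x = V a x / W x" for a x
  have e0: "0 < e S x" if "S \<in> C" for S x unfolding e_def using c[OF that] by simp
  have W0: "0 < W x" for x unfolding W_def by (rule sum_pos) (use C e0 in auto)
  have em [measurable]: "e S \<in> borel_measurable D" for S unfolding e_def by measurable
  have Wm [measurable]: "W \<in> borel_measurable D" unfolding W_def by measurable
  show ?thesis unfolding has_subgradient_def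
  proof (intro conjI exI[of _ v] ballI allI)
    show "(\<lambda>\<omega>. ln (\<Sum>S\<in>C. c S * exp (\<Sum>x\<in>S \<inter> A. \<omega> x))) \<in> borel_measurable D" by measurable
    show "v a \<in> borel_measurable D" for a unfolding v_def V_def by measurable
    show "0 \<le> v a x" for a x unfolding v_def V_def
      by (intro divide_nonneg_nonneg sum_nonneg less_imp_le[OF W0] less_imp_le[OF e0]) auto
    show "v a x \<le> 1" for a x
    proof -
      have "V a x \<le> W x"
        unfolding W_def V_def by (rule sum_mono2) (use C less_imp_le[OF e0] in auto)
      thus ?thesis unfolding v_def using W0[of x] by simp
    qed
    show "ln (\<Sum>S\<in>C. c S * exp (\<Sum>a\<in>S \<inter> A. x a)) - ln (\<Sum>S\<in>C. c S * exp (\<Sum>a\<in>S \<inter> A. y a))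
        \<le> (\<Sum>a\<in>A. v a x * (x a - y a))" for x y
    proof -
      define d where "d S = (\<Sum>a\<in>S \<inter> A. y a - x a)" for S
      define m where "m = (\<Sum>a\<in>A. v a x * (y a - x a))"
      have m: "m * W x = (\<Sum>S\<in>C. e S x * d S)"
      proof -
        have "m * W x = (\<Sum>a\<in>A. V a x * (y a - x a))"
          unfolding m_def v_def sum_distrib_right using W0[of x] by (intro sum.cong) auto
        also have "\<dots> = (\<Sum>a\<in>A. \<Sum>S\<in>C. if a \<in> S then e S x * (y a - x a) else 0)"
          by (simp add: V_def sum_distrib_right sum.inter_filter[OF C(1)] if_distrib[of "\<lambda>z. z * _"] cong: if_cong)
        also have "\<dots> = (\<Sum>S\<in>C. \<Sum>a\<in>A. if a \<in> S then e S x * (y a - x a) else 0)" by (rule sum.swap)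
        also have "\<dots> = (\<Sum>S\<in>C. e S x * d S)"
        proof (rule sum.cong[OF refl])
          fix S
          have "(\<Sum>a\<in>A. if a \<in> S then e S x * (y a - x a) else 0) = (\<Sum>a\<in>{a\<in>A. a \<in> S}. e S x * (y a - x a))"
            using A by (simp add: sum.inter_filter)
          also have "{a\<in>A. a \<in> S} = S \<inter> A" by auto
          finally show "(\<Sum>a\<in>A. if a \<in> S then e S x * (y a - x a) else 0) = e S x * d S"
            by (simp add: d_def sum_distrib_left)
        qed
        finally show ?thesis .
      qed
      have "exp m * W x = (\<Sum>S\<in>C. e S x * (exp m * (1 + (d S - m))))"
      proof -
        have "(\<Sum>S\<in>C. e S x * (exp m * (1 + (d S - m)))) = exp m * ((1 - m) * W x + (\<Sum>S\<in>C. e S x * d S))"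
          unfolding W_def by (simp add: sum_distrib_left sum.distrib[symmetric] algebra_simps)
        thus ?thesis unfolding m[symmetric] by (simp add: algebra_simps)
      qed
      also have "\<dots> \<le> (\<Sum>S\<in>C. e S y)"
      proof (rule sum_mono)
        fix S assume S: "S \<in> C"
        have "exp m * (1 + (d S - m)) \<le> exp m * exp (d S - m)"
          by (intro mult_left_mono) auto
        also have "\<dots> = exp (d S)" by (simp add: exp_add[symmetric])
        finally have "e S x * (exp m * (1 + (d S - m))) \<le> e S x * exp (d S)"
          using e0[OF S, of x] by (intro mult_left_mono) auto
        also have "\<dots> = e S y" unfolding e_def d_def by (simp add: exp_add[symmetric] sum.distrib[symmetric])
        finally show "e S x * (exp m * (1 + (d S - m))) \<le> e S y" .
      qed
      finally have "exp m * W x \<le> W y" unfolding W_def .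
      hence "ln (exp m * W x) \<le> ln (W y)" using W0 by (subst ln_le_cancel_iff) auto
      hence "m + ln (W x) \<le> ln (W y)" using W0[of x] by (simp add: ln_mult)
      moreover have "m = - (\<Sum>a\<in>A. v a x * (x a - y a))"
        unfolding m_def sum_negf[symmetric] by (intro sum.cong) (auto simp: algebra_simps)
      ultimately show ?thesis unfolding W_def e_def by linarith
    qed
  qed (use A in auto)
qed

definition LL :: "real \<Rightarrow> nat \<Rightarrow> nat \<Rightarrow> (nat \<Rightarrow> real) \<Rightarrow> real" where
  "LL h i j \<omega> = ln (Z i j h \<omega>)"

text \<open>Without the reward at the endpoint, the logarithm is nondecreasing in \<open>h\<close> and does not depend on
  \<open>\<omega> j\<close>, so that adjacent gaps involve disjoint sets of disorder variables.\<close>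

definition LLo :: "real \<Rightarrow> nat \<Rightarrow> nat \<Rightarrow> (nat \<Rightarrow> real) \<Rightarrow> real" where
  "LLo h i j \<omega> = LL h i j \<omega> - (h + \<omega> j)"

lemma paths_nonempty: "i \<le> j \<Longrightarrow> paths i j \<noteq> {}"
  by (auto simp: paths_def intro!: exI[of _ "{i..j}"])

lemma LL_subgradient:
  assumes "i \<le> j"
  shows "has_subgradient (LL h i j) {i<..j}"
proof -
  have "LL h i j = (\<lambda>\<omega>. ln (\<Sum>S\<in>paths i j. (pw p S * exp (\<Sum>x\<in>S - {i}. h)) * exp (\<Sum>x\<in>S \<inter> {i<..j}. \<omega> x)))"
  proof
    fix \<omega>
    have "S \<inter> {i<..j} = S - {i}" if "S \<in> paths i j" for S using pathsD[OF that] by force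
    thus "LL h i j \<omega> = ln (\<Sum>S\<in>paths i j. (pw p S * exp (\<Sum>x\<in>S - {i}. h)) * exp (\<Sum>x\<in>S \<inter> {i<..j}. \<omega> x))"
      unfolding LL_def Z_eq by (intro arg_cong[of _ _ ln] sum.cong refl) (simp add: sum.distrib exp_add)
  qed
  thus ?thesis using log_sum_exp_subgradient[OF finite_paths paths_nonempty[OF assms], of "{i<..j}"] pw_pos by simp
qed

lemma LLo_eq:
  assumes "i < j"
  shows "LLo h i j \<omega> = ln (\<Sum>S\<in>paths i j. (pw p S * exp (\<Sum>x\<in>S - {i, j}. h)) * exp (\<Sum>x\<in>S \<inter> {i<..<j}. \<omega> x))"
proof -
  let ?S = "\<Sum>S\<in>paths i j. (pw p S * exp (\<Sum>x\<in>S - {i, j}. h)) * exp (\<Sum>x\<in>S \<inter> {i<..<j}. \<omega> x)"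
  have pos: "0 < ?S" using pw_pos paths_nonempty[of i j] assms by (intro sum_pos) auto
  have "Z i j h \<omega> = exp (h + \<omega> j) * ?S"
    unfolding Z_eq sum_distrib_left
  proof (rule sum.cong[OF refl])
    fix S assume S: "S \<in> paths i j"
    have 1: "S \<inter> {i<..<j} = S - {i, j}" using pathsD[OF S] by force
    have "(\<Sum>x\<in>S - {i}. h + \<omega> x) = (h + \<omega> j) + (\<Sum>x\<in>S - {i} - {j}. h + \<omega> x)"
      by (rule sum.remove) (use pathsD[OF S] assms finite_path[OF S] in auto)
    also have "S - {i} - {j} = S - {i, j}" by auto
    finally show "pw p S * exp (\<Sum>x\<in>S - {i}. h + \<omega> x) = exp (h + \<omega> j) * (pw p S * exp (\<Sum>x\<in>S - {i, j}. h) * exp (\<Sum>x\<in>S \<inter> {i<..<j}. \<omega> x))"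
      unfolding 1 by (simp add: sum.distrib exp_add mult_ac)
  qed
  thus ?thesis unfolding LLo_def LL_def using pos by (simp add: ln_mult)
qed

lemma LLo_subgradient:
  assumes "i < j"
  shows "has_subgradient (LLo h i j) {i<..<j}"
proof -
  have "LLo h i j = (\<lambda>\<omega>. ln (\<Sum>S\<in>paths i j. (pw p S * exp (\<Sum>x\<in>S - {i, j}. h)) * exp (\<Sum>x\<in>S \<inter> {i<..<j}. \<omega> x)))"
    using LLo_eq[OF assms] by blast
  thus ?thesis using log_sum_exp_subgradient[OF finite_paths paths_nonempty[of i j], of "{i<..<j}"] pw_pos assms by simp
qed

lemma LLo_mono:
  assumes "i < j" "h \<le> h'"
  shows "LLo h i j \<omega> \<le> LLo h' i j \<omega>"
  unfolding LLo_eq[OF assms(1)]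
proof (subst ln_le_cancel_iff)
  show "0 < (\<Sum>S\<in>paths i j. (pw p S * exp (\<Sum>x\<in>S - {i, j}. k)) * exp (\<Sum>x\<in>S \<inter> {i<..<j}. \<omega> x))" for k
    using pw_pos paths_nonempty[of i j] assms by (intro sum_pos) auto
  thus "0 < (\<Sum>S\<in>paths i j. (pw p S * exp (\<Sum>x\<in>S - {i, j}. h')) * exp (\<Sum>x\<in>S \<inter> {i<..<j}. \<omega> x))" .
  show "(\<Sum>S\<in>paths i j. (pw p S * exp (\<Sum>x\<in>S - {i, j}. h)) * exp (\<Sum>x\<in>S \<inter> {i<..<j}. \<omega> x))
    \<le> (\<Sum>S\<in>paths i j. (pw p S * exp (\<Sum>x\<in>S - {i, j}. h')) * exp (\<Sum>x\<in>S \<inter> {i<..<j}. \<omega> x))"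
    using assms(2) less_imp_le[OF pw_pos] by (intro sum_mono mult_right_mono mult_left_mono) (auto intro!: sum_mono mult_left_mono)
qed

lemma Z_Lipschitz:
  assumes "h \<le> h'" "i \<le> j"
  shows "Z i j h \<omega> \<le> Z i j h' \<omega>" "Z i j h' \<omega> \<le> exp ((h' - h) * real (j - i)) * Z i j h \<omega>"
proof -
  show "Z i j h \<omega> \<le> Z i j h' \<omega>"
    unfolding Z_eq using assms(1) less_imp_le[OF pw_pos]
    by (intro sum_mono mult_left_mono) (auto intro!: sum_mono)
  show "Z i j h' \<omega> \<le> exp ((h' - h) * real (j - i)) * Z i j h \<omega>"
    unfolding Z_eq sum_distrib_left
  proof (rule sum_mono)
    fix S assume S: "S \<in> paths i j"
    have "card (S - {i}) \<le> card {i<..j}" using pathsD[OF S] by (intro card_mono) force+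
    hence "(h' - h) * real (card (S - {i})) \<le> (h' - h) * real (j - i)" using assms by (intro mult_left_mono) auto
    moreover have "(\<Sum>x\<in>S - {i}. h' + \<omega> x) = (h' - h) * real (card (S - {i})) + (\<Sum>x\<in>S - {i}. h + \<omega> x)"
      by (simp add: sum.distrib algebra_simps)
    ultimately have "exp (\<Sum>x\<in>S - {i}. h' + \<omega> x) \<le> exp ((h' - h) * real (j - i)) * exp (\<Sum>x\<in>S - {i}. h + \<omega> x)"
      by (simp add: exp_add[symmetric])
    thus "pw p S * exp (\<Sum>x\<in>S - {i}. h' + \<omega> x) \<le> exp ((h' - h) * real (j - i)) * (pw p S * exp (\<Sum>x\<in>S - {i}. h + \<omega> x))"
      using pw_pos[of S] by (simp add: mult_ac)
  qed
qed

lemma LL_Lipschitz: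
  assumes "h \<le> h'" "i \<le> j"
  shows "LL h i j \<omega> \<le> LL h' i j \<omega>" "LL h' i j \<omega> \<le> LL h i j \<omega> + (h' - h) * real (j - i)"
proof -
  show "LL h i j \<omega> \<le> LL h' i j \<omega>" unfolding LL_def using Z_Lipschitz(1)[OF assms] Z_pos[OF assms(2)] by simp
  have "LL h' i j \<omega> \<le> ln (exp ((h' - h) * real (j - i)) * Z i j h \<omega>)"
    unfolding LL_def using Z_Lipschitz(2)[OF assms] Z_pos[OF assms(2)] by simp
  thus "LL h' i j \<omega> \<le> LL h i j \<omega> + (h' - h) * real (j - i)"
    using Z_pos[OF assms(2), of \<omega> h] by (simp add: ln_mult LL_def)
qed

lemma LL_measurable [measurable]: "LL h i j \<in> borel_measurable D"
  unfolding LL_def by measurable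

lemma LL_integrable [simp]: "i \<le> j \<Longrightarrow> integrable D (LL h i j)"
  using has_subgradient_integrable(1)[OF LL_subgradient] .

lemma LL_refl [simp]: "LL h i i = (\<lambda>_. 0)"
  by (simp add: LL_def ZZ_def fun_eq_iff)

definition ell :: "real \<Rightarrow> nat \<Rightarrow> real" where
  "ell h n = expectation (LL h 0 n)"

lemma expectation_LL:
  assumes "i \<le> j"
  shows "expectation (LL h i j) = ell h (j - i)"
proof -
  have "LL h i j = (\<lambda>\<omega>. LL h 0 (j - i) (\<lambda>a. \<omega> (a + i)))"
    using ZZ_shift[of p _ 0 i "j - i" h] assms by (auto simp: LL_def)
  thus ?thesis unfolding ell_def using expectation_shift(1)[of "LL h 0 (j - i)" i] by simp
qed

text \<open>The left-hand side is the contribution of the paths that visit \<open>x\<close>.\<close>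

lemma Z_supermult:
  assumes "i \<le> x" "x \<le> j"
  shows "Z i x h \<omega> * Z x j h \<omega> \<le> Z i j h \<omega>"
proof -
  let ?g = "bw p \<omega> h"
  have inj: "inj_on (\<lambda>(S, R). S \<union> R) (paths i x \<times> paths x j)"
  proof (rule inj_onI, clarify)
    fix S R S' R' assume h: "S \<in> paths i x" "R \<in> paths x j" "S' \<in> paths i x" "R' \<in> paths x j" "S \<union> R = S' \<union> R'"
    have *: "S = (S \<union> R) \<inter> {..x} \<and> R = (S \<union> R) \<inter> {x..}" if "S \<in> paths i x" "R \<in> paths x j" for S R
      using pathsD[OF that(1)] pathsD[OF that(2)] by force
    show "S = S' \<and> R = R'" using *[OF h(1,2)] *[OF h(3,4)] h(5) by auto
  qed
  have "Z i x h \<omega> * Z x j h \<omega> = (\<Sum>(S, R)\<in>paths i x \<times> paths x j. wt ?g S * wt ?g R)"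
    unfolding ZZ_def path_sum_def by (simp add: sum_product sum.cartesian_product)
  also have "\<dots> = (\<Sum>(S, R)\<in>paths i x \<times> paths x j. wt ?g (S \<union> R))"
    by (rule sum.cong) (auto simp: wt_concat)
  also have "\<dots> = (\<Sum>U\<in>(\<lambda>(S, R). S \<union> R) ` (paths i x \<times> paths x j). wt ?g U)"
    by (subst sum.reindex[OF inj]) (simp add: case_prod_unfold)
  also have "\<dots> \<le> Z i j h \<omega>" unfolding ZZ_def path_sum_def
    by (rule sum_mono2) (use concat_path wt_nonneg[OF pos_bw] in auto)
  finally show ?thesis .
qed

lemma ell_superadditive: "ell h m + ell h n \<le> ell h (m + n)"
proof -
  have "LL h 0 m \<omega> + LL h m (m + n) \<omega> \<le> LL h 0 (m + n) \<omega>" for \<omega>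
  proof -
    have "ln (Z 0 m h \<omega> * Z m (m + n) h \<omega>) \<le> LL h 0 (m + n) \<omega>"
      unfolding LL_def using Z_supermult[of 0 m "m + n" \<omega> h] Z_pos by (subst ln_le_cancel_iff) auto
    thus ?thesis using Z_pos[of 0 m \<omega> h] Z_pos[of m "m + n" \<omega> h] by (simp add: LL_def ln_mult)
  qed
  hence "expectation (\<lambda>\<omega>. LL h 0 m \<omega> + LL h m (m + n) \<omega>) \<le> expectation (LL h 0 (m + n))"
    by (intro integral_mono) auto
  thus ?thesis by (simp add: expectation_LL)
qed

definition m1 :: real where "m1 = expectation (\<lambda>\<omega>. \<bar>\<omega> 0\<bar>)"

lemma expectation_abs_coord: "expectation (\<lambda>\<omega>. \<bar>\<omega> a\<bar>) = m1"
  using expectation_shift(1)[of "\<lambda>\<omega>. \<bar>\<omega> 0\<bar>" a] by (simp add: m1_def)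

lemma Z_le_exp: "Z 0 n h \<omega> \<le> exp (\<Sum>x\<in>{0<..n}. \<bar>h\<bar> + \<bar>\<omega> x\<bar>)"
proof -
  have "Z 0 n h \<omega> \<le> (\<Sum>S\<in>paths 0 n. pw p S * exp (\<Sum>x\<in>{0<..n}. \<bar>h\<bar> + \<bar>\<omega> x\<bar>))"
    unfolding Z_eq
  proof (intro sum_mono mult_left_mono less_imp_le[OF pw_pos], unfold exp_le_cancel_iff)
    fix S assume S: "S \<in> paths 0 n"
    have "(\<Sum>x\<in>S - {0}. h + \<omega> x) \<le> (\<Sum>x\<in>S - {0}. \<bar>h\<bar> + \<bar>\<omega> x\<bar>)" by (intro sum_mono) linarith
    also have "\<dots> \<le> (\<Sum>x\<in>{0<..n}. \<bar>h\<bar> + \<bar>\<omega> x\<bar>)" by (intro sum_mono2) (use pathsD[OF S] in auto)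
    finally show "(\<Sum>x\<in>S - {0}. h + \<omega> x) \<le> (\<Sum>x\<in>{0<..n}. \<bar>h\<bar> + \<bar>\<omega> x\<bar>)" .
  qed
  also have "\<dots> \<le> 1 * exp (\<Sum>x\<in>{0<..n}. \<bar>h\<bar> + \<bar>\<omega> x\<bar>)"
    unfolding sum_distrib_right[symmetric] by (rule mult_right_mono[OF sum_pw_le_1]) simp
  finally show ?thesis by simp
qed

lemma ell_le: "ell h n \<le> (\<bar>h\<bar> + m1) * real n"
proof -
  have "LL h 0 n \<omega> \<le> (\<Sum>x\<in>{0<..n}. \<bar>h\<bar> + \<bar>\<omega> x\<bar>)" for \<omega>
    unfolding LL_def using Z_le_exp[of \<omega> n h] Z_pos[of 0 n \<omega> h] by (metis ln_exp ln_le_cancel_iff exp_gt_zero zero_le)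
  hence "ell h n \<le> expectation (\<lambda>\<omega>. \<Sum>x\<in>{0<..n}. \<bar>h\<bar> + \<bar>\<omega> x\<bar>)"
    unfolding ell_def by (intro integral_mono) auto
  also have "\<dots> = (\<Sum>x\<in>{0<..n}. \<bar>h\<bar> + m1)"
    by (simp add: expectation_abs_coord prob_space[unfolded space_D])
  finally show ?thesis by (simp add: mult.commute)
qed

definition FE :: "real \<Rightarrow> real" where "FE h = lim (\<lambda>n. ell h n / real n)"

lemma FE_lim: "(\<lambda>n. ell h n / real n) \<longlonglongrightarrow> FE h" and ell_div_le_FE: "1 \<le> n \<Longrightarrow> ell h n / real n \<le> FE h"
proof -
  obtain L where L: "(\<lambda>n. ell h n / real n) \<longlonglongrightarrow> L" "\<And>n. 1 \<le> n \<Longrightarrow> ell h n / real n \<le> L"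
    by (rule superadditive_limit[of "ell h", OF ell_superadditive ell_le]) (auto simp: ell_def)
  have "FE h = L" unfolding FE_def using L(1) by (rule limI)
  thus "(\<lambda>n. ell h n / real n) \<longlonglongrightarrow> FE h" "1 \<le> n \<Longrightarrow> ell h n / real n \<le> FE h" using L by auto
qed

lemma ell_mono: "h \<le> h' \<Longrightarrow> ell h n \<le> ell h' n"
  unfolding ell_def by (intro integral_mono LL_integrable LL_Lipschitz) auto

lemma FE_mono: "h \<le> h' \<Longrightarrow> FE h \<le> FE h'"
  by (rule LIMSEQ_le[OF FE_lim FE_lim]) (auto intro!: exI[of _ 0] divide_right_mono ell_mono)

text \<open>Length 1, where there is a single path, is already enough. The bound makes the free
  energy positive for large \<open>h\<close>, so that the set in the definition of the critical
  point is not empty.\<close>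

lemma FE_ge: "h + ln (p 1) \<le> FE h"
proof -
  have "Z 0 1 h \<omega> = p 1 * exp (h + \<omega> 1)" for \<omega>
  proof -
    have "paths 0 1 = {{0, 1}}" by (auto simp: paths_def)
    moreover have "gaps {0, 1 :: nat} = {(0, 1)}" by (auto simp: gaps_def)
    ultimately show ?thesis by (simp add: ZZ_def path_sum_def wt_def bw_def)
  qed
  moreover have p1: "0 < p 1" using p_pos by simp
  ultimately have "LL h 0 1 = (\<lambda>\<omega>. ln (p 1) + h + \<omega> 1)" using p1 by (simp add: LL_def ln_mult fun_eq_iff)
  hence "ell h 1 = ln (p 1) + h" unfolding ell_def by (simp add: prob_space[unfolded space_D])
  thus ?thesis using ell_div_le_FE[of 1 h] by simp
qed

end

section \<open>Decay of the probability that two polymers do not meet\<close>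

lemma gaps_disjoint:
  assumes "(a, b) \<in> gaps S" "(a', b') \<in> gaps S" "(a, b) \<noteq> (a', b')"
  shows "{a<..<b} \<inter> {a'<..<b'} = {}"
proof (rule ccontr)
  assume "\<not> ?thesis"
  then obtain x where x: "a < x" "x < b" "a' < x" "x < b'" by auto
  have "a' \<le> a \<or> b \<le> a'" "b' \<le> a \<or> b \<le> b'" using gaps_no_between[OF assms(1)] gapsD[OF assms(2)] by auto
  moreover have "a \<le> a' \<or> b' \<le> a" "b \<le> a' \<or> b' \<le> b" using gaps_no_between[OF assms(2)] gapsD[OF assms(1)] by auto
  ultimately show False using x assms(3) by auto
qed

text \<open>Half of the exponent pays for the decay in \<open>j - i\<close>: the gaps cover at least
  an eighth of the interval, whence \<open>c / 16\<close>. The other half pays for the number of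
  families, since their sum is at most a product over all possible gaps, and gaps of length at least
  \<open>m\<close> contribute at most \<open>q ^ m / (1 - q)\<close> per starting point.\<close>

lemma sum_exp_gap_families_le:
  fixes c :: real
  assumes c: "0 < c"
  shows "(\<Sum>J\<in>gap_families m i j. exp (- c * real (total_length J)))
    \<le> exp (- c / 16 * real (j - i)) * exp (real (j - i + 1) * (exp (- c / 2) ^ m / (1 - exp (- c / 2))))"
proof -
  define q where "q = exp (- c / 2)"
  define k where "k = j - i"
  have q: "0 < q" "q < 1" unfolding q_def using c by auto
  define P where "P = {(a, b). i \<le> a \<and> a < b \<and> b \<le> j \<and> m \<le> b - a}"
  have fP: "finite P" by (rule finite_subset[of _ "{i..j} \<times> {i..j}"]) (auto simp: P_def)
  have sumP: "(\<Sum>(a, b)\<in>P. q ^ (b - a)) \<le> real (k + 1) * (q ^ m / (1 - q))"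
  proof -
    let ?f = "\<lambda>(a, l). (a, a + l) :: nat \<times> nat"
    have "(\<Sum>(a, b)\<in>P. q ^ (b - a)) \<le> (\<Sum>(a, b)\<in>?f ` ({i..<i+k+1} \<times> {m..<m+k+1}). q ^ (b - a))"
    proof (rule sum_mono2)
      show "P \<subseteq> ?f ` ({i..<i+k+1} \<times> {m..<m+k+1})"
      proof
        fix y assume "y \<in> P"
        then obtain a b where y: "y = (a, b)" "i \<le> a" "a < b" "b \<le> j" "m \<le> b - a" unfolding P_def by auto
        show "y \<in> ?f ` ({i..<i+k+1} \<times> {m..<m+k+1})"
          by (rule image_eqI[of _ _ "(a, b - a)"]) (use y in \<open>auto simp: k_def\<close>)
      qed
    qed (use q in auto)
    also have "\<dots> = (\<Sum>(a, l)\<in>{i..<i+k+1} \<times> {m..<m+k+1}. q ^ l)"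
      by (subst sum.reindex) (auto simp: inj_on_def case_prod_unfold)
    also have "\<dots> = real (k + 1) * (\<Sum>l\<in>{m..<m+k+1}. q ^ l)"
      by (simp add: sum.cartesian_product[symmetric])
    also have "(\<Sum>l\<in>{m..<m+k+1}. q ^ l) \<le> q ^ m / (1 - q)"
    proof -
      have "(\<Sum>l\<in>{m..<m+k+1}. q ^ l) = (\<Sum>l\<in>{0+m..<(k+1)+m}. q ^ l)" by (simp add: add.commute)
      also have "\<dots> = (\<Sum>l<k+1. q ^ m * q ^ l)"
        unfolding sum.shift_bounds_nat_ivl by (simp only: power_add mult.commute atLeast0LessThan)
      also have "\<dots> = q ^ m * (\<Sum>l<k+1. q ^ l)" by (simp only: sum_distrib_left)
      also have "(\<Sum>l<k+1. q ^ l) \<le> 1 / (1 - q)"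
      proof -
        have "1 - q ^ (k+1) = (1 - q) * (\<Sum>l<k+1. q ^ l)" by (rule one_diff_power_eq)
        moreover have "0 \<le> q ^ (k+1)" using q by simp
        ultimately have "(\<Sum>l<k+1. q ^ l) * (1 - q) \<le> 1"
          using mult.commute[of "1 - q" "\<Sum>l<k+1. q ^ l"] by linarith
        thus ?thesis using q by (simp add: pos_le_divide_eq)
      qed
      finally show ?thesis using q by (simp add: mult_left_mono)
    qed
    finally show ?thesis by (simp add: mult_left_mono)
  qed
  have "(\<Sum>J\<in>gap_families m i j. exp (- c * real (total_length J)))
    \<le> (\<Sum>J\<in>gap_families m i j. exp (- c / 16 * real k) * (\<Prod>(a, b)\<in>J. q ^ (b - a)))"
  proof (rule sum_mono)
    fix J assume J: "J \<in> gap_families m i j"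
    have "real k \<le> 8 * real (total_length J)" using J unfolding gap_families_def k_def by auto
    hence "c / 16 * real k \<le> c / 16 * (8 * real (total_length J))" using c by (intro mult_left_mono) auto
    hence "- c * real (total_length J) \<le> - c / 16 * real k + (- c / 2) * real (total_length J)" by simp
    hence "exp (- c * real (total_length J)) \<le> exp (- c / 16 * real k) * exp ((- c / 2) * real (total_length J))"
      by (simp add: exp_add[symmetric])
    also have "exp ((- c / 2) * real (total_length J)) = (\<Prod>(a, b)\<in>J. q ^ (b - a))"
      unfolding q_def total_length_def using gap_familyD(1)[OF J]
      by (simp add: exp_sum sum_distrib_left case_prod_unfold exp_of_nat_mult[symmetric] mult.commute)
    finally show "exp (- c * real (total_length J)) \<le> exp (- c / 16 * real k) * (\<Prod>(a, b)\<in>J. q ^ (b - a))" .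
  qed
  also have "\<dots> \<le> exp (- c / 16 * real k) * (\<Sum>J\<in>Pow P. \<Prod>(a, b)\<in>J. q ^ (b - a))"
    unfolding sum_distrib_left[symmetric]
  proof (intro mult_left_mono sum_mono2)
    show "gap_families m i j \<subseteq> Pow P" using gap_families_subset[of _ m i j] unfolding P_def by blast
  qed (use fP q in \<open>auto intro!: prod_nonneg\<close>)
  also have "(\<Sum>J\<in>Pow P. \<Prod>(a, b)\<in>J. q ^ (b - a)) = (\<Prod>(a, b)\<in>P. q ^ (b - a) + 1)"
    using prod_add[OF fP, of "\<lambda>(a, b). q ^ (b - a)" "\<lambda>_. 1"] by (simp add: case_prod_unfold)
  also have "\<dots> \<le> (\<Prod>(a, b)\<in>P. exp (q ^ (b - a)))"
    using q by (intro prod_mono) (auto simp: add.commute intro!: exp_ge_add_one_self)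
  also have "\<dots> = exp (\<Sum>(a, b)\<in>P. q ^ (b - a))" using fP by (simp add: exp_sum case_prod_unfold)
  also have "\<dots> \<le> exp (real (k + 1) * (q ^ m / (1 - q)))" using sumP by simp
  finally show ?thesis unfolding k_def q_def by simp
qed

section \<open>Long gaps are unlikely\<close>

context pinning
begin

text \<open>Disjointness of the two sets of coordinates keeps the coefficients of the sum at most
  1.\<close>

lemma has_subgradient_add:
  assumes F: "has_subgradient F A" and G: "has_subgradient G B" and AB: "A \<inter> B = {}"
  shows "has_subgradient (\<lambda>\<omega>. F \<omega> + G \<omega>) (A \<union> B)"
proof -
  obtain v where v: "\<And>a. a \<in> A \<Longrightarrow> v a \<in> borel_measurable D" "\<And>a x. a \<in> A \<Longrightarrow> 0 \<le> v a x" "\<And>a x. a \<in> A \<Longrightarrow> v a x \<le> 1"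
     "\<And>x y. F x - F y \<le> (\<Sum>a\<in>A. v a x * (x a - y a))" using F unfolding has_subgradient_def by blast
  obtain w where w: "\<And>a. a \<in> B \<Longrightarrow> w a \<in> borel_measurable D" "\<And>a x. a \<in> B \<Longrightarrow> 0 \<le> w a x" "\<And>a x. a \<in> B \<Longrightarrow> w a x \<le> 1"
     "\<And>x y. G x - G y \<le> (\<Sum>a\<in>B. w a x * (x a - y a))" using G unfolding has_subgradient_def by blast
  have fin: "finite A" "finite B" "F \<in> borel_measurable D" "G \<in> borel_measurable D"
    using F G unfolding has_subgradient_def by auto
  define u where "u a = (if a \<in> A then v a else w a)" for a
  have "F x + G x - (F y + G y) \<le> (\<Sum>a\<in>A \<union> B. u a x * (x a - y a))" for x y
  proof -
    have "(\<Sum>a\<in>A \<union> B. u a x * (x a - y a)) = (\<Sum>a\<in>A. u a x * (x a - y a)) + (\<Sum>a\<in>B. u a x * (x a - y a))"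
      by (rule sum.union_disjoint) (use fin AB in auto)
    also have "(\<Sum>a\<in>A. u a x * (x a - y a)) = (\<Sum>a\<in>A. v a x * (x a - y a))"
      by (rule sum.cong) (auto simp: u_def)
    also have "(\<Sum>a\<in>B. u a x * (x a - y a)) = (\<Sum>a\<in>B. w a x * (x a - y a))"
      by (rule sum.cong) (use AB in \<open>auto simp: u_def\<close>)
    finally show ?thesis using v(4)[of x y] w(4)[of x y] by linarith
  qed
  moreover have "\<forall>a\<in>A \<union> B. u a \<in> borel_measurable D \<and> (\<forall>x. 0 \<le> u a x \<and> u a x \<le> 1)"
    unfolding u_def using v w by auto
  ultimately show ?thesis unfolding has_subgradient_def using fin
    by (intro conjI exI[of _ u]) auto
qed

lemma has_subgradient_gaps:
  assumes "finite J" "J \<subseteq> gaps S"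
  shows "has_subgradient (\<lambda>\<omega>. \<Sum>(a, b)\<in>J. LLo h a b \<omega>) (\<Union>(a, b)\<in>J. {a<..<b})"
  using assms
proof (induction J rule: finite_induct)
  case empty
  show ?case unfolding has_subgradient_def by (auto intro!: exI[of _ "\<lambda>_ _. 0"])
next
  case (insert I J)
  obtain a b where I: "I = (a, b)" by (cases I)
  have "{a<..<b} \<inter> (\<Union>(a, b)\<in>J. {a<..<b}) = {}"
    using gaps_disjoint[of a b S] insert.prems insert.hyps I by fastforce
  moreover have "a < b" using gapsD[of a b S] insert.prems I by auto
  ultimately have "has_subgradient (\<lambda>\<omega>. LLo h a b \<omega> + (\<Sum>(a, b)\<in>J. LLo h a b \<omega>)) ({a<..<b} \<union> (\<Union>(a, b)\<in>J. {a<..<b}))"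
    using insert by (intro has_subgradient_add LLo_subgradient) auto
  thus ?case using insert.hyps by (simp add: I)
qed

lemma expectation_LLo:
  assumes "i < j"
  shows "expectation (LLo h i j) = ell h (j - i) - h"
  unfolding LLo_def using assms by (simp add: expectation_LL prob_space[unfolded space_D])

lemma LLo_integrable: "i < j \<Longrightarrow> integrable D (LLo h i j)"
  using has_subgradient_integrable(1)[OF LLo_subgradient] .

text \<open>Concentration is applied to the whole sum at once. The summands are correlated, but they
  involve disjoint coordinates, so the fluctuation term is proportional to the total length.\<close>

lemma exp_moment_gaps:
  assumes J: "finite J" "J \<subseteq> gaps S"
  shows "integrable D (\<lambda>\<omega>. exp (- t * (\<Sum>(a, b)\<in>J. LLo h a b \<omega>)))"
    and "expectation (\<lambda>\<omega>. exp (- t * (\<Sum>(a, b)\<in>J. LLo h a b \<omega>)))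
      \<le> exp (- t * (\<Sum>(a, b)\<in>J. ell h (b - a) - h) + cgauss * t\<^sup>2 * real (total_length J))"
proof -
  define F where "F \<omega> = (\<Sum>(a, b)\<in>J. LLo h a b \<omega>)" for \<omega>
  define U where "U = (\<Union>(a, b)\<in>J. {a<..<b})"
  have hs: "has_subgradient F U" unfolding F_def U_def by (rule has_subgradient_gaps[OF J])
  show "integrable D (\<lambda>\<omega>. exp (- t * (\<Sum>(a, b)\<in>J. LLo h a b \<omega>)))"
    using has_subgradient_integrable(2)[OF hs, of "- t"] unfolding F_def .
  have lt: "a < b" if "(a, b) \<in> J" for a b using J(2) gapsD that by blast
  have EF: "expectation F = (\<Sum>(a, b)\<in>J. ell h (b - a) - h)"
  proof -
    have "expectation F = (\<Sum>y\<in>J. expectation (\<lambda>\<omega>. LLo h (fst y) (snd y) \<omega>))"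
      unfolding F_def case_prod_unfold by (rule Bochner_Integration.integral_sum) (use lt LLo_integrable in auto)
    also have "\<dots> = (\<Sum>y\<in>J. ell h (snd y - fst y) - h)" by (intro sum.cong refl expectation_LLo lt) auto
    finally show ?thesis by (simp add: case_prod_unfold)
  qed
  have "card U \<le> (\<Sum>y\<in>J. card (case y of (a, b) \<Rightarrow> {a<..<b}))" unfolding U_def by (rule card_UN_le[OF J(1)])
  also have "\<dots> \<le> total_length J" unfolding total_length_def by (rule sum_mono) auto
  finally have cU: "cgauss * t\<^sup>2 * real (card U) \<le> cgauss * t\<^sup>2 * real (total_length J)"
    using cgauss_nonneg by (intro mult_left_mono) auto
  have "expectation (\<lambda>\<omega>. exp (- t * F \<omega>)) = exp (- t * expectation F) * expectation (\<lambda>\<omega>. exp (- t * (F \<omega> - expectation F)))"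
  proof -
    have "exp (- t * F \<omega>) = exp (- t * expectation F) * exp (- t * (F \<omega> - expectation F))" for \<omega>
      by (simp add: exp_add[symmetric] algebra_simps)
    thus ?thesis by simp
  qed
  also have "\<dots> \<le> exp (- t * expectation F) * exp (cgauss * t\<^sup>2 * real (total_length J))"
    using order_trans[OF concentration[OF hs, of "- t"]] cU by (intro mult_left_mono) auto
  finally show "expectation (\<lambda>\<omega>. exp (- t * (\<Sum>(a, b)\<in>J. LLo h a b \<omega>)))
      \<le> exp (- t * (\<Sum>(a, b)\<in>J. ell h (b - a) - h) + cgauss * t\<^sup>2 * real (total_length J))"
    unfolding F_def EF[unfolded F_def] exp_add .
qed

text \<open>Bounds the probability that long gaps cover an eighth of \<open>{i..j}\<close>. The exponent \<open>t\<close> is small, so that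
  the drift of \<open>LLo\<close> beats its Gaussian fluctuations.\<close>

definition RR :: "real \<Rightarrow> nat \<Rightarrow> real \<Rightarrow> nat \<Rightarrow> nat \<Rightarrow> (nat \<Rightarrow> real) \<Rightarrow> real" where
  "RR h m t i j \<omega> = (\<Sum>J\<in>gap_families m i j. exp (- t * (\<Sum>(a, b)\<in>J. LLo h a b \<omega>)))"

lemma RR_nonneg: "0 \<le> RR h m t i j \<omega>" unfolding RR_def by (intro sum_nonneg) auto

lemma gap_family_gaps: assumes "J \<in> gap_families m i j" obtains S where "J \<subseteq> gaps S"
  using assms unfolding gap_families_def big_gaps_def by blast

lemma RR_integrable: "integrable D (RR h m t i j)"
proof -
  have "integrable D (\<lambda>\<omega>. exp (- t * (\<Sum>(a, b)\<in>J. LLo h a b \<omega>)))" if J: "J \<in> gap_families m i j" for J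
    using exp_moment_gaps(1)[OF gap_familyD(1)[OF J]] gap_family_gaps[OF J] by metis
  thus ?thesis unfolding RR_def by (rule Bochner_Integration.integrable_sum)
qed

lemma expectation_RR_le:
  assumes FE0: "0 < FE h"
  obtains m t c where "1 \<le> m" "0 < t" "t \<le> 1" "0 < c"
    "\<And>i j. expectation (RR h m t i j) \<le> exp c * exp (- c * real (j - i))"
proof -
  define f where "f = FE h"
  \<comment> \<open>Makes the fluctuation rate \<open>cgauss * t\<^sup>2\<close> at most a quarter
    of the drift rate \<open>t * f\<close>; the summand 1 avoids division by 0.\<close>
  define t where "t = min 1 (f / (4 * (cgauss + 1)))"
  have cg: "0 < cgauss + 1" using cgauss_nonneg by linarith
  have f0: "0 < f" using FE0 by (simp add: f_def)
  have t: "0 < t" "t \<le> 1" "cgauss * t \<le> f / 4"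
  proof -
    show "0 < t" "t \<le> 1" unfolding t_def using f0 cg by auto
    have "cgauss * t \<le> (cgauss + 1) * t" using \<open>0 < t\<close> by simp
    also have "\<dots> \<le> (cgauss + 1) * (f / (4 * (cgauss + 1)))" using cg by (intro mult_left_mono) (auto simp: t_def)
    also have "\<dots> = f / 4"
    proof -
      have "x * (f / (4 * x)) = f / 4" if "0 < x" for x :: real using that by simp
      thus ?thesis using cg by blast
    qed
    finally show "cgauss * t \<le> f / 4" .
  qed
  \<comment> \<open>In long gaps the mean of \<open>LL\<close> is at least \<open>3 / 4 * f\<close>
    per site. A quarter of \<open>f\<close> absorbs the removed end reward \<open>h\<close>, another
    quarter the fluctuations, and the last one remains, multiplied by \<open>t\<close>.\<close>
  define c where "c = t * f / 4"
  have c0: "0 < c" unfolding c_def using t f0 by simp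
  define q where "q = exp (- c / 2)"
  have q: "0 < q" "q < 1" unfolding q_def using c0 by auto
  have "eventually (\<lambda>n. 3 / 4 * f < ell h n / real n) sequentially"
    by (rule order_tendstoD(1)[OF FE_lim]) (use f0 in \<open>simp add: f_def\<close>)
  moreover have "eventually (\<lambda>n. h \<le> f / 4 * real n) sequentially"
    using f0 by real_asymp
  \<comment> \<open>The sum over the families gains a rate \<open>c / 16\<close>; the minimal length
    is increased until their number costs at most half of that.\<close>
  moreover have "eventually (\<lambda>m. q ^ m / (1 - q) < c / 32) sequentially"
  proof -
    have "(\<lambda>m. q ^ m / (1 - q)) \<longlonglongrightarrow> 0 / (1 - q)" using q by (intro tendsto_intros LIMSEQ_power_zero) auto
    thus ?thesis using c0 by (intro order_tendstoD(2)) auto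
  qed
  ultimately have "eventually (\<lambda>n. 3 / 4 * f < ell h n / real n \<and> h \<le> f / 4 * real n \<and> q ^ n / (1 - q) < c / 32) sequentially"
    by eventually_elim auto
  then obtain m' where m': "\<And>n. m' \<le> n \<Longrightarrow> 3 / 4 * f < ell h n / real n \<and> h \<le> f / 4 * real n \<and> q ^ n / (1 - q) < c / 32"
    unfolding eventually_sequentially by blast
  define m where "m = max m' 1"
  have big: "f / 2 * real n \<le> ell h n - h" if "m \<le> n" for n
  proof -
    have n: "0 < n" "m' \<le> n" using that by (auto simp: m_def)
    have "3 / 4 * f * real n \<le> ell h n" using m'[OF n(2)] n(1) by (simp add: field_simps)
    thus ?thesis using m'[OF n(2)] by linarith
  qed
  have mom: "expectation (\<lambda>\<omega>. exp (- t * (\<Sum>(a, b)\<in>J. LLo h a b \<omega>))) \<le> exp (- c * real (total_length J))"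
    if J: "J \<in> gap_families m i j" for J i j
  proof -
    obtain S where S: "J \<subseteq> gaps S" using gap_family_gaps[OF J] .
    have "f / 2 * real (total_length J) = (\<Sum>(a, b)\<in>J. f / 2 * real (b - a))"
      unfolding total_length_def by (simp add: sum_distrib_left case_prod_unfold)
    also have "\<dots> \<le> (\<Sum>(a, b)\<in>J. ell h (b - a) - h)"
      by (intro sum_mono) (use gap_familyD(2)[OF J] big in auto)
    finally have "t * (f / 2 * real (total_length J)) \<le> t * (\<Sum>(a, b)\<in>J. ell h (b - a) - h)"
      using t by (intro mult_left_mono) auto
    moreover have "(cgauss * t) * (t * real (total_length J)) \<le> f / 4 * (t * real (total_length J))"
      using t by (intro mult_right_mono) auto
    ultimately have "- t * (\<Sum>(a, b)\<in>J. ell h (b - a) - h) + cgauss * t\<^sup>2 * real (total_length J) \<le> - c * real (total_length J)"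
      unfolding c_def power2_eq_square by (simp add: algebra_simps)
    thus ?thesis using order_trans[OF exp_moment_gaps(2)[OF gap_familyD(1)[OF J] S, of t h]] by simp
  qed
  have "expectation (RR h m t i j) \<le> exp (c / 32) * exp (- (c / 32) * real (j - i))" for i j
  proof -
    have "expectation (RR h m t i j) = (\<Sum>J\<in>gap_families m i j. expectation (\<lambda>\<omega>. exp (- t * (\<Sum>(a, b)\<in>J. LLo h a b \<omega>))))"
      unfolding RR_def
    proof (rule Bochner_Integration.integral_sum)
      fix J assume J: "J \<in> gap_families m i j"
      show "integrable D (\<lambda>\<omega>. exp (- t * (\<Sum>(a, b)\<in>J. LLo h a b \<omega>)))"
        using exp_moment_gaps(1)[OF gap_familyD(1)[OF J]] gap_family_gaps[OF J] by metis
    qed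
    also have "\<dots> \<le> (\<Sum>J\<in>gap_families m i j. exp (- c * real (total_length J)))" by (intro sum_mono mom)
    also have "\<dots> \<le> exp (- c / 16 * real (j - i)) * exp (real (j - i + 1) * (q ^ m / (1 - q)))"
      unfolding q_def by (rule sum_exp_gap_families_le[OF c0])
    also have "\<dots> \<le> exp (- c / 16 * real (j - i)) * exp (real (j - i + 1) * (c / 32))"
    proof -
      have "m' \<le> m" by (simp add: m_def)
      hence "q ^ m / (1 - q) \<le> c / 32" using m' less_imp_le by blast
      hence "real (j - i + 1) * (q ^ m / (1 - q)) \<le> real (j - i + 1) * (c / 32)" by (rule mult_left_mono) simp
      thus ?thesis by (intro mult_left_mono) auto
    qed
    also have "\<dots> = exp (c / 32) * exp (- (c / 32) * real (j - i))"
      unfolding exp_add[symmetric] by (rule arg_cong[of _ _ exp]) (simp add: algebra_simps)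
    finally show ?thesis .
  qed
  thus ?thesis using that[of m t "c / 32"] t c0 by (auto simp: m_def)
qed

text \<open>\<open>LLo\<close> increases with \<open>h\<close>, so the inverse weights of the gaps
  may be evaluated at \<open>h0\<close>. The power \<open>t\<close> is admissible because a
  probability is being bounded: if some term is at least 1, so is its power and the claim is
  trivial; otherwise every term is below its power.\<close>

lemma big_gaps_prob_le:
  assumes h: "h0 \<le> h" and t: "0 < t" "t \<le> 1" and ij: "i \<le> i'" "j' \<le> j"
  shows "(\<Sum>S | S \<in> paths i' j' \<and> j - i \<le> 8 * total_length (big_gaps m S). wt (bw p \<omega> h) S) \<le> Z i' j' h \<omega> * RR h0 m t i j \<omega>"
proof (cases "i' \<le> j'")
  case True
  let ?g = "bw p \<omega> h"
  define W where "W = (\<Sum>S | S \<in> paths i' j' \<and> j - i \<le> 8 * total_length (big_gaps m S). wt ?g S)"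
  define y where "y J = exp (- (\<Sum>(a, b)\<in>J. LLo h0 a b \<omega>))" for J
  have Z0: "0 < Z i' j' h \<omega>" by (rule Z_pos[OF True])
  have WZ: "W \<le> Z i' j' h \<omega>"
    unfolding W_def ZZ_def path_sum_def by (rule sum_mono2) (use wt_nonneg[OF pos_bw] in auto)
  have "W \<le> Z i' j' h \<omega> * (\<Sum>J\<in>gap_families m i j. \<Prod>(a, b)\<in>J. ?g a b / path_sum ?g a b)"
    unfolding W_def ZZ_def by (rule sum_many_big_gaps_le[OF pos_bw ij])
  also have "\<dots> \<le> Z i' j' h \<omega> * (\<Sum>J\<in>gap_families m i j. y J)"
  proof (intro mult_left_mono sum_mono less_imp_le[OF Z0])
    fix J assume J: "J \<in> gap_families m i j"
    have "(\<Prod>(a, b)\<in>J. ?g a b / path_sum ?g a b) \<le> (\<Prod>(a, b)\<in>J. exp (- LLo h0 a b \<omega>))"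
    proof (rule prod_mono, clarify)
      fix a b assume "(a, b) \<in> J"
      hence ab: "a < b" using gap_familyD(2)[OF J] by auto
      have Zab: "0 < Z a b h \<omega>" using Z_pos ab by simp
      have "?g a b / path_sum ?g a b = p (b - a) * exp (h + \<omega> b) / exp (LL h a b \<omega>)"
        unfolding LL_def using Zab by (simp add: bw_def ZZ_def)
      also have "\<dots> = p (b - a) * exp (- LLo h a b \<omega>)" unfolding LLo_def by (simp add: exp_diff)
      finally have e: "?g a b / path_sum ?g a b = p (b - a) * exp (- LLo h a b \<omega>)" .
      have pp: "0 < p (b - a)" using p_pos ab by simp
      have "p (b - a) * exp (- LLo h a b \<omega>) \<le> 1 * exp (- LLo h0 a b \<omega>)"
        using LLo_mono[OF ab h, of \<omega>] p_le_1[of "b - a"] pp by (intro mult_mono) auto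
      thus "0 \<le> ?g a b / path_sum ?g a b \<and> ?g a b / path_sum ?g a b \<le> exp (- LLo h0 a b \<omega>)"
        unfolding e using pp by simp
    qed
    also have "\<dots> = y J" unfolding y_def using gap_familyD(1)[OF J] by (simp add: exp_sum sum_negf[symmetric] case_prod_unfold)
    finally show "(\<Prod>(a, b)\<in>J. ?g a b / path_sum ?g a b) \<le> y J" .
  qed
  finally have W: "W / Z i' j' h \<omega> \<le> (\<Sum>J\<in>gap_families m i j. y J)" using Z0 by (simp add: divide_le_eq mult.commute)
  have RR: "RR h0 m t i j \<omega> = (\<Sum>J\<in>gap_families m i j. y J powr t)"
    unfolding RR_def y_def by (intro sum.cong refl) (simp add: powr_def)
  have "W / Z i' j' h \<omega> \<le> RR h0 m t i j \<omega>"
  proof (cases "\<exists>J\<in>gap_families m i j. 1 \<le> y J")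
    case True
    then obtain J where J: "J \<in> gap_families m i j" "1 \<le> y J" by auto
    have "1 \<le> y J powr t" using J(2) t by (simp add: ge_one_powr_ge_zero)
    also have "\<dots> \<le> RR h0 m t i j \<omega>" unfolding RR by (rule member_le_sum) (use J in auto)
    finally show ?thesis using WZ Z0 by (simp add: divide_le_eq order_trans[OF WZ])
  next
    case False
    have "y J \<le> y J powr t" if "J \<in> gap_families m i j" for J
    proof -
      have "0 < y J" "y J \<le> 1" using False that by (auto simp: y_def not_le intro: less_imp_le)
      thus ?thesis using powr_mono'[of t 1 "y J"] t by simp
    qed
    thus ?thesis using W unfolding RR by (meson order_trans sum_mono)
  qed
  thus ?thesis unfolding W_def using Z0 by (simp add: divide_le_eq mult.commute)
next
  case False
  hence "paths i' j' = {}" using path_le by blast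
  thus ?thesis by (simp add: ZZ_def path_sum_def)
qed

end

section \<open>Pairs of polymers that do not meet\<close>

context pinning
begin

lemma disj_sum_le:
  "disj_sum (bw p \<omega> h) i j i' j' \<le> Z i j h \<omega> * Z i' j' h \<omega>"
proof -
  have "disj_sum (bw p \<omega> h) i j i' j' \<le> (\<Sum>(S, S')\<in>paths i j \<times> paths i' j'. wt (bw p \<omega> h) S * wt (bw p \<omega> h) S')"
    unfolding disj_sum_def
    by (rule sum_mono2) (use wt_nonneg[OF pos_bw] in \<open>auto simp: disj_pairs_def\<close>)
  thus ?thesis unfolding ZZ_def path_sum_def by (simp add: sum_product sum.cartesian_product)
qed

text \<open>Either one of the two paths has many long gaps, or there are many points at which both
  have short gaps, unless too much of the disorder is used to make \<open>\<omega>\<close> very negative.\<close>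

lemma disj_sum_bound:
  assumes h: "h0 \<le> h" and t: "0 < t" "t \<le> 1" and ij: "i \<le> u" "u \<le> i + 1" "i \<le> u'" "u' \<le> i + 1"
    "j \<le> v + 1" "v \<le> j" "j \<le> v' + 1" "v' \<le> j"
    and \<epsilon>: "0 < \<epsilon>" "\<epsilon> \<le> 1" "\<forall>s s'. 1 \<le> s \<and> 1 \<le> s' \<and> s + s' < m \<longrightarrow> \<epsilon> \<le> p s * p s' * exp (h0 - K)"
    and K: "0 < K"
  shows "disj_sum (bw p \<omega> h) u v u' v' \<le> Z u v h \<omega> * Z u' v' h \<omega> *
     (2 * RR h0 m t i j \<omega> + exp ((\<Sum>x\<in>{i..j}. \<bar>\<omega> x\<bar>) - K * real (j - i) / 8) + 1 / (1 + \<epsilon>\<^sup>2 / 4) ^ ((j - i) div 8 - 3))"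
    (is "_ \<le> ?ZZ * (2 * ?R + ?b + ?e)")
proof -
  let ?g = "bw p \<omega> h"
  define k where "k = j - i"
  define X where "X = {x \<in> {i+2..j-2}. - K \<le> \<omega> x}"
  \<comment> \<open>Without two points at either end the interval still has \<open>k - 3\<close>
    points. Three exceptional sets, the bad points of each path and the sites of very negative
    disorder, take at most \<open>k / 8\<close> points each; \<open>G\<close> is a generous lower
    bound for the rest.\<close>
  define G where "G = k div 8 - 3"
  have Z0: "0 \<le> Z u v h \<omega>" "0 \<le> Z u' v' h \<omega>" unfolding ZZ_def by (rule path_sum_nonneg[OF pos_bw])+
  have R0: "0 \<le> ?R" by (rule RR_nonneg)
  have e0: "0 < ?e" by (intro divide_pos_pos zero_less_power add_pos_nonneg) auto
  show ?thesis
  \<comment> \<open>When the disorder is large on average, the middle term of the bound is at least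
    1 and the estimate is trivial. Otherwise few sites lie below \<open>- K\<close>.\<close>
  proof (cases "K * real k \<le> 8 * (\<Sum>x\<in>{i..j}. \<bar>\<omega> x\<bar>)")
    case True
    hence "1 \<le> ?b" unfolding k_def by simp
    hence "1 \<le> 2 * ?R + ?b + ?e" using R0 e0 by linarith
    hence "?ZZ * 1 \<le> ?ZZ * (2 * ?R + ?b + ?e)" using Z0 by (intro mult_left_mono) auto
    thus ?thesis using disj_sum_le[of \<omega> h u v u' v'] by linarith
  next
    case False
    have bad: "8 * card {x \<in> {i..j}. \<not> - K \<le> \<omega> x} \<le> k"
    proof -
      have "K * real (card {x \<in> {i..j}. \<not> - K \<le> \<omega> x}) = (\<Sum>x\<in>{x \<in> {i..j}. \<not> - K \<le> \<omega> x}. K)" by simp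
      also have "\<dots> \<le> (\<Sum>x\<in>{x \<in> {i..j}. \<not> - K \<le> \<omega> x}. \<bar>\<omega> x\<bar>)" by (rule sum_mono) auto
      also have "\<dots> \<le> (\<Sum>x\<in>{i..j}. \<bar>\<omega> x\<bar>)" by (rule sum_mono2) auto
      finally have "K * (8 * real (card {x \<in> {i..j}. \<not> - K \<le> \<omega> x})) \<le> K * real k" using False by simp
      hence "8 * real (card {x \<in> {i..j}. \<not> - K \<le> \<omega> x}) \<le> real k" using K by simp
      thus ?thesis by linarith
    qed
    let ?big = "\<lambda>S. k \<le> 8 * total_length (big_gaps m S)"
    define good_pairs where "good_pairs = {(S, S'). (S, S') \<in> disj_pairs u v u' v' \<and> G \<le> card {x \<in> X. good m S x \<and> good m S' x}}"
    define B1 where "B1 = {S. S \<in> paths u v \<and> ?big S} \<times> paths u' v'"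
    define B2 where "B2 = paths u v \<times> {S. S \<in> paths u' v' \<and> ?big S}"
    have fin: "finite good_pairs" "finite B1" "finite B2"
      unfolding good_pairs_def B1_def B2_def by (auto intro: finite_subset[of _ "disj_pairs u v u' v'"])
    have cover: "disj_pairs u v u' v' \<subseteq> good_pairs \<union> (B1 \<union> B2)"
    proof (rule subrelI)
      fix S S' assume d: "(S, S') \<in> disj_pairs u v u' v'"
      hence S: "S \<in> paths u v" and S': "S' \<in> paths u' v'" by (auto simp: disj_pairs_def)
      show "(S, S') \<in> good_pairs \<union> (B1 \<union> B2)"
      proof (cases "?big S \<or> ?big S'")
        case True thus ?thesis using S S' unfolding B1_def B2_def by auto
      next
        case False
        have c1: "8 * card {x \<in> {u..v}. \<not> good m S x} < k" using card_not_good_le[OF S, of m] False by linarith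
        have c2: "8 * card {x \<in> {u'..v'}. \<not> good m S' x} < k" using card_not_good_le[OF S', of m] False by linarith
        have "{i+2..j-2} \<subseteq> {x \<in> X. good m S x \<and> good m S' x} \<union> ({x \<in> {u..v}. \<not> good m S x} \<union> ({x \<in> {u'..v'}. \<not> good m S' x} \<union> {x \<in> {i..j}. \<not> - K \<le> \<omega> x}))"
        proof
          fix x assume x: "x \<in> {i+2..j-2}"
          hence "x \<in> {u..v}" "x \<in> {u'..v'}" "x \<in> {i..j}" using ij by auto
          thus "x \<in> {x \<in> X. good m S x \<and> good m S' x} \<union> ({x \<in> {u..v}. \<not> good m S x} \<union> ({x \<in> {u'..v'}. \<not> good m S' x} \<union> {x \<in> {i..j}. \<not> - K \<le> \<omega> x}))"
            using x unfolding X_def by blast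
        qed
        hence "card {i+2..j-2} \<le> card ({x \<in> X. good m S x \<and> good m S' x} \<union> ({x \<in> {u..v}. \<not> good m S x} \<union> ({x \<in> {u'..v'}. \<not> good m S' x} \<union> {x \<in> {i..j}. \<not> - K \<le> \<omega> x})))"
          by (rule card_mono[rotated]) (auto simp: X_def)
        also have "\<dots> \<le> card {x \<in> X. good m S x \<and> good m S' x} + (card {x \<in> {u..v}. \<not> good m S x} + (card {x \<in> {u'..v'}. \<not> good m S' x} + card {x \<in> {i..j}. \<not> - K \<le> \<omega> x}))"
          by (intro order_trans[OF card_Un_le] add_mono order_refl)
        finally have c: "card {i+2..j-2} \<le> card {x \<in> X. good m S x \<and> good m S' x} + (card {x \<in> {u..v}. \<not> good m S x} + (card {x \<in> {u'..v'}. \<not> good m S' x} + card {x \<in> {i..j}. \<not> - K \<le> \<omega> x}))" .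
        have "G \<le> card {x \<in> X. good m S x \<and> good m S' x}"
        proof (cases "G = 0")
          case G0: False
          hence "k \<le> card {i+2..j-2} + 3" unfolding G_def k_def by simp
          thus ?thesis using c c1 c2 bad unfolding G_def by linarith
        qed simp
        thus ?thesis using d unfolding good_pairs_def by auto
      qed
    qed
    let ?w = "\<lambda>y. wt ?g (fst y) * wt ?g (snd y)"
    have wn: "0 \<le> ?w y" for y using wt_nonneg[OF pos_bw] by simp
    have "disj_sum ?g u v u' v' = sum ?w (disj_pairs u v u' v')" unfolding disj_sum_def by (simp add: case_prod_unfold)
    also have "\<dots> \<le> sum ?w (good_pairs \<union> (B1 \<union> B2))" by (rule sum_mono2) (use fin cover wn in auto)
    also have "\<dots> \<le> sum ?w good_pairs + (sum ?w B1 + sum ?w B2)"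
    proof -
      have u: "sum ?w (A \<union> B) \<le> sum ?w A + sum ?w B" if "finite A" "finite B" for A B
        using sum.union_inter[OF that, of ?w] sum_nonneg[of "A \<inter> B" ?w] wn by simp
      show ?thesis using u[of good_pairs "B1 \<union> B2"] u[of B1 B2] fin by simp
    qed
    also have "\<dots> \<le> ?ZZ * ?e + (?ZZ * ?R + ?ZZ * ?R)"
    proof (intro add_mono)
      have "sum ?w good_pairs * (1 + \<epsilon>\<^sup>2 / 4) ^ G \<le> path_sum ?g u v * path_sum ?g u' v'"
      proof -
        have "(\<Sum>(S, S')\<in>good_pairs. wt ?g S * wt ?g S') * (1 + \<epsilon>\<^sup>2 / 4) ^ G \<le> path_sum ?g u v * path_sum ?g u' v'"
          unfolding good_pairs_def
        proof (rule disjoint_pairs_good_le[OF pos_bw \<epsilon>(1,2)])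
          show "\<forall>a x b. a < x \<and> x < b \<and> b - a < m \<and> x \<in> X \<longrightarrow> \<epsilon> * ?g a b \<le> ?g a x * ?g x b"
          proof (intro allI impI, elim conjE)
            fix a x b assume h': "a < x" "x < b" "b - a < m" "x \<in> X"
            have "\<epsilon> \<le> p (x - a) * p (b - x) * exp (h0 - K)" 
            proof -
              have "1 \<le> x - a \<and> 1 \<le> b - x \<and> x - a + (b - x) < m" using h' by linarith
              thus ?thesis using \<epsilon>(3) by blast
            qed
            also have "\<dots> \<le> p (x - a) * p (b - x) * exp (h + \<omega> x)"
            proof (rule mult_left_mono)
              show "exp (h0 - K) \<le> exp (h + \<omega> x)" using h h' by (simp add: X_def)
              show "0 \<le> p (x - a) * p (b - x)" using p_pos h' by (auto intro!: mult_nonneg_nonneg less_imp_le)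
            qed
            finally have 1: "\<epsilon> * p (b - a) \<le> (p (x - a) * p (b - x) * exp (h + \<omega> x)) * 1"
              using p_le_1[of "b - a"] less_imp_le[OF p_pos[rule_format, of "b - a"]] h' \<epsilon>(1)
              by (intro mult_mono) auto
            have "\<epsilon> * p (b - a) * exp (h + \<omega> b) \<le> (p (x - a) * p (b - x) * exp (h + \<omega> x)) * 1 * exp (h + \<omega> b)"
              by (rule mult_right_mono[OF 1]) simp
            thus "\<epsilon> * ?g a b \<le> ?g a x * ?g x b" by (simp add: bw_def mult_ac)
          qed
        qed (auto simp: X_def)
        thus ?thesis by (simp add: case_prod_unfold)
      qed
      moreover have "0 < (1 + \<epsilon>\<^sup>2 / 4) ^ G" by (intro zero_less_power add_pos_nonneg) auto
      ultimately show "sum ?w good_pairs \<le> ?ZZ * ?e" unfolding G_def k_def ZZ_def by (simp add: pos_le_divide_eq)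
      have "sum ?w B1 = (\<Sum>S | S \<in> paths u v \<and> ?big S. wt ?g S) * Z u' v' h \<omega>"
        unfolding B1_def ZZ_def path_sum_def by (simp add: sum_product sum.cartesian_product case_prod_unfold)
      also have "\<dots> \<le> (Z u v h \<omega> * ?R) * Z u' v' h \<omega>"
        unfolding k_def by (rule mult_right_mono[OF big_gaps_prob_le[OF h t] Z0(2)]) (use ij in auto)
      finally show "sum ?w B1 \<le> ?ZZ * ?R" by (simp add: mult_ac)
      have "sum ?w B2 = Z u v h \<omega> * (\<Sum>S | S \<in> paths u' v' \<and> ?big S. wt ?g S)"
        unfolding B2_def ZZ_def path_sum_def by (simp add: sum_product sum.cartesian_product case_prod_unfold)
      also have "\<dots> \<le> Z u v h \<omega> * (Z u' v' h \<omega> * ?R)"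
        unfolding k_def by (rule mult_left_mono[OF big_gaps_prob_le[OF h t] Z0(1)]) (use ij in auto)
      finally show "sum ?w B2 \<le> ?ZZ * ?R" by (simp add: mult_ac)
    qed
    also have "\<dots> = ?ZZ * (2 * ?R + 0 + ?e)" by (simp add: algebra_simps)
    also have "\<dots> \<le> ?ZZ * (2 * ?R + ?b + ?e)"
      using Z0 by (intro mult_left_mono) auto
    finally show ?thesis .
  qed
qed

text \<open>Only finitely many gap lengths occur, so a minimum of finitely many positive values
  suffices.\<close>

lemma exists_insertion_cost:
  obtains \<epsilon> where "0 < \<epsilon>" "\<epsilon> \<le> 1" "\<forall>s s'. 1 \<le> s \<and> 1 \<le> s' \<and> s + s' < m \<longrightarrow> \<epsilon> \<le> p s * p s' * exp (h - K)"
proof -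
  define A where "A = insert 1 (p ` {1..m})"
  define q where "q = Min A"
  have A: "finite A" "A \<noteq> {}" unfolding A_def by auto
  have q0: "0 < q" unfolding q_def using Min_in[OF A] p_pos unfolding A_def by fastforce
  have qle: "q \<le> p s" if "1 \<le> s" "s \<le> m" for s
    unfolding q_def by (rule Min_le) (use that in \<open>auto simp: A_def\<close>)
  define \<epsilon> where "\<epsilon> = min 1 (q * q * exp (h - K))"
  have "\<epsilon> \<le> p s * p s' * exp (h - K)" if "1 \<le> s" "1 \<le> s'" "s + s' < m" for s s'
  proof -
    have "q * q \<le> p s * p s'" using qle[of s] qle[of s'] q0 that by (intro mult_mono) auto
    hence "q * q * exp (h - K) \<le> p s * p s' * exp (h - K)" by (rule mult_right_mono) simp
    moreover have "\<epsilon> \<le> q * q * exp (h - K)" by (simp add: \<epsilon>_def)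
    ultimately show ?thesis by (rule order_trans[rotated])
  qed
  moreover have "0 < \<epsilon>" "\<epsilon> \<le> 1" unfolding \<epsilon>_def using q0 by auto
  ultimately show ?thesis using that by blast
qed

text \<open>The dominating \<open>Q\<close> is free of \<open>h\<close>. A single exceptional null
  set then serves all \<open>h \<ge> h0\<close>, and the bounds on the derivatives of the means are
  uniform in \<open>h\<close>.\<close>

lemma meet_defect_decay:
  assumes FE0: "0 < FE h0"
  obtains Q C c where "0 < c" "0 < C" "\<And>i j. integrable D (Q i j)" "\<And>i j \<omega>. 0 \<le> Q i j \<omega>"
    "\<And>i j. expectation (Q i j) \<le> C * exp (- c * real (j - i))"
    "\<And>i j h \<omega>. h0 \<le> h \<Longrightarrow> i + 2 \<le> j \<Longrightarrow> meet_defect p \<omega> i j (i+1) (j-1) h + meet_defect p \<omega> i (j-1) (i+1) j h \<le> Q i j \<omega>"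
proof -
  obtain m t c1 where mt: "1 \<le> m" "0 < t" "t \<le> 1" "0 < c1"
    "\<And>i j. expectation (RR h0 m t i j) \<le> exp c1 * exp (- c1 * real (j - i))"
    by (rule expectation_RR_le[OF FE0]) (rule that)
  \<comment> \<open>The exponential moment of the sum of the absolute values grows at the rate
    \<open>ln 2 + gbar\<close> per site; \<open>K / 8\<close> exceeds this rate by 1.\<close>
  define K where "K = 8 * (ln 2 + gbar + 1)"
  have K: "0 < K" unfolding K_def using gbar_nonneg by (simp add: add_nonneg_pos)
  obtain \<epsilon> where \<epsilon>: "0 < \<epsilon>" "\<epsilon> \<le> 1" "\<forall>s s'. 1 \<le> s \<and> 1 \<le> s' \<and> s + s' < m \<longrightarrow> \<epsilon> \<le> p s * p s' * exp (h0 - K)"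
    by (rule exists_insertion_cost[of m h0 K]) (rule that)
  define l where "l = ln (1 + \<epsilon>\<^sup>2 / 4)"
  have l0: "0 < l" unfolding l_def by (rule ln_gt_zero) (use \<epsilon>(1) in simp)
  define Q where "Q i j \<omega> = 2 * (2 * RR h0 m t i j \<omega> + exp ((\<Sum>x\<in>{i..j}. \<bar>\<omega> x\<bar>) - K * real (j - i) / 8) + 1 / (1 + \<epsilon>\<^sup>2 / 4) ^ ((j - i) div 8 - 3))" for i j and \<omega> :: "nat \<Rightarrow> real"
  \<comment> \<open>The smallest of three rates: long gaps, large disorder, and failed insertions,
    of which there is about one per eight sites.\<close>
  define c where "c = min c1 (min 1 (l / 8))"
  define C where "C = 2 * (2 * exp c1 + 2 * exp gbar + exp (4 * l))"
  have ei: "integrable D (\<lambda>\<omega>. exp (\<Sum>x\<in>{i..j}. \<bar>\<omega> x\<bar>))" for i j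
    using exp_abs_sum(1)[of "{i..j}" 1] by simp
  have ei': "integrable D (\<lambda>\<omega>. exp ((\<Sum>x\<in>{i..j}. \<bar>\<omega> x\<bar>) - K * real (j - i) / 8))" for i j
    unfolding exp_diff using ei by simp
  have b0: "0 < 1 + \<epsilon>\<^sup>2 / 4" by (intro add_pos_nonneg) auto
  show ?thesis
  proof (rule that[of c C Q])
    show "0 < c" unfolding c_def using mt l0 by simp
    show "0 < C" unfolding C_def by (intro mult_pos_pos add_pos_pos) auto
    show "integrable D (Q i j)" for i j unfolding Q_def
      by (intro integrable_mult_right Bochner_Integration.integrable_add RR_integrable ei' integrable_const)
    show "0 \<le> Q i j \<omega>" for i j \<omega> unfolding Q_def using RR_nonneg[of h0 m t i j \<omega>] b0 by auto
    show "expectation (Q i j) \<le> C * exp (- c * real (j - i))" for i j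
    proof -
      let ?k = "real (j - i)"
      have "expectation (Q i j) = 2 * (2 * expectation (RR h0 m t i j) + expectation (\<lambda>\<omega>. exp ((\<Sum>x\<in>{i..j}. \<bar>\<omega> x\<bar>) - K * ?k / 8)) + 1 / (1 + \<epsilon>\<^sup>2 / 4) ^ ((j - i) div 8 - 3))"
        unfolding Q_def using RR_integrable ei' by (simp add: prob_space[unfolded space_D])
      moreover have "expectation (RR h0 m t i j) \<le> exp c1 * exp (- c * ?k)"
        by (rule order_trans[OF mt(5)]) (auto simp: c_def intro!: mult_right_mono)
      moreover have "expectation (\<lambda>\<omega>. exp ((\<Sum>x\<in>{i..j}. \<bar>\<omega> x\<bar>) - K * ?k / 8)) \<le> 2 * exp gbar * exp (- c * ?k)"
      proof (cases "i \<le> j")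
        case True
        have "expectation (\<lambda>\<omega>. exp ((\<Sum>x\<in>{i..j}. \<bar>\<omega> x\<bar>) - K * ?k / 8)) = expectation (\<lambda>\<omega>. exp (\<Sum>x\<in>{i..j}. \<bar>\<omega> x\<bar>)) * exp (- K * ?k / 8)"
        proof -
          have "exp (y - K * ?k / 8) = exp y * exp (- K * ?k / 8)" for y by (simp add: exp_add[symmetric])
          thus ?thesis by (simp only: integral_mult_left_zero)
        qed
        also have "\<dots> \<le> (2 * exp gbar) ^ card {i..j} * exp (- K * ?k / 8)"
          using exp_abs_sum(2)[of "{i..j}" 1] by (intro mult_right_mono) auto
        also have "(2 * exp gbar) ^ card {i..j} = exp ((ln 2 + gbar) * (?k + 1))"
        proof -
          have 1: "2 * exp gbar = exp (ln 2 + gbar)" by (simp add: exp_add)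
          have 2: "?k + 1 = real (card {i..j})" using True by (simp add: of_nat_diff)
          show ?thesis unfolding 1 2 by (simp only: exp_of_nat_mult mult.commute)
        qed
        also have "\<dots> * exp (- K * ?k / 8) = 2 * exp gbar * exp (- ?k)"
        proof -
          have "(ln 2 + gbar) * (?k + 1) + - K * ?k / 8 = ln 2 + gbar + - ?k" unfolding K_def by (simp add: field_simps)
          hence "exp ((ln 2 + gbar) * (?k + 1)) * exp (- K * ?k / 8) = exp (ln 2 + gbar + - ?k)" by (simp only: exp_add[symmetric])
          moreover have "exp (ln 2 + gbar + - ?k) = 2 * exp gbar * exp (- ?k)" unfolding exp_add by simp
          ultimately show ?thesis by (simp only:)
        qed
        also have "\<dots> \<le> 2 * exp gbar * exp (- c * ?k)"
        proof -
          have "c * ?k \<le> 1 * ?k" by (rule mult_right_mono) (auto simp: c_def)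
          thus ?thesis by simp
        qed
        finally show ?thesis .
      next
        case False
        have "1 \<le> 2 * exp gbar" using gbar_nonneg one_le_exp_iff[of gbar] by linarith
        thus ?thesis using False by (simp add: prob_space[unfolded space_D])
      qed
      moreover have "1 / (1 + \<epsilon>\<^sup>2 / 4) ^ ((j - i) div 8 - 3) \<le> exp (4 * l) * exp (- c * ?k)"
      proof -
        have "1 / (1 + \<epsilon>\<^sup>2 / 4) ^ ((j - i) div 8 - 3) = exp (- l * real ((j - i) div 8 - 3))"
        proof -
          have el: "1 + \<epsilon>\<^sup>2 / 4 = exp l" unfolding l_def using b0 by simp
          show ?thesis by (simp only: el mult_minus_left exp_minus exp_of_nat2_mult inverse_eq_divide)
        qed
        also have "\<dots> \<le> exp (4 * l + - c * ?k)"
        proof (subst exp_le_cancel_iff)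
          have "?k / 8 - 4 \<le> real ((j - i) div 8 - 3)" by linarith
          hence "l * (?k / 8 - 4) \<le> l * real ((j - i) div 8 - 3)" using l0 by (intro mult_left_mono) auto
          moreover have "c * ?k \<le> l / 8 * ?k" by (rule mult_right_mono) (auto simp: c_def)
          ultimately show "- l * real ((j - i) div 8 - 3) \<le> 4 * l + - c * ?k" by (simp add: algebra_simps)
        qed
        finally show ?thesis by (simp only: exp_add)
      qed
      moreover have "x \<le> 2 * (2 * a' + b' + d')" if "x = 2 * (2 * a + b + d)" "a \<le> a'" "b \<le> b'" "d \<le> d'" for x a b d a' b' d' :: real
        using that by argo
      ultimately have "expectation (Q i j) \<le> 2 * (2 * (exp c1 * exp (- c * ?k)) + 2 * exp gbar * exp (- c * ?k) + exp (4 * l) * exp (- c * ?k))"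
        by presburger
      thus ?thesis unfolding C_def by (simp add: algebra_simps)
    qed
    show "meet_defect p \<omega> i j (i+1) (j-1) h + meet_defect p \<omega> i (j-1) (i+1) j h \<le> Q i j \<omega>"
      if h: "h0 \<le> h" and ij: "i + 2 \<le> j" for i j h \<omega>
    proof -
      let ?q = "2 * RR h0 m t i j \<omega> + exp ((\<Sum>x\<in>{i..j}. \<bar>\<omega> x\<bar>) - K * real (j - i) / 8) + 1 / (1 + \<epsilon>\<^sup>2 / 4) ^ ((j - i) div 8 - 3)"
      have md: "meet_defect p \<omega> u v u' v' h \<le> ?q"
        if "i \<le> u" "u \<le> i + 1" "i \<le> u'" "u' \<le> i + 1" "j \<le> v + 1" "v \<le> j" "j \<le> v' + 1" "v' \<le> j" for u v u' v'
      proof -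
        have "u \<le> v" "u' \<le> v'" using that ij by auto
        hence Zp: "0 < Z u v h \<omega> * Z u' v' h \<omega>" using Z_pos by (intro mult_pos_pos) auto
        show ?thesis unfolding meet_defect_def[OF p_pos]
          using disj_sum_bound[OF h mt(2,3) that \<epsilon> K, where \<omega> = \<omega>] Zp
          by (simp only: pos_divide_le_eq mult.commute)
      qed
      show ?thesis unfolding Q_def using md[of i "i+1" j "j-1"] md[of i "i+1" "j-1" j] ij by simp
    qed
  qed
qed

end

section \<open>Convergence of derivatives\<close>

lemma quadratic_remainder_bound:
  fixes g g1 g2 :: "real \<Rightarrow> real"
  assumes d1: "\<And>z. z \<in> closed_segment x y \<Longrightarrow> (g has_real_derivative g1 z) (at z)"
    and d2: "\<And>z. z \<in> closed_segment x y \<Longrightarrow> (g1 has_real_derivative g2 z) (at z)"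
    and M: "\<And>z. z \<in> closed_segment x y \<Longrightarrow> \<bar>g2 z\<bar> \<le> M"
  shows "\<bar>g y - g x - (y - x) * g1 x\<bar> \<le> M * (y - x)\<^sup>2"
proof -
  have M0: "0 \<le> M" using M[of x] by simp
  have lip: "norm (g1 z - g1 x) \<le> M * norm (z - x)" if z: "z \<in> closed_segment x y" for z
  proof (rule field_differentiable_bound[of "closed_segment x y" g1 g2])
    show "(g1 has_field_derivative g2 w) (at w within closed_segment x y)" if "w \<in> closed_segment x y" for w
      using d2[OF that] by (rule DERIV_subset) simp
  qed (use M z in auto)
  have "norm ((g y - y * g1 x) - (g x - x * g1 x)) \<le> (M * \<bar>y - x\<bar>) * norm (y - x)"
  proof (rule field_differentiable_bound[of "closed_segment x y" "\<lambda>z. g z - z * g1 x" "\<lambda>z. g1 z - g1 x"])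
    show "((\<lambda>z. g z - z * g1 x) has_field_derivative g1 w - g1 x) (at w within closed_segment x y)"
      if "w \<in> closed_segment x y" for w
      using DERIV_subset[OF d1[OF that]] by (auto intro!: derivative_eq_intros)
    show "norm (g1 w - g1 x) \<le> M * \<bar>y - x\<bar>" if "w \<in> closed_segment x y" for w
    proof -
      have "\<bar>w - x\<bar> \<le> \<bar>y - x\<bar>" using that by (auto simp: closed_segment_eq_real_ivl split: if_splits)
      thus ?thesis using lip[OF that] M0 mult_left_mono[of "\<bar>w - x\<bar>" "\<bar>y - x\<bar>" M] by simp
    qed
  qed auto
  moreover have "(g y - y * g1 x) - (g x - x * g1 x) = g y - g x - (y - x) * g1 x" by (simp add: algebra_simps)
  moreover have "(M * \<bar>y - x\<bar>) * norm (y - x) = M * (y - x)\<^sup>2" by (simp add: power2_eq_square)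
  ultimately show ?thesis by (simp only: real_norm_def)
qed

text \<open>A quadratic remainder bound with a uniform constant survives limits and expectations;
  here the derivative is recovered from it.\<close>

lemma has_real_derivative_from_remainder:
  fixes g :: "real \<Rightarrow> real"
  assumes e: "0 < e" and le: "\<And>y. \<bar>y - x\<bar> < e \<Longrightarrow> \<bar>g y - g x - (y - x) * d\<bar> \<le> M * (y - x)\<^sup>2"
  shows "(g has_real_derivative d) (at x)"
proof -
  have q: "\<bar>(g y - g x) / (y - x) - d\<bar> \<le> M * \<bar>y - x\<bar>" if "y \<noteq> x" "\<bar>y - x\<bar> < e" for y
  proof -
    have "\<bar>(g y - g x) / (y - x) - d\<bar> = \<bar>g y - g x - (y - x) * d\<bar> / \<bar>y - x\<bar>"
      using that(1) by (simp add: field_simps flip: abs_divide)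
    also have "\<dots> \<le> M * (y - x)\<^sup>2 / \<bar>y - x\<bar>" by (rule divide_right_mono[OF le[OF that(2)]]) simp
    also have "\<dots> = M * \<bar>y - x\<bar>"
    proof -
      have 1: "(y - x)\<^sup>2 = \<bar>y - x\<bar> * \<bar>y - x\<bar>" by (simp add: power2_eq_square)
      have gen: "M * (t * t) / t = M * t" if "t \<noteq> 0" for t using that by simp
      show ?thesis unfolding 1 by (rule gen) (use that(1) in simp)
    qed
    finally show ?thesis .
  qed
  have "((\<lambda>y. (g y - g x) / (y - x) - d) \<longlongrightarrow> 0) (at x)"
  proof (rule Lim_null_comparison)
    show "\<forall>\<^sub>F y in at x. norm ((g y - g x) / (y - x) - d) \<le> M * \<bar>y - x\<bar>"
      unfolding eventually_at using e q by (intro exI[of _ e]) (auto simp: dist_real_def)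
    have "((\<lambda>y. M * \<bar>y - x\<bar>) \<longlongrightarrow> M * \<bar>x - x\<bar>) (at x)" by (intro tendsto_intros)
    thus "((\<lambda>y. M * \<bar>y - x\<bar>) \<longlongrightarrow> 0) (at x)" by simp
  qed
  hence "((\<lambda>y. (g y - g x) / (y - x)) \<longlongrightarrow> d) (at x)" by (simp add: LIM_zero_iff)
  thus ?thesis by (simp add: has_field_derivative_iff)
qed

text \<open>Bounded second derivatives make difference quotients approximate the first derivatives
  uniformly in \<open>n\<close>. Convergence thus passes from each order to the next, and the
  remainder bound, taken to the limit, identifies the new limit as a derivative.\<close>

lemma smooth_limit:
  fixes U :: "nat \<Rightarrow> nat \<Rightarrow> real \<Rightarrow> real"
  assumes D: "\<And>r n h. a < h \<Longrightarrow> (U r n has_real_derivative U (Suc r) n h) (at h)"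
    and B: "\<And>r. 1 \<le> r \<Longrightarrow> \<exists>M. \<forall>n\<ge>1. \<forall>h>a. \<bar>U r n h\<bar> \<le> M"
    and L: "\<And>h. a < h \<Longrightarrow> (\<lambda>n. U 0 n h) \<longlonglongrightarrow> f h"
    and h: "a < h"
  shows "(\<lambda>n. U r n h) \<longlonglongrightarrow> (deriv ^^ r) f h"
    and "((deriv ^^ r) f has_real_derivative (deriv ^^ Suc r) f h) (at h)"
proof -
  have rem: "\<exists>M\<ge>0. \<forall>n\<ge>1. \<forall>x>a. \<forall>y>a. \<bar>U r n y - U r n x - (y - x) * U (Suc r) n x\<bar> \<le> M * (y - x)\<^sup>2" for r
  proof -
    obtain M where M: "\<And>n h. 1 \<le> n \<Longrightarrow> a < h \<Longrightarrow> \<bar>U (Suc (Suc r)) n h\<bar> \<le> M" using B[of "Suc (Suc r)"] by auto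
    have "\<bar>U r n y - U r n x - (y - x) * U (Suc r) n x\<bar> \<le> M * (y - x)\<^sup>2" if "1 \<le> n" "a < x" "a < y" for n x y
    proof (rule quadratic_remainder_bound)
      fix z assume "z \<in> closed_segment x y"
      hence z: "a < z" using that by (auto simp: closed_segment_eq_real_ivl split: if_splits)
      show "(U r n has_real_derivative U (Suc r) n z) (at z)" "(U (Suc r) n has_real_derivative U (Suc (Suc r)) n z) (at z)"
        "\<bar>U (Suc (Suc r)) n z\<bar> \<le> M" using D M z that by auto
    qed
    moreover have "0 \<le> M" using M[of 1 "a + 1"] by simp
    ultimately show ?thesis by blast
  qed
  have step: "(\<forall>x>a. (\<lambda>n. U (Suc r) n x) \<longlonglongrightarrow> (deriv ^^ Suc r) f x) \<and> (\<forall>x>a. ((deriv ^^ r) f has_real_derivative (deriv ^^ Suc r) f x) (at x))"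
    if c: "\<And>x. a < x \<Longrightarrow> (\<lambda>n. U r n x) \<longlonglongrightarrow> (deriv ^^ r) f x" for r
  proof -
    obtain M where M0: "0 \<le> M" and M: "\<And>n x y. 1 \<le> n \<Longrightarrow> a < x \<Longrightarrow> a < y \<Longrightarrow> \<bar>U r n y - U r n x - (y - x) * U (Suc r) n x\<bar> \<le> M * (y - x)\<^sup>2"
      using rem[of r] by blast
    have conv: "convergent (\<lambda>n. U (Suc r) n x)" if x: "a < x" for x
    proof (rule Cauchy_convergent, rule CauchyI)
      fix e :: real assume e: "0 < e"
      define d where "d = e / (4 * (M + 1))"
      have d: "0 < d" "M * d \<le> e / 4"
      proof -
        show "0 < d" unfolding d_def using e M0 by simp
        have "M * d \<le> (M + 1) * d" using \<open>0 < d\<close> by simp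
        also have "\<dots> = e / 4" unfolding d_def using M0 by (simp add: field_simps)
        finally show "M * d \<le> e / 4" .
      qed
      let ?q = "\<lambda>n. (U r n (x + d) - U r n x) / d"
      have close: "\<bar>U (Suc r) n x - ?q n\<bar> \<le> e / 4" if n: "1 \<le> n" for n
      proof -
        have "\<bar>U r n (x + d) - U r n x - d * U (Suc r) n x\<bar> \<le> M * d\<^sup>2" using M[OF n x, of "x + d"] x d by simp
        hence "\<bar>U r n (x + d) - U r n x - d * U (Suc r) n x\<bar> / d \<le> M * d\<^sup>2 / d" using d by (intro divide_right_mono) auto
        moreover have "\<bar>U (Suc r) n x - ?q n\<bar> = \<bar>U r n (x + d) - U r n x - d * U (Suc r) n x\<bar> / d"
        proof -
          have "U (Suc r) n x - ?q n = - ((U r n (x + d) - U r n x - d * U (Suc r) n x) / d)" using d by (simp add: field_simps)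
          thus ?thesis using d by (simp add: abs_divide)
        qed
        moreover have "M * d\<^sup>2 / d = M * d" using d by (simp add: power2_eq_square)
        ultimately show ?thesis using d by linarith
      qed
      have "?q \<longlonglongrightarrow> ((deriv ^^ r) f (x + d) - (deriv ^^ r) f x) / d"
        using c[of x] c[of "x + d"] x d by (intro tendsto_intros) auto
      hence "Cauchy ?q" by (rule LIMSEQ_imp_Cauchy)
      then obtain N where N: "\<And>m n. N \<le> m \<Longrightarrow> N \<le> n \<Longrightarrow> norm (?q m - ?q n) < e / 4"
        using CauchyD[of ?q "e / 4"] e by auto
      show "\<exists>N. \<forall>m\<ge>N. \<forall>n\<ge>N. norm (U (Suc r) m x - U (Suc r) n x) < e"
      proof (intro exI[of _ "max N 1"] allI impI)
        fix m n assume mn: "max N 1 \<le> m" "max N 1 \<le> n"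
        have "\<bar>?q m - ?q n\<bar> < e / 4" "\<bar>U (Suc r) m x - ?q m\<bar> \<le> e / 4" "\<bar>U (Suc r) n x - ?q n\<bar> \<le> e / 4"
          using N[of m n] close[of m] close[of n] mn by auto
        thus "norm (U (Suc r) m x - U (Suc r) n x) < e" unfolding real_norm_def using e by linarith
      qed
    qed
    define g where "g x = lim (\<lambda>n. U (Suc r) n x)" for x
    have g: "(\<lambda>n. U (Suc r) n x) \<longlonglongrightarrow> g x" if "a < x" for x
      unfolding g_def using conv[OF that] by (simp add: convergent_LIMSEQ_iff)
    have der: "((deriv ^^ r) f has_real_derivative g x) (at x)" if x: "a < x" for x
    proof (rule has_real_derivative_from_remainder[of "x - a"])
      fix y assume "\<bar>y - x\<bar> < x - a"
      hence y: "a < y" by linarith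
      have "(\<lambda>n. \<bar>U r n y - U r n x - (y - x) * U (Suc r) n x\<bar>) \<longlonglongrightarrow> \<bar>(deriv ^^ r) f y - (deriv ^^ r) f x - (y - x) * g x\<bar>"
        using c[OF x] c[OF y] g[OF x] by (intro tendsto_intros)
      thus "\<bar>(deriv ^^ r) f y - (deriv ^^ r) f x - (y - x) * g x\<bar> \<le> M * (y - x)\<^sup>2"
        by (rule LIMSEQ_le_const2) (use M x y in \<open>auto intro!: exI[of _ 1]\<close>)
    qed (use x in simp)
    have "g x = (deriv ^^ Suc r) f x" if "a < x" for x using DERIV_imp_deriv[OF der[OF that]] by simp
    thus ?thesis using g der by auto
  qed
  have all: "(\<lambda>n. U r n x) \<longlonglongrightarrow> (deriv ^^ r) f x" if "a < x" for r x
    using that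
  proof (induction r arbitrary: x)
    case 0 thus ?case using L by simp
  next
    case (Suc r) thus ?case using step[of r] by blast
  qed
  show "(\<lambda>n. U r n h) \<longlonglongrightarrow> (deriv ^^ r) f h" by (rule all[OF h])
  show "((deriv ^^ r) f has_real_derivative (deriv ^^ Suc r) f h) (at h)" using step[OF all] h by blast
qed

text \<open>The common Lipschitz constant passes to the limit, so closeness on a sufficiently fine
  finite grid extends to the whole interval.\<close>

lemma uniform_of_pointwise_Lipschitz:
  fixes g :: "nat \<Rightarrow> real \<Rightarrow> real"
  assumes uv: "u < v" and lim: "\<And>x. x \<in> {u..v} \<Longrightarrow> (\<lambda>n. g n x) \<longlonglongrightarrow> f x"
    and lip: "\<And>n x y. 1 \<le> n \<Longrightarrow> x \<in> {u..v} \<Longrightarrow> y \<in> {u..v} \<Longrightarrow> \<bar>g n x - g n y\<bar> \<le> M * \<bar>x - y\<bar>" and e: "0 < e"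
  shows "eventually (\<lambda>n. \<forall>x\<in>{u..v}. \<bar>g n x - f x\<bar> < e) sequentially"
proof -
  have "0 \<le> M * \<bar>u - v\<bar>" by (rule order_trans[OF abs_ge_zero lip[of 1 u v]]) (use uv in auto)
  hence M0: "0 \<le> M" using uv by (simp add: zero_le_mult_iff)
  have lipf: "\<bar>f x - f y\<bar> \<le> M * \<bar>x - y\<bar>" if "x \<in> {u..v}" "y \<in> {u..v}" for x y
    by (rule LIMSEQ_le_const2[OF tendsto_rabs[OF tendsto_diff[OF lim[OF that(1)] lim[OF that(2)]]]])
       (use lip that in \<open>auto intro!: exI[of _ 1]\<close>)
  obtain N :: nat where N: "M * (v - u) * 4 / e < real N" using reals_Archimedean2 by blast
  define G where "G = (\<lambda>l. u + (v - u) * real l / real (Suc N)) ` {..Suc N}"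
  have G: "G \<subseteq> {u..v}"
  proof
    fix y assume "y \<in> G"
    then obtain l where l: "l \<le> Suc N" "y = u + (v - u) * real l / real (Suc N)" unfolding G_def by auto
    have "real l / real (Suc N) \<le> 1" using l by simp
    hence "(v - u) * (real l / real (Suc N)) \<le> (v - u) * 1" using uv by (intro mult_left_mono) auto
    moreover have "0 \<le> (v - u) * (real l / real (Suc N))" using uv by simp
    ultimately show "y \<in> {u..v}" using l(2) by simp
  qed
  have "eventually (\<lambda>n. \<forall>y\<in>G. \<bar>g n y - f y\<bar> < e / 2) sequentially"
  proof (rule eventually_ball_finite)
    show "\<forall>y\<in>G. eventually (\<lambda>n. \<bar>g n y - f y\<bar> < e / 2) sequentially"
    proof
      fix y assume "y \<in> G"
      hence "(\<lambda>n. \<bar>g n y - f y\<bar>) \<longlonglongrightarrow> \<bar>f y - f y\<bar>" using G lim by (intro tendsto_intros) auto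
      thus "eventually (\<lambda>n. \<bar>g n y - f y\<bar> < e / 2) sequentially" using e by (intro order_tendstoD(2)) auto
    qed
  qed (simp add: G_def)
  thus ?thesis using eventually_ge_at_top[of 1]
  proof eventually_elim
    case (elim n)
    show ?case
    proof
      fix x assume x: "x \<in> {u..v}"
      define l where "l = nat \<lfloor>(x - u) / (v - u) * real (Suc N)\<rfloor>"
      define y where "y = u + (v - u) * real l / real (Suc N)"
      have q: "0 \<le> (x - u) / (v - u)" "(x - u) / (v - u) \<le> 1" using x uv by auto
      have "0 \<le> (x - u) / (v - u) * real (Suc N)" by (rule mult_nonneg_nonneg[OF q(1)]) simp
      hence rl: "real l \<le> (x - u) / (v - u) * real (Suc N)" "(x - u) / (v - u) * real (Suc N) < real l + 1"
        unfolding l_def by linarith+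
      have "real l \<le> 1 * real (Suc N)" using rl(1) mult_right_mono[OF q(2), of "real (Suc N)"] by simp
      hence yG: "y \<in> G" unfolding y_def G_def by auto
      have "\<bar>x - y\<bar> \<le> (v - u) / real (Suc N)"
      proof -
        have "x - y = (v - u) * (((x - u) / (v - u) * real (Suc N) - real l) / real (Suc N))"
        proof -
          have 1: "(t * real (Suc N) - real l) / real (Suc N) = t - real l / real (Suc N)" for t
            by (simp add: diff_divide_distrib del: of_nat_Suc)
          have 2: "(v - u) * ((x - u) / (v - u)) = x - u" using uv by simp
          show ?thesis unfolding y_def 1 right_diff_distrib[of "v - u" "(x - u) / (v - u)"] 2 by simp
        qed
        moreover have "\<bar>((x - u) / (v - u) * real (Suc N) - real l) / real (Suc N)\<bar> \<le> 1 / real (Suc N)"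
          unfolding abs_divide using rl by (intro frac_le) auto
        ultimately show ?thesis using uv mult_left_mono[of "\<bar>((x - u) / (v - u) * real (Suc N) - real l) / real (Suc N)\<bar>" "1 / real (Suc N)" "v - u"]
          by (simp add: abs_mult)
      qed
      hence "M * \<bar>x - y\<bar> \<le> M * ((v - u) / real (Suc N))" using M0 by (rule mult_left_mono)
      also have "\<dots> < e / 4"
      proof -
        have "M * (v - u) * 4 / e < real (Suc N)" using N by simp
        thus ?thesis using e by (simp add: field_simps)
      qed
      finally have xy: "M * \<bar>x - y\<bar> < e / 4" .
      have "\<bar>g n x - g n y\<bar> \<le> M * \<bar>x - y\<bar>" "\<bar>f y - f x\<bar> \<le> M * \<bar>x - y\<bar>" "\<bar>g n y - f y\<bar> < e / 2"
        using lip[of n x y] lipf[of y x] elim yG x G by (auto simp: abs_minus_commute)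
      thus "\<bar>g n x - f x\<bar> < e" using xy by linarith
    qed
  qed
qed

text \<open>Landau--Kolmogorov interpolation: a polynomially small sequence whose derivatives grow more
  slowly than every power has polynomially small derivatives.\<close>

lemma interpolation_decay:
  fixes U :: "nat \<Rightarrow> nat \<Rightarrow> real \<Rightarrow> real"
  assumes uv: "u < v" and D: "\<And>r n h. h \<in> {u..v} \<Longrightarrow> (U r n has_real_derivative U (Suc r) n h) (at h)"
    and B: "\<And>r d. 1 \<le> r \<Longrightarrow> 0 < d \<Longrightarrow> \<exists>C. \<forall>n\<ge>1. \<forall>h\<in>{u..v}. \<bar>U r n h\<bar> \<le> C * real n powr d"
    and S: "\<exists>b>0. \<exists>C. \<forall>n\<ge>1. \<forall>h\<in>{u..v}. \<bar>U 0 n h\<bar> \<le> C * real n powr (- b)"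
  shows "\<exists>b>0. \<exists>C. \<forall>n\<ge>1. \<forall>h\<in>{u..v}. \<bar>U r n h\<bar> \<le> C * real n powr (- b)"
proof (induction r)
  case 0
  show ?case by (rule S)
next
  case (Suc r)
  obtain b C where b: "0 < b" and C: "\<And>n h. 1 \<le> n \<Longrightarrow> h \<in> {u..v} \<Longrightarrow> \<bar>U r n h\<bar> \<le> C * real n powr (- b)"
    using Suc by blast
  obtain C2 where C2: "\<And>n h. 1 \<le> n \<Longrightarrow> h \<in> {u..v} \<Longrightarrow> \<bar>U (Suc (Suc r)) n h\<bar> \<le> C2 * real n powr (b / 4)"
  proof -
    have "\<exists>C. \<forall>n\<ge>1. \<forall>h\<in>{u..v}. \<bar>U (Suc (Suc r)) n h\<bar> \<le> C * real n powr (b / 4)" by (rule B) (use b in auto)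
    thus ?thesis using that by blast
  qed
  have C0: "0 \<le> C" "0 \<le> C2" using C[of 1 u] C2[of 1 u] uv by auto
  define w where "w = (v - u) / 2"
  have w: "0 < w" using uv by (simp add: w_def)
  have "\<bar>U (Suc r) n x\<bar> \<le> (2 * C / w + C2 * w) * real n powr (- (b / 4))" if n: "1 \<le> n" and x: "x \<in> {u..v}" for n x
  proof -
    \<comment> \<open>With this step the difference quotient contributes the order
      \<open>n powr (- b/2)\<close> and the second derivative the order
      \<open>n powr (b/4 - b/2)\<close>; both are at most \<open>n powr (- b/4)\<close>. As
      \<open>w\<close> is half the length of the interval, a step of this size fits on one side of
      \<open>x\<close>.\<close>
    define \<eta> where "\<eta> = w * real n powr (- (b / 2))"
    have n0: "0 < real n" "1 \<le> real n" using n by auto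
    have p1: "real n powr (- (b / 2)) \<le> 1" using powr_mono[of "- (b / 2)" 0 "real n"] n0 b by simp
    have \<eta>: "0 < \<eta>" "\<eta> \<le> w" unfolding \<eta>_def using w n0 p1 mult_left_mono[OF p1, of w] by auto
    obtain y where y: "y \<in> {u..v}" "\<bar>y - x\<bar> = \<eta>"
    proof (cases "x \<le> (u + v) / 2")
      case True
      have "x + \<eta> \<in> {u..v}" using True x \<eta> unfolding w_def by auto
      thus ?thesis using that[of "x + \<eta>"] \<eta> by auto
    next
      case False
      have "x - \<eta> \<in> {u..v}" using False x \<eta> unfolding w_def by auto
      thus ?thesis using that[of "x - \<eta>"] \<eta> by auto
    qed
    have "\<bar>U r n y - U r n x - (y - x) * U (Suc r) n x\<bar> \<le> (C2 * real n powr (b / 4)) * (y - x)\<^sup>2"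
    proof (rule quadratic_remainder_bound)
      fix z assume "z \<in> closed_segment x y"
      hence z: "z \<in> {u..v}" using x y by (auto simp: closed_segment_eq_real_ivl split: if_splits)
      show "(U r n has_real_derivative U (Suc r) n z) (at z)" "(U (Suc r) n has_real_derivative U (Suc (Suc r)) n z) (at z)"
        "\<bar>U (Suc (Suc r)) n z\<bar> \<le> C2 * real n powr (b / 4)" using D[OF z] C2[OF n z] by auto
    qed
    hence "\<bar>(y - x) * U (Suc r) n x\<bar> \<le> \<bar>U r n y\<bar> + \<bar>U r n x\<bar> + (C2 * real n powr (b / 4)) * (y - x)\<^sup>2" by linarith
    moreover have "(y - x)\<^sup>2 = \<eta>\<^sup>2" using y(2) by (metis power2_abs)
    moreover have "\<bar>(y - x) * U (Suc r) n x\<bar> = \<eta> * \<bar>U (Suc r) n x\<bar>" by (simp add: abs_mult y(2))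
    ultimately have "\<eta> * \<bar>U (Suc r) n x\<bar> \<le> 2 * (C * real n powr (- b)) + (C2 * real n powr (b / 4)) * \<eta>\<^sup>2"
      using C[OF n x] C[OF n y(1)] by simp
    hence "\<bar>U (Suc r) n x\<bar> \<le> (2 * (C * real n powr (- b)) + (C2 * real n powr (b / 4)) * \<eta>\<^sup>2) / \<eta>"
      using \<eta> by (simp add: pos_le_divide_eq mult.commute)
    also have "\<dots> = 2 * C / w * (real n powr (- b) / real n powr (- (b / 2))) + C2 * w * (real n powr (b / 4) * real n powr (- (b / 2)))"
      using \<eta> w n0 unfolding \<eta>_def by (simp add: field_simps power2_eq_square)
    also have "real n powr (- b) / real n powr (- (b / 2)) = real n powr (- (b / 2))"
      using n0 by (simp add: powr_diff[symmetric] field_simps)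
    also have "real n powr (b / 4) * real n powr (- (b / 2)) = real n powr (- (b / 4))"
      using n0 by (simp add: powr_add[symmetric] field_simps)
    also have "2 * C / w * real n powr (- (b / 2)) + C2 * w * real n powr (- (b / 4))
       \<le> 2 * C / w * real n powr (- (b / 4)) + C2 * w * real n powr (- (b / 4))"
      using n0 b C0 w by (intro add_right_mono mult_left_mono powr_mono) auto
    finally show ?thesis by (simp add: distrib_right)
  qed
  thus ?case using b by (intro exI[of _ "b / 4"] conjI exI[of _ "2 * C / w + C2 * w"]) auto
qed

text \<open>Half of the exponential absorbs the power at the price of a factorial, because one term
  of the exponential series is at most the whole series.\<close>

lemma power_exp_le:
  fixes c x :: real
  assumes c: "0 < c" and x: "0 \<le> x"
  shows "x ^ r * exp (- c * x) \<le> fact r * (2 / c) ^ r * exp (- (c / 2) * x)"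
proof -
  have "(c / 2 * x) ^ r / fact r \<le> exp (c / 2 * x)"
  proof -
    have "(\<Sum>k\<in>{r}. (c / 2 * x) ^ k /\<^sub>R fact k) \<le> (\<Sum>k. (c / 2 * x) ^ k /\<^sub>R fact k)"
      by (rule sum_le_suminf[OF summable_exp_generic]) (use c x in auto)
    moreover have "(\<Sum>k\<in>{r}. (c / 2 * x) ^ k /\<^sub>R fact k) = (c / 2 * x) ^ r / fact r"
    proof -
      have sc: "y /\<^sub>R z = y / z" for y z :: real by (simp only: real_scaleR_def divide_inverse mult.commute)
      show ?thesis unfolding sc by simp
    qed
    ultimately show ?thesis by (simp only: exp_def)
  qed
  hence "(c / 2 * x) ^ r \<le> exp (c / 2 * x) * fact r" by (subst (asm) pos_divide_le_eq) auto
  hence "x ^ r * (c / 2) ^ r \<le> fact r * exp (c / 2 * x)" by (simp only: power_mult_distrib mult.commute)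
  hence "x ^ r * (c / 2) ^ r * (2 / c) ^ r \<le> fact r * exp (c / 2 * x) * (2 / c) ^ r"
    using c by (intro mult_right_mono) auto
  moreover have "(c / 2) ^ r * (2 / c) ^ r = 1" using c by (simp add: power_mult_distrib[symmetric])
  ultimately have "x ^ r \<le> fact r * exp (c / 2 * x) * (2 / c) ^ r" by (simp add: mult.assoc)
  hence "x ^ r * exp (- c * x) \<le> fact r * exp (c / 2 * x) * (2 / c) ^ r * exp (- c * x)" by (intro mult_right_mono) auto
  also have "\<dots> = fact r * (2 / c) ^ r * (exp (c / 2 * x) * exp (- c * x))" by simp
  also have "exp (c / 2 * x) * exp (- c * x) = exp (- (c / 2) * x)" by (simp add: exp_add[symmetric])
  finally show ?thesis .
qed

lemma sum_power_exp_le: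
  fixes c :: real
  assumes c: "0 < c"
  shows "(\<Sum>i<j. real (j + 1 - i) ^ r * exp (- c * real (j + 1 - i))) \<le> fact r * (2 / c) ^ r / (1 - exp (- c / 2))"
proof -
  define q where "q = exp (- c / 2)"
  have q: "0 < q" "q < 1" unfolding q_def using c by auto
  have "(\<Sum>i<j. real (j + 1 - i) ^ r * exp (- c * real (j + 1 - i))) \<le> (\<Sum>i<j. fact r * (2 / c) ^ r * q ^ (j + 1 - i))"
  proof (rule sum_mono)
    fix i
    have "exp (- (c / 2) * real (j + 1 - i)) = q ^ (j + 1 - i)"
      unfolding q_def using exp_of_nat2_mult[of "- (c / 2)" "j + 1 - i"] by simp
    thus "real (j + 1 - i) ^ r * exp (- c * real (j + 1 - i)) \<le> fact r * (2 / c) ^ r * q ^ (j + 1 - i)"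
      using power_exp_le[OF c, of "real (j + 1 - i)" r] by simp
  qed
  also have "\<dots> = fact r * (2 / c) ^ r * (\<Sum>i<j. q ^ (j + 1 - i))" by (simp only: sum_distrib_left)
  also have "(\<Sum>i<j. q ^ (j + 1 - i)) \<le> (\<Sum>l<j+2. q ^ l)"
  proof -
    have "(\<Sum>i<j. q ^ (j + 1 - i)) = (\<Sum>l\<in>(\<lambda>i. j + 1 - i) ` {..<j}. q ^ l)"
      by (subst sum.reindex) (auto simp: inj_on_def)
    also have "\<dots> \<le> (\<Sum>l<j+2. q ^ l)" by (rule sum_mono2) (use q in auto)
    finally show ?thesis .
  qed
  also have "(\<Sum>l<j+2. q ^ l) \<le> 1 / (1 - q)"
  proof -
    have "1 - q ^ (j+2) = (1 - q) * (\<Sum>l<j+2. q ^ l)" by (rule one_diff_power_eq)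
    moreover have "0 \<le> q ^ (j+2)" using q by simp
    ultimately have "(\<Sum>l<j+2. q ^ l) * (1 - q) \<le> 1"
      using mult.commute[of "1 - q" "\<Sum>l<j+2. q ^ l"] by linarith
    thus ?thesis using q by (simp add: pos_le_divide_eq)
  qed
  finally show ?thesis using c unfolding q_def by (simp add: mult_left_mono)
qed

text \<open>Telescoping over the left end turns the inner sum into an increment in the right end,
  and these increments telescope in turn.\<close>

lemma second_difference_sum:
  fixes F :: "nat \<Rightarrow> nat \<Rightarrow> real"
  assumes "\<And>i. F i i = 0"
  shows "F 0 n = (\<Sum>j<n. F j (j+1) + (\<Sum>i<j. F i (j+1) - F (i+1) (j+1) - F i j + F (i+1) j))"
proof (induction n)
  case 0 show ?case using assms by simp
next
  case (Suc n)
  define G where "G i = F i (n+1) - F i n" for i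
  have "(\<Sum>i<n. F i (n+1) - F (i+1) (n+1) - F i n + F (i+1) n) = (\<Sum>i<n. G i - G (Suc i))"
    by (rule sum.cong) (auto simp: G_def)
  also have "\<dots> = G 0 - G n" by (rule sum_lessThan_telescope')
  also have "\<dots> = F 0 (n+1) - F 0 n - F n (n+1)" using assms[of n] by (simp add: G_def)
  finally show ?case using Suc by simp
qed

text \<open>The sum of the whole family has finite expectation, hence is finite almost surely and
  serves as a common bound of all members. This takes the place of Borel--Cantelli
  arguments.\<close>

lemma (in disorder) AE_bounded_family:
  fixes X :: "nat \<Rightarrow> nat \<Rightarrow> (nat \<Rightarrow> real) \<Rightarrow> real"
  assumes int: "\<And>i k. integrable D (X i k)" and nn: "\<And>i k \<omega>. 0 \<le> X i k \<omega>"
    and le: "\<And>i k. expectation (X i k) \<le> s i * t k" and s: "summable s" "\<And>i. 0 \<le> s i" and t: "summable t" "\<And>k. 0 \<le> t k"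
  shows "AE \<omega> in D. \<exists>C>0. \<forall>i k. X i k \<omega> \<le> C"
proof -
  have [measurable]: "X i k \<in> borel_measurable D" for i k using int by auto
  define Y where "Y \<omega> = (\<Sum>i. \<Sum>k. ennreal (X i k \<omega>))" for \<omega>
  have [measurable]: "Y \<in> borel_measurable D" unfolding Y_def by measurable
  have "(\<integral>\<^sup>+\<omega>. Y \<omega> \<partial>D) = (\<Sum>i. \<Sum>k. \<integral>\<^sup>+\<omega>. ennreal (X i k \<omega>) \<partial>D)"
    unfolding Y_def by (subst nn_integral_suminf, measurable, subst nn_integral_suminf, measurable)
  also have "\<dots> \<le> (\<Sum>i. \<Sum>k. ennreal (s i) * ennreal (t k))"
  proof -
    have 1: "(\<integral>\<^sup>+\<omega>. ennreal (X i k \<omega>) \<partial>D) \<le> ennreal (s i) * ennreal (t k)" for i k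
    proof -
      have "(\<integral>\<^sup>+\<omega>. ennreal (X i k \<omega>) \<partial>D) = ennreal (expectation (X i k))"
        by (rule nn_integral_eq_integral[OF int]) (simp add: nn)
      also have "\<dots> \<le> ennreal (s i * t k)" by (rule ennreal_leI[OF le])
      finally show ?thesis using s(2) t(2) by (simp add: ennreal_mult)
    qed
    show ?thesis by (intro suminf_le summableI 1)
  qed
  also have "\<dots> = (\<Sum>i. ennreal (s i)) * (\<Sum>k. ennreal (t k))"
    by simp
  also have "\<dots> = ennreal (suminf s) * ennreal (suminf t)"
    using s t by (simp add: suminf_ennreal2)
  also have "\<dots> < \<infinity>" by (simp add: ennreal_mult_less_top)
  finally have "AE \<omega> in D. Y \<omega> \<noteq> \<infinity>" by (intro nn_integral_PInf_AE) auto
  thus ?thesis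
  proof (eventually_elim)
    case (elim \<omega>)
    have "X i k \<omega> \<le> enn2real (Y \<omega>)" for i k
    proof -
      have "ennreal (X i k \<omega>) \<le> (\<Sum>k. ennreal (X i k \<omega>))" using sum_le_suminf[of "\<lambda>k. ennreal (X i k \<omega>)" "{k}"] by simp
      also have "\<dots> \<le> Y \<omega>" unfolding Y_def using sum_le_suminf[of "\<lambda>i. \<Sum>k. ennreal (X i k \<omega>)" "{i}"] by simp
      finally have "enn2real (ennreal (X i k \<omega>)) \<le> enn2real (Y \<omega>)" by (rule enn2real_mono) (use elim in \<open>simp add: less_top\<close>)
      thus ?thesis using nn by simp
    qed
    hence "X i k \<omega> \<le> enn2real (Y \<omega>) + 1" for i k by (meson add_increasing2 zero_le_one)
    moreover have "0 < enn2real (Y \<omega>) + 1" by (rule add_nonneg_pos) auto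
    ultimately show ?case by blast
  qed
qed

section \<open>Second differences of the cumulants and their means\<close>

context pinning
begin

definition K :: "nat \<Rightarrow> real \<Rightarrow> nat \<Rightarrow> nat \<Rightarrow> (nat \<Rightarrow> real) \<Rightarrow> real" where
  "K r h i j \<omega> = KK p r \<omega> i j h"

lemma K_0: "K 0 h i j \<omega> = LL h i j \<omega>"
  by (simp add: K_def KK_def LL_def)

lemma K_DERIV: "i \<le> j \<Longrightarrow> ((\<lambda>h. K r h i j \<omega>) has_real_derivative K (Suc r) h i j \<omega>) (at h)"
  unfolding K_def by (rule KK_DERIV[OF p_pos])

lemma K_crude:
  assumes "i \<le> j" "1 \<le> r"
  shows "\<bar>K r h i j \<omega>\<bar> \<le> fact r * (8 * real (j - i)) ^ r"
proof (cases "i = j")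
  case True
  have "(\<lambda>h. ln (ZZ p \<omega> i i h)) = (\<lambda>h. 0)" by (simp add: ZZ_def)
  hence "K r h i j \<omega> = 0" using assms True by (simp add: K_def KK_def)
  thus ?thesis by simp
next
  case False
  thus ?thesis unfolding K_def using assms by (intro KK_crude_bound[OF p_pos]) auto
qed

lemma K_diag: "1 \<le> r \<Longrightarrow> K r h i i \<omega> = 0"
  using K_crude[of i i r h \<omega>] by (cases r) simp_all

lemma K_measurable [measurable]: "i \<le> j \<Longrightarrow> K r h i j \<in> borel_measurable D"
proof (induction r arbitrary: h)
  case 0
  have "K 0 h i j = LL h i j" by (simp add: fun_eq_iff K_0)
  thus ?case by simp
next
  case (Suc r)
  have [measurable]: "K r h i j \<in> borel_measurable D" for h using Suc by simp
  show ?case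
  proof (rule borel_measurable_LIMSEQ_real)
    fix \<omega>
    have "((\<lambda>d. (K r (h + d) i j \<omega> - K r h i j \<omega>) / d) \<longlongrightarrow> K (Suc r) h i j \<omega>) (at 0)"
      using K_DERIV[OF Suc.prems, of r \<omega> h] by (simp add: DERIV_def)
    moreover have "filterlim (\<lambda>m. inverse (real (Suc m))) (at 0) sequentially"
      unfolding filterlim_at using LIMSEQ_inverse_real_of_nat by auto
    ultimately show "(\<lambda>m. (K r (h + inverse (real (Suc m))) i j \<omega> - K r h i j \<omega>) / inverse (real (Suc m))) \<longlonglongrightarrow> K (Suc r) h i j \<omega>"
      by (rule filterlim_compose)
  qed measurable
qed

lemma K_integrable: assumes "i \<le> j" shows "integrable D (K r h i j)"
proof (cases "r = 0")
  case True
  have "K 0 h i j = LL h i j" by (simp add: fun_eq_iff K_0)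
  thus ?thesis using True assms by simp
next
  case False
  show ?thesis
    by (rule integrable_const_bound[where B = "fact r * (8 * real (j - i)) ^ r"])
       (use K_crude[OF assms, of r] False assms in auto)
qed

definition ek :: "nat \<Rightarrow> nat \<Rightarrow> real \<Rightarrow> real" where
  "ek r n h = expectation (\<lambda>\<omega>. 1 / real n * K r h 0 n \<omega>)"

lemma ek_0: "ek 0 n h = ell h n / real n"
  unfolding ek_def ell_def by (simp add: K_0)

text \<open>Differentiation under the expectation: the crude bound on the derivative two orders
  higher controls the Taylor remainder uniformly in the disorder.\<close>

lemma ek_DERIV: "(ek r n has_real_derivative ek (Suc r) n h) (at h)"
proof -
  define M where "M = fact (Suc (Suc r)) * (8 * real n) ^ Suc (Suc r)"
  have q: "\<bar>K r y 0 n \<omega> - K r h 0 n \<omega> - (y - h) * K (Suc r) h 0 n \<omega>\<bar> \<le> M * (y - h)\<^sup>2" for y \<omega>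
  proof (rule quadratic_remainder_bound[where g = "\<lambda>h. K r h 0 n \<omega>" and ?g1.0 = "\<lambda>h. K (Suc r) h 0 n \<omega>"
        and ?g2.0 = "\<lambda>h. K (Suc (Suc r)) h 0 n \<omega>"])
    show "\<bar>K (Suc (Suc r)) z 0 n \<omega>\<bar> \<le> M" for z unfolding M_def using K_crude[of 0 n "Suc (Suc r)" z \<omega>] by simp
    show "((\<lambda>h. K r h 0 n \<omega>) has_real_derivative K (Suc r) z 0 n \<omega>) (at z)"
      "((\<lambda>h. K (Suc r) h 0 n \<omega>) has_real_derivative K (Suc (Suc r)) z 0 n \<omega>) (at z)" for z
      by (rule K_DERIV, simp)+
  qed
  have "\<bar>ek r n y - ek r n h - (y - h) * ek (Suc r) n h\<bar> \<le> (1 / real n * M) * (y - h)\<^sup>2" for y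
  proof -
    define R where "R \<omega> = 1 / real n * (K r y 0 n \<omega> - K r h 0 n \<omega> - (y - h) * K (Suc r) h 0 n \<omega>)" for \<omega>
    note [simp] = K_integrable[of 0 n]
    have Ri: "integrable D R" unfolding R_def by simp
    have eq: "ek r n y - ek r n h - (y - h) * ek (Suc r) n h = expectation R"
      unfolding ek_def R_def by (simp add: algebra_simps diff_divide_distrib)
    have "\<bar>expectation R\<bar> \<le> expectation (\<lambda>\<omega>. \<bar>R \<omega>\<bar>)" by (rule integral_abs_bound)
    also have "\<dots> \<le> expectation (\<lambda>\<omega>. 1 / real n * (M * (y - h)\<^sup>2))"
    proof (rule integral_mono)
      show "integrable D (\<lambda>\<omega>. \<bar>R \<omega>\<bar>)" using Ri by simp
      show "\<bar>R \<omega>\<bar> \<le> 1 / real n * (M * (y - h)\<^sup>2)" for \<omega>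
        unfolding R_def abs_mult using q[of y \<omega>] by (intro mult_mono) auto
    qed simp
    also have "\<dots> = (1 / real n * M) * (y - h)\<^sup>2" by (simp add: prob_space[unfolded space_D])
    finally show ?thesis unfolding eq .
  qed
  thus ?thesis by (rule has_real_derivative_from_remainder[OF zero_less_one])
qed

lemma K_second_difference:
  assumes "1 \<le> r"
  shows "\<bar>K r h 0 n \<omega>\<bar> \<le> (\<Sum>j<n. fact r * 8 ^ r + (\<Sum>i<j. \<bar>K r h i (j+1) \<omega> - K r h (i+1) (j+1) \<omega> - K r h i j \<omega> + K r h (i+1) j \<omega>\<bar>))"
proof -
  define d where "d i j = K r h i (j+1) \<omega> - K r h (i+1) (j+1) \<omega> - K r h i j \<omega> + K r h (i+1) j \<omega>" for i j
  define T where "T j = K r h j (j+1) \<omega> + (\<Sum>i<j. d i j)" for j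
  have eq: "K r h 0 n \<omega> = (\<Sum>j<n. T j)"
    unfolding T_def d_def using second_difference_sum[of "\<lambda>i j. K r h i j \<omega>" n] K_diag[OF assms] by simp
  have T: "\<bar>T j\<bar> \<le> fact r * 8 ^ r + (\<Sum>i<j. \<bar>d i j\<bar>)" for j
  proof -
    have "\<bar>K r h j (j+1) \<omega>\<bar> \<le> fact r * 8 ^ r" using K_crude[of j "j+1" r h \<omega>] assms by simp
    moreover have "\<bar>\<Sum>i<j. d i j\<bar> \<le> (\<Sum>i<j. \<bar>d i j\<bar>)" by (rule sum_abs)
    ultimately show ?thesis unfolding T_def by linarith
  qed
  have "\<bar>\<Sum>j<n. T j\<bar> \<le> (\<Sum>j<n. \<bar>T j\<bar>)" by (rule sum_abs)
  also have "\<dots> \<le> (\<Sum>j<n. fact r * 8 ^ r + (\<Sum>i<j. \<bar>d i j\<bar>))" by (intro sum_mono T)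
  finally show ?thesis unfolding eq d_def .
qed

text \<open>Serves where \<open>Q\<close> exceeds 1. Together with the bound through
  \<open>Q\<close> it gives a bound through the minimum of 1 and \<open>Q\<close>, which may be
  raised to small powers.\<close>

lemma second_difference_crude:
  assumes "1 \<le> r" "i < j"
  shows "\<bar>K r h i (j+1) \<omega> - K r h (i+1) (j+1) \<omega> - K r h i j \<omega> + K r h (i+1) j \<omega>\<bar> \<le> 4 * (fact r * (8 * real (j + 1 - i)) ^ r)"
proof -
  have b: "\<bar>K r h u v \<omega>\<bar> \<le> fact r * (8 * real (j + 1 - i)) ^ r" if "u \<le> v" "v - u \<le> j + 1 - i" for u v
  proof -
    have "\<bar>K r h u v \<omega>\<bar> \<le> fact r * (8 * real (v - u)) ^ r" by (rule K_crude) (use that assms in auto)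
    also have "\<dots> \<le> fact r * (8 * real (j + 1 - i)) ^ r" using that by (intro mult_left_mono power_mono) auto
    finally show ?thesis .
  qed
  have "\<bar>K r h i (j+1) \<omega>\<bar> \<le> fact r * (8 * real (j + 1 - i)) ^ r" "\<bar>K r h (i+1) (j+1) \<omega>\<bar> \<le> fact r * (8 * real (j + 1 - i)) ^ r"
    "\<bar>K r h i j \<omega>\<bar> \<le> fact r * (8 * real (j + 1 - i)) ^ r" "\<bar>K r h (i+1) j \<omega>\<bar> \<le> fact r * (8 * real (j + 1 - i)) ^ r"
    using assms by (intro b; simp)+
  thus ?thesis by linarith
qed

end

text \<open>\<open>Q i j\<close> dominates the failure of two polymers on \<open>{i..j}\<close> to meet, for all \<open>h \<ge> h0\<close> simultaneously.\<close>

locale localized_pinning = pinning +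
  fixes h0 :: real and Q :: "nat \<Rightarrow> nat \<Rightarrow> (nat \<Rightarrow> real) \<Rightarrow> real" and C c :: real
  assumes cC: "0 < c" "0 < C"
    and Q_int: "\<forall>i j. integrable D (Q i j)" and Q_nn: "\<forall>i j \<omega>. 0 \<le> Q i j \<omega>"
    and Q_exp: "\<forall>i j. expectation (Q i j) \<le> C * exp (- c * real (j - i))"
    and Q_defect: "\<forall>i j h \<omega>. h0 \<le> h \<longrightarrow> i + 2 \<le> j \<longrightarrow>
       meet_defect p \<omega> i j (i+1) (j-1) h + meet_defect p \<omega> i (j-1) (i+1) j h \<le> Q i j \<omega>"
begin

lemma second_difference_Q:
  assumes "1 \<le> r" "i < j" "h0 \<le> h"
  shows "\<bar>K r h i (j+1) \<omega> - K r h (i+1) (j+1) \<omega> - K r h i j \<omega> + K r h (i+1) j \<omega>\<bar> \<le> 64 * (fact r * (8 * real (j + 1 - i)) ^ r) * Q i (j+1) \<omega>"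
proof -
  have "\<bar>KK p r \<omega> i (j+1) h - KK p r \<omega> (i+1) (j+1) h - KK p r \<omega> i (j+1-1) h + KK p r \<omega> (i+1) (j+1-1) h\<bar>
    \<le> 64 * fact r * (8 * real (j + 1 - i)) ^ r * (meet_defect p \<omega> i (j+1) (i+1) (j+1-1) h + meet_defect p \<omega> i (j+1-1) (i+1) (j+1) h)"
    by (rule KK_second_difference_bound[OF p_pos]) (use assms in auto)
  also have "\<dots> \<le> 64 * fact r * (8 * real (j + 1 - i)) ^ r * Q i (j+1) \<omega>"
    using Q_defect[rule_format, where i = i and j = "j + 1" and h = h and \<omega> = \<omega>] assms
    by (intro mult_left_mono) auto
  finally show ?thesis unfolding K_def by simp
qed

text \<open>The 8 is the inverse Cauchy radius per unit of length, and \<open>2 / c\<close> comes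
  from summing powers of the length against the exponential. The summands 1 make the factors at
  least 1, so that constants may be raised to the power \<open>r\<close>.\<close>

definition gev :: real where "gev = 8 * (1 + 64 * C / (1 - exp (- c / 2))) * (1 + 2 / c)"

lemma ek_bound:
  assumes "1 \<le> r" "h0 \<le> h" "1 \<le> n"
  shows "\<bar>ek r n h\<bar> \<le> gev ^ r * fact r ^ 3"
proof -
  define s where "s = 1 / (1 - exp (- c / 2))"
  have s: "0 < s" unfolding s_def using cC by simp
  define B where "B \<omega> = (\<Sum>j<n. fact r * 8 ^ r + (\<Sum>i<j. 64 * (fact r * (8 * real (j + 1 - i)) ^ r) * Q i (j+1) \<omega>))" for \<omega>
  have KB: "\<bar>K r h 0 n \<omega>\<bar> \<le> B \<omega>" for \<omega>
    unfolding B_def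
    by (rule order_trans[OF K_second_difference[OF assms(1)]], intro sum_mono add_left_mono second_difference_Q) (use assms in auto)
  have Bi: "integrable D B" unfolding B_def using Q_int by simp
  have "expectation B = (\<Sum>j<n. fact r * 8 ^ r + (\<Sum>i<j. 64 * (fact r * (8 * real (j + 1 - i)) ^ r) * expectation (Q i (j+1))))"
    unfolding B_def using Q_int by (simp add: prob_space[unfolded space_D])
  also have "\<dots> \<le> (\<Sum>j<n. fact r * 8 ^ r + 64 * fact r * 8 ^ r * C * (fact r * (2 / c) ^ r * s))"
  proof (intro sum_mono add_left_mono)
    fix j
    have "(\<Sum>i<j. 64 * (fact r * (8 * real (j + 1 - i)) ^ r) * expectation (Q i (j+1)))
       \<le> (\<Sum>i<j. 64 * fact r * 8 ^ r * C * (real (j + 1 - i) ^ r * exp (- c * real (j + 1 - i))))"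
    proof (rule sum_mono)
      fix i
      have "64 * (fact r * (8 * real (j + 1 - i)) ^ r) * expectation (Q i (j+1)) \<le> 64 * (fact r * (8 * real (j + 1 - i)) ^ r) * (C * exp (- c * real (j + 1 - i)))"
        using Q_exp by (intro mult_left_mono) auto
      thus "64 * (fact r * (8 * real (j + 1 - i)) ^ r) * expectation (Q i (j+1)) \<le> 64 * fact r * 8 ^ r * C * (real (j + 1 - i) ^ r * exp (- c * real (j + 1 - i)))"
        unfolding power_mult_distrib by (simp only: mult_ac)
    qed
    also have "\<dots> = 64 * fact r * 8 ^ r * C * (\<Sum>i<j. real (j + 1 - i) ^ r * exp (- c * real (j + 1 - i)))"
      by (simp only: sum_distrib_left)
    also have "\<dots> \<le> 64 * fact r * 8 ^ r * C * (fact r * (2 / c) ^ r * s)"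
      using sum_power_exp_le[OF cC(1), of j r] cC unfolding s_def by (intro mult_left_mono) auto
    finally show "(\<Sum>i<j. 64 * (fact r * (8 * real (j + 1 - i)) ^ r) * expectation (Q i (j+1))) \<le> 64 * fact r * 8 ^ r * C * (fact r * (2 / c) ^ r * s)" .
  qed
  also have "\<dots> = real n * (fact r * 8 ^ r * (1 + 64 * C * s * (fact r * (2 / c) ^ r)))"
    by (simp add: algebra_simps)
  also have "\<dots> \<le> real n * (gev ^ r * fact r ^ 3)"
  proof (rule mult_left_mono)
    have f1: "(1::real) \<le> fact r" by (rule fact_ge_1)
    have "1 + 64 * C * s * (fact r * (2 / c) ^ r) \<le> (1 + 64 * C * s) ^ r * (fact r * (1 + 2 / c) ^ r)"
    proof -
      have a: "(2 / c) ^ r \<le> (1 + 2 / c) ^ r" using cC by (intro power_mono) auto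
      have "1 \<le> (1 + 2 / c) ^ r" using cC by (intro one_le_power) auto
      hence b: "1 \<le> fact r * (1 + 2 / c) ^ r" using f1 mult_mono[of 1 "fact r" 1 "(1 + 2 / c) ^ r"] by simp
      have "64 * C * s * (fact r * (2 / c) ^ r) \<le> 64 * C * s * (fact r * (1 + 2 / c) ^ r)"
        using a cC s by (intro mult_left_mono) auto
      hence "1 + 64 * C * s * (fact r * (2 / c) ^ r) \<le> (1 + 64 * C * s) * (fact r * (1 + 2 / c) ^ r)"
        using b by (simp add: distrib_right)
      also have "\<dots> \<le> (1 + 64 * C * s) ^ r * (fact r * (1 + 2 / c) ^ r)"
      proof (rule mult_right_mono)
        show "1 + 64 * C * s \<le> (1 + 64 * C * s) ^ r"
          by (rule self_le_power) (use cC s assms(1) in auto)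
      qed (use cC in auto)
      finally show ?thesis .
    qed
    hence "fact r * 8 ^ r * (1 + 64 * C * s * (fact r * (2 / c) ^ r)) \<le> fact r * 8 ^ r * ((1 + 64 * C * s) ^ r * (fact r * (1 + 2 / c) ^ r))"
      by (intro mult_left_mono) auto
    also have "\<dots> = gev ^ r * (fact r * fact r * 1)"
    proof -
      have g: "gev = 8 * (1 + 64 * C * s) * (1 + 2 / c)" by (simp add: gev_def s_def)
      show ?thesis unfolding g power_mult_distrib by (simp only: mult_ac mult_1_right)
    qed
    \<comment> \<open>One factorial stems from Cauchy's estimate and one from the sum over lengths;
      a third is inserted to reach the cube.\<close>
    also have "\<dots> \<le> gev ^ r * (fact r * fact r * fact r)"
      using f1 cC unfolding gev_def by (intro mult_left_mono mult_nonneg_nonneg zero_le_power) auto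
    finally show "fact r * 8 ^ r * (1 + 64 * C * s * (fact r * (2 / c) ^ r)) \<le> gev ^ r * fact r ^ 3" by (simp add: power3_eq_cube)
  qed simp
  finally have EB: "expectation B \<le> real n * (gev ^ r * fact r ^ 3)" .
  have "\<bar>ek r n h\<bar> \<le> expectation (\<lambda>\<omega>. \<bar>1 / real n * K r h 0 n \<omega>\<bar>)"
    unfolding ek_def by (rule integral_abs_bound)
  also have "\<dots> \<le> expectation (\<lambda>\<omega>. 1 / real n * B \<omega>)"
    by (rule integral_mono) (use KB Bi K_integrable in \<open>auto simp: abs_mult intro!: mult_left_mono divide_right_mono\<close>)
  also have "\<dots> = 1 / real n * expectation B" by simp
  also have "\<dots> \<le> 1 / real n * (real n * (gev ^ r * fact r ^ 3))" using EB by (intro mult_left_mono) auto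
  also have "\<dots> = gev ^ r * fact r ^ 3" using assms by simp
  finally show ?thesis .
qed

lemma gev_pos: "0 < gev"
  unfolding gev_def using cC by (intro mult_pos_pos add_pos_pos divide_pos_pos) auto

lemma FE_derivs:
  assumes "h0 < h"
  shows "(\<lambda>n. ek r n h) \<longlonglongrightarrow> (deriv ^^ r) FE h"
    and "((deriv ^^ r) FE has_real_derivative (deriv ^^ Suc r) FE h) (at h)"
    and "1 \<le> r \<Longrightarrow> \<bar>(deriv ^^ r) FE h\<bar> \<le> gev ^ r * fact r ^ 3"
proof -
  have B: "\<exists>M. \<forall>n\<ge>1. \<forall>h>h0. \<bar>ek r n h\<bar> \<le> M" if "1 \<le> r" for r
    using ek_bound[OF that] by (intro exI[of _ "gev ^ r * fact r ^ 3"]) auto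
  have L: "(\<lambda>n. ek 0 n h) \<longlonglongrightarrow> FE h" for h unfolding ek_0 by (rule FE_lim)
  show l: "(\<lambda>n. ek r n h) \<longlonglongrightarrow> (deriv ^^ r) FE h"
    by (rule smooth_limit(1)[where a = h0 and U = ek]) (use ek_DERIV B L assms in simp_all)
  show "((deriv ^^ r) FE has_real_derivative (deriv ^^ Suc r) FE h) (at h)"
    by (rule smooth_limit(2)[where a = h0 and U = ek]) (use ek_DERIV B L assms in simp_all)
  show "\<bar>(deriv ^^ r) FE h\<bar> \<le> gev ^ r * fact r ^ 3" if "1 \<le> r"
    by (rule LIMSEQ_le_const2[OF tendsto_rabs[OF l]]) (use ek_bound that assms in \<open>auto intro!: exI[of _ 1]\<close>)
qed

lemma ek_uniform:
  assumes uv: "h0 < u" "u < v" and e: "0 < e"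
  shows "eventually (\<lambda>n. \<forall>h\<in>{u..v}. \<bar>ek r n h - (deriv ^^ r) FE h\<bar> < e) sequentially"
proof (rule uniform_of_pointwise_Lipschitz[OF uv(2) _ _ e])
  show "(\<lambda>n. ek r n h) \<longlonglongrightarrow> (deriv ^^ r) FE h" if "h \<in> {u..v}" for h
    by (rule FE_derivs) (use that uv in auto)
  show "\<bar>ek r n x - ek r n y\<bar> \<le> gev ^ Suc r * fact (Suc r) ^ 3 * \<bar>x - y\<bar>" if "1 \<le> n" "x \<in> {u..v}" "y \<in> {u..v}" for n x y
  proof -
    have "norm (ek r n x - ek r n y) \<le> gev ^ Suc r * fact (Suc r) ^ 3 * norm (x - y)"
    proof (rule field_differentiable_bound[of "{u..v}" "ek r n" "ek (Suc r) n"])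
      show "(ek r n has_field_derivative ek (Suc r) n z) (at z within {u..v})" for z
        by (rule DERIV_subset[OF ek_DERIV]) simp
      show "norm (ek (Suc r) n z) \<le> gev ^ Suc r * fact (Suc r) ^ 3" if "z \<in> {u..v}" for z
        using ek_bound[of "Suc r" z n] that uv \<open>1 \<le> n\<close> by simp
    qed (use that in auto)
    thus ?thesis by simp
  qed
qed

end

section \<open>Almost sure convergence\<close>

lemma summable_inverse_Suc_square: "summable (\<lambda>n. 1 / (real n + 1)\<^sup>2)"
proof -
  have "summable (\<lambda>n. inverse (real (Suc n) ^ 2))"
    using inverse_power_summable[of 2, where 'a = real] summable_Suc_iff[of "\<lambda>n. inverse (real n ^ 2)"] by simp
  thus ?thesis by (simp add: divide_inverse add.commute)
qed

lemma min_one_le_powr: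
  fixes x :: real
  assumes "0 \<le> x" "0 < d" "d \<le> 1"
  shows "min 1 x \<le> x powr d"
proof (cases "x \<le> 1")
  case True
  show ?thesis
  proof (cases "x = 0")
    case False
    thus ?thesis using powr_mono'[of d 1 x] assms True by simp
  qed simp
next
  case False
  thus ?thesis using ge_one_powr_ge_zero[of x d] assms by simp
qed

context localized_pinning
begin

text \<open>Half of the exponential decay makes the family summable in the length, and the weight
  \<open>(real i + 1)\<^sup>2\<close> makes it summable in the starting point; the other half of the
  decay is kept.\<close>

lemma AE_Q_decay: "AE \<omega> in D. \<exists>B>0. \<forall>i k. Q i (i + k) \<omega> \<le> B * (real i + 1)\<^sup>2 * exp (- (c / 2) * real k)"
proof -
  define X where "X i k \<omega> = Q i (i + k) \<omega> * (exp (c / 2 * real k) / (real i + 1)\<^sup>2)" for i k \<omega>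
  have "AE \<omega> in D. \<exists>B>0. \<forall>i k. X i k \<omega> \<le> B"
  proof (rule AE_bounded_family[where s = "\<lambda>i. C * (1 / (real i + 1)\<^sup>2)" and t = "\<lambda>k. exp (- (c / 2)) ^ k"])
    show "integrable D (X i k)" for i k unfolding X_def using Q_int by simp
    show "0 \<le> X i k \<omega>" for i k \<omega> unfolding X_def using Q_nn by simp
    show "expectation (X i k) \<le> C * (1 / (real i + 1)\<^sup>2) * exp (- (c / 2)) ^ k" for i k
    proof -
      have "expectation (X i k) = expectation (Q i (i + k)) * (exp (c / 2 * real k) / (real i + 1)\<^sup>2)" unfolding X_def by simp
      also have "\<dots> \<le> (C * exp (- c * real k)) * (exp (c / 2 * real k) / (real i + 1)\<^sup>2)"
        using Q_exp[rule_format, of i "i + k"] by (intro mult_right_mono) auto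
      also have "\<dots> = C * (1 / (real i + 1)\<^sup>2) * (exp (- c * real k) * exp (c / 2 * real k))" by simp
      also have "exp (- c * real k) * exp (c / 2 * real k) = exp (- (c / 2) * real k)" by (simp add: exp_add[symmetric])
      also have "exp (- (c / 2) * real k) = exp (- (c / 2)) ^ k" by (rule exp_of_nat2_mult)
      finally show ?thesis .
    qed
    show "summable (\<lambda>i. C * (1 / (real i + 1)\<^sup>2))" by (intro summable_mult summable_inverse_Suc_square)
    show "summable (\<lambda>k. exp (- (c / 2)) ^ k)" by (rule summable_geometric) (use cC in auto)
  qed (use cC in auto)
  thus ?thesis
  proof eventually_elim
    case (elim \<omega>)
    then obtain B where B: "0 < B" "\<And>i k. X i k \<omega> \<le> B" by blast
    have "Q i (i + k) \<omega> \<le> B * (real i + 1)\<^sup>2 * exp (- (c / 2) * real k)" for i k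
    proof -
      have "X i k \<omega> * ((real i + 1)\<^sup>2 * exp (- (c / 2) * real k)) \<le> B * ((real i + 1)\<^sup>2 * exp (- (c / 2) * real k))"
        by (rule mult_right_mono[OF B(2)]) simp
      moreover have "X i k \<omega> * ((real i + 1)\<^sup>2 * exp (- (c / 2) * real k)) = Q i (i + k) \<omega>"
      proof -
        have e1: "exp (c / 2 * real k) * exp (- (c / 2) * real k) = 1" by (simp add: exp_add[symmetric])
        have ne: "(real i + 1)\<^sup>2 \<noteq> 0" by simp
        have gen: "q * (e / m) * (m * e') = q * (e * e')" if "m \<noteq> 0" for q e m e' :: real using that by simp
        show ?thesis unfolding X_def gen[OF ne] e1 by simp
      qed
      ultimately show ?thesis by (simp only: mult.assoc)
    qed
    thus ?case using B(1) by blast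
  qed
qed

text \<open>The almost sure bound on \<open>Q\<close> loses the square of the starting point. Since
  only the minimum of 1 and \<open>Q\<close> matters, it may be raised to a small power
  \<open>d'\<close>: the loss becomes \<open>n powr (2 * d')\<close>, while the decay in the length
  remains exponential.\<close>

lemma K_growth:
  assumes B: "0 < B" "\<And>i k. Q i (i + k) \<omega> \<le> B * (real i + 1)\<^sup>2 * exp (- (c / 2) * real k)"
    and r: "1 \<le> r" and d: "0 < d"
  shows "\<exists>A. \<forall>n\<ge>1. \<forall>h\<ge>h0. \<bar>1 / real n * K r h 0 n \<omega>\<bar> \<le> A * real n powr d"
proof -
  define d' where "d' = min (d / 2) 1"
  have d': "0 < d'" "d' \<le> 1" "2 * d' \<le> d" unfolding d'_def using d by auto
  define c' where "c' = c / 2 * d'"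
  have c'0: "0 < c'" unfolding c'_def using cC d' by simp
  define S where "S = fact r * (2 / c') ^ r / (1 - exp (- c' / 2))"
  have S0: "0 \<le> S" unfolding S_def using c'0 by (intro divide_nonneg_nonneg mult_nonneg_nonneg) auto
  define A0 :: real where "A0 = fact r * 8 ^ r"
  have A0: "0 \<le> A0" unfolding A0_def by simp
  have "\<bar>1 / real n * K r h 0 n \<omega>\<bar> \<le> (A0 + 64 * A0 * B powr d' * S) * real n powr d" if n: "1 \<le> n" and h: "h0 \<le> h" for n h
  proof -
    have n1: "1 \<le> real n" using n by simp
    have summand: "\<bar>K r h i (j+1) \<omega> - K r h (i+1) (j+1) \<omega> - K r h i j \<omega> + K r h (i+1) j \<omega>\<bar>
       \<le> 64 * A0 * B powr d' * real n powr d * (real (j + 1 - i) ^ r * exp (- c' * real (j + 1 - i)))"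
      if ij: "i < j" "j < n" for i j
    proof -
      let ?x = "\<bar>K r h i (j+1) \<omega> - K r h (i+1) (j+1) \<omega> - K r h i j \<omega> + K r h (i+1) j \<omega>\<bar>"
      let ?k = "j + 1 - i"
      define w where "w = fact r * (8 * real ?k) ^ r"
      have w0: "0 \<le> w" unfolding w_def by simp
      define q where "q = Q i (j+1) \<omega>"
      have q0: "0 \<le> q" unfolding q_def using Q_nn by simp
      have "?x \<le> 4 * w" "?x \<le> 64 * w * q"
        using second_difference_crude[OF r ij(1), of h \<omega>] second_difference_Q[OF r ij(1) h, of \<omega>] by (auto simp: w_def q_def)
      hence "?x \<le> 64 * w * min 1 q" using w0 by (auto simp: min_def)
      also have "\<dots> \<le> 64 * w * q powr d'" using min_one_le_powr[OF q0 d'(1,2)] w0 by (intro mult_left_mono) auto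
      also have "q powr d' \<le> (B * (real n)\<^sup>2 * exp (- (c / 2) * real ?k)) powr d'"
      proof (rule powr_mono2)
        have "q \<le> B * (real i + 1)\<^sup>2 * exp (- (c / 2) * real ?k)" using B(2)[of i ?k] ij unfolding q_def by simp
        also have "\<dots> \<le> B * (real n)\<^sup>2 * exp (- (c / 2) * real ?k)"
          using ij B(1) by (intro mult_right_mono mult_left_mono power_mono) auto
        finally show "q \<le> B * (real n)\<^sup>2 * exp (- (c / 2) * real ?k)" .
      qed (use q0 d' in auto)
      also have "(B * (real n)\<^sup>2 * exp (- (c / 2) * real ?k)) powr d' = B powr d' * real n powr (2 * d') * exp (- c' * real ?k)"
      proof -
        have "(real n)\<^sup>2 powr d' = real n powr (2 * d')" using n1 by (simp add: powr_powr flip: powr_numeral)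
        moreover have "exp (- (c / 2) * real ?k) powr d' = exp (- c' * real ?k)" unfolding c'_def by (simp add: powr_def mult_ac)
        ultimately show ?thesis using B(1) by (simp add: powr_mult)
      qed
      also have "\<dots> \<le> B powr d' * real n powr d * exp (- c' * real ?k)"
        using d' n1 by (intro mult_right_mono mult_left_mono powr_mono) auto
      finally have "?x \<le> 64 * w * (B powr d' * real n powr d * exp (- c' * real ?k))"
        using w0 by (simp add: mult_left_mono)
      thus ?thesis unfolding w_def A0_def power_mult_distrib by (simp only: mult_ac)
    qed
    have "\<bar>K r h 0 n \<omega>\<bar> \<le> (\<Sum>j<n. A0 + (\<Sum>i<j. \<bar>K r h i (j+1) \<omega> - K r h (i+1) (j+1) \<omega> - K r h i j \<omega> + K r h (i+1) j \<omega>\<bar>))"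
      unfolding A0_def by (rule K_second_difference[OF r])
    also have "\<dots> \<le> (\<Sum>j<n. A0 + 64 * A0 * B powr d' * real n powr d * S)"
    proof (intro sum_mono add_left_mono)
      fix j assume j: "j \<in> {..<n}"
      have "(\<Sum>i<j. \<bar>K r h i (j+1) \<omega> - K r h (i+1) (j+1) \<omega> - K r h i j \<omega> + K r h (i+1) j \<omega>\<bar>)
        \<le> (\<Sum>i<j. 64 * A0 * B powr d' * real n powr d * (real (j + 1 - i) ^ r * exp (- c' * real (j + 1 - i))))"
        by (intro sum_mono summand) (use j in auto)
      also have "\<dots> = 64 * A0 * B powr d' * real n powr d * (\<Sum>i<j. real (j + 1 - i) ^ r * exp (- c' * real (j + 1 - i)))"
        by (simp only: sum_distrib_left)
      also have "\<dots> \<le> 64 * A0 * B powr d' * real n powr d * S"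
        unfolding S_def using sum_power_exp_le[OF c'0] A0 by (intro mult_left_mono) auto
      finally show "(\<Sum>i<j. \<bar>K r h i (j+1) \<omega> - K r h (i+1) (j+1) \<omega> - K r h i j \<omega> + K r h (i+1) j \<omega>\<bar>) \<le> 64 * A0 * B powr d' * real n powr d * S" .
    qed
    also have "\<dots> = real n * (A0 * 1 + 64 * A0 * B powr d' * S * real n powr d)" by (simp add: mult_ac)
    also have "\<dots> \<le> real n * (A0 * real n powr d + 64 * A0 * B powr d' * S * real n powr d)"
      using A0 n1 d by (intro mult_left_mono add_right_mono ge_one_powr_ge_zero) auto
    finally have "\<bar>K r h 0 n \<omega>\<bar> / real n \<le> A0 * real n powr d + 64 * A0 * B powr d' * S * real n powr d"
      using n1 by (simp add: pos_divide_le_eq mult.commute)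
    thus ?thesis by (simp add: abs_mult distrib_right)
  qed
  thus ?thesis by blast
qed

lemma LL_deviation_moment:
  "integrable D (\<lambda>\<omega>. exp (t * \<bar>LL h 0 n \<omega> - ell h n\<bar>))"
  "0 \<le> t \<Longrightarrow> t\<^sup>2 * real n \<le> 1 \<Longrightarrow> expectation (\<lambda>\<omega>. exp (t * \<bar>LL h 0 n \<omega> - ell h n\<bar>)) \<le> 2 * exp cgauss"
proof -
  have hs: "has_subgradient (LL h 0 n) {0<..n}" by (rule LL_subgradient) simp
  define G where "G \<omega> = LL h 0 n \<omega> - ell h n" for \<omega>
  have i: "integrable D (\<lambda>\<omega>. exp (s * G \<omega>))" for s
  proof -
    have "exp (s * G \<omega>) = exp (- s * ell h n) * exp (s * LL h 0 n \<omega>)" for \<omega>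
      unfolding G_def by (simp add: exp_add[symmetric] algebra_simps)
    thus ?thesis using has_subgradient_integrable(2)[OF hs, of s] by simp
  qed
  have le: "exp (t * \<bar>G \<omega>\<bar>) \<le> exp (t * G \<omega>) + exp (- t * G \<omega>)" for \<omega>
    by (cases "0 \<le> G \<omega>") auto
  have m: "(\<lambda>\<omega>. exp (t * \<bar>G \<omega>\<bar>)) \<in> borel_measurable D" unfolding G_def by measurable
  show 1: "integrable D (\<lambda>\<omega>. exp (t * \<bar>LL h 0 n \<omega> - ell h n\<bar>))"
    unfolding G_def[symmetric]
    by (rule Bochner_Integration.integrable_bound[OF Bochner_Integration.integrable_add[OF i[of t] i[of "- t"]] m])
       (use le in \<open>auto intro!: AE_I2 order_trans[OF le]\<close>)
  assume t: "0 \<le> t" "t\<^sup>2 * real n \<le> 1"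
  have "expectation (\<lambda>\<omega>. exp (s * G \<omega>)) \<le> exp cgauss" if "s\<^sup>2 = t\<^sup>2" for s
  proof -
    have "expectation (\<lambda>\<omega>. exp (s * G \<omega>)) \<le> exp (cgauss * s\<^sup>2 * real (card {0<..n}))"
      using concentration[OF hs, of s] unfolding G_def ell_def .
    also have "\<dots> \<le> exp (cgauss * 1)"
      using mult_left_mono[OF t(2) cgauss_nonneg] that by (simp add: mult.assoc)
    finally show ?thesis by simp
  qed
  from this[of t] this[of "- t"]
  have "expectation (\<lambda>\<omega>. exp (t * G \<omega>) + exp (- t * G \<omega>)) \<le> 2 * exp cgauss" using i[of t] i[of "- t"] by simp
  moreover have "expectation (\<lambda>\<omega>. exp (t * \<bar>G \<omega>\<bar>)) \<le> expectation (\<lambda>\<omega>. exp (t * G \<omega>) + exp (- t * G \<omega>))"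
    by (rule integral_mono[OF 1[folded G_def] Bochner_Integration.integrable_add[OF i[of t] i[of "- t"]] le])
  ultimately show "expectation (\<lambda>\<omega>. exp (t * \<bar>LL h 0 n \<omega> - ell h n\<bar>)) \<le> 2 * exp cgauss"
    unfolding G_def by linarith
qed

lemma LL_ell_Lipschitz:
  "\<bar>LL x 0 n \<omega> - LL y 0 n \<omega>\<bar> \<le> real n * \<bar>x - y\<bar>" "\<bar>ell x n - ell y n\<bar> \<le> real n * \<bar>x - y\<bar>"
proof -
  show L: "\<bar>LL x 0 n \<omega> - LL y 0 n \<omega>\<bar> \<le> real n * \<bar>x - y\<bar>" for \<omega>
    using LL_Lipschitz[of x y 0 n \<omega>] LL_Lipschitz[of y x 0 n \<omega>] by (cases "x \<le> y") (auto simp: mult.commute abs_if)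
  have "\<bar>ell x n - ell y n\<bar> = \<bar>expectation (\<lambda>\<omega>. LL x 0 n \<omega> - LL y 0 n \<omega>)\<bar>" unfolding ell_def by simp
  also have "\<dots> \<le> expectation (\<lambda>\<omega>. \<bar>LL x 0 n \<omega> - LL y 0 n \<omega>\<bar>)" by (rule integral_abs_bound)
  also have "\<dots> \<le> expectation (\<lambda>\<omega>. real n * \<bar>x - y\<bar>)" by (rule integral_mono) (use L in auto)
  finally show "\<bar>ell x n - ell y n\<bar> \<le> real n * \<bar>x - y\<bar>" by (simp add: prob_space[unfolded space_D])
qed

text \<open>Concentration is applied on a grid of mesh \<open>(v - u) / n\<close>; leaving the grid
  changes \<open>LL\<close> and its mean only by constants. With the exponent
  \<open>1 / sqrt n\<close> the exponential moments stay bounded, so the deviation is of order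
  \<open>sqrt n\<close> times a logarithm, which after division by \<open>n\<close> is well below
  \<open>n powr (- (1/4))\<close>.\<close>

lemma AE_LL_deviation:
  assumes uv: "u < v"
  shows "AE \<omega> in D. \<exists>A. \<forall>n\<ge>1. \<forall>h\<in>{u..v}. \<bar>1 / real n * LL h 0 n \<omega> - ell h n / real n\<bar> \<le> A * real n powr (- (1/4))"
proof -
  define hh where "hh n l = u + (v - u) * real l / real n" for n l :: nat
  \<comment> \<open>The weights make the family summable over all lengths and grid points. As they
    are polynomial and the deviation stands in an exponent, they cost only a logarithm.\<close>
  define X where "X n l \<omega> = exp (1 / sqrt (real n) * \<bar>LL (hh n l) 0 n \<omega> - ell (hh n l) n\<bar>) * (1 / (real n + 1)\<^sup>2 * (1 / (real l + 1)\<^sup>2))" for n l \<omega>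
  have "AE \<omega> in D. \<exists>B>0. \<forall>n l. X n l \<omega> \<le> B"
  proof (rule AE_bounded_family[where s = "\<lambda>n. 2 * exp cgauss * (1 / (real n + 1)\<^sup>2)" and t = "\<lambda>l. 1 / (real l + 1)\<^sup>2"])
    show "integrable D (X n l)" for n l unfolding X_def by (intro integrable_mult_left LL_deviation_moment(1))
    show "expectation (X n l) \<le> 2 * exp cgauss * (1 / (real n + 1)\<^sup>2) * (1 / (real l + 1)\<^sup>2)" for n l
    proof -
      have "expectation (X n l) = expectation (\<lambda>\<omega>. exp (1 / sqrt (real n) * \<bar>LL (hh n l) 0 n \<omega> - ell (hh n l) n\<bar>)) * (1 / (real n + 1)\<^sup>2 * (1 / (real l + 1)\<^sup>2))"
        unfolding X_def by (rule integral_mult_left_zero)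
      also have "\<dots> \<le> 2 * exp cgauss * (1 / (real n + 1)\<^sup>2 * (1 / (real l + 1)\<^sup>2))"
        by (intro mult_right_mono LL_deviation_moment(2)) (auto simp: power_divide)
      finally show ?thesis by (simp only: mult.assoc)
    qed
    show "summable (\<lambda>n. 2 * exp cgauss * (1 / (real n + 1)\<^sup>2))" by (intro summable_mult summable_inverse_Suc_square)
  qed (auto simp: X_def intro: summable_inverse_Suc_square)
  thus ?thesis
  proof eventually_elim
    case (elim \<omega>)
    then obtain B where B: "0 < B" "\<And>n l. X n l \<omega> \<le> B" by blast
    define A where "A = \<bar>ln B\<bar> + 32 + 2 * (v - u)"
    have "\<bar>1 / real n * LL h 0 n \<omega> - ell h n / real n\<bar> \<le> A * real n powr (- (1/4))" if n: "1 \<le> n" and h: "h \<in> {u..v}" for n h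
    proof -
      have n1: "1 \<le> real n" using n by simp
      define l where "l = nat \<lfloor>(h - u) / (v - u) * real n\<rfloor>"
      have q: "0 \<le> (h - u) / (v - u)" "(h - u) / (v - u) \<le> 1" using h uv by auto
      have "0 \<le> (h - u) / (v - u) * real n" by (rule mult_nonneg_nonneg[OF q(1)]) simp
      hence rl: "real l \<le> (h - u) / (v - u) * real n" "(h - u) / (v - u) * real n < real l + 1"
        unfolding l_def by linarith+
      have "real l \<le> 1 * real n" using rl(1) mult_right_mono[OF q(2), of "real n"] by simp
      hence ln: "l \<le> n" by simp
      define y where "y = hh n l"
      have hy: "\<bar>h - y\<bar> \<le> (v - u) / real n"
      proof -
        have 2: "(v - u) * ((h - u) / (v - u)) = h - u" using uv by simp
        have "(v - u) * (real l / real n) \<le> (v - u) * ((h - u) / (v - u))"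
          using rl(1) n1 uv by (intro mult_left_mono) (auto simp: pos_divide_le_eq)
        moreover have "(v - u) * ((h - u) / (v - u)) \<le> (v - u) * ((real l + 1) / real n)"
          using rl(2) n1 uv by (intro mult_left_mono) (auto simp: pos_le_divide_eq)
        moreover have "(v - u) * ((real l + 1) / real n) = (v - u) * (real l / real n) + (v - u) / real n"
          by (simp add: add_divide_distrib distrib_left)
        ultimately show ?thesis unfolding y_def hh_def 2 by (simp add: abs_if)
      qed
      define G where "G = \<bar>LL y 0 n \<omega> - ell y n\<bar>"
      have "exp (1 / sqrt (real n) * G) * (1 / (real n + 1)\<^sup>2 * (1 / (real l + 1)\<^sup>2)) \<le> B"
        using B(2)[of n l] unfolding X_def G_def y_def .
      hence "exp (1 / sqrt (real n) * G) \<le> B * ((real n + 1)\<^sup>2 * (real l + 1)\<^sup>2)"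
        by (simp add: divide_simps) (simp add: mult_ac)?
      also have "\<dots> \<le> B * ((real n + 1)\<^sup>2 * (real n + 1)\<^sup>2)"
        using B(1) ln by (intro mult_left_mono power_mono) auto
      also have "\<dots> = B * (real n + 1) ^ 4" by (simp add: power_add[symmetric])
      finally have "ln (exp (1 / sqrt (real n) * G)) \<le> ln (B * (real n + 1) ^ 4)"
        using B(1) by (subst ln_le_cancel_iff) auto
      hence "1 / sqrt (real n) * G \<le> ln B + 4 * ln (real n + 1)"
        using B(1) by (simp add: ln_mult ln_realpow)
      also have "\<dots> \<le> (\<bar>ln B\<bar> + 32) * real n powr (1/4)"
      proof -
        have p1: "1 \<le> real n powr (1/4)" using n1 by (intro ge_one_powr_ge_zero) auto
        have "ln (real n + 1) = 4 * ln ((real n + 1) powr (1/4))" by (simp add: ln_powr)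
        also have "\<dots> \<le> 4 * (real n + 1) powr (1/4)"
          using ln_le_minus_one[of "(real n + 1) powr (1/4)"] by simp
        also have "(real n + 1) powr (1/4) \<le> (2 * real n) powr (1/4)" using n1 by (intro powr_mono2) auto
        also have "\<dots> = 2 powr (1/4) * real n powr (1/4)" by (simp add: powr_mult)
        also have "\<dots> \<le> 2 * real n powr (1/4)"
          using powr_mono[of "1/4" 1 "2::real"] by (intro mult_right_mono) auto
        finally have "ln (real n + 1) \<le> 8 * real n powr (1/4)" by simp
        moreover have "ln B \<le> \<bar>ln B\<bar> * real n powr (1/4)"
          using mult_left_mono[OF p1, of "\<bar>ln B\<bar>"] by simp
        ultimately show ?thesis by (simp add: distrib_right)
      qed
      finally have G1: "G \<le> sqrt (real n) * ((\<bar>ln B\<bar> + 32) * real n powr (1/4))"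
        using n1 by (simp add: pos_divide_le_eq mult.commute)
      have "\<bar>LL h 0 n \<omega> - ell h n\<bar> \<le> G + 2 * (v - u)"
      proof -
        have "real n * \<bar>h - y\<bar> \<le> v - u" using mult_left_mono[OF hy, of "real n"] n1 by simp
        moreover have "\<bar>a - b\<bar> \<le> \<bar>a' - b'\<bar> + 2 * w"
          if "\<bar>a - a'\<bar> \<le> t" "\<bar>b - b'\<bar> \<le> t" "t \<le> w" for a b a' b' t w :: real
          using that by linarith
        ultimately show ?thesis
          using LL_ell_Lipschitz(1)[of h n \<omega> y] LL_ell_Lipschitz(2)[of h n y] unfolding G_def by blast
      qed
      hence "\<bar>LL h 0 n \<omega> - ell h n\<bar> / real n \<le> (sqrt (real n) * ((\<bar>ln B\<bar> + 32) * real n powr (1/4)) + 2 * (v - u)) / real n"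
        using G1 by (intro divide_right_mono) auto
      also have "\<dots> = (\<bar>ln B\<bar> + 32) * (sqrt (real n) * real n powr (1/4) / real n) + 2 * (v - u) * (1 / real n)"
        by (simp add: add_divide_distrib)
      also have "sqrt (real n) * real n powr (1/4) / real n = real n powr (- (1/4))"
      proof -
        have "sqrt (real n) * real n powr (1/4) / real n = real n powr (1/2) * real n powr (1/4) / real n powr 1"
          using n1 by (simp add: powr_half_sqrt)
        also have "\<dots> = real n powr (1/2 + 1/4 - 1)" by (simp only: powr_add powr_diff)
        finally show ?thesis by simp
      qed
      also have "1 / real n \<le> real n powr (- (1/4))"
        using n1 powr_mono[of "- 1" "- (1/4)" "real n"] by (simp add: powr_minus_divide)
      finally have "\<bar>LL h 0 n \<omega> - ell h n\<bar> / real n \<le> A * real n powr (- (1/4))"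
        unfolding A_def using uv by (simp add: distrib_right)
      moreover have "\<bar>1 / real n * LL h 0 n \<omega> - ell h n / real n\<bar> = \<bar>LL h 0 n \<omega> - ell h n\<bar> / real n"
        using n1 by (simp add: diff_divide_distrib[symmetric])
      ultimately show ?thesis by simp
    qed
    thus ?case by blast
  qed
qed

text \<open>Interpolation is applied to the difference \<open>U\<close> from the mean, which is
  polynomially small at order 0. The means converge separately, by their bounded
  derivatives.\<close>

lemma AE_K_uniform:
  assumes uv: "h0 < u" "u < v"
  shows "AE \<omega> in D. \<forall>r e. 0 < e \<longrightarrow> eventually (\<lambda>n. \<forall>h\<in>{u..v}. \<bar>1 / real n * K r h 0 n \<omega> - (deriv ^^ r) FE h\<bar> < e) sequentially"
  using AE_Q_decay AE_LL_deviation[OF uv(2)]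
proof eventually_elim
  case (elim \<omega>)
  obtain B where B: "0 < B" "\<And>i k. Q i (i + k) \<omega> \<le> B * (real i + 1)\<^sup>2 * exp (- (c / 2) * real k)" using elim(1) by blast
  define U where "U r n h = 1 / real n * K r h 0 n \<omega> - ek r n h" for r n h
  have dec: "\<exists>b>0. \<exists>A. \<forall>n\<ge>1. \<forall>h\<in>{u..v}. \<bar>U r n h\<bar> \<le> A * real n powr (- b)" for r
  proof (rule interpolation_decay[OF uv(2)])
    show "(U r n has_real_derivative U (Suc r) n h) (at h)" for r n h
      unfolding U_def by (intro DERIV_diff DERIV_cmult K_DERIV ek_DERIV) simp
    show "\<exists>A. \<forall>n\<ge>1. \<forall>h\<in>{u..v}. \<bar>U r n h\<bar> \<le> A * real n powr d" if r: "1 \<le> r" and d: "0 < d" for r d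
    proof -
      obtain A where A: "\<And>n h. 1 \<le> n \<Longrightarrow> h0 \<le> h \<Longrightarrow> \<bar>1 / real n * K r h 0 n \<omega>\<bar> \<le> A * real n powr d"
        using K_growth[OF B r d] by blast
      have "\<bar>U r n h\<bar> \<le> (A + gev ^ r * fact r ^ 3) * real n powr d" if n: "1 \<le> n" and h: "h \<in> {u..v}" for n h
      proof -
        have "1 \<le> real n powr d" using n d by (intro ge_one_powr_ge_zero) auto
        hence "gev ^ r * fact r ^ 3 * 1 \<le> gev ^ r * fact r ^ 3 * real n powr d"
          using gev_pos by (intro mult_left_mono) auto
        moreover have "\<bar>ek r n h\<bar> \<le> gev ^ r * fact r ^ 3" by (rule ek_bound) (use r n h uv in auto)
        moreover have "\<bar>1 / real n * K r h 0 n \<omega>\<bar> \<le> A * real n powr d" by (rule A) (use n h uv in auto)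
        ultimately show ?thesis unfolding U_def distrib_right by linarith
      qed
      thus ?thesis by blast
    qed
    show "\<exists>b>0. \<exists>A. \<forall>n\<ge>1. \<forall>h\<in>{u..v}. \<bar>U 0 n h\<bar> \<le> A * real n powr - b"
      using elim(2) unfolding U_def ek_0 K_0 by (intro exI[of _ "1/4"]) auto
  qed
  show ?case
  proof (intro allI impI)
    fix r and e :: real assume e: "0 < e"
    obtain b A where b: "0 < b" and A: "\<And>n h. 1 \<le> n \<Longrightarrow> h \<in> {u..v} \<Longrightarrow> \<bar>U r n h\<bar> \<le> A * real n powr (- b)" using dec[of r] by blast
    have "(\<lambda>n. A * real n powr (- b)) \<longlonglongrightarrow> A * 0"
      by (intro tendsto_mult tendsto_const tendsto_neg_powr filterlim_real_sequentially) (use b in auto)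
    hence "eventually (\<lambda>n. A * real n powr (- b) < e / 2) sequentially" using e by (intro order_tendstoD(2)) auto
    moreover have "eventually (\<lambda>n. \<forall>h\<in>{u..v}. \<bar>ek r n h - (deriv ^^ r) FE h\<bar> < e / 2) sequentially"
      using ek_uniform[OF uv, of "e / 2" r] e by simp
    moreover have "eventually (\<lambda>n. 1 \<le> n) sequentially" by (rule eventually_ge_at_top)
    ultimately show "eventually (\<lambda>n. \<forall>h\<in>{u..v}. \<bar>1 / real n * K r h 0 n \<omega> - (deriv ^^ r) FE h\<bar> < e) sequentially"
    proof eventually_elim
      case (elim n)
      show ?case
      proof
        fix h assume h: "h \<in> {u..v}"
        have "\<bar>1 / real n * K r h 0 n \<omega> - ek r n h\<bar> < e / 2" "\<bar>ek r n h - (deriv ^^ r) FE h\<bar> < e / 2"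
          using A[of n h] elim h unfolding U_def by force+
        thus "\<bar>1 / real n * K r h 0 n \<omega> - (deriv ^^ r) FE h\<bar> < e" by linarith
      qed
    qed
  qed
qed

end

section \<open>The contact set of the renewal process\<close>

locale renewal = prob_space P for P :: "'a measure" +
  fixes T :: "nat \<Rightarrow> 'a \<Rightarrow> nat"
  assumes iid: "iid_interarrival_times P T"
begin

definition pT :: "nat \<Rightarrow> real" where "pT t = prob {x \<in> space P. T 1 x = t}"

lemma T_pos: "1 \<le> i \<Longrightarrow> x \<in> space P \<Longrightarrow> 1 \<le> T i x"
  using iid unfolding iid_interarrival_times_def by blast

lemma T_indep: "indep_vars (\<lambda>_. count_space UNIV) T {1..}"
  using iid unfolding iid_interarrival_times_def by blast

lemma T_measurable [measurable]: "1 \<le> i \<Longrightarrow> T i \<in> measurable P (count_space UNIV)"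
  using T_indep unfolding indep_vars_def by auto

lemma prob_T:
  assumes "1 \<le> i"
  shows "prob {x \<in> space P. T i x = t} = pT t"
proof -
  have [measurable]: "T i \<in> measurable P (count_space UNIV)" "T 1 \<in> measurable P (count_space UNIV)" using assms by auto
  have v: "{x \<in> space P. T j x = t} = T j -` {t} \<inter> space P" for j by auto
  have "prob {x \<in> space P. T i x = t} = measure (distr P (count_space UNIV) (T i)) {t}"
    unfolding v by (subst measure_distr) auto
  also have "\<dots> = measure (distr P (count_space UNIV) (T 1)) {t}"
    using iid assms unfolding iid_interarrival_times_def by metis
  also have "\<dots> = pT t" unfolding pT_def v by (subst measure_distr) auto
  finally show ?thesis .
qed

abbreviation "R \<equiv> renewal_epoch T"

lemma R_0 [simp]: "R 0 x = 0" by (simp add: renewal_epoch_def)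

lemma R_Suc: "R (Suc i) x = R i x + T (Suc i) x" by (simp add: renewal_epoch_def)

lemma R_strict: "x \<in> space P \<Longrightarrow> i < j \<Longrightarrow> R i x < R j x"
proof (induction j)
  case (Suc j)
  have "R j x < R (Suc j) x" using T_pos[of "Suc j" x] Suc.prems by (simp add: R_Suc)
  thus ?case using Suc by (cases "i = j") auto
qed simp

definition trace :: "nat \<Rightarrow> 'a \<Rightarrow> nat set" where
  "trace n x = range (\<lambda>i. R i x) \<inter> {0..n}"

lemma R_mono: "x \<in> space P \<Longrightarrow> i \<le> j \<Longrightarrow> R i x \<le> R j x"
  using R_strict[of x i j] by (cases "i = j") auto

lemma trace_extend:
  assumes x: "x \<in> space P" and R: "R i x = a" "R (Suc i) x = b"
  shows "trace b x = trace a x \<union> {b}"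
proof -
  have ab: "a < b" using R_strict[OF x, of i "Suc i"] R by simp
  have "y \<in> trace a x \<union> {b} \<longleftrightarrow> y \<in> trace b x" for y
  proof -
    have "y \<le> a \<or> y = b" if y: "y = R k x" "y \<le> b" for k
    proof (cases "k \<le> i")
      case True thus ?thesis using R_mono[OF x, of k i] R y by auto
    next
      case False
      hence "R (Suc i) x \<le> R k x" using R_mono[OF x, of "Suc i" k] by simp
      thus ?thesis using y R by simp
    qed
    moreover have "b \<in> range (\<lambda>i. R i x)" using R(2) by blast
    ultimately show ?thesis unfolding trace_def using ab by fastforce
  qed
  thus ?thesis by blast
qed

text \<open>The event that the trace on \<open>{0..n}\<close> is a given path is an intersection of events
  \<open>T\<^sub>i = t\<^sub>i\<close>; the renewal index of the endpoint is the number of gaps.\<close>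

lemma prob_trace:
  assumes "S \<in> paths 0 n"
  shows "\<exists>t. (\<forall>x\<in>space P. trace n x = S \<longleftrightarrow> (\<forall>i\<in>{1..card (gaps S)}. T i x = t i)) \<and>
     (\<forall>x\<in>space P. trace n x = S \<longrightarrow> R (card (gaps S)) x = n) \<and> (\<Prod>i\<in>{1..card (gaps S)}. pT (t i)) = pw pT S"
  using assms
proof (induction "card (gaps S)" arbitrary: S n)
  case 0
  have "gaps S = {}" using 0 finite_path[OF 0(2)] by auto
  hence "S - {0} = {}" using snd_gaps_bij[OF 0(2)] by (simp add: bij_betw_def)
  hence S: "S = {0}" "n = 0" using pathsD[OF 0(2)] by auto
  have "trace 0 x = {0}" for x unfolding trace_def by (auto intro: image_eqI[of _ _ 0])
  thus ?case unfolding S by (auto simp: pw_def wt_def)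
next
  case (Suc k)
  have fS: "finite S" using finite_path[OF Suc.prems] .
  have n0: "n \<in> S - {0}"
  proof -
    have "gaps S \<noteq> {}" using Suc.hyps(2) by auto
    then obtain a b where "(a, b) \<in> gaps S" by auto
    hence "0 < b" "b \<in> S" using gapsD by force+
    thus ?thesis using pathsD[OF Suc.prems] by auto
  qed
  have "n \<in> snd ` gaps S" using snd_gaps_bij[OF Suc.prems] n0 by (simp add: bij_betw_def)
  then obtain a where a: "(a, n) \<in> gaps S" by auto
  have an: "a \<in> S" "a < n" using gapsD[OF a] by auto
  define S' where "S' = S \<inter> {..a}"
  have S': "S' \<in> paths 0 a" unfolding S'_def by (rule split_path(1)[OF Suc.prems an(1)])
  have tail: "S \<inter> {a..} = {a, n}" using gaps_no_between[OF a] an n0 pathsD(1)[OF Suc.prems] by force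
  have gt: "gaps {a, n} = {(a, n)}" unfolding gaps_def using an by auto
  have pt: "{a, n} \<in> paths a n" using an by (auto simp: paths_def)
  have Seq: "S = S' \<union> {a, n}" using split_path(3)[OF Suc.prems an(1)] tail unfolding S'_def by simp
  have g: "gaps S = gaps S' \<union> {(a, n)}" "gaps S' \<inter> {(a, n)} = {}"
    using gaps_concat[OF S' pt] Seq gt by auto
  have k: "k = card (gaps S')" using Suc.hyps(2) g finite_path[OF S'] by simp
  obtain t where t: "\<And>x. x \<in> space P \<Longrightarrow> trace a x = S' \<longleftrightarrow> (\<forall>i\<in>{1..k}. T i x = t i)"
     "\<And>x. x \<in> space P \<Longrightarrow> trace a x = S' \<Longrightarrow> R k x = a" "(\<Prod>i\<in>{1..k}. pT (t i)) = pw pT S'"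
    using Suc.hyps(1)[OF k S'] unfolding k[symmetric] by blast
  define t' where "t' = t(Suc k := n - a)"
  have t'1: "(\<forall>i\<in>{1..Suc k}. T i x = t' i) \<longleftrightarrow> (\<forall>i\<in>{1..k}. T i x = t i) \<and> T (Suc k) x = n - a" for x
    unfolding t'_def by (auto simp: le_Suc_eq)
  \<comment> \<open>If the trace up to \<open>a\<close> is \<open>S'\<close>, then \<open>a\<close>
    has renewal index \<open>k\<close>. As \<open>S\<close> has no point between \<open>a\<close>
    and \<open>n\<close>, the next inter-arrival alone decides whether the trace extends to
    \<open>S\<close>.\<close>
  have main: "trace n x = S \<longleftrightarrow> trace a x = S' \<and> T (Suc k) x = n - a" if x: "x \<in> space P" for x
  proof
    assume tr: "trace n x = S"
    have "trace a x = trace n x \<inter> {..a}" using an unfolding trace_def by auto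
    hence ta: "trace a x = S'" using tr unfolding S'_def by simp
    hence Rk: "R k x = a" using t(2)[OF x] by simp
    have "n \<in> trace n x" using tr pathsD[OF Suc.prems] by simp
    then obtain j where j: "R j x = n" unfolding trace_def by auto
    have "k < j" using R_mono[OF x, of j k] j Rk an by (metis leD leI)
    hence "R (Suc k) x \<le> n" using R_mono[OF x, of "Suc k" j] j by simp
    moreover have "a < R (Suc k) x" using R_strict[OF x, of k "Suc k"] Rk by simp
    moreover have "R (Suc k) x \<in> S" using calculation tr unfolding trace_def by auto
    ultimately have "R (Suc k) x = n" using gaps_no_between[OF a] by force
    thus "trace a x = S' \<and> T (Suc k) x = n - a" using ta Rk by (simp add: R_Suc)
  next
    assume h: "trace a x = S' \<and> T (Suc k) x = n - a"
    hence Rk: "R k x = a" "R (Suc k) x = n" using t(2)[OF x] an by (auto simp: R_Suc)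
    have "trace n x = S' \<union> {n}" using trace_extend[OF x Rk] h by simp
    thus "trace n x = S" using Seq S' pathsD(3)[OF S'] by auto
  qed
  have "\<forall>x\<in>space P. trace n x = S \<longleftrightarrow> (\<forall>i\<in>{1..Suc k}. T i x = t' i)" using main t(1) t'1 by blast
  moreover have "\<forall>x\<in>space P. trace n x = S \<longrightarrow> R (Suc k) x = n" using main t(2) an by (auto simp: R_Suc)
  moreover have "(\<Prod>i\<in>{1..Suc k}. pT (t' i)) = pw pT S"
  proof -
    have "(\<Prod>i\<in>{1..Suc k}. pT (t' i)) = (\<Prod>i\<in>{1..k}. pT (t' i)) * pT (t' (Suc k))" by (simp add: prod.nat_ivl_Suc')
    also have "(\<Prod>i\<in>{1..k}. pT (t' i)) = (\<Prod>i\<in>{1..k}. pT (t i))" by (rule prod.cong) (auto simp: t'_def)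
    finally have "(\<Prod>i\<in>{1..Suc k}. pT (t' i)) = pw pT S' * pT (n - a)" using t(3) by (simp add: t'_def)
    also have "\<dots> = pw pT S" unfolding pw_def Seq wt_concat[OF S' pt] by (simp add: wt_def gt)
    finally show ?thesis .
  qed
  ultimately show ?case using Suc.hyps(2) by (intro exI[of _ t']) simp
qed

lemma prob_trace_eq:
  assumes S: "S \<in> paths 0 n"
  shows "{x \<in> space P. trace n x = S} \<in> events" "prob {x \<in> space P. trace n x = S} = pw pT S"
proof -
  define k where "k = card (gaps S)"
  obtain t where t: "\<And>x. x \<in> space P \<Longrightarrow> trace n x = S \<longleftrightarrow> (\<forall>i\<in>{1..k}. T i x = t i)"
     "(\<Prod>i\<in>{1..k}. pT (t i)) = pw pT S" using prob_trace[OF S] unfolding k_def by blast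
  have ev: "{x \<in> space P. trace n x = S} = {x \<in> space P. \<forall>i\<in>{1..k}. T i x = t i}" using t(1) by blast
  have [measurable]: "i \<in> {1..k} \<Longrightarrow> T i \<in> measurable P (count_space UNIV)" for i by auto
  show "{x \<in> space P. trace n x = S} \<in> events" unfolding ev by measurable
  show "prob {x \<in> space P. trace n x = S} = pw pT S"
  proof (cases "k = 0")
    case True
    thus ?thesis unfolding ev t(2)[symmetric] by (simp add: prob_space)
  next
    case False
    have "{x \<in> space P. \<forall>i\<in>{1..k}. T i x = t i} = (\<Inter>i\<in>{1..k}. T i -` {t i} \<inter> space P)"
      using False by auto
    also have "prob \<dots> = (\<Prod>i\<in>{1..k}. prob (T i -` {t i} \<inter> space P))"
      by (rule indep_varsD[OF T_indep]) (use False in auto)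
    also have "\<dots> = (\<Prod>i\<in>{1..k}. pT (t i))"
    proof (rule prod.cong[OF refl])
      fix i assume "i \<in> {1..k}"
      moreover have "T i -` {t i} \<inter> space P = {x \<in> space P. T i x = t i}" by auto
      ultimately show "prob (T i -` {t i} \<inter> space P) = pT (t i)" using prob_T[of i "t i"] by simp
    qed
    finally show ?thesis unfolding ev t(2) .
  qed
qed

lemma contact_eq: "a \<le> n \<Longrightarrow> contact T a x = indicator (trace n x) a"
  by (auto simp: contact_def trace_def indicator_def)

text \<open>The factor \<open>contact T n\<close> selects the traces that contain \<open>n\<close>,
  and these are exactly the paths. The point 0 always belongs to the trace but carries no
  reward.\<close>

lemma partition_fun_eq_sum:
  "partition_fun P T n h \<omega> = (\<Sum>S\<in>paths 0 n. pw pT S * exp (\<Sum>x\<in>S - {0}. h + \<omega> x))"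
proof -
  let ?A = "\<lambda>S. {x \<in> space P. trace n x = S}"
  have "partition_fun P T n h \<omega> = (\<integral>x. (\<Sum>S\<in>paths 0 n. indicator (?A S) x * exp (\<Sum>x\<in>S - {0}. h + \<omega> x)) \<partial>P)"
    unfolding partition_fun_def
  proof (rule Bochner_Integration.integral_cong[OF refl])
    fix x assume x: "x \<in> space P"
    have sum: "(\<Sum>S\<in>paths 0 n. indicator (?A S) x * exp (\<Sum>x\<in>S - {0}. h + \<omega> x))
       = (if trace n x \<in> paths 0 n then exp (\<Sum>x\<in>trace n x - {0}. h + \<omega> x) else 0)"
    proof -
      have "(\<Sum>S\<in>paths 0 n. indicator (?A S) x * exp (\<Sum>x\<in>S - {0}. h + \<omega> x))
        = (\<Sum>S\<in>paths 0 n. if S = trace n x then exp (\<Sum>x\<in>S - {0}. h + \<omega> x) else 0)"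
        by (rule sum.cong) (use x in \<open>auto simp: indicator_def\<close>)
      thus ?thesis by (simp add: sum.delta)
    qed
    have "0 \<in> trace n x" unfolding trace_def by (auto intro: image_eqI[of _ _ 0])
    hence iff: "trace n x \<in> paths 0 n \<longleftrightarrow> n \<in> trace n x" unfolding paths_def trace_def by auto
    have "(\<Sum>a=1..n. (h + \<omega> a) * contact T a x) = (\<Sum>a\<in>{1..n}. if a \<in> trace n x then h + \<omega> a else 0)"
      by (rule sum.cong) (auto simp: contact_eq[of _ n] indicator_def)
    also have "\<dots> = (\<Sum>a\<in>{a\<in>{1..n}. a \<in> trace n x}. h + \<omega> a)"
      by (rule sum.inter_filter[symmetric]) simp
    also have "{a\<in>{1..n}. a \<in> trace n x} = trace n x - {0}" unfolding trace_def by auto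
    finally show "exp (\<Sum>a=1..n. (h + \<omega> a) * contact T a x) * contact T n x
      = (\<Sum>S\<in>paths 0 n. indicator (?A S) x * exp (\<Sum>x\<in>S - {0}. h + \<omega> x))"
      unfolding sum iff by (simp add: contact_eq[of n n])
  qed
  also have "\<dots> = (\<Sum>S\<in>paths 0 n. (\<integral>x. indicator (?A S) x * exp (\<Sum>x\<in>S - {0}. h + \<omega> x) \<partial>P))"
  proof (rule Bochner_Integration.integral_sum)
    fix S assume S: "S \<in> paths 0 n"
    show "integrable P (\<lambda>x. indicator (?A S) x * exp (\<Sum>x\<in>S - {0}. h + \<omega> x))"
      using prob_trace_eq(1)[OF S] by (intro integrable_mult_left integrable_real_indicator) (auto simp: emeasure_eq_measure)
  qed
  also have "\<dots> = (\<Sum>S\<in>paths 0 n. pw pT S * exp (\<Sum>x\<in>S - {0}. h + \<omega> x))"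
  proof (rule sum.cong[OF refl])
    fix S assume S: "S \<in> paths 0 n"
    have "(\<integral>x. indicator (?A S) x \<partial>P) = prob (?A S)" using prob_trace_eq(1)[OF S] by simp
    thus "(\<integral>x. indicator (?A S) x * exp (\<Sum>x\<in>S - {0}. h + \<omega> x) \<partial>P) = pw pT S * exp (\<Sum>x\<in>S - {0}. h + \<omega> x)"
      using prob_trace_eq(2)[OF S] by simp
  qed
  finally show ?thesis .
qed

lemma sum_pw_pT_le_1: "(\<Sum>S\<in>paths 0 n. pw pT S) \<le> 1"
proof -
  have "(\<Sum>S\<in>paths 0 n. pw pT S) = (\<Sum>S\<in>paths 0 n. prob {x \<in> space P. trace n x = S})"
    using prob_trace_eq(2) by simp
  also have "\<dots> = prob (\<Union>S\<in>paths 0 n. {x \<in> space P. trace n x = S})"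
    by (rule finite_measure_finite_Union[symmetric]) (use prob_trace_eq(1) in \<open>auto simp: disjoint_family_on_def\<close>)
  finally show ?thesis by simp
qed

end

section \<open>Strict convexity\<close>

lemma strictly_convex_on_half_line:
  fixes f f1 f2 :: "real \<Rightarrow> real"
  assumes d1: "\<And>x. a < x \<Longrightarrow> (f has_real_derivative f1 x) (at x)"
    and d2: "\<And>x. a < x \<Longrightarrow> (f1 has_real_derivative f2 x) (at x)" and pos: "\<And>x. a < x \<Longrightarrow> 0 < f2 x"
  shows "strictly_convex_on {a<..} f"
proof -
  have lt: "f (u * x + v * y) < u * f x + v * f y" if a: "a < x" and xy: "x < y" and uv: "0 < u" "0 < v" "u + v = 1" for x y u v
  proof -
    define z where "z = u * x + v * y"
    have u: "u = 1 - v" using uv by simp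
    have zx: "z - x = v * (y - x)" unfolding z_def u by (simp add: algebra_simps)
    have yz: "y - z = u * (y - x)" unfolding z_def u by (simp add: algebra_simps)
    have "0 < z - x" "0 < y - z" unfolding zx yz using uv xy by auto
    hence z: "x < z" "z < y" by auto
    obtain \<xi> where \<xi>: "x < \<xi>" "\<xi> < z" "f z - f x = (z - x) * f1 \<xi>"
      using MVT2[OF z(1), of f f1] d1 a by auto
    obtain \<zeta> where \<zeta>: "z < \<zeta>" "\<zeta> < y" "f y - f z = (y - z) * f1 \<zeta>"
      using MVT2[OF z(2), of f f1] d1 a z by auto
    have "f1 \<xi> < f1 \<zeta>"
    proof (rule DERIV_pos_imp_increasing[of \<xi> \<zeta> f1])
      show "\<xi> < \<zeta>" using \<xi> \<zeta> by simp
      show "\<exists>y. DERIV f1 x :> y \<and> 0 < y" if "\<xi> \<le> x" for x using d2[of x] pos[of x] that \<xi> a by auto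
    qed
    hence "(u * v * (y - x)) * f1 \<xi> < (u * v * (y - x)) * f1 \<zeta>" using uv xy by (intro mult_strict_left_mono) auto
    moreover have "u * (f z - f x) = (u * v * (y - x)) * f1 \<xi>" "v * (f y - f z) = (u * v * (y - x)) * f1 \<zeta>"
      unfolding \<xi>(3) \<zeta>(3) zx yz by simp_all
    ultimately have "u * (f z - f x) < v * (f y - f z)" by (simp only:)
    hence "(u + v) * f z < u * f x + v * f y" by (simp add: algebra_simps)
    thus ?thesis using uv unfolding z_def by simp
  qed
  show ?thesis unfolding strictly_convex_on_def
  proof (intro conjI ballI allI impI)
    fix x y u v :: real assume h: "x \<in> {a<..}" "y \<in> {a<..}" "0 < u" "0 < v" "x \<noteq> y" "u + v = 1"
    show "f (u * x + v * y) < u * f x + v * f y"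
    proof (cases "x < y")
      case True thus ?thesis using lt h by auto
    next
      case False
      hence "f (v * y + u * x) < v * f y + u * f x" using h by (intro lt) auto
      thus ?thesis by (simp add: add.commute)
    qed
  qed (simp add: convex_real_interval)
qed

section \<open>A lower bound on the variance of the number of contacts\<close>

context pinning
begin

text \<open>The expectation with respect to the polymer measure, for fixed disorder.\<close>

definition av :: "real \<Rightarrow> nat \<Rightarrow> (nat \<Rightarrow> real) \<Rightarrow> (nat set \<Rightarrow> real) \<Rightarrow> real" where
  "av h n \<omega> \<phi> = (\<Sum>S\<in>paths 0 n. wt (bw p \<omega> h) S * \<phi> S) / Z 0 n h \<omega>"

lemma av_add: "av h n \<omega> (\<lambda>S. \<phi> S + \<psi> S) = av h n \<omega> \<phi> + av h n \<omega> \<psi>"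
  unfolding av_def by (simp add: distrib_left sum.distrib add_divide_distrib)

lemma av_cmult: "av h n \<omega> (\<lambda>S. c * \<phi> S) = c * av h n \<omega> \<phi>"
  unfolding av_def by (simp add: sum_distrib_left mult_ac)

lemma av_diff: "av h n \<omega> (\<lambda>S. \<phi> S - \<psi> S) = av h n \<omega> \<phi> - av h n \<omega> \<psi>"
  unfolding av_def by (simp add: right_diff_distrib sum_subtractf diff_divide_distrib)

lemma av_sum: "av h n \<omega> (\<lambda>S. \<Sum>x\<in>X. \<phi> x S) = (\<Sum>x\<in>X. av h n \<omega> (\<phi> x))"
  unfolding av_def by (simp add: sum_distrib_left sum_divide_distrib) (rule sum.swap)

lemma av_const: "av h n \<omega> (\<lambda>S. c) = c"
proof -
  have "(\<Sum>S\<in>paths 0 n. wt (bw p \<omega> h) S * c) = Z 0 n h \<omega> * c"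
    unfolding ZZ_def path_sum_def by (simp add: sum_distrib_right)
  thus ?thesis unfolding av_def using Z_pos[of 0 n \<omega> h] by simp
qed

lemma av_mono:
  assumes "\<And>S. S \<in> paths 0 n \<Longrightarrow> \<phi> S \<le> \<psi> S"
  shows "av h n \<omega> \<phi> \<le> av h n \<omega> \<psi>"
  unfolding av_def using Z_pos[of 0 n \<omega> h] wt_nonneg[OF pos_bw] assms
  by (intro divide_right_mono sum_mono mult_left_mono) (auto intro: less_imp_le)

lemma av_cong:
  assumes "\<And>S. S \<in> paths 0 n \<Longrightarrow> \<phi> S = \<psi> S"
  shows "av h n \<omega> \<phi> = av h n \<omega> \<psi>"
  unfolding av_def using assms by simp

lemma av_nonneg:
  assumes "\<And>S. S \<in> paths 0 n \<Longrightarrow> 0 \<le> \<phi> S"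
  shows "0 \<le> av h n \<omega> \<phi>"
  using av_mono[of n "\<lambda>_. 0" \<phi> h \<omega>] assms by (simp add: av_const)

text \<open>As a function of \<open>h\<close> the partition function is a moment generating function
  of the number of contacts, so the first two derivatives of its logarithm are mean and
  variance.\<close>

lemma K_1_2:
  defines "N \<equiv> \<lambda>S. real (card (S - {0}))"
  shows "K 1 h 0 n \<omega> = av h n \<omega> N" "K 2 h 0 n \<omega> = av h n \<omega> (\<lambda>S. (N S)\<^sup>2) - (av h n \<omega> N)\<^sup>2"
proof -
  define M where "M k h = (\<Sum>S\<in>paths 0 n. wt (bw p \<omega> h) S * N S ^ k)" for k h
  have M0: "M 0 h = Z 0 n h \<omega>" for h by (simp add: M_def ZZ_def path_sum_def)
  have w: "wt (bw p \<omega> h) S = pw p S * exp (\<Sum>x\<in>S - {0}. \<omega> x) * exp (h * N S)" if "S \<in> paths 0 n" for S h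
    unfolding wt_bw_real[OF that] N_def by (simp add: sum.distrib exp_add mult_ac)
  have DM: "(M k has_real_derivative M (Suc k) h) (at h)" for k h
  proof -
    have "M k = (\<lambda>h. \<Sum>S\<in>paths 0 n. pw p S * exp (\<Sum>x\<in>S - {0}. \<omega> x) * exp (h * N S) * N S ^ k)"
      unfolding M_def using w by (simp add: fun_eq_iff)
    moreover have "((\<lambda>h. \<Sum>S\<in>paths 0 n. pw p S * exp (\<Sum>x\<in>S - {0}. \<omega> x) * exp (h * N S) * N S ^ k) has_real_derivative
        (\<Sum>S\<in>paths 0 n. pw p S * exp (\<Sum>x\<in>S - {0}. \<omega> x) * (exp (h * N S) * N S) * N S ^ k)) (at h)"
      by (auto intro!: derivative_eq_intros sum.cong)
    moreover have "(\<Sum>S\<in>paths 0 n. pw p S * exp (\<Sum>x\<in>S - {0}. \<omega> x) * (exp (h * N S) * N S) * N S ^ k) = M (Suc k) h"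
      unfolding M_def using w by (simp add: mult_ac)
    ultimately show ?thesis by simp
  qed
  have pos: "0 < M 0 h" for h unfolding M0 using Z_pos by simp
  have k0: "(\<lambda>h. K 0 h 0 n \<omega>) = (\<lambda>h. ln (M 0 h))" by (simp add: K_0 LL_def M0)
  have "((\<lambda>h. K 0 h 0 n \<omega>) has_real_derivative M 1 h / M 0 h) (at h)" for h
    unfolding k0 using DM[of 0 h] pos[of h] by (auto intro!: derivative_eq_intros simp: field_simps)
  hence k1: "K 1 h 0 n \<omega> = M 1 h / M 0 h" for h
    using K_DERIV[of 0 n 0 \<omega> h] by (auto intro: DERIV_unique)
  have "((\<lambda>h. M 1 h / M 0 h) has_real_derivative (M 2 h * M 0 h - M 1 h * M 1 h) / (M 0 h * M 0 h)) (at h)" for h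
    using DERIV_divide[OF DM[of 1 h] DM[of 0 h]] pos[of h] by (simp add: numeral_2_eq_2)
  hence "((\<lambda>h. K 1 h 0 n \<omega>) has_real_derivative (M 2 h * M 0 h - M 1 h * M 1 h) / (M 0 h * M 0 h)) (at h)" for h
    unfolding k1 .
  hence k2: "K 2 h 0 n \<omega> = (M 2 h * M 0 h - M 1 h * M 1 h) / (M 0 h * M 0 h)"
    using K_DERIV[of 0 n 1 \<omega> h] DERIV_unique by (metis Suc_1 zero_le)
  have a1: "av h n \<omega> N = M 1 h / M 0 h" and a2: "av h n \<omega> (\<lambda>S. (N S)\<^sup>2) = M 2 h / M 0 h"
    unfolding av_def M0 by (simp_all add: M_def)
  show "K 1 h 0 n \<omega> = av h n \<omega> N" unfolding k1 a1 ..
  show "K 2 h 0 n \<omega> = av h n \<omega> (\<lambda>S. (N S)\<^sup>2) - (av h n \<omega> N)\<^sup>2"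
    unfolding k2 a1 a2 using pos[of h] by (simp add: power2_eq_square diff_divide_distrib)
qed

definition nbr :: "nat \<Rightarrow> nat set \<Rightarrow> real" where
  "nbr x S = (if x - 1 \<in> S \<and> x + 1 \<in> S then 1 else 0)"

definition cprob :: "real \<Rightarrow> (nat \<Rightarrow> real) \<Rightarrow> nat \<Rightarrow> real" where
  "cprob h \<omega> x = (p 1)\<^sup>2 * exp (h + \<omega> x) / ((p 1)\<^sup>2 * exp (h + \<omega> x) + p 2)"

text \<open>Given that \<open>x - 1\<close> and \<open>x + 1\<close> are contacts, \<open>x\<close> is a contact with probability
  \<open>cprob h \<omega> x\<close>, independently of everything else.\<close>

lemma av_toggle:
  assumes x: "1 \<le> x" "x + 1 \<le> n" and \<phi>: "\<And>S. \<phi> (insert x S) = \<phi> (S - {x})"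
  shows "av h n \<omega> (\<lambda>S. nbr x S * (indicator S x - cprob h \<omega> x) * \<phi> S) = 0"
proof -
  let ?g = "bw p \<omega> h"
  define \<pi> where "\<pi> = cprob h \<omega> x"
  define F where "F S = wt ?g S * (nbr x S * (indicator S x - \<pi>) * \<phi> S)" for S
  \<comment> \<open>Paths through both neighbours of \<open>x\<close> are paired by adding and
    removing \<open>x\<close>. The two weights of a pair have the ratio
    \<open>\<alpha> / \<beta>\<close>, whatever the rest of the path is, so the contributions cancel
    within each pair.\<close>
  define A where "A = {S \<in> paths 0 n. x - 1 \<in> S \<and> x + 1 \<in> S \<and> x \<notin> S}"
  define B where "B = {S \<in> paths 0 n. x - 1 \<in> S \<and> x + 1 \<in> S \<and> x \<in> S}"
  have AB: "finite A" "finite B" "A \<inter> B = {}" unfolding A_def B_def by auto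
  have "(\<Sum>S\<in>paths 0 n. F S) = (\<Sum>S\<in>A \<union> B. F S)"
    by (rule sum.mono_neutral_right) (auto simp: A_def B_def F_def nbr_def)
  also have "\<dots> = (\<Sum>S\<in>A. F S) + (\<Sum>S\<in>B. F S)" using AB by (rule sum.union_disjoint)
  also have "(\<Sum>S\<in>B. F S) = (\<Sum>S\<in>A. F (insert x S))"
  proof (rule sum.reindex_bij_witness[of _ "insert x" "\<lambda>S. S - {x}"])
    show "insert x (S - {x}) = S" if "S \<in> B" for S using that unfolding B_def by auto
    show "S - {x} \<in> A" if "S \<in> B" for S using that x unfolding A_def B_def paths_def by auto
    show "insert x S - {x} = S" if "S \<in> A" for S using that unfolding A_def by auto
    show "insert x S \<in> B" if "S \<in> A" for S using that x unfolding A_def B_def paths_def by auto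
    show "F (insert x (S - {x})) = F S" if "S \<in> B" for S using that unfolding B_def by (simp add: insert_absorb)
  qed
  also have "(\<Sum>S\<in>A. F S) + (\<Sum>S\<in>A. F (insert x S)) = (\<Sum>S\<in>A. F S + F (insert x S))" by (simp add: sum.distrib)
  also have "\<dots> = 0"
  proof (rule sum.neutral, rule ballI)
    fix S assume S: "S \<in> A"
    hence Sp: "S \<in> paths 0 n" "x - 1 \<in> S" "x + 1 \<in> S" "x \<notin> S" unfolding A_def by auto
    have gap: "(x - 1, x + 1) \<in> gaps S"
    proof (rule gapsI)
      fix y assume "y \<in> S"
      hence "y \<noteq> x" using Sp by auto
      thus "y \<le> x - 1 \<or> x + 1 \<le> y" by linarith
    qed (use Sp x in auto)
    define R where "R = {x - 1, x, x + 1}"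
    have R: "R \<in> paths (x - 1) (x + 1)" unfolding R_def paths_def using x by auto
    have gR: "gaps R = {(x - 1, x), (x, x + 1)}" unfolding R_def gaps_def using x by auto
    have SR: "S \<union> R = insert x S" unfolding R_def using Sp by auto
    have wR: "wt ?g R = ?g (x - 1) x * ?g x (x + 1)" unfolding wt_def gR using x by simp
    define \<alpha> where "\<alpha> = ?g (x - 1) x * ?g x (x + 1)"
    define \<beta> where "\<beta> = ?g (x - 1) (x + 1)"
    have w: "\<beta> * wt ?g (insert x S) = wt ?g S * \<alpha>"
      using wt_fill[OF finite_path[OF Sp(1)] gap R, of ?g] unfolding SR wR \<alpha>_def \<beta>_def .
    have p12: "0 < p 1" "0 < p 2" using p_pos by auto
    have \<beta>: "0 < \<beta>" and \<alpha>: "0 < \<alpha>" unfolding \<alpha>_def \<beta>_def using pos_wtD[OF pos_bw] x by auto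
    have two: "x + 1 - (x - 1) = 2" using x by simp
    have \<pi>: "\<pi> = \<alpha> / (\<alpha> + \<beta>)"
    proof -
      define a where "a = (p 1)\<^sup>2 * exp (h + \<omega> x)"
      have a0: "0 < a" unfolding a_def using p12 by simp
      have \<alpha>': "\<alpha> = a * exp (h + \<omega> (x + 1))" unfolding \<alpha>_def a_def bw_def using x by (simp add: power2_eq_square)
      have \<beta>': "\<beta> = p 2 * exp (h + \<omega> (x + 1))" unfolding \<beta>_def bw_def two by simp
      have "\<alpha> / (\<alpha> + \<beta>) = (a * exp (h + \<omega> (x + 1))) / ((a + p 2) * exp (h + \<omega> (x + 1)))"
        unfolding \<alpha>' \<beta>' by (simp add: distrib_right)
      also have "\<dots> = a / (a + p 2)" by simp
      finally show ?thesis unfolding \<pi>_def cprob_def a_def by simp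
    qed
    have \<phi>': "\<phi> (insert x S) = \<phi> S" using \<phi>[of S] Sp(4) by simp
    have "F S + F (insert x S) = \<phi> S * (wt ?g (insert x S) * (1 - \<pi>) - wt ?g S * \<pi>)"
      unfolding F_def nbr_def using Sp x \<phi>' by (simp add: algebra_simps)
    also have "wt ?g (insert x S) = wt ?g S * \<alpha> / \<beta>" using w \<beta> by (simp add: field_simps)
    also have "wt ?g S * \<alpha> / \<beta> * (1 - \<pi>) - wt ?g S * \<pi> = 0"
    proof -
      have "1 - \<pi> = \<beta> / (\<alpha> + \<beta>)" unfolding \<pi> using \<alpha> \<beta> by (simp add: field_simps)
      thus ?thesis unfolding \<pi> using \<beta> by simp
    qed
    finally show "F S + F (insert x S) = 0" by simp
  qed
  finally have "(\<Sum>S\<in>paths 0 n. F S) = 0" .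
  thus ?thesis unfolding av_def F_def \<pi>_def by simp
qed

text \<open>The variance of the number of contacts is bounded below by that of
  \<open>G = \<Sum> nbr x (indicator S x - cprob h \<omega> x)\<close>, which equals its covariance with \<open>G\<close>; the sum is over
  even \<open>x\<close>, so that the summands are uncorrelated.\<close>

lemma K_2_ge:
  assumes X: "X \<subseteq> {x. even x \<and> 1 \<le> x \<and> x + 1 \<le> n}"
  shows "(\<Sum>x\<in>X. av h n \<omega> (\<lambda>S. nbr x S * (indicator S x - cprob h \<omega> x)\<^sup>2)) \<le> K 2 h 0 n \<omega>"
proof -
  have fX: "finite X" by (rule finite_subset[OF X]) (rule finite_subset[of _ "{..n}"], auto)
  define N where "N S = real (card (S - {0}))" for S :: "nat set"
  define d where "d x S = nbr x S * (indicator S x - cprob h \<omega> x)" for x S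
  define G where "G S = (\<Sum>x\<in>X. d x S)" for S
  let ?E = "av h n \<omega>"
  define V where "V = (\<Sum>x\<in>X. ?E (\<lambda>S. nbr x S * (indicator S x - cprob h \<omega> x)\<^sup>2))"
  have xX: "1 \<le> x" "x + 1 \<le> n" "even x" if "x \<in> X" for x using X that by auto
  have tog: "?E (\<lambda>S. d x S * \<phi> S) = 0" if "x \<in> X" "\<And>S. \<phi> (insert x S) = \<phi> (S - {x})" for x \<phi>
    using av_toggle[OF xX(1,2)[OF that(1)] that(2)] unfolding d_def .
  have sq: "d x S * d x S = nbr x S * (indicator S x - cprob h \<omega> x)\<^sup>2" for x S
    unfolding d_def nbr_def by (simp add: power2_eq_square)
  have EG: "?E G = 0"
  proof -
    have "?E (d x) = 0" if "x \<in> X" for x using tog[OF that, of "\<lambda>_. 1"] by simp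
    thus ?thesis unfolding G_def by (simp add: av_sum)
  qed
  have EGG: "?E (\<lambda>S. (G S)\<^sup>2) = V"
  proof -
    have "?E (\<lambda>S. (G S)\<^sup>2) = (\<Sum>x\<in>X. \<Sum>y\<in>X. ?E (\<lambda>S. d x S * d y S))"
      unfolding G_def power2_eq_square sum_product by (simp add: av_sum)
    also have "\<dots> = (\<Sum>x\<in>X. \<Sum>y\<in>X. if y = x then ?E (\<lambda>S. d x S * d x S) else 0)"
    proof (intro sum.cong refl)
      fix x y assume xy: "x \<in> X" "y \<in> X"
      show "?E (\<lambda>S. d x S * d y S) = (if y = x then ?E (\<lambda>S. d x S * d x S) else 0)"
      proof (cases "y = x")
        case False
        \<comment> \<open>Both sites are even and distinct, so toggling \<open>x\<close> affects
          neither \<open>y\<close> nor the neighbours of \<open>y\<close>.\<close>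
        have ev: "even x" "even y" "1 \<le> y" using xX xy by auto
        have "x \<noteq> y - 1" "x \<noteq> y + 1" using ev by presburger+
        hence "d y (insert x S) = d y (S - {x})" for S using False unfolding d_def nbr_def by (auto simp: indicator_def)
        thus ?thesis using tog[OF xy(1), of "d y"] False by simp
      qed simp
    qed
    also have "\<dots> = V" unfolding V_def sq using fX by (simp add: sum.delta)
    finally show ?thesis .
  qed
  have ENG: "?E (\<lambda>S. N S * G S) = V"
  proof -
    have N: "N S = (\<Sum>y\<in>{1..n}. indicator S y)" if "S \<in> paths 0 n" for S
    proof -
      have sub: "S - {0} \<subseteq> {1..n}" using pathsD[OF that] by force
      have "(\<Sum>y\<in>{1..n}. indicator S y) = (\<Sum>y\<in>S - {0}. (1::real))"
        by (rule sum.mono_neutral_cong_right) (use sub in \<open>auto simp: indicator_def\<close>)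
      thus ?thesis unfolding N_def by simp
    qed
    have "?E (\<lambda>S. N S * G S) = ?E (\<lambda>S. \<Sum>x\<in>X. \<Sum>y\<in>{1..n}. d x S * indicator S y)"
    proof (rule av_cong)
      fix S assume S: "S \<in> paths 0 n"
      have "N S * G S = G S * N S" by simp
      also have "\<dots> = (\<Sum>x\<in>X. \<Sum>y\<in>{1..n}. d x S * indicator S y)"
        unfolding N[OF S] G_def by (rule sum_product)
      finally show "N S * G S = (\<Sum>x\<in>X. \<Sum>y\<in>{1..n}. d x S * indicator S y)" .
    qed
    also have "\<dots> = (\<Sum>x\<in>X. \<Sum>y\<in>{1..n}. ?E (\<lambda>S. d x S * indicator S y))" by (simp only: av_sum)
    also have "\<dots> = (\<Sum>x\<in>X. \<Sum>y\<in>{1..n}. if y = x then ?E (\<lambda>S. d x S * d x S) else 0)"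
    proof (intro sum.cong refl)
      fix x y assume xy: "x \<in> X" "y \<in> {1..n}"
      show "?E (\<lambda>S. d x S * indicator S y) = (if y = x then ?E (\<lambda>S. d x S * d x S) else 0)"
      proof (cases "y = x")
        case True
        \<comment> \<open>The indicator is its centered version plus the conditional probability,
          and the latter multiplies a term of mean 0.\<close>
        have e: "d x S * indicator S x = d x S * d x S + cprob h \<omega> x * d x S" for S
          unfolding d_def nbr_def by (simp add: algebra_simps)
        have "?E (\<lambda>S. cprob h \<omega> x * d x S) = 0" using tog[OF xy(1), of "\<lambda>_. 1"] by (simp add: av_cmult)
        thus ?thesis unfolding True e by (simp add: av_add)
      next
        case False
        have "indicator (insert x S) y = (indicator (S - {x}) y :: real)" for S using False by (auto simp: indicator_def)
        thus ?thesis using tog[OF xy(1), of "\<lambda>S. indicator S y"] False by simp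
      qed
    qed
    also have "\<dots> = (\<Sum>x\<in>X. ?E (\<lambda>S. d x S * d x S))"
    proof (rule sum.cong[OF refl])
      fix x assume "x \<in> X"
      hence "x \<in> {1..n}" using xX[of x] by simp
      thus "(\<Sum>y\<in>{1..n}. if y = x then ?E (\<lambda>S. d x S * d x S) else 0) = ?E (\<lambda>S. d x S * d x S)" by simp
    qed
    also have "\<dots> = V" unfolding V_def sq ..
    finally show ?thesis .
  qed
  define c where "c = ?E N"
  \<comment> \<open>The covariance of \<open>N\<close> and \<open>G\<close> and the variance of
    \<open>G\<close> are both \<open>V\<close>, so the mean of this square is the variance of
    \<open>N\<close> minus \<open>V\<close>.\<close>
  have "0 \<le> ?E (\<lambda>S. (N S - c - G S)\<^sup>2)" by (rule av_nonneg) simp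
  also have "(\<lambda>S. (N S - c - G S)\<^sup>2) = (\<lambda>S. ((N S)\<^sup>2 - 2 * c * N S + c\<^sup>2) - 2 * (N S * G S) + 2 * c * G S + (G S)\<^sup>2)"
    by (simp add: fun_eq_iff power2_eq_square algebra_simps)
  also have "?E \<dots> = (?E (\<lambda>S. (N S)\<^sup>2) - 2 * c * c + c\<^sup>2) - 2 * V + 0 + V"
    by (simp only: av_add av_diff av_cmult[where c = 2] av_cmult[where c = "2 * c"] av_const EG EGG ENG c_def[symmetric] mult_zero_right)
  finally have "V \<le> ?E (\<lambda>S. (N S)\<^sup>2) - c\<^sup>2" by (simp add: power2_eq_square)
  thus ?thesis unfolding V_def c_def K_1_2(2) N_def .
qed

text \<open>Both neighbours of \<open>x\<close> are inserted as contacts. Each insertion costs at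
  most a factor \<open>\<epsilon>\<close>, and 4 bounds the number of ways in which they may have
  been present before.\<close>

lemma av_nbr_ge:
  assumes x: "1 \<le> x" "x + 1 \<le> n" and h: "h0 \<le> h" and m: "1 \<le> m"
    and \<epsilon>: "0 < \<epsilon>" "\<epsilon> \<le> 1" "\<forall>s s'. 1 \<le> s \<and> 1 \<le> s' \<and> s + s' < m \<longrightarrow> \<epsilon> \<le> p s * p s' * exp (h0 - \<kappa>)"
    and ok: "- \<kappa> \<le> \<omega> (x - 1)" "- \<kappa> \<le> \<omega> (x + 1)"
  shows "\<epsilon>\<^sup>2 / 4 * av h n \<omega> (\<lambda>S. if good m S (x - 1) \<and> good m S (x + 1) then 1 else 0) \<le> av h n \<omega> (nbr x)"
proof -
  let ?g = "bw p \<omega> h"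
  define A where "A = {x - 1, x + 1}"
  have cA: "card A = 2" unfolding A_def using x by simp
  define Gd where "Gd = {S \<in> paths 0 n. good m S (x - 1) \<and> good m S (x + 1)}"
  define U where "U = {S \<in> paths 0 n. A \<subseteq> S}"
  have fin: "finite Gd" "finite U" "finite A" unfolding Gd_def U_def A_def by auto
  have cost: "\<forall>a y b. a < y \<and> y < b \<and> b - a < m \<and> y \<in> A \<longrightarrow> \<epsilon> * ?g a b \<le> ?g a y * ?g y b"
  proof (intro allI impI, elim conjE)
    fix a y b assume h': "a < y" "y < b" "b - a < m" "y \<in> A"
    have "1 \<le> y - a \<and> 1 \<le> b - y \<and> y - a + (b - y) < m" using h' by linarith
    hence "\<epsilon> \<le> p (y - a) * p (b - y) * exp (h0 - \<kappa>)" using \<epsilon>(3) by blast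
    also have "\<dots> \<le> p (y - a) * p (b - y) * exp (h + \<omega> y)"
    proof (rule mult_left_mono)
      show "exp (h0 - \<kappa>) \<le> exp (h + \<omega> y)" using h h' ok by (auto simp: A_def)
      show "0 \<le> p (y - a) * p (b - y)" using p_pos h' by (auto intro!: mult_nonneg_nonneg less_imp_le)
    qed
    finally have 1: "\<epsilon> * p (b - a) \<le> (p (y - a) * p (b - y) * exp (h + \<omega> y)) * 1"
      using p_le_1[of "b - a"] less_imp_le[OF p_pos[rule_format, of "b - a"]] h' \<epsilon>(1) by (intro mult_mono) auto
    have "\<epsilon> * p (b - a) * exp (h + \<omega> b) \<le> (p (y - a) * p (b - y) * exp (h + \<omega> y)) * 1 * exp (h + \<omega> b)"
      by (rule mult_right_mono[OF 1]) simp
    thus "\<epsilon> * ?g a b \<le> ?g a y * ?g y b" by (simp add: bw_def mult_ac)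
  qed
  have add: "S \<union> A \<in> paths 0 n" "\<epsilon>\<^sup>2 * wt ?g S \<le> wt ?g (S \<union> A)" if "S \<in> Gd" for S
    using add_good_points[OF pos_bw \<epsilon>(1,2) cost, of S 0 n A] that fin(3) unfolding cA Gd_def by (auto simp: A_def)
  have inj: "inj_on (\<lambda>S. (S \<union> A, S \<inter> A)) Gd" by (rule inj_onI) blast
  have "\<epsilon>\<^sup>2 * (\<Sum>S\<in>Gd. wt ?g S) \<le> (\<Sum>S\<in>Gd. wt ?g (S \<union> A))"
    unfolding sum_distrib_left by (rule sum_mono) (rule add)
  also have "\<dots> = (\<Sum>(V, B)\<in>(\<lambda>S. (S \<union> A, S \<inter> A)) ` Gd. wt ?g V)" by (subst sum.reindex[OF inj]) simp
  also have "\<dots> \<le> (\<Sum>(V, B)\<in>U \<times> Pow A. wt ?g V)"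
    by (rule sum_mono2) (use fin add wt_nonneg[OF pos_bw] in \<open>auto simp: U_def\<close>)
  also have "\<dots> = 4 * (\<Sum>V\<in>U. wt ?g V)"
    using cA fin by (simp add: sum.cartesian_product[symmetric] card_Pow sum_distrib_left)
  finally have "\<epsilon>\<^sup>2 / 4 * (\<Sum>S\<in>Gd. wt ?g S) \<le> (\<Sum>V\<in>U. wt ?g V)" by simp
  moreover have "(\<Sum>S\<in>Gd. wt ?g S) = (\<Sum>S\<in>paths 0 n. wt ?g S * (if good m S (x - 1) \<and> good m S (x + 1) then 1 else 0))"
    unfolding Gd_def by (simp add: sum.inter_filter if_distrib cong: if_cong)
  moreover have "(\<Sum>V\<in>U. wt ?g V) = (\<Sum>S\<in>paths 0 n. wt ?g S * nbr x S)"
    unfolding U_def A_def nbr_def by (simp add: sum.inter_filter if_distrib cong: if_cong)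
  ultimately have "\<epsilon>\<^sup>2 / 4 * (\<Sum>S\<in>paths 0 n. wt ?g S * (if good m S (x - 1) \<and> good m S (x + 1) then 1 else 0))
      \<le> (\<Sum>S\<in>paths 0 n. wt ?g S * nbr x S)" by (simp only:)
  from divide_right_mono[OF this less_imp_le[OF Z_pos[of 0 n \<omega> h]]] show ?thesis unfolding av_def
    by (simp only: times_divide_eq_right le0)
qed

definition bad :: "nat \<Rightarrow> nat \<Rightarrow> nat set \<Rightarrow> real" where
  "bad m x S = (if good m S x then 0 else 1)"

text \<open>Outside an event whose probability is at most \<open>RR\<close>, long gaps cover less
  than an eighth of the sites; on that event all sites are counted.\<close>

lemma av_sum_bad_le:
  assumes t: "0 < t" "t \<le> 1" and X: "X \<subseteq> {0..n}"
  shows "(\<Sum>x\<in>X. av h n \<omega> (bad m x)) \<le> real n / 8 + (real n + 1) * RR h m t 0 n \<omega>"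
proof -
  define B where "B S \<longleftrightarrow> n \<le> 8 * total_length (big_gaps m S)" for S
  have "(\<Sum>x\<in>X. av h n \<omega> (bad m x)) = av h n \<omega> (\<lambda>S. \<Sum>x\<in>X. bad m x S)" by (simp only: av_sum)
  also have "\<dots> \<le> av h n \<omega> (\<lambda>S. real n / 8 + (real n + 1) * (if B S then 1 else 0))"
  proof (rule av_mono)
    fix S assume S: "S \<in> paths 0 n"
    have "(\<Sum>x\<in>X. bad m x S) \<le> (\<Sum>x\<in>{0..n}. bad m x S)"
      by (rule sum_mono2) (use X in \<open>auto simp: bad_def\<close>)
    also have "\<dots> = (\<Sum>x\<in>{x\<in>{0..n}. \<not> good m S x}. 1)"
      by (rule sum.mono_neutral_cong_right) (auto simp: bad_def)
    finally have 1: "(\<Sum>x\<in>X. bad m x S) \<le> real (card {x\<in>{0..n}. \<not> good m S x})" by simp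
    show "(\<Sum>x\<in>X. bad m x S) \<le> real n / 8 + (real n + 1) * (if B S then 1 else 0)"
    proof (cases "B S")
      case True
      have "card {x\<in>{0..n}. \<not> good m S x} \<le> card {0..n}" by (rule card_mono) auto
      thus ?thesis using 1 True by simp
    next
      case False
      have "real (card {x\<in>{0..n}. \<not> good m S x}) \<le> real (total_length (big_gaps m S))"
        using card_not_good_le[OF S, of m] by simp
      thus ?thesis using 1 False unfolding B_def by simp
    qed
  qed
  also have "\<dots> = real n / 8 + (real n + 1) * av h n \<omega> (\<lambda>S. if B S then 1 else 0)"
    by (simp only: av_add av_const av_cmult)
  also have "av h n \<omega> (\<lambda>S. if B S then 1 else 0) \<le> RR h m t 0 n \<omega>"
  proof -
    have "(\<Sum>S\<in>paths 0 n. wt (bw p \<omega> h) S * (if B S then 1 else 0)) = (\<Sum>S | S \<in> paths 0 n \<and> B S. wt (bw p \<omega> h) S)"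
      by (rule sum.mono_neutral_cong_right) auto
    also have "\<dots> \<le> Z 0 n h \<omega> * RR h m t 0 n \<omega>"
      unfolding B_def using big_gaps_prob_le[of h h t 0 0 n n \<omega> m] t by simp
    finally show ?thesis unfolding av_def using Z_pos[of 0 n \<omega> h] by (simp add: divide_le_eq mult.commute)
  qed
  finally show ?thesis by (simp add: mult_left_mono)
qed

text \<open>Bounded disorder keeps the conditional probability of a contact away from 0 and 1, so
  neither value of the indicator comes close to it.\<close>

lemma cprob_bounds:
  assumes "0 < \<kappa>"
  obtains \<eta> where "0 < \<eta>" "\<forall>\<omega> x S. \<bar>\<omega> x\<bar> \<le> \<kappa> \<longrightarrow> \<eta> \<le> (indicator S x - cprob h \<omega> x)\<^sup>2"
proof -
  define a where "a y = (p 1)\<^sup>2 * exp (h + y)" for y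
  have p12: "0 < p 1" "0 < p 2" using p_pos by auto
  have a: "0 < a y" for y unfolding a_def using p12 by simp
  have amono: "a y \<le> a z" if "y \<le> z" for y z unfolding a_def using that by (intro mult_left_mono) auto
  define \<theta> where "\<theta> = min (a (- \<kappa>)) (p 2) / (a \<kappa> + p 2)"
  have \<theta>: "0 < \<theta>" unfolding \<theta>_def using a p12 by (simp add: add_pos_pos)
  show ?thesis
  proof (rule that[of "\<theta>\<^sup>2"])
    show "0 < \<theta>\<^sup>2" using \<theta> by simp
    show "\<forall>\<omega> x S. \<bar>\<omega> x\<bar> \<le> \<kappa> \<longrightarrow> \<theta>\<^sup>2 \<le> (indicator S x - cprob h \<omega> x)\<^sup>2"
    proof (intro allI impI)
      fix \<omega> :: "nat \<Rightarrow> real" and x S assume w: "\<bar>\<omega> x\<bar> \<le> \<kappa>"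
      define A where "A = a (\<omega> x)"
      have A: "0 < A" "a (- \<kappa>) \<le> A" "A \<le> a \<kappa>" unfolding A_def using a amono w by auto
      have cp: "cprob h \<omega> x = A / (A + p 2)" unfolding cprob_def A_def a_def ..
      have 1: "1 - A / (A + p 2) = p 2 / (A + p 2)" using A p12 by (simp add: field_simps)
      have "\<theta> \<le> A / (A + p 2)" "\<theta> \<le> p 2 / (A + p 2)"
        unfolding \<theta>_def by (rule frac_le, use A p12 a[of "- \<kappa>"] in auto)+
      hence "\<theta> \<le> \<bar>indicator S x - cprob h \<omega> x\<bar>" unfolding cp using 1 A p12 by (auto simp: indicator_def)
      thus "\<theta>\<^sup>2 \<le> (indicator S x - cprob h \<omega> x)\<^sup>2" using \<theta> by (simp add: abs_le_square_iff[symmetric])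
    qed
  qed
qed

text \<open>A site contributes a fixed amount to the variance if its disorder and that of its
  neighbours is moderate and both neighbours are good. On average a positive fraction of the even
  sites has these properties.\<close>

lemma eventually_ek_2_ge:
  assumes FE0: "0 < FE h"
  obtains b where "0 < b" "eventually (\<lambda>n. b \<le> ek 2 n h) sequentially"
proof -
  obtain m t c where mt: "1 \<le> m" "0 < t" "t \<le> 1" "0 < c"
    "\<And>i j. expectation (RR h m t i j) \<le> exp c * exp (- c * real (j - i))"
    by (rule expectation_RR_le[OF FE0]) (rule that)
  \<comment> \<open>By Markov's inequality this threshold makes the proportion of sites with large
    disorder at themselves or at a neighbour at most \<open>3 * m1 / \<kappa>\<close>, which is at
    most 1/8.\<close>
  define \<kappa> where "\<kappa> = 24 * m1 + 1"
  have m1: "0 \<le> m1" unfolding m1_def by (rule Bochner_Integration.integral_nonneg) simp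
  have \<kappa>: "0 < \<kappa>" unfolding \<kappa>_def using m1 by simp
  obtain \<epsilon> where \<epsilon>: "0 < \<epsilon>" "\<epsilon> \<le> 1" "\<forall>s s'. 1 \<le> s \<and> 1 \<le> s' \<and> s + s' < m \<longrightarrow> \<epsilon> \<le> p s * p s' * exp (h - \<kappa>)"
    by (rule exists_insertion_cost[of m h \<kappa>]) (rule that)
  obtain \<eta> where \<eta>: "0 < \<eta>" "\<forall>\<omega> x S. \<bar>\<omega> x\<bar> \<le> \<kappa> \<longrightarrow> \<eta> \<le> (indicator S x - cprob h \<omega> x)\<^sup>2"
    by (rule cprob_bounds[OF \<kappa>, of h]) (rule that)
  define b where "b = \<eta> * (\<epsilon>\<^sup>2 / 4)"
  have b: "0 < b" unfolding b_def using \<eta> \<epsilon> by simp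
  define X where "X n = (\<lambda>k. 2 * k) ` {1..(n - 1) div 2}" for n :: nat
  define W where "W \<omega> x = (\<bar>\<omega> (x - 1)\<bar> + \<bar>\<omega> x\<bar> + \<bar>\<omega> (x + 1)\<bar>) / \<kappa>" for \<omega> :: "nat \<Rightarrow> real" and x
  have X: "X n \<subseteq> {x. even x \<and> 1 \<le> x \<and> x + 1 \<le> n}" for n unfolding X_def by auto
  have cX: "card (X n) = (n - 1) div 2" for n unfolding X_def by (subst card_image) (auto simp: inj_on_def)
  have site: "b * (1 - av h n \<omega> (bad m (x - 1)) - av h n \<omega> (bad m (x + 1)) - W \<omega> x)
     \<le> av h n \<omega> (\<lambda>S. nbr x S * (indicator S x - cprob h \<omega> x)\<^sup>2)" if x: "x \<in> X n" for n \<omega> x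
  proof (cases "\<bar>\<omega> (x - 1)\<bar> \<le> \<kappa> \<and> \<bar>\<omega> x\<bar> \<le> \<kappa> \<and> \<bar>\<omega> (x + 1)\<bar> \<le> \<kappa>")
    case True
    have x1: "1 \<le> x" "x + 1 \<le> n" using X x by auto
    have "1 - av h n \<omega> (bad m (x - 1)) - av h n \<omega> (bad m (x + 1)) - W \<omega> x \<le> 1 - av h n \<omega> (bad m (x - 1)) - av h n \<omega> (bad m (x + 1))"
      unfolding W_def using \<kappa> by simp
    also have "\<dots> = av h n \<omega> (\<lambda>S. 1 - bad m (x - 1) S - bad m (x + 1) S)" by (simp only: av_diff av_const)
    also have "\<dots> \<le> av h n \<omega> (\<lambda>S. if good m S (x - 1) \<and> good m S (x + 1) then 1 else 0)"
      by (rule av_mono) (simp add: bad_def)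
    finally have "b * (1 - av h n \<omega> (bad m (x - 1)) - av h n \<omega> (bad m (x + 1)) - W \<omega> x)
      \<le> \<eta> * (\<epsilon>\<^sup>2 / 4 * av h n \<omega> (\<lambda>S. if good m S (x - 1) \<and> good m S (x + 1) then 1 else 0))"
      unfolding b_def mult.assoc using \<eta> \<epsilon> by (intro mult_left_mono) auto
    also have "\<dots> \<le> \<eta> * av h n \<omega> (nbr x)"
      using av_nbr_ge[OF x1 order_refl mt(1) \<epsilon>, of \<omega>] True \<eta>(1) by (intro mult_left_mono) (auto simp: abs_le_iff)
    also have "\<dots> = av h n \<omega> (\<lambda>S. \<eta> * nbr x S)" by (simp only: av_cmult)
    also have "\<dots> \<le> av h n \<omega> (\<lambda>S. nbr x S * (indicator S x - cprob h \<omega> x)\<^sup>2)"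
      using \<eta>(2) True by (intro av_mono) (simp add: nbr_def)
    finally show ?thesis .
  next
    case False
    hence "\<kappa> \<le> \<bar>\<omega> (x - 1)\<bar> + \<bar>\<omega> x\<bar> + \<bar>\<omega> (x + 1)\<bar>" by linarith
    hence "1 \<le> W \<omega> x" unfolding W_def using \<kappa> by (simp add: pos_le_divide_eq)
    moreover have "0 \<le> av h n \<omega> (bad m (x - 1))" "0 \<le> av h n \<omega> (bad m (x + 1))" by (rule av_nonneg, simp add: bad_def)+
    ultimately have "b * (1 - av h n \<omega> (bad m (x - 1)) - av h n \<omega> (bad m (x + 1)) - W \<omega> x) \<le> 0"
      using b by (intro mult_nonneg_nonpos) auto
    also have "0 \<le> av h n \<omega> (\<lambda>S. nbr x S * (indicator S x - cprob h \<omega> x)\<^sup>2)"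
      by (rule av_nonneg) (simp add: nbr_def)
    finally show ?thesis .
  qed
  have point: "b * (real (card (X n)) - 2 * (real n / 8 + (real n + 1) * RR h m t 0 n \<omega>) - (\<Sum>x\<in>X n. W \<omega> x)) \<le> K 2 h 0 n \<omega>" for n \<omega>
  proof -
    have neighbour: "(\<Sum>x\<in>X n. av h n \<omega> (bad m (f x))) \<le> real n / 8 + (real n + 1) * RR h m t 0 n \<omega>"
      if f: "inj_on f (X n)" "f ` X n \<subseteq> {0..n}" for f
      using av_sum_bad_le[OF mt(2,3) f(2), of h \<omega> m] by (simp add: sum.reindex[OF f(1)])
    have "(\<Sum>x\<in>X n. av h n \<omega> (bad m (x - 1))) \<le> real n / 8 + (real n + 1) * RR h m t 0 n \<omega>"
      by (rule neighbour) (use X[of n] in \<open>auto simp: X_def inj_on_def\<close>)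
    moreover have "(\<Sum>x\<in>X n. av h n \<omega> (bad m (x + 1))) \<le> real n / 8 + (real n + 1) * RR h m t 0 n \<omega>"
      by (rule neighbour) (use X[of n] in \<open>auto simp: inj_on_def\<close>)
    ultimately have "real (card (X n)) - 2 * (real n / 8 + (real n + 1) * RR h m t 0 n \<omega>) - (\<Sum>x\<in>X n. W \<omega> x)
      \<le> (\<Sum>x\<in>X n. 1 - av h n \<omega> (bad m (x - 1)) - av h n \<omega> (bad m (x + 1)) - W \<omega> x)"
      by (simp add: sum_subtractf)
    hence "b * (real (card (X n)) - 2 * (real n / 8 + (real n + 1) * RR h m t 0 n \<omega>) - (\<Sum>x\<in>X n. W \<omega> x))
      \<le> (\<Sum>x\<in>X n. b * (1 - av h n \<omega> (bad m (x - 1)) - av h n \<omega> (bad m (x + 1)) - W \<omega> x))"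
      unfolding sum_distrib_left[symmetric] using b by (intro mult_left_mono) auto
    also have "\<dots> \<le> (\<Sum>x\<in>X n. av h n \<omega> (\<lambda>S. nbr x S * (indicator S x - cprob h \<omega> x)\<^sup>2))" by (intro sum_mono site)
    also have "\<dots> \<le> K 2 h 0 n \<omega>" by (rule K_2_ge[OF X])
    finally show ?thesis .
  qed
  have coord: "integrable D (\<lambda>\<omega>. \<bar>\<omega> x\<bar>)" for x by (intro integrable_abs integrable_coord)
  have W_int: "integrable D (\<lambda>\<omega>. W \<omega> x)" and EW: "expectation (\<lambda>\<omega>. W \<omega> x) \<le> 1 / 8" for x
  proof -
    show "integrable D (\<lambda>\<omega>. W \<omega> x)" unfolding W_def using coord by simp
    have "expectation (\<lambda>\<omega>. W \<omega> x) = 3 * m1 / \<kappa>" unfolding W_def using coord by (simp add: expectation_abs_coord)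
    also have "\<dots> \<le> 1 / 8" using \<kappa> unfolding \<kappa>_def by (simp add: divide_le_eq)
    finally show "expectation (\<lambda>\<omega>. W \<omega> x) \<le> 1 / 8" .
  qed
  have main: "b * (7 / 8 * ((real n - 2) / 2) - 2 * (real n / 8 + (real n + 1) * (exp c * exp (- c * real n)))) / real n \<le> ek 2 n h"
    if n: "1 \<le> n" for n
  proof -
    let ?r = "exp c * exp (- c * real n)"
    have r: "expectation (RR h m t 0 n) \<le> ?r" using mt(5)[of 0 n] by simp
    have cn: "(real n - 2) / 2 \<le> real (card (X n))"
    proof -
      have "n \<le> 2 * ((n - 1) div 2) + 2" by presburger
      hence "real n \<le> real (2 * ((n - 1) div 2) + 2)" by (simp only: of_nat_le_iff)
      thus ?thesis unfolding cX by simp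
    qed
    have "7 / 8 * ((real n - 2) / 2) - 2 * (real n / 8 + (real n + 1) * ?r)
      \<le> real (card (X n)) - 2 * (real n / 8 + (real n + 1) * expectation (RR h m t 0 n)) - (\<Sum>x\<in>X n. expectation (\<lambda>\<omega>. W \<omega> x))"
    proof -
      have "(\<Sum>x\<in>X n. expectation (\<lambda>\<omega>. W \<omega> x)) \<le> real (card (X n)) * (1 / 8)"
        using sum_bounded_above[of "X n" "\<lambda>x. expectation (\<lambda>\<omega>. W \<omega> x)" "1 / 8"] EW by simp
      moreover have "(real n + 1) * expectation (RR h m t 0 n) \<le> (real n + 1) * ?r" using r by (intro mult_left_mono) auto
      ultimately show ?thesis using cn by argo
    qed
    hence "b * (7 / 8 * ((real n - 2) / 2) - 2 * (real n / 8 + (real n + 1) * ?r))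
      \<le> b * (real (card (X n)) - 2 * (real n / 8 + (real n + 1) * expectation (RR h m t 0 n)) - (\<Sum>x\<in>X n. expectation (\<lambda>\<omega>. W \<omega> x)))"
      using b by (intro mult_left_mono) auto
    also have "\<dots> = expectation (\<lambda>\<omega>. b * (real (card (X n)) - 2 * (real n / 8 + (real n + 1) * RR h m t 0 n \<omega>) - (\<Sum>x\<in>X n. W \<omega> x)))"
      using RR_integrable W_int by (simp add: prob_space[unfolded space_D])
    also have "\<dots> \<le> expectation (K 2 h 0 n)"
      by (rule integral_mono) (use RR_integrable W_int K_integrable[of 0 n 2 h] point in auto)
    finally have "b * (7 / 8 * ((real n - 2) / 2) - 2 * (real n / 8 + (real n + 1) * ?r)) / real n \<le> expectation (K 2 h 0 n) / real n"
      by (rule divide_right_mono) simp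
    thus ?thesis unfolding ek_def by simp
  qed
  have "eventually (\<lambda>n. b * (1 / 8) \<le> b * (7 / 8 * ((real n - 2) / 2) - 2 * (real n / 8 + (real n + 1) * (exp c * exp (- c * real n)))) / real n) sequentially"
  proof -
    \<comment> \<open>Half of the sites are even, and an eighth of these is lost to large disorder;
      each of the two neighbours may be bad for an eighth of all sites. What remains is 7/16 -
      1/4.\<close>
    have "(\<lambda>n. (7 / 8 * ((real n - 2) / 2) - 2 * (real n / 8 + (real n + 1) * (exp c * exp (- c * real n)))) / real n) \<longlonglongrightarrow> 3 / 16"
      using mt(4) by real_asymp
    hence "eventually (\<lambda>n. 1 / 8 < (7 / 8 * ((real n - 2) / 2) - 2 * (real n / 8 + (real n + 1) * (exp c * exp (- c * real n)))) / real n) sequentially"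
      by (rule order_tendstoD) simp
    thus ?thesis
    proof eventually_elim
      case (elim n)
      from mult_left_mono[OF less_imp_le[OF elim] less_imp_le[OF b]] show ?case by (simp only: times_divide_eq_right)
    qed
  qed
  hence "eventually (\<lambda>n. b * (1 / 8) \<le> ek 2 n h) sequentially"
    using eventually_ge_at_top[of 1] by eventually_elim (use main in \<open>blast intro: order_trans\<close>)
  thus ?thesis using that[of "b * (1 / 8)"] b by simp
qed

end

section \<open>Above the critical point\<close>

text \<open>In \<open>ennreal\<close> the supremum is meaningful without a proof of boundedness, and
  over the empty set it is 0.\<close>

lemma tendsto_SUP_abs_0:
  fixes g :: "nat \<Rightarrow> 'b \<Rightarrow> real"
  assumes "\<And>e. 0 < e \<Longrightarrow> eventually (\<lambda>n. \<forall>h\<in>H. \<bar>g n h\<bar> < e) sequentially"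
  shows "(\<lambda>n. SUP h\<in>H. ennreal \<bar>g n h\<bar>) \<longlonglongrightarrow> 0"
proof (rule order_tendstoI)
  fix a :: ennreal assume "0 < a"
  then obtain z where z: "0 < z" "z < a" using dense by blast
  obtain e where e: "0 < e" "ennreal e < a" using z by (cases z) (auto simp: top_unique)
  have "eventually (\<lambda>n. \<forall>h\<in>H. \<bar>g n h\<bar> < e) sequentially" by (rule assms[OF e(1)])
  thus "eventually (\<lambda>n. (SUP h\<in>H. ennreal \<bar>g n h\<bar>) < a) sequentially"
  proof eventually_elim
    case (elim n)
    have "(SUP h\<in>H. ennreal \<bar>g n h\<bar>) \<le> ennreal e" using elim by (intro SUP_least ennreal_leI) (auto intro: less_imp_le)
    thus ?case using e(2) by (rule le_less_trans)
  qed
qed auto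

context pinning
begin

definition crit :: real where "crit = Inf {h. 0 < FE h}"

lemma FE_pos_above_crit: "crit < h \<Longrightarrow> 0 < FE h"
proof -
  assume h: "crit < h"
  have "0 < FE (1 - ln (p 1))" using FE_ge[of "1 - ln (p 1)"] by simp
  hence ne: "{h. 0 < FE h} \<noteq> {}" by blast
  obtain h' where "0 < FE h'" "h' < h" using cInf_lessD[OF ne h[unfolded crit_def]] by auto
  thus "0 < FE h" using FE_mono[of h' h] by simp
qed

lemma localization:
  assumes "0 < FE h0"
  obtains Q C c where "localized_pinning D p h0 Q C c"
proof -
  obtain Q C c where "0 < c" "0 < C" "\<And>i j. integrable D (Q i j)" "\<And>i j \<omega>. 0 \<le> Q i j \<omega>"
    "\<And>i j. expectation (Q i j) \<le> C * exp (- c * real (j - i))"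
    "\<And>i j h \<omega>. h0 \<le> h \<Longrightarrow> i + 2 \<le> j \<Longrightarrow> meet_defect p \<omega> i j (i+1) (j-1) h + meet_defect p \<omega> i (j-1) (i+1) j h \<le> Q i j \<omega>"
    by (rule meet_defect_decay[OF assms]) (rule that)
  hence "localized_pinning D p h0 Q C c" by unfold_locales auto
  thus ?thesis by (rule that)
qed

text \<open>The estimates hold on the open half-line above a level \<open>h0\<close> of positive
  free energy, so \<open>h0\<close> is placed strictly between \<open>crit\<close> and
  \<open>h\<close>.\<close>

lemma FE_DERIV:
  assumes "crit < h"
  shows "((deriv ^^ r) FE has_real_derivative (deriv ^^ Suc r) FE h) (at h)"
proof -
  obtain h0 where h0: "crit < h0" "h0 < h" using dense[OF assms] by blast
  obtain Q C c where "localized_pinning D p h0 Q C c" by (rule localization[OF FE_pos_above_crit[OF h0(1)]])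
  then interpret localized_pinning D p h0 Q C c .
  show ?thesis by (rule FE_derivs(2)[OF h0(2)])
qed

lemma FE_smooth: "smooth_on_open {crit<..} FE"
  unfolding smooth_on_open_def differentiable_on_def
proof (intro allI ballI)
  fix r h assume "h \<in> {crit<..}"
  hence "(deriv ^^ r) FE differentiable (at h)" using FE_DERIV[of h r] by (auto simp: real_differentiable_def)
  thus "(deriv ^^ r) FE differentiable (at h within {crit<..})" by (rule differentiable_at_withinI)
qed

lemma FE_second_deriv_pos:
  assumes "crit < h"
  shows "0 < (deriv ^^ 2) FE h"
proof -
  obtain h0 where h0: "crit < h0" "h0 < h" using dense[OF assms] by blast
  obtain Q C c where "localized_pinning D p h0 Q C c" by (rule localization[OF FE_pos_above_crit[OF h0(1)]])
  then interpret localized_pinning D p h0 Q C c .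
  obtain b where b: "0 < b" "eventually (\<lambda>n. b \<le> ek 2 n h) sequentially" by (rule eventually_ek_2_ge[OF FE_pos_above_crit[OF assms]])
  have "b \<le> (deriv ^^ 2) FE h" by (rule tendsto_lowerbound[OF FE_derivs(1)[OF h0(2)] b(2)]) simp
  thus ?thesis using b(1) by simp
qed

lemma FE_strictly_convex: "strictly_convex_on {crit<..} FE"
proof (rule strictly_convex_on_half_line)
  fix h assume h: "crit < h"
  show "(FE has_real_derivative (deriv ^^ 1) FE h) (at h)" using FE_DERIV[OF h, of 0] by simp
  show "((deriv ^^ 1) FE has_real_derivative (deriv ^^ 2) FE h) (at h)"
    using FE_DERIV[OF h, of 1] by (simp only: Suc_1)
  show "0 < (deriv ^^ 2) FE h" by (rule FE_second_deriv_pos[OF h])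
qed

text \<open>A nonempty closed set in the open half-line has a minimum. One level \<open>h0\<close>,
  and with it one set of constants, therefore serves all its points, even when the set is unbounded
  above.\<close>

lemma closed_above_crit:
  assumes "closed H" "H \<subseteq> {crit<..}"
  obtains h0 where "crit < h0" "\<And>h. h \<in> H \<Longrightarrow> h0 < h"
proof (cases "H = {}")
  case True
  thus ?thesis using that[of "crit + 1"] by simp
next
  case False
  have bdd: "bdd_below H" using assms(2) by (intro bdd_belowI[of _ crit]) auto
  have "Inf H \<in> H" by (rule closed_contains_Inf[OF False bdd assms(1)])
  hence "crit < Inf H" using assms(2) by auto
  then obtain h0 where h0: "crit < h0" "h0 < Inf H" using dense by blast
  show ?thesis by (rule that[OF h0(1)]) (use h0(2) cInf_lower[OF _ bdd] in force)
qed

lemma FE_Gevrey: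
  assumes "closed H" "H \<subseteq> {crit<..}"
  shows "\<exists>c>0. \<forall>r\<ge>1. (SUP h\<in>H. ennreal \<bar>(deriv ^^ r) FE h\<bar>) \<le> ennreal (c ^ r * fact r ^ 3)"
proof -
  obtain h0 where h0: "crit < h0" "\<And>h. h \<in> H \<Longrightarrow> h0 < h" by (rule closed_above_crit[OF assms]) (rule that)
  obtain Q C c where "localized_pinning D p h0 Q C c" by (rule localization[OF FE_pos_above_crit[OF h0(1)]])
  then interpret localized_pinning D p h0 Q C c .
  show ?thesis
    using gev_pos FE_derivs(3)[OF h0(2)] by (intro exI[of _ gev] conjI allI impI SUP_least ennreal_leI) auto
qed

lemma ek_uniform_compact:
  assumes H: "compact H" "H \<subseteq> {crit<..}" and e: "0 < e"
  shows "eventually (\<lambda>n. \<forall>h\<in>H. \<bar>ek r n h - (deriv ^^ r) FE h\<bar> < e) sequentially"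
proof -
  obtain u where u: "crit < u" "\<And>h. h \<in> H \<Longrightarrow> u < h" by (rule closed_above_crit[OF compact_imp_closed[OF H(1)] H(2)]) (rule that)
  obtain h0 where h0: "crit < h0" "h0 < u" using dense[OF u(1)] by blast
  obtain Q C c where "localized_pinning D p h0 Q C c" by (rule localization[OF FE_pos_above_crit[OF h0(1)]])
  then interpret localized_pinning D p h0 Q C c .
  obtain B where B: "\<forall>h\<in>H. \<bar>h\<bar> \<le> B" using compact_imp_bounded[OF H(1)] by (auto simp: bounded_iff)
  have "eventually (\<lambda>n. \<forall>h\<in>{u..max B u + 1}. \<bar>ek r n h - (deriv ^^ r) FE h\<bar> < e) sequentially"
    by (rule ek_uniform[OF h0(2) _ e]) simp
  thus ?thesis by eventually_elim (use u(2) B in \<open>fastforce simp: abs_le_iff\<close>)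
qed

text \<open>The intervals \<open>U N\<close> exhaust the half-line above \<open>crit\<close> and are
  countable in number, so a single null set serves all compact sets.\<close>

lemma AE_K_uniform_compact:
  "AE \<omega> in D. \<forall>H r e. compact H \<and> H \<subseteq> {crit<..} \<and> 0 < e \<longrightarrow>
     eventually (\<lambda>n. \<forall>h\<in>H. \<bar>1 / real n * K r h 0 n \<omega> - (deriv ^^ r) FE h\<bar> < e) sequentially"
proof -
  define U where "U N = {crit + 1 / (real N + 1)..crit + real N + 2}" for N :: nat
  have "AE \<omega> in D. \<forall>r e. 0 < e \<longrightarrow> eventually (\<lambda>n. \<forall>h\<in>U N. \<bar>1 / real n * K r h 0 n \<omega> - (deriv ^^ r) FE h\<bar> < e) sequentially" for N
  proof -
    obtain h0 where h0: "crit < h0" "h0 < crit + 1 / (real N + 1)"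
      using dense[of crit "crit + 1 / (real N + 1)"] by auto
    obtain Q C c where "localized_pinning D p h0 Q C c" by (rule localization[OF FE_pos_above_crit[OF h0(1)]])
    then interpret localized_pinning D p h0 Q C c .
    have "1 / (real N + 1) \<le> 1" by simp
    hence "crit + 1 / (real N + 1) < crit + real N + 2" by linarith
    thus ?thesis unfolding U_def by (rule AE_K_uniform[OF h0(2)])
  qed
  hence "AE \<omega> in D. \<forall>N r e. 0 < e \<longrightarrow> eventually (\<lambda>n. \<forall>h\<in>U N. \<bar>1 / real n * K r h 0 n \<omega> - (deriv ^^ r) FE h\<bar> < e) sequentially"
    by (simp add: AE_all_countable)
  thus ?thesis
  proof eventually_elim
    case (elim \<omega>)
    show ?case
    proof (intro allI impI, elim conjE)
      fix H r and e :: real assume H: "compact H" "H \<subseteq> {crit<..}" and e: "0 < e"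
      obtain u where u: "crit < u" "\<And>h. h \<in> H \<Longrightarrow> u < h" by (rule closed_above_crit[OF compact_imp_closed[OF H(1)] H(2)]) (rule that)
      obtain B where B: "\<forall>h\<in>H. \<bar>h\<bar> \<le> B" using compact_imp_bounded[OF H(1)] by (auto simp: bounded_iff)
      obtain N1 :: nat where N1: "B - crit \<le> real N1" using real_arch_simple by blast
      obtain N2 :: nat where N2: "1 / (u - crit) \<le> real N2" using real_arch_simple by blast
      define N where "N = max N1 N2"
      have "1 / (u - crit) \<le> real N + 1" using N2 by (simp add: N_def)
      hence "1 / (real N + 1) \<le> u - crit" using u(1) by (simp add: field_simps)
      moreover have "B \<le> crit + real N" using N1 by (simp add: N_def)
      ultimately have "H \<subseteq> U N" unfolding U_def using u(2) B by (fastforce simp: abs_le_iff)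
      moreover have "eventually (\<lambda>n. \<forall>h\<in>U N. \<bar>1 / real n * K r h 0 n \<omega> - (deriv ^^ r) FE h\<bar> < e) sequentially"
        using elim e by blast
      ultimately show "eventually (\<lambda>n. \<forall>h\<in>H. \<bar>1 / real n * K r h 0 n \<omega> - (deriv ^^ r) FE h\<bar> < e) sequentially"
        by (auto elim!: eventually_mono)
    qed
  qed
qed

end

theorem theorem1p3:
  fixes P :: "'a measure" and T :: "nat \<Rightarrow> 'a \<Rightarrow> nat"
    and l :: "real \<Rightarrow> real" and \<alpha> :: real
    and D :: "(nat \<Rightarrow> real) measure"
  defines "f \<equiv> free_energy P T D"
    and "hc \<equiv> critical_point P T D"
    and "logZ \<equiv> (\<lambda>n \<omega> h. ln (partition_fun P T n h \<omega>))"
  assumes "prob_space P"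
    and "iid_interarrival_times P T"
    and "0 \<le> \<alpha>"
    and "slowly_varying l"
    and "\<And>t::nat. 1 \<le> t \<Longrightarrow>
           measure P {x \<in> space P. T 1 x = t} = l (real t) / real t powr (\<alpha> + 1)"
    and "\<And>t::nat. 1 \<le> t \<Longrightarrow> 0 < measure P {x \<in> space P. T 1 x = t}"
    and "prob_space D"
    and "sets D = sets (borel :: (nat \<Rightarrow> real) measure)"
    and "gaussian_sequence D"
    and "centered_sequence D"
    and "stationary_sequence D"
    and "summable (\<lambda>a. \<bar>covariance_fun D a\<bar>)"
  shows "strictly_convex_on {hc<..} f \<and>
    smooth_on_open {hc<..} f \<and>
    (AE \<omega> in D. \<forall>H r. compact H \<and> H \<subseteq> {hc<..} \<longrightarrow>
       ((\<lambda>n. SUP h\<in>H. ennreal \<bar>1 / real n * (deriv ^^ r) (logZ n \<omega>) h - (deriv ^^ r) f h\<bar>)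
          \<longlonglongrightarrow> 0) \<and>
       ((\<lambda>n. SUP h\<in>H. ennreal \<bar>integral\<^sup>L D (\<lambda>\<omega>'. 1 / real n * (deriv ^^ r) (logZ n \<omega>') h)
                               - (deriv ^^ r) f h\<bar>)
          \<longlonglongrightarrow> 0)) \<and>
    (\<forall>H. closed H \<and> H \<subseteq> {hc<..} \<longrightarrow>
       (\<exists>c>0. \<forall>r\<ge>1. (SUP h\<in>H. ennreal \<bar>(deriv ^^ r) f h\<bar>) \<le> ennreal (c ^ r * fact r ^ 3)))"
proof -
  interpret S: renewal P T using assms(4,5) by (simp add: renewal_def renewal_axioms_def)
  interpret D: prob_space D by (rule assms(10))
  interpret X: pinning D S.pT
    by unfold_locales (use assms(9,11-15) S.sum_pw_pT_le_1 in \<open>auto simp: S.pT_def\<close>)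
  have Zeq: "partition_fun P T n h \<omega> = ZZ S.pT \<omega> 0 n h" for n h \<omega>
    unfolding S.partition_fun_eq_sum X.Z_eq ..
  have K: "(deriv ^^ r) (logZ n \<omega>) h = X.K r h 0 n \<omega>" for r n \<omega> h
    unfolding logZ_def Zeq X.K_def KK_def ..
  have f: "f = X.FE"
  proof
    fix h
    show "f h = X.FE h" unfolding f_def free_energy_def X.FE_def Zeq X.ell_def X.LL_def by simp
  qed
  have hc: "hc = X.crit" unfolding hc_def critical_point_def X.crit_def f[symmetric] f_def ..
  have E: "integral\<^sup>L D (\<lambda>\<omega>'. 1 / real n * (deriv ^^ r) (logZ n \<omega>') h) = X.ek r n h" for r n h
    unfolding K X.ek_def ..
  have "AE \<omega> in D. \<forall>H r. compact H \<and> H \<subseteq> {hc<..} \<longrightarrow>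
       ((\<lambda>n. SUP h\<in>H. ennreal \<bar>1 / real n * (deriv ^^ r) (logZ n \<omega>) h - (deriv ^^ r) f h\<bar>) \<longlonglongrightarrow> 0) \<and>
       ((\<lambda>n. SUP h\<in>H. ennreal \<bar>integral\<^sup>L D (\<lambda>\<omega>'. 1 / real n * (deriv ^^ r) (logZ n \<omega>') h) - (deriv ^^ r) f h\<bar>) \<longlonglongrightarrow> 0)"
    using X.AE_K_uniform_compact
  proof eventually_elim
    case (elim \<omega>)
    show ?case unfolding E unfolding K f hc
      using elim X.ek_uniform_compact by (intro allI impI conjI tendsto_SUP_abs_0) auto
  qed
  thus ?thesis using X.FE_strictly_convex X.FE_smooth X.FE_Gevrey unfolding f hc by blast
qed

end
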